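(* Let $\Omega\subset\mathbb{R}^n$ be a bounded open domain, let $1<p\le q\le n$, and let $\mu$ be a nonnegative bounded Radon measure on $\Omega$. Suppose that $u$ is a local renormalized solution in $\Omega$ to $$-\operatorname{div}\left(|\nabla u|^{p-2}\nabla u+|\nabla u|^{q-2}\nabla u\right)=\mu .$$ Then there is a $q$-superharmonic function $\tilde u$ in $\Omega$ such that $\tilde u=u$ almost everywhere in $\Omega$.
   Context: **$q$-harmonic and $q$-superharmonic functions.** A continuous function $h\in W^{1,q}_{\rm loc}(U)$ is $q$-harmonic in an open set $U$ if $\int_U(|\nabla h|^{p-2}\nabla h+|\nabla h|^{q-2}\nabla h)\cdot\nabla\varphi\,dx=0$ for all $\varphi\in C_0^\infty(U)$ (the notion refers to the $(p,q)$-operator, not to the $q$-Laplacian). A lower semicontinuous function $u:\Omega\to\mathbb{R}\cup\{\infty\}$ is $q$-superharmonic in $\Omega$ if $u\not\equiv\infty$ in each component of $\Omega$ and, for each open $U\Subset\Omega$ and each $h\in C(\overline U)$ that is $q$-harmonic in $U$, the inequality $u\ge h$ on $\partial U$ implies $u\ge h$ in $U$. **Capacity and decomposition of measures.** For an open set $U$ and compact $K\subset U$, $\mathrm{cap}_q(K,U)=\inf\{\int_U|\nabla\varphi|^q\,dx:\varphi\in C_0^\infty(U),\ \varphi\ge1\text{ on }K\}$; for open $V\subset U$, $\mathrm{cap}_q(V,U)$ is the supremum of $\mathrm{cap}_q(K,U)$ over compact $K\subset V$; for general $E\subset U$, $\mathrm{cap}_q(E,U)$ is the infimum of $\mathrm{cap}_q(V,U)$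 over open $V$ with $E\subset V\subset U$. A set $E\subset\Omega$ has $q$-capacity zero if $\mathrm{cap}_q(E\cap U,U)=0$ for all open $U\subset\Omega$. Every nonnegative bounded Radon measure $\mu$ on $\Omega$ decomposes as $\mu=\mu_0+\mu_s$, where $\mu_0\ge0$ does not charge sets of $q$-capacity zero and $\mu_s\ge0$ is concentrated on a set of $q$-capacity zero. **Generalized gradient.** For $k>0$, $T_k(s)=\max\{-k,\min\{k,s\}\}$. If $u$ is measurable and $T_k(u)\in W^{1,q}_{\rm loc}(\Omega)$ for all $k>0$, then $\nabla u$ denotes the measurable vector field with $\nabla T_k(u)=\chi_{\{|u|<k\}}\nabla u$ a.e. for every $k>0$. **Local renormalized solution.** Let $\mu$ be a nonnegative bounded Radon measure on $\Omega$. A measurable function $u$ is a local renormalized solution in $\Omega$ to the equation if $T_k(u)\in W^{1,q}_{\rm loc}(\Omega)$ for all $k>0$, $|u|^{q-1}\in L^m_{\rm loc}(\Omega)$ for all $1\le m<\frac{n}{n-q}$ (all finite $m\geq 1$ if $q=n$), and $$\int_\Omega(|\nabla u|^p+|\nabla u|^q)h'(u)\phi\,dx+\int_\Omega(|\nabla u|^{p-2}\nabla u+|\nabla u|^{q-2}\nabla u)\cdot\nabla\phi\,h(u)\,dx=\int_\Omega h(u)\phi\,d\mu_0+h(+\infty)\int_\Omega\phi\,d\mu_s$$ for every $h\in W^{1,\infty}(\mathbb{R})$ such that $h'$ has compact support and every $\phi\in C_0^\infty(\Omega)$. Here $h(+\infty)=\lim_{t\to+\infty}h(t)$, and in the integral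 against $\mu_0$ the $q$-quasicontinuous representative of $u$ is used. *)

theory Defs
  imports "HOL-Analysis.Analysis"
begin

subsection \<open>Smooth compactly supported functions\<close>

definition grad :: "('a::euclidean_space \<Rightarrow> real) \<Rightarrow> 'a \<Rightarrow> 'a" where
  "grad f x = (\<Sum>b\<in>Basis. frechet_derivative f (at x) b *\<^sub>R b)"

primrec Ck :: "nat \<Rightarrow> ('a::euclidean_space \<Rightarrow> real) \<Rightarrow> bool" where
  "Ck 0 f \<longleftrightarrow> continuous_on UNIV f"
| "Ck (Suc k) f \<longleftrightarrow>
     f differentiable_on UNIV \<and> (\<forall>b\<in>Basis. Ck k (\<lambda>x. frechet_derivative f (at x) b))"

text \<open>The space \<open>C\<^sub>0\<^sup>\<infinity>(U)\<close>; its members are extended by zero to the whole space.\<close>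

definition test_functions :: "'a::euclidean_space set \<Rightarrow> ('a \<Rightarrow> real) set" where
  "test_functions U = {\<phi>. (\<forall>k. Ck k \<phi>) \<and> compact (closure {x. \<phi> x \<noteq> 0}) \<and>
     closure {x. \<phi> x \<noteq> 0} \<subseteq> U}"


subsection \<open>Local Lebesgue and Sobolev spaces\<close>

definition Lp_loc :: "real \<Rightarrow> 'a::euclidean_space set \<Rightarrow> ('a \<Rightarrow> 'b::euclidean_space) set" where
  "Lp_loc m U = {f. set_borel_measurable lebesgue U f \<and>
     (\<forall>K. compact K \<longrightarrow> K \<subseteq> U \<longrightarrow> set_integrable lebesgue K (\<lambda>x. norm (f x) powr m))}"

definition has_weak_gradient ::
    "'a::euclidean_space set \<Rightarrow> ('a \<Rightarrow> real) \<Rightarrow> ('a \<Rightarrow> 'a) \<Rightarrow> bool" where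
  "has_weak_gradient U f v \<longleftrightarrow> f \<in> Lp_loc 1 U \<and> v \<in> Lp_loc 1 U \<and>
     (\<forall>\<phi>\<in>test_functions U.
        (LINT x:U|lebesgue. f x *\<^sub>R grad \<phi> x)
        = - (LINT x:U|lebesgue. \<phi> x *\<^sub>R v x))"

text \<open>Determined up to a null set whenever a weak gradient exists.\<close>

definition weak_grad :: "'a::euclidean_space set \<Rightarrow> ('a \<Rightarrow> real) \<Rightarrow> 'a \<Rightarrow> 'a" where
  "weak_grad U f = (SOME v. has_weak_gradient U f v)"

definition W1_loc :: "real \<Rightarrow> 'a::euclidean_space set \<Rightarrow> ('a \<Rightarrow> real) set" where
  "W1_loc q U = {f \<in> Lp_loc q U. \<exists>v\<in>Lp_loc q U. has_weak_gradient U f v}"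

text \<open>The space \<open>W\<^sup>1\<^sup>,\<^sup>\<infinity>(\<real>)\<close>. Its elements are composed with other functions, so
  the continuous (in fact Lipschitz) representative is the one that is meant.\<close>

definition W1_infty :: "(real \<Rightarrow> real) set" where
  "W1_infty = {h. continuous_on UNIV h \<and> bounded (range h) \<and>
     (\<exists>g. has_weak_gradient UNIV h g \<and> (\<exists>C. AE t in lebesgue. \<bar>g t\<bar> \<le> C))}"


subsection \<open>The operator, harmonic and superharmonic functions\<close>

definition pq_flux :: "real \<Rightarrow> real \<Rightarrow> 'a::euclidean_space \<Rightarrow> 'a" where
  "pq_flux p q \<xi> = norm \<xi> powr (p - 2) *\<^sub>R \<xi> + norm \<xi> powr (q - 2) *\<^sub>R \<xi>"

definition q_harmonic_on ::
    "real \<Rightarrow> real \<Rightarrow> 'a::euclidean_space set \<Rightarrow> ('a \<Rightarrow> real) \<Rightarrow> bool" where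
  "q_harmonic_on p q U h \<longleftrightarrow> continuous_on U h \<and> h \<in> W1_loc q U \<and>
     (\<forall>\<phi>\<in>test_functions U.
        (LINT x:U|lebesgue. pq_flux p q (weak_grad U h x) \<bullet> grad \<phi> x) = 0)"

definition lower_semicontinuous_on ::
    "'a::topological_space set \<Rightarrow> ('a \<Rightarrow> ereal) \<Rightarrow> bool" where
  "lower_semicontinuous_on S u \<longleftrightarrow> (\<forall>a. openin (top_of_set S) {x \<in> S. a < u x})"

definition q_superharmonic_on ::
    "real \<Rightarrow> real \<Rightarrow> 'a::euclidean_space set \<Rightarrow> ('a \<Rightarrow> ereal) \<Rightarrow> bool" where
  "q_superharmonic_on p q \<Omega> u \<longleftrightarrow>
     (\<forall>x\<in>\<Omega>. u x \<noteq> -\<infinity>) \<and>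
     lower_semicontinuous_on \<Omega> u \<and>
     (\<forall>C\<in>components \<Omega>. \<exists>x\<in>C. u x \<noteq> \<infinity>) \<and>
     (\<forall>U h. open U \<longrightarrow> compact (closure U) \<longrightarrow> closure U \<subseteq> \<Omega> \<longrightarrow>
        continuous_on (closure U) h \<longrightarrow> q_harmonic_on p q U h \<longrightarrow>
        (\<forall>x\<in>frontier U. ereal (h x) \<le> u x) \<longrightarrow>
        (\<forall>x\<in>U. ereal (h x) \<le> u x))"


subsection \<open>Capacity\<close>

definition cap_compact :: "real \<Rightarrow> 'a::euclidean_space set \<Rightarrow> 'a set \<Rightarrow> ennreal" where
  "cap_compact q K U = (INF \<phi>\<in>{\<phi> \<in> test_functions U. \<forall>x\<in>K. 1 \<le> \<phi> x}.
     set_nn_integral lebesgue U (\<lambda>x. ennreal (norm (grad \<phi> x) powr q)))"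

definition cap_open :: "real \<Rightarrow> 'a::euclidean_space set \<Rightarrow> 'a set \<Rightarrow> ennreal" where
  "cap_open q V U = (SUP K\<in>{K. compact K \<and> K \<subseteq> V}. cap_compact q K U)"

definition cap :: "real \<Rightarrow> 'a::euclidean_space set \<Rightarrow> 'a set \<Rightarrow> ennreal" where
  "cap q E U = (INF V\<in>{V. open V \<and> E \<subseteq> V \<and> V \<subseteq> U}. cap_open q V U)"

definition cap_zero :: "real \<Rightarrow> 'a::euclidean_space set \<Rightarrow> 'a set \<Rightarrow> bool" where
  "cap_zero q \<Omega> E \<longleftrightarrow> E \<subseteq> \<Omega> \<and> (\<forall>U. open U \<longrightarrow> U \<subseteq> \<Omega> \<longrightarrow> cap q (E \<inter> U) U = 0)"

text \<open>Infinite values are allowed: if every truncation of a function lies in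
  \<open>W\<^sup>1\<^sup>,\<^sup>q\<close> locally, the function has a quasicontinuous representative in this sense, and
  it is unique up to sets of capacity zero.\<close>

definition quasicontinuous_on ::
    "real \<Rightarrow> 'a::euclidean_space set \<Rightarrow> ('a \<Rightarrow> ereal) \<Rightarrow> bool" where
  "quasicontinuous_on q \<Omega> v \<longleftrightarrow>
     (\<forall>\<epsilon>>0. \<exists>G. open G \<and> G \<subseteq> \<Omega> \<and> cap q G \<Omega> < ennreal \<epsilon> \<and> continuous_on (\<Omega> - G) v)"

definition quasicontinuous_rep ::
    "real \<Rightarrow> 'a::euclidean_space set \<Rightarrow> ('a \<Rightarrow> real) \<Rightarrow> ('a \<Rightarrow> ereal) \<Rightarrow> bool" where
  "quasicontinuous_rep q \<Omega> u v \<longleftrightarrow>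
     quasicontinuous_on q \<Omega> v \<and> (AE x in lebesgue_on \<Omega>. v x = ereal (u x))"


subsection \<open>Measures\<close>

text \<open>On an open subset of a Euclidean space every finite Borel measure is inner and outer
  regular (cf. \<open>HOL-Analysis.Regularity\<close>), hence Radon.\<close>

definition bounded_Radon_measure_on :: "'a::euclidean_space set \<Rightarrow> 'a measure \<Rightarrow> bool" where
  "bounded_Radon_measure_on \<Omega> \<mu> \<longleftrightarrow>
     sets \<mu> = sets (restrict_space borel \<Omega>) \<and> finite_measure \<mu>"

definition capacity_decomposition ::
    "real \<Rightarrow> 'a::euclidean_space set \<Rightarrow> 'a measure \<Rightarrow> 'a measure \<Rightarrow> 'a measure \<Rightarrow> bool" where
  "capacity_decomposition q \<Omega> \<mu> \<mu>0 \<mu>s \<longleftrightarrow>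
     sets \<mu>0 = sets \<mu> \<and> sets \<mu>s = sets \<mu> \<and>
     (\<forall>A\<in>sets \<mu>. emeasure \<mu> A = emeasure \<mu>0 A + emeasure \<mu>s A) \<and>
     (\<forall>E\<in>sets \<mu>. cap_zero q \<Omega> E \<longrightarrow> emeasure \<mu>0 E = 0) \<and>
     (\<exists>E\<in>sets \<mu>. cap_zero q \<Omega> E \<and> emeasure \<mu>s (\<Omega> - E) = 0)"


subsection \<open>Local renormalized solutions\<close>

definition trunc :: "real \<Rightarrow> real \<Rightarrow> real" where
  "trunc k s = max (- k) (min k s)"

text \<open>As weak gradients are determined up to null sets, the last condition is the almost
  everywhere identity between the weak gradient of \<open>trunc k \<circ> u\<close> and the truncated field.\<close>

definition has_generalized_gradient ::
    "'a::euclidean_space set \<Rightarrow> ('a \<Rightarrow> real) \<Rightarrow> ('a \<Rightarrow> 'a) \<Rightarrow> bool" where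
  "has_generalized_gradient \<Omega> u v \<longleftrightarrow> set_borel_measurable lebesgue \<Omega> v \<and>
     (\<forall>k>0. has_weak_gradient \<Omega> (trunc k \<circ> u) (\<lambda>x. indicator {x. \<bar>u x\<bar> < k} x *\<^sub>R v x))"

definition generalized_grad ::
    "'a::euclidean_space set \<Rightarrow> ('a \<Rightarrow> real) \<Rightarrow> 'a \<Rightarrow> 'a" where
  "generalized_grad \<Omega> u = (SOME v. has_generalized_gradient \<Omega> u v)"

definition extend_ereal :: "(real \<Rightarrow> real) \<Rightarrow> ereal \<Rightarrow> real" where
  "extend_ereal h x =
     (if x = \<infinity> then Lim at_top h else if x = -\<infinity> then Lim at_bot h else h (real_of_ereal x))"

text \<open>The decomposition of \<open>\<mu>\<close> is unique, and quasicontinuous representatives agree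
  \<open>\<mu>0\<close>-almost everywhere, so the existential quantifier over them only introduces names.

  Two points concern the totalised Bochner integral. Since \<open>h\<close> need not have compact
  support, integrability of the divergence term is not automatic and is part of the
  requirement that the identity holds; the other integrands are always integrable.
  A quasicontinuous function is Borel only up to a \<open>\<mu>0\<close>-null set, hence the completion
  of \<open>\<mu>0\<close>.\<close>

definition local_renormalized_solution ::
    "real \<Rightarrow> real \<Rightarrow> 'a::euclidean_space set \<Rightarrow> 'a measure \<Rightarrow> ('a \<Rightarrow> real) \<Rightarrow> bool" where
  "local_renormalized_solution p q \<Omega> \<mu> u \<longleftrightarrow>
     set_borel_measurable lebesgue \<Omega> u \<and>
     (\<forall>k>0. trunc k \<circ> u \<in> W1_loc q \<Omega>) \<and>
     (\<forall>m\<ge>1. (q < real DIM('a) \<longrightarrow> m < real DIM('a) / (real DIM('a) - q)) \<longrightarrow>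
        (\<lambda>x. \<bar>u x\<bar> powr (q - 1)) \<in> Lp_loc m \<Omega>) \<and>
     (\<exists>\<mu>0 \<mu>s v. capacity_decomposition q \<Omega> \<mu> \<mu>0 \<mu>s \<and> quasicontinuous_rep q \<Omega> u v \<and>
       (let Du = generalized_grad \<Omega> u in
        \<forall>h\<in>W1_infty. let h' = weak_grad UNIV h in
          (\<exists>R. AE t in lebesgue. R < \<bar>t\<bar> \<longrightarrow> h' t = 0) \<longrightarrow>
          (\<forall>\<phi>\<in>test_functions \<Omega>.
             set_integrable lebesgue \<Omega> (\<lambda>x. (pq_flux p q (Du x) \<bullet> grad \<phi> x) * h (u x)) \<and>
             (LINT x:\<Omega>|lebesgue. (norm (Du x) powr p + norm (Du x) powr q) * h' (u x) * \<phi> x)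
             + (LINT x:\<Omega>|lebesgue. (pq_flux p q (Du x) \<bullet> grad \<phi> x) * h (u x))
             = (LINT x|completion \<mu>0. extend_ereal h (v x) * \<phi> x)
             + Lim at_top h * (LINT x|\<mu>s. \<phi> x))))"

end

theory Submission
  imports Defs
begin

text \<open>
Write \<open>A\<close> for the flux \<open>pq_flux p q\<close>.  For nonnegative \<open>h\<close> and \<open>\<phi>\<close> both measure terms of the renormalized
identity are nonnegative, so
  \<open>0 \<le> \<integral> (|\<nabla>u|\<^sup>p + |\<nabla>u|\<^sup>q) h'(u) \<phi> + \<integral> A(\<nabla>u) \<bullet> \<nabla>\<phi> h(u)\<close>
(\<open>renormalized_representative\<close>).  The proof rests on this inequality, on the regularity of the truncations of \<open>u\<close>, and
on the local integrability of \<open>|u|\<^sup>\<sigma>\<close> for some \<open>\<sigma> > q - 1\<close>.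

The superharmonic representative is \<open>ess_liminf u\<close>, the largest lower semicontinuous function that is almost
everywhere at most \<open>u\<close>.  It has to be shown that it is not too small.  This follows from an estimate of
De Giorgi type, \<open>lower_bound_from_small_excess\<close>: if the mean of \<open>(1 + k - u)\<^sup>\<theta>\<close> over the part of a ball where
\<open>u < k\<close> is small compared to a bound for the mean with exponent \<open>\<sigma>\<close>, then \<open>u \<ge> k - d\<close> almost everywhere in the concentric ball of half the radius.
As \<open>k \<rightarrow> -\<infinity>\<close> the mean tends to zero, hence \<open>u\<close> is locally bounded below (\<open>locally_bounded_below\<close>).  Where it is
bounded below, the mean is controlled by the density of the set \<open>u < k\<close>, which vanishes at almost every
point with \<open>u \<ge> k\<close>; hence \<open>ess_liminf u \<ge> u\<close> almost everywhere (\<open>ess_liminf_ge_AE\<close>).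
The estimate itself combines an energy inequality with a bounded weight (\<open>weighted_energy\<close>), which avoids any
a priori lower bound for \<open>u\<close>, with Hoelder's inequality and an inequality of Faber-Krahn type in the place of
Sobolev's inequality (\<open>Faber_Krahn\<close>, \<open>de_giorgi_step\<close>).

For the comparison principle let \<open>h\<close> be harmonic in \<open>U\<close> with \<open>h \<le> ess_liminf u\<close> on the boundary.  For \<open>e > 0\<close>
lower semicontinuity confines the set where \<open>u < h - e\<close> to a compact subset of \<open>U\<close>, up to a null set.  Hence
\<open>(h - e - u)\<^sup>+\<close> is an admissible test function (\<open>weak_inequality_extends\<close>), both in the equation for \<open>h\<close> and in the
inequality for \<open>u\<close> that arises when the function \<open>h\<close> of the renormalized inequality decreases to the indicator
of \<open>{..k}\<close> (\<open>truncated_flux_nonneg\<close>).  Strict monotonicity of \<open>A\<close> gives \<open>\<nabla>(h - e - u)\<^sup>+ = 0\<close>, and the function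
itself vanishes by \<open>Faber_Krahn\<close> (\<open>comparison_AE\<close>).

The sections before these arguments develop the calculus of weak gradients by mollification.  The chain
rule is proved for primitives of bounded Borel functions (\<open>chain_rule\<close>): the derivative of a Lipschitz function is
determined only up to a null set, and that it may be composed with \<open>u\<close> at all is the assertion that \<open>\<nabla>u = 0\<close> almost
everywhere on preimages of null sets (\<open>weak_gradient_zero_on_null_preimage\<close>).
\<close>

section \<open>Smooth functions\<close>

definition smooth :: "('a::euclidean_space \<Rightarrow> real) \<Rightarrow> bool" where
  "smooth f \<longleftrightarrow> (\<forall>k. Ck k f)"

lemma Ck_SucD: "Ck (Suc k) f \<Longrightarrow> Ck k f"
proof (induction k arbitrary: f)
  case 0
  then show ?case by (auto intro: differentiable_imp_continuous_on)
next
  case (Suc k)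
  from Suc.prems have "f differentiable_on UNIV"
    and "\<forall>b\<in>Basis. Ck (Suc k) (\<lambda>x. frechet_derivative f (at x) b)"
    by (simp_all del: Ck.simps(2) add: Ck.simps(2)[of "Suc k"])
  with Suc.IH show ?case by simp
qed

lemma Ck_SucI:
  assumes "\<And>x. (f has_derivative f' x) (at x)" "\<And>b. b \<in> Basis \<Longrightarrow> Ck k (\<lambda>x. f' x b)"
  shows "Ck (Suc k) f"
proof -
  have "frechet_derivative f (at x) = f' x" for x
    using frechet_derivative_at[OF assms(1)] by simp
  moreover have "f differentiable_on UNIV"
    using assms(1) by (auto simp: differentiable_on_def differentiable_def)
  ultimately show ?thesis using assms(2) by simp
qed

lemma Ck_SucE:
  assumes "Ck (Suc k) f"
  obtains f' where "\<And>x. (f has_derivative f' x) (at x)" "\<And>b. b \<in> Basis \<Longrightarrow> Ck k (\<lambda>x. f' x b)"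
proof (rule that[of "\<lambda>x. frechet_derivative f (at x)"])
  show "(f has_derivative frechet_derivative f (at x)) (at x)" for x
    using assms by (auto simp: differentiable_on_def frechet_derivative_works)
qed (use assms in auto)

lemma Ck_const: "Ck k (\<lambda>x. c)"
proof (induction k arbitrary: c)
  case (Suc k)
  show ?case by (rule Ck_SucI[where f' = "\<lambda>x h. 0"]) (auto simp: Suc)
qed auto

lemma Ck_add: "Ck k f \<Longrightarrow> Ck k g \<Longrightarrow> Ck k (\<lambda>x. f x + g x)"
proof (induction k arbitrary: f g)
  case 0
  then show ?case by (auto intro: continuous_on_add)
next
  case (Suc k)
  from Suc.prems(1) obtain f' where f: "\<And>x. (f has_derivative f' x) (at x)" "\<And>b. b \<in> Basis \<Longrightarrow> Ck k (\<lambda>x. f' x b)"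
    by (rule Ck_SucE) blast
  from Suc.prems(2) obtain g' where g: "\<And>x. (g has_derivative g' x) (at x)" "\<And>b. b \<in> Basis \<Longrightarrow> Ck k (\<lambda>x. g' x b)"
    by (rule Ck_SucE) blast
  show ?case
    by (rule Ck_SucI[OF has_derivative_add[OF f(1) g(1)]]) (use f g Suc.IH in auto)
qed

lemma Ck_mult: "Ck k f \<Longrightarrow> Ck k g \<Longrightarrow> Ck k (\<lambda>x. f x * g x)"
proof (induction k arbitrary: f g)
  case 0
  then show ?case by (auto intro: continuous_on_mult)
next
  case (Suc k)
  from Suc.prems(1) obtain f' where f: "\<And>x. (f has_derivative f' x) (at x)" "\<And>b. b \<in> Basis \<Longrightarrow> Ck k (\<lambda>x. f' x b)"
    by (rule Ck_SucE) blast
  from Suc.prems(2) obtain g' where g: "\<And>x. (g has_derivative g' x) (at x)" "\<And>b. b \<in> Basis \<Longrightarrow> Ck k (\<lambda>x. g' x b)"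
    by (rule Ck_SucE) blast
  show ?case
    by (rule Ck_SucI[OF has_derivative_mult[OF f(1) g(1)]])
      (intro Ck_add Suc.IH f g Suc.prems[THEN Ck_SucD])
qed

lemma Ck_sum: "finite A \<Longrightarrow> (\<And>i. i \<in> A \<Longrightarrow> Ck k (f i)) \<Longrightarrow> Ck k (\<lambda>x. \<Sum>i\<in>A. f i x)"
  by (induction A rule: finite_induct) (auto intro: Ck_const Ck_add)

lemma Ck_inner: "Ck k (\<lambda>x. x \<bullet> b)"
proof (cases k)
  case 0
  then show ?thesis by (auto intro!: continuous_intros)
next
  case (Suc j)
  show ?thesis unfolding Suc
    by (rule Ck_SucI[where f' = "\<lambda>x h. h \<bullet> b"]) (auto intro!: derivative_eq_intros Ck_const)
qed

lemma Ck_affine: "Ck k f \<Longrightarrow> Ck k (\<lambda>x. f (c + s *\<^sub>R x))"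
proof (induction k arbitrary: f)
  case 0
  have "continuous_on UNIV (f \<circ> (\<lambda>x. c + s *\<^sub>R x))"
    by (rule continuous_on_compose) (use 0 continuous_on_subset in \<open>auto intro!: continuous_intros\<close>)
  then show ?case by (simp add: o_def)
next
  case (Suc k)
  from Suc.prems obtain f' where f: "\<And>x. (f has_derivative f' x) (at x)" "\<And>b. b \<in> Basis \<Longrightarrow> Ck k (\<lambda>x. f' x b)"
    by (rule Ck_SucE) blast
  have lin: "f' x (s *\<^sub>R h) = s * f' x h" for x h
    using linear_scale[OF has_derivative_linear[OF f(1)]] by simp
  have "((\<lambda>x. f (c + s *\<^sub>R x)) has_derivative (\<lambda>h. s * f' (c + s *\<^sub>R x) h)) (at x)" for x
  proof -
    have "((\<lambda>x. c + s *\<^sub>R x) has_derivative (\<lambda>h. s *\<^sub>R h)) (at x)"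
      by (auto intro!: derivative_eq_intros)
    from has_derivative_compose[OF this f(1)] show ?thesis by (simp add: lin)
  qed
  then show ?case
    by (rule Ck_SucI) (use Ck_mult[OF Ck_const Suc.IH[OF f(2)]] in simp)
qed

text \<open>Treating all orders of differentiability at once keeps the induction short, because both factors of
  the derivative are again smooth or compositions of smooth functions.\<close>

lemma smooth_compose:
  fixes f :: "real \<Rightarrow> real"
  assumes "smooth f" "smooth g"
  shows "smooth (\<lambda>x. f (g x))"
proof -
  have "smooth f \<Longrightarrow> Ck k (\<lambda>x. f (g x))" for k f
  proof (induction k arbitrary: f)
    case 0
    have "continuous_on UNIV (f \<circ> g)"
      by (rule continuous_on_compose; rule continuous_on_subset[of UNIV])
        (use 0 assms(2) in \<open>auto simp: smooth_def dest: spec[of _ 0]\<close>)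
    then show ?case by (simp add: o_def)
  next
    case (Suc k)
    have f1: "Ck (Suc j) f" for j using Suc.prems by (simp add: smooth_def del: Ck.simps)
    define f' where "f' = (\<lambda>x. frechet_derivative f (at x) 1)"
    have "f differentiable (at x)" for x
      using f1[of 0] by (auto simp: differentiable_on_def)
    then have df0: "(f has_derivative frechet_derivative f (at x)) (at x)" for x
      by (simp add: frechet_derivative_works)
    have "frechet_derivative f (at x) = (\<lambda>h. f' x * h)" for x
    proof
      fix h
      show "frechet_derivative f (at x) h = f' x * h"
        using linear_scale[OF has_derivative_linear[OF df0[of x]], of h 1] by (simp add: f'_def)
    qed
    with df0 have df: "(f has_derivative (\<lambda>h. f' x * h)) (at x)" for x by simp
    have sf': "smooth f'"
      using f1 by (simp add: smooth_def f'_def)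
    from assms(2) have "Ck (Suc k) g" by (simp add: smooth_def del: Ck.simps)
    then obtain g' where g: "\<And>x. (g has_derivative g' x) (at x)" "\<And>b. b \<in> Basis \<Longrightarrow> Ck k (\<lambda>x. g' x b)"
      by (rule Ck_SucE) blast
    show ?case
      by (rule Ck_SucI[OF has_derivative_compose[OF g(1) df]]) (intro Ck_mult Suc.IH sf' g(2))
  qed
  with assms(1) show ?thesis by (simp add: smooth_def)
qed

lemma smooth_const: "smooth (\<lambda>x. c)"
  by (auto simp: smooth_def intro: Ck_const)

lemma smooth_add: "smooth f \<Longrightarrow> smooth g \<Longrightarrow> smooth (\<lambda>x. f x + g x)"
  by (auto simp: smooth_def intro: Ck_add)

lemma smooth_mult: "smooth f \<Longrightarrow> smooth g \<Longrightarrow> smooth (\<lambda>x. f x * g x)"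
  by (auto simp: smooth_def intro: Ck_mult)

lemma smooth_inner: "smooth (\<lambda>x. x \<bullet> b)"
  by (auto simp: smooth_def intro: Ck_inner)

lemma smooth_affine: "smooth f \<Longrightarrow> smooth (\<lambda>x. f (c + s *\<^sub>R x))"
  by (auto simp: smooth_def intro: Ck_affine)

lemma smooth_sum: "finite A \<Longrightarrow> (\<And>i. i \<in> A \<Longrightarrow> smooth (f i)) \<Longrightarrow> smooth (\<lambda>x. \<Sum>i\<in>A. f i x)"
  by (auto simp: smooth_def intro: Ck_sum)

lemma smooth_diff: "smooth f \<Longrightarrow> smooth g \<Longrightarrow> smooth (\<lambda>x. f x - g x)"
  using smooth_add[of f "\<lambda>x. (-1) * g x"] smooth_mult[OF smooth_const[of "-1"], of g] by simp

lemma smooth_power: "smooth f \<Longrightarrow> smooth (\<lambda>x. f x ^ n)"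
  by (induction n) (auto intro: smooth_const smooth_mult)

lemma smooth_norm_square: "smooth (\<lambda>x. x \<bullet> x)"
proof -
  have "(\<lambda>x::'a. x \<bullet> x) = (\<lambda>x. \<Sum>b\<in>Basis. (x \<bullet> b) * (x \<bullet> b))"
    by (simp add: euclidean_inner[symmetric])
  then show ?thesis by (simp add: smooth_sum smooth_mult smooth_inner)
qed

lemma smooth_continuous: "smooth f \<Longrightarrow> continuous_on UNIV f"
  by (auto simp: smooth_def dest: spec[of _ 0])

lemma smooth_differentiable: "smooth f \<Longrightarrow> f differentiable (at x)"
  by (auto simp: smooth_def differentiable_on_def dest: spec[of _ "Suc 0"])

lemma has_derivative_grad:
  assumes "f differentiable (at x)"
  shows "(f has_derivative (\<lambda>h. grad f x \<bullet> h)) (at x)"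
proof -
  let ?D = "frechet_derivative f (at x)"
  from assms have d: "(f has_derivative ?D) (at x)" by (simp add: frechet_derivative_works)
  have "?D = (\<lambda>h. grad f x \<bullet> h)"
  proof
    fix h
    have "?D h = ?D (\<Sum>b\<in>Basis. (h \<bullet> b) *\<^sub>R b)" by (simp add: euclidean_representation)
    also have "\<dots> = (\<Sum>b\<in>Basis. (h \<bullet> b) * ?D b)"
      using has_derivative_linear[OF d] by (simp add: linear_sum linear_scale)
    also have "\<dots> = grad f x \<bullet> h"
      by (simp add: grad_def inner_sum_left inner_commute[of h] mult.commute)
    finally show "?D h = grad f x \<bullet> h" .
  qed
  with d show ?thesis by simp
qed

lemma grad_eqI:
  assumes "(f has_derivative (\<lambda>h. v \<bullet> h)) (at x)"
  shows "grad f x = v"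
  unfolding grad_def frechet_derivative_at[OF assms, symmetric]
  by (simp add: euclidean_representation)

lemma smooth_has_derivative: "smooth f \<Longrightarrow> (f has_derivative (\<lambda>h. grad f x \<bullet> h)) (at x)"
  by (intro has_derivative_grad smooth_differentiable)

lemma smooth_grad_inner:
  assumes "smooth f"
  shows "smooth (\<lambda>x. grad f x \<bullet> e)"
proof -
  have "smooth (\<lambda>x. frechet_derivative f (at x) b)" if "b \<in> Basis" for b
    unfolding smooth_def
  proof
    fix k
    have "Ck (Suc k) f" using assms by (simp only: smooth_def)
    then show "Ck k (\<lambda>x. frechet_derivative f (at x) b)" using that by simp
  qed
  then show ?thesis
    unfolding grad_def inner_sum_left inner_scaleR_left
    by (intro smooth_sum smooth_mult[OF _ smooth_const] finite_Basis)
qed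

lemma continuous_on_grad: "smooth f \<Longrightarrow> continuous_on UNIV (grad f)"
  using continuous_on_componentwise[of UNIV "grad f"] smooth_continuous[OF smooth_grad_inner] by blast

lemma grad_mult:
  assumes "f differentiable (at x)" "g differentiable (at x)"
  shows "grad (\<lambda>x. f x * g x) x = f x *\<^sub>R grad g x + g x *\<^sub>R grad f x"
  by (rule grad_eqI, rule has_derivative_eq_rhs[OF has_derivative_mult[OF assms[THEN has_derivative_grad]]])
    (auto simp: inner_add_left)

lemma grad_power:
  assumes "f differentiable (at x)"
  shows "grad (\<lambda>x. f x ^ n) x = (real n * f x ^ (n - 1)) *\<^sub>R grad f x"
  by (rule grad_eqI, rule has_derivative_eq_rhs[OF has_derivative_power[OF has_derivative_grad[OF assms]]])
    (auto simp: algebra_simps)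

lemma grad_affine:
  assumes "smooth f"
  shows "grad (\<lambda>x. f (c + s *\<^sub>R x)) x = s *\<^sub>R grad f (c + s *\<^sub>R x)"
proof (rule grad_eqI)
  have "((\<lambda>x. c + s *\<^sub>R x) has_derivative (\<lambda>h. s *\<^sub>R h)) (at x)"
    by (auto intro!: derivative_eq_intros)
  from has_derivative_compose[OF this smooth_has_derivative[OF assms]]
  show "((\<lambda>x. f (c + s *\<^sub>R x)) has_derivative (\<bullet>) (s *\<^sub>R grad f (c + s *\<^sub>R x))) (at x)"
    by (rule has_derivative_eq_rhs) auto
qed

lemma test_functionsI:
  assumes "smooth \<phi>" "compact K" "K \<subseteq> U" "\<And>x. x \<notin> K \<Longrightarrow> \<phi> x = 0"
  shows "\<phi> \<in> test_functions U"
proof -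
  have "closure {x. \<phi> x \<noteq> 0} \<subseteq> K"
    by (rule closure_minimal) (use assms compact_imp_closed in auto)
  moreover have "compact (closure {x. \<phi> x \<noteq> 0})"
    using assms(2) compact_imp_bounded bounded_subset[of K "{x. \<phi> x \<noteq> 0}"] assms(4)
    by (auto simp: compact_closure)
  ultimately show ?thesis
    using assms by (auto simp: test_functions_def smooth_def)
qed

lemma test_functionsE:
  assumes "\<phi> \<in> test_functions U"
  obtains K where "smooth \<phi>" "compact K" "K \<subseteq> U" "\<And>x. x \<notin> K \<Longrightarrow> \<phi> x = 0" "\<And>x. x \<notin> K \<Longrightarrow> grad \<phi> x = 0"
proof
  let ?K = "closure {x. \<phi> x \<noteq> 0}"
  show "smooth \<phi>" "compact ?K" "?K \<subseteq> U" using assms by (auto simp: test_functions_def smooth_def)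
  show *: "\<phi> x = 0" if "x \<notin> ?K" for x using that closure_subset[of "{x. \<phi> x \<noteq> 0}"] by auto
  show "grad \<phi> x = 0" if "x \<notin> ?K" for x
  proof (rule grad_eqI)
    have "((\<lambda>x. 0) has_derivative (\<lambda>h. 0)) (at x)" by simp
    then have "(\<phi> has_derivative (\<lambda>h. 0)) (at x)"
    proof (rule has_derivative_transform_within_open[OF _ open_Compl[OF closed_closure]])
      show "x \<in> - ?K" using that by blast
      show "0 = \<phi> y" if "y \<in> - ?K" for y using *[of y] that by simp
    qed
    then show "(\<phi> has_derivative (\<bullet>) 0) (at x)" by (rule has_derivative_eq_rhs) (simp add: fun_eq_iff)
  qed
qed

lemma test_smooth: "\<phi> \<in> test_functions U \<Longrightarrow> smooth \<phi>"
  by (auto simp: test_functions_def smooth_def)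

lemma test_mono: "\<phi> \<in> test_functions U \<Longrightarrow> U \<subseteq> V \<Longrightarrow> \<phi> \<in> test_functions V"
  by (auto simp: test_functions_def)

lemma test_zero:
  assumes "\<phi> \<in> test_functions U" "x \<notin> U"
  shows "\<phi> x = 0" "grad \<phi> x = 0"
proof -
  obtain K where "K \<subseteq> U" "\<And>x. x \<notin> K \<Longrightarrow> \<phi> x = 0" "\<And>x. x \<notin> K \<Longrightarrow> grad \<phi> x = 0"
    using assms(1) by (rule test_functionsE) blast
  with assms(2) show "\<phi> x = 0" "grad \<phi> x = 0" by auto
qed

lemma test_grad_inner:
  assumes "\<phi> \<in> test_functions U"
  shows "(\<lambda>x. grad \<phi> x \<bullet> e) \<in> test_functions U"
proof -
  obtain K where K: "smooth \<phi>" "compact K" "K \<subseteq> U" "\<And>x. x \<notin> K \<Longrightarrow> \<phi> x = 0" "\<And>x. x \<notin> K \<Longrightarrow> grad \<phi> x = 0"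
    using assms(1) by (rule test_functionsE) blast
  show ?thesis
    by (rule test_functionsI[of _ K]) (use K assms in \<open>auto intro: smooth_grad_inner\<close>)
qed

lemma test_mult:
  assumes "\<phi> \<in> test_functions U" "smooth \<psi>"
  shows "(\<lambda>x. \<psi> x * \<phi> x) \<in> test_functions U"
proof -
  obtain K where K: "smooth \<phi>" "compact K" "K \<subseteq> U" "\<And>x. x \<notin> K \<Longrightarrow> \<phi> x = 0" "\<And>x. x \<notin> K \<Longrightarrow> grad \<phi> x = 0"
    using assms(1) by (rule test_functionsE) blast
  show ?thesis
    by (rule test_functionsI[of _ K]) (use K assms in \<open>auto intro: smooth_mult\<close>)
qed

lemma test_power:
  assumes "\<phi> \<in> test_functions U" "n \<noteq> 0"
  shows "(\<lambda>x. \<phi> x ^ n) \<in> test_functions U"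
proof -
  obtain K where K: "smooth \<phi>" "compact K" "K \<subseteq> U" "\<And>x. x \<notin> K \<Longrightarrow> \<phi> x = 0" "\<And>x. x \<notin> K \<Longrightarrow> grad \<phi> x = 0"
    using assms(1) by (rule test_functionsE) blast
  show ?thesis
    by (rule test_functionsI[of _ K]) (use K assms in \<open>auto intro: smooth_power\<close>)
qed

lemma test_affine:
  assumes "\<phi> \<in> test_functions UNIV" "s \<noteq> 0"
  shows "(\<lambda>x. \<phi> (c + s *\<^sub>R x)) \<in> test_functions UNIV"
proof -
  obtain K where K: "smooth \<phi>" "compact K" "\<And>x. x \<notin> K \<Longrightarrow> \<phi> x = 0"
    using assms(1) by (rule test_functionsE) blast
  show ?thesis
  proof (rule test_functionsI)
    show "smooth (\<lambda>x. \<phi> (c + s *\<^sub>R x))" by (rule smooth_affine[OF K(1)])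
    show "compact ((\<lambda>y. (1/s) *\<^sub>R (y - c)) ` K)"
      by (rule compact_continuous_image[OF _ K(2)]) (auto intro!: continuous_intros)
    show "\<phi> (c + s *\<^sub>R x) = 0" if "x \<notin> (\<lambda>y. (1/s) *\<^sub>R (y - c)) ` K" for x
    proof (rule K(3))
      show "c + s *\<^sub>R x \<notin> K"
      proof
        assume "c + s *\<^sub>R x \<in> K"
        then have "(1/s) *\<^sub>R ((c + s *\<^sub>R x) - c) \<in> (\<lambda>y. (1/s) *\<^sub>R (y - c)) ` K" by (rule imageI)
        with that assms(2) show False by simp
      qed
    qed
  qed simp
qed

lemma compact_support_bounded:
  fixes f :: "'a::euclidean_space \<Rightarrow> 'b::real_normed_vector"
  assumes "continuous_on UNIV f" "compact K" "\<And>x. x \<notin> K \<Longrightarrow> f x = 0"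
  obtains B where "B > 0" "\<And>x. norm (f x) \<le> B"
proof -
  have "compact (f ` K)" using compact_continuous_image[OF continuous_on_subset[OF assms(1)] assms(2)] by simp
  then have "bounded (f ` K)" by (rule compact_imp_bounded)
  then obtain B where B: "\<And>y. y \<in> f ` K \<Longrightarrow> norm y \<le> B"
    unfolding bounded_iff by blast
  have "norm (f x) \<le> max B 1" for x
  proof (cases "x \<in> K")
    case True
    then show ?thesis using B[OF imageI[OF True, of f]] by linarith
  next
    case False
    show ?thesis using assms(3)[OF False] by simp
  qed
  then show ?thesis using that[of "max B 1"] by auto
qed

lemma compact_support_integrable:
  fixes f :: "'a::euclidean_space \<Rightarrow> 'b::euclidean_space"
  assumes "continuous_on UNIV f" "compact K" "\<And>x. x \<notin> K \<Longrightarrow> f x = 0"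
  shows "integrable lborel f"
proof -
  have "set_integrable lborel K f"
    unfolding set_integrable_def
    using borel_integrable_compact[OF assms(2) continuous_on_subset[OF assms(1)]] by simp
  moreover have "(\<lambda>x. indicator K x *\<^sub>R f x) = f" using assms(3) by (auto simp: indicator_def)
  ultimately show ?thesis by (simp add: set_integrable_def)
qed

lemma test_bounded:
  assumes "\<phi> \<in> test_functions U"
  obtains B where "B > 0" "\<And>x. \<bar>\<phi> x\<bar> \<le> B" "\<And>x. norm (grad \<phi> x) \<le> B"
proof -
  obtain K where K: "smooth \<phi>" "compact K" "\<And>x. x \<notin> K \<Longrightarrow> \<phi> x = 0" "\<And>x. x \<notin> K \<Longrightarrow> grad \<phi> x = 0"
    using assms by (rule test_functionsE) blast
  obtain A where "A > 0" "\<And>x. norm (\<phi> x) \<le> A"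
    using compact_support_bounded[OF smooth_continuous[OF K(1)] K(2,3)] by blast
  moreover obtain B where "B > 0" "\<And>x. norm (grad \<phi> x) \<le> B"
    using compact_support_bounded[OF continuous_on_grad[OF K(1)] K(2,4)] by blast
  ultimately show ?thesis using that[of "max A B"] by (auto simp: le_max_iff_disj)
qed

lemma test_integrable:
  assumes "\<phi> \<in> test_functions U"
  shows "integrable lborel \<phi>" "integrable lborel (grad \<phi>)"
proof -
  obtain K where K: "smooth \<phi>" "compact K" "\<And>x. x \<notin> K \<Longrightarrow> \<phi> x = 0" "\<And>x. x \<notin> K \<Longrightarrow> grad \<phi> x = 0"
    using assms by (rule test_functionsE) blast
  show "integrable lborel \<phi>" by (rule compact_support_integrable[OF smooth_continuous[OF K(1)] K(2,3)])
  show "integrable lborel (grad \<phi>)" by (rule compact_support_integrable[OF continuous_on_grad[OF K(1)] K(2,4)])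
qed

lemma test_borel:
  assumes "\<phi> \<in> test_functions U"
  shows "\<phi> \<in> borel_measurable borel" "grad \<phi> \<in> borel_measurable borel"
  using borel_measurable_integrable[OF test_integrable(1)[OF assms]] borel_measurable_integrable[OF test_integrable(2)[OF assms]]
  by simp_all

section \<open>Mollifiers\<close>

text \<open>The derivatives of \<open>exp (-1/t)\<close>, extended by zero, stay within the span of this family.\<close>

definition flat :: "nat \<Rightarrow> real \<Rightarrow> real" where
  "flat n t = (if t > 0 then inverse t ^ n * exp (- inverse t) else 0)"

lemma flat_tendsto_0: "(flat n \<longlongrightarrow> 0) (at 0)"
proof -
  have "((\<lambda>t. inverse t ^ n / exp (inverse t)) \<longlongrightarrow> 0) (at_right (0::real))"
    by (rule filterlim_compose[OF tendsto_power_div_exp_0 filterlim_inverse_at_top_right])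
  moreover have "\<forall>\<^sub>F t in at_right 0. inverse t ^ n / exp (inverse t) = flat n t"
    by (rule eventually_mono[OF eventually_at_right_less]) (simp add: flat_def exp_minus divide_inverse)
  ultimately have "(flat n \<longlongrightarrow> 0) (at_right 0)"
    by (rule Lim_transform_eventually)
  moreover have "(flat n \<longlongrightarrow> 0) (at_left 0)"
  proof (rule Lim_transform_eventually[OF tendsto_const])
    have "\<forall>\<^sub>F t in at_left (0::real). t < 0"
      by (simp add: eventually_at_filter)
    then show "\<forall>\<^sub>F t in at_left 0. 0 = flat n t"
      by (rule eventually_mono) (simp add: flat_def)
  qed
  ultimately show ?thesis by (simp add: filterlim_at_split)
qed

lemma flat_derivative:
  "(flat n has_real_derivative (flat (n + 2) t - real n * flat (n + 1) t)) (at t)"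
proof (cases t "0::real" rule: linorder_cases)
  case greater
  have "((\<lambda>t. inverse t ^ n * exp (- inverse t)) has_real_derivative
      (flat (n + 2) t - real n * flat (n + 1) t)) (at t)"
  proof -
    have "((\<lambda>t. inverse t ^ n * exp (- inverse t)) has_real_derivative
        (real n * inverse t ^ (n - 1) * (- (inverse t * inverse t))) * exp (- inverse t)
        + inverse t ^ n * (exp (- inverse t) * (inverse t * inverse t))) (at t)"
      by (rule derivative_eq_intros refl | use greater in simp)+
    moreover have "(real n * inverse t ^ (n - 1) * (- (inverse t * inverse t))) * exp (- inverse t)
        + inverse t ^ n * (exp (- inverse t) * (inverse t * inverse t)) = flat (n + 2) t - real n * flat (n + 1) t"
    proof (cases n)
      case (Suc m)
      then have "inverse t ^ n = inverse t ^ m * inverse t" "inverse t ^ (n - 1) = inverse t ^ m"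
        "inverse t ^ (n + 1) = inverse t ^ m * inverse t * inverse t"
        "inverse t ^ (n + 2) = inverse t ^ m * inverse t * inverse t * inverse t"
        by simp_all
      then show ?thesis using greater unfolding flat_def by (simp add: algebra_simps)
    qed (use greater in \<open>simp add: flat_def power2_eq_square\<close>)
    ultimately show ?thesis by simp
  qed
  then show ?thesis
    by (rule has_field_derivative_transform_within_open[where S = "{0<..}"])
      (use greater in \<open>auto simp: flat_def\<close>)
next
  case less
  have "((\<lambda>t. 0) has_real_derivative (flat (n + 2) t - real n * flat (n + 1) t)) (at t)"
    using less by (simp add: flat_def)
  then show ?thesis
    by (rule has_field_derivative_transform_within_open[where S = "{..<0}"])
      (use less in \<open>auto simp: flat_def\<close>)
next
  case equal
  have "((\<lambda>y. (flat n y - flat n 0) / (y - 0)) \<longlongrightarrow> 0) (at 0)"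
  proof (rule Lim_transform_eventually[OF flat_tendsto_0[of "n + 1"]])
    show "\<forall>\<^sub>F x in at 0. flat (n + 1) x = (flat n x - flat n 0) / (x - 0)"
      by (auto simp: eventually_at flat_def divide_inverse intro!: exI[of _ 1])
  qed
  then show ?thesis using equal by (simp add: has_field_derivative_iff flat_def)
qed

lemma smooth_flat: "smooth (flat n)"
proof -
  have "Ck k (flat n)" for k
  proof (induction k arbitrary: n)
    case 0
    then show ?case
      using DERIV_isCont[OF flat_derivative] by (simp add: continuous_at_imp_continuous_on)
  next
    case (Suc k)
    have d: "(flat n has_derivative (\<lambda>h. (flat (n + 2) x + (- real n) * flat (n + 1) x) * h)) (at x)" for x
      using flat_derivative[of n x] by (simp add: has_field_derivative_def)
    show ?case
      by (rule Ck_SucI[OF d]) (intro Ck_mult Ck_add Ck_const Suc)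
  qed
  then show ?thesis by (simp add: smooth_def)
qed

lemma nn_integral_affine:
  fixes f :: "'a::euclidean_space \<Rightarrow> ennreal"
  assumes [measurable]: "f \<in> borel_measurable borel" and "s \<noteq> 0"
  shows "(\<integral>\<^sup>+x. f x \<partial>lborel) = ennreal (\<bar>s\<bar> ^ DIM('a)) * (\<integral>\<^sup>+x. f (t + s *\<^sub>R x) \<partial>lborel)"
  by (subst lborel_affine[OF assms(2), of t])
    (simp add: nn_integral_density nn_integral_distr nn_integral_cmult)

lemma integrable_affine:
  fixes f :: "'a::euclidean_space \<Rightarrow> 'b::euclidean_space"
  assumes f: "integrable lborel f" and s: "s \<noteq> 0"
  shows "integrable lborel (\<lambda>x. f (t + s *\<^sub>R x))"
proof -
  have [measurable]: "f \<in> borel_measurable borel" using f by auto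
  have "(\<integral>\<^sup>+x. norm (f x) \<partial>lborel) < \<infinity>" using f by (simp add: integrable_iff_bounded)
  then show ?thesis
    unfolding integrable_iff_bounded
    by (subst (asm) nn_integral_affine[where s = s and t = t]) (use s in \<open>auto simp: ennreal_mult_less_top\<close>)
qed

lemma integral_affine:
  fixes f :: "'a::euclidean_space \<Rightarrow> 'b::euclidean_space"
  assumes f: "integrable lborel f" and s: "s \<noteq> 0"
  shows "(LBINT x. f x) = (\<bar>s\<bar> ^ DIM('a)) *\<^sub>R (LBINT x. f (t + s *\<^sub>R x))"
proof -
  have [measurable]: "f \<in> borel_measurable borel" using f by auto
  show ?thesis
    by (subst lborel_affine[OF s, of t]) (simp add: integral_density integral_distr)
qed

lemma integrable_reflect:
  fixes f :: "'a::euclidean_space \<Rightarrow> 'b::euclidean_space"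
  assumes "integrable lborel f"
  shows "integrable lborel (\<lambda>y. f (x - y))"
  using integrable_affine[OF assms, of "-1" x] by simp

lemma integral_reflect:
  fixes f :: "'a::euclidean_space \<Rightarrow> 'b::euclidean_space"
  assumes "integrable lborel f"
  shows "(LBINT y. f (x - y)) = (LBINT y. f y)"
  using integral_affine[OF assms, of "-1" x] by simp

definition bump :: "'a::euclidean_space \<Rightarrow> real" where
  "bump x = flat 0 (1 - x \<bullet> x)"

lemma smooth_bump: "smooth bump"
  unfolding bump_def[abs_def]
  by (rule smooth_compose[OF smooth_flat smooth_diff[OF smooth_const smooth_norm_square]])

lemma bump_nonneg: "0 \<le> bump x"
  and bump_pos: "norm x < 1 \<Longrightarrow> 0 < bump x"
  and bump_zero: "1 \<le> norm x \<Longrightarrow> bump x = 0"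
proof -
  have *: "x \<bullet> x = norm x ^ 2" for x :: 'a by (simp add: power2_norm_eq_inner)
  show "0 \<le> bump x" by (simp add: bump_def flat_def)
  show "0 < bump x" if "norm x < 1"
  proof -
    have "norm x ^ 2 < 1" using that by (simp add: power_less_one_iff abs_square_less_1)
    then show ?thesis by (simp add: bump_def flat_def *)
  qed
  show "bump x = 0" if "1 \<le> norm x"
  proof -
    have "norm x ^ 2 \<ge> 1" using that by (simp add: one_le_power)
    then show ?thesis by (simp add: bump_def flat_def *)
  qed
qed

lemma test_bump: "bump \<in> test_functions UNIV"
  by (rule test_functionsI[OF smooth_bump compact_cball[of 0 1]]) (auto intro: bump_zero)

definition bump_mass :: "'a::euclidean_space itself \<Rightarrow> real" where
  "bump_mass _ = (\<integral>x. bump x \<partial>(lborel::'a measure))"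

lemma bump_mass_pos: "0 < bump_mass TYPE('a::euclidean_space)"
proof (rule ccontr)
  assume "\<not> ?thesis"
  moreover have "0 \<le> (\<integral>x. bump x \<partial>(lborel::'a measure))" by (simp add: bump_nonneg)
  ultimately have "(\<integral>x. bump x \<partial>(lborel::'a measure)) = 0" by (simp add: bump_mass_def)
  then have "AE x::'a in lborel. bump x = 0"
    using integral_nonneg_eq_0_iff_AE[OF test_integrable(1)[OF test_bump[where 'a = 'a]]] by (simp add: bump_nonneg)
  then have "AE x::'a in lborel. x \<notin> ball 0 1"
    by eventually_elim (use bump_pos in force)
  then have "ball (0::'a) 1 \<in> null_sets lborel"
    by (subst (asm) AE_iff_null) (auto simp: ball_def)
  then have "negligible (ball (0::'a) 1)"
    by (simp add: negligible_iff_null_sets null_sets_completionI)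
  then show False using open_not_negligible[of "ball (0::'a) 1"] by auto
qed

text \<open>The argument of \<open>bump\<close> is written as an affine map, as in the substitution rules above.\<close>

definition mollifier :: "real \<Rightarrow> 'a::euclidean_space \<Rightarrow> real" where
  "mollifier \<epsilon> x = inverse (\<epsilon> ^ DIM('a) * bump_mass TYPE('a)) * bump (0 + inverse \<epsilon> *\<^sub>R x)"

lemma test_mollifier: "\<epsilon> > 0 \<Longrightarrow> mollifier \<epsilon> \<in> test_functions UNIV"
  unfolding mollifier_def[abs_def]
  by (intro test_mult test_affine test_bump smooth_const) auto

lemma mollifier_nonneg: "\<epsilon> > 0 \<Longrightarrow> 0 \<le> mollifier \<epsilon> x"
  unfolding mollifier_def using bump_mass_pos[where 'a = 'a] by (simp add: bump_nonneg less_imp_le)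

lemma mollifier_zero: "\<epsilon> > 0 \<Longrightarrow> \<epsilon> \<le> norm x \<Longrightarrow> mollifier \<epsilon> x = 0"
  unfolding mollifier_def by (simp add: bump_zero field_simps)

lemma integral_mollifier:
  assumes "\<epsilon> > 0"
  shows "(LBINT x. mollifier \<epsilon> (x::'a::euclidean_space)) = 1"
proof -
  have "bump_mass TYPE('a) = inverse \<epsilon> ^ DIM('a) * (\<integral>x. bump (0 + inverse \<epsilon> *\<^sub>R x) \<partial>(lborel::'a measure))"
    unfolding bump_mass_def
    using integral_affine[OF test_integrable(1)[OF test_bump], of "inverse \<epsilon>" 0] assms by simp
  then have "(\<integral>x. bump (0 + inverse \<epsilon> *\<^sub>R x) \<partial>(lborel::'a measure)) = \<epsilon> ^ DIM('a) * bump_mass TYPE('a)"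
    using assms by (simp add: power_inverse field_simps)
  then show ?thesis
    unfolding mollifier_def using assms bump_mass_pos[where 'a = 'a] by (simp add: field_simps)
qed

text \<open>The integral of \<open>norm (grad (mollifier \<epsilon>))\<close> is this number divided by \<open>\<epsilon>\<close>.\<close>

definition mollifier_const :: "'a::euclidean_space itself \<Rightarrow> real" where
  "mollifier_const _ = inverse (bump_mass TYPE('a)) * (\<integral>x. norm (grad bump x) \<partial>(lborel::'a measure))"

lemma integral_grad_mollifier:
  assumes "\<epsilon> > 0"
  shows "(LBINT x. norm (grad (mollifier \<epsilon>) (x::'a::euclidean_space))) = mollifier_const TYPE('a) / \<epsilon>"
proof -
  let ?c = "inverse (\<epsilon> ^ DIM('a) * bump_mass TYPE('a))"
  have sm: "smooth (\<lambda>x::'a. bump (0 + inverse \<epsilon> *\<^sub>R x))" by (rule smooth_affine[OF smooth_bump])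
  have "grad (mollifier \<epsilon>) x = (?c * inverse \<epsilon>) *\<^sub>R grad bump (0 + inverse \<epsilon> *\<^sub>R x)" for x :: 'a
  proof -
    have "grad (mollifier \<epsilon>) x = ?c *\<^sub>R grad (\<lambda>x. bump (0 + inverse \<epsilon> *\<^sub>R x)) x"
      unfolding mollifier_def[abs_def]
      by (subst grad_mult[OF smooth_differentiable[OF smooth_const] smooth_differentiable[OF sm]])
        (simp add: grad_eqI[of "\<lambda>x. _"])
    then show ?thesis unfolding grad_affine[OF smooth_bump] by simp
  qed
  moreover have "0 < ?c" using assms bump_mass_pos[where 'a = 'a] by simp
  ultimately have "(LBINT x. norm (grad (mollifier \<epsilon>) (x::'a)))
      = ?c * inverse \<epsilon> * (\<integral>x. norm (grad bump (0 + inverse \<epsilon> *\<^sub>R x)) \<partial>(lborel::'a measure))"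
    using assms by simp
  also have "(\<integral>x. norm (grad bump x) \<partial>(lborel::'a measure))
      = inverse \<epsilon> ^ DIM('a) * (\<integral>x. norm (grad bump (0 + inverse \<epsilon> *\<^sub>R x)) \<partial>(lborel::'a measure))"
    using integral_affine[OF integrable_norm[OF test_integrable(2)[OF test_bump]], of "inverse \<epsilon>" 0] assms by simp
  then have "(\<integral>x. norm (grad bump (0 + inverse \<epsilon> *\<^sub>R x)) \<partial>(lborel::'a measure))
      = \<epsilon> ^ DIM('a) * (\<integral>x. norm (grad bump x) \<partial>(lborel::'a measure))"
    using assms by (simp add: power_inverse field_simps)
  finally show ?thesis
    using assms bump_mass_pos[where 'a = 'a] by (simp add: mollifier_const_def field_simps)
qed

lemma mollifier_const_nonneg: "0 \<le> mollifier_const TYPE('a::euclidean_space)"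
  unfolding mollifier_const_def using bump_mass_pos[where 'a = 'a] by simp

section \<open>Convolution\<close>

definition conv :: "('a::euclidean_space \<Rightarrow> 'b::euclidean_space) \<Rightarrow> ('a \<Rightarrow> real) \<Rightarrow> 'a \<Rightarrow> 'b" where
  "conv f \<rho> x = (LBINT y. \<rho> (x - y) *\<^sub>R f y)"

lemma integrable_bounded_mult:
  fixes f :: "'a::euclidean_space \<Rightarrow> 'b::euclidean_space" and g :: "'a \<Rightarrow> real"
  assumes "integrable lborel f" and [measurable]: "g \<in> borel_measurable borel" and "\<And>x. \<bar>g x\<bar> \<le> B"
  shows "integrable lborel (\<lambda>x. g x *\<^sub>R f x)"
proof (rule Bochner_Integration.integrable_bound)
  show "integrable lborel (\<lambda>x. B * norm (f x))" using assms(1) by simp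
  show "AE x in lborel. norm (g x *\<^sub>R f x) \<le> norm (B * norm (f x))"
  proof (rule AE_I2)
    fix x
    have "\<bar>g x\<bar> * norm (f x) \<le> \<bar>B\<bar> * norm (f x)"
      using assms(3)[of x] by (intro mult_right_mono) auto
    then show "norm (g x *\<^sub>R f x) \<le> norm (B * norm (f x))" by (simp add: abs_mult)
  qed
  have "f \<in> borel_measurable borel" using borel_measurable_integrable[OF assms(1)] by simp
  then have "(\<lambda>x. g x *\<^sub>R f x) \<in> borel_measurable borel"
    by (rule borel_measurable_scaleR[OF assms(2)])
  then show "(\<lambda>x. g x *\<^sub>R f x) \<in> borel_measurable lborel" by simp
qed

lemma conv_integrable:
  fixes f :: "'a::euclidean_space \<Rightarrow> 'b::euclidean_space"
  assumes "integrable lborel f" "\<rho> \<in> test_functions UNIV"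
  shows "integrable lborel (\<lambda>y. \<rho> (x - y) *\<^sub>R f y)"
proof -
  have [measurable]: "\<rho> \<in> borel_measurable borel" by (rule test_borel[OF assms(2)])
  obtain B where B: "B > 0" "\<And>x. \<bar>\<rho> x\<bar> \<le> B" "\<And>x. norm (grad \<rho> x) \<le> B"
    using test_bounded[OF assms(2)] by blast
  show ?thesis by (rule integrable_bounded_mult[OF assms(1), where B = B]) (simp, rule B(2))
qed

lemma conv_diff:
  fixes f g :: "'a::euclidean_space \<Rightarrow> 'b::euclidean_space"
  assumes "integrable lborel f" "integrable lborel g" "\<rho> \<in> test_functions UNIV"
  shows "conv (\<lambda>x. f x - g x) \<rho> x = conv f \<rho> x - conv g \<rho> x"
  unfolding conv_def scaleR_diff_right
  by (rule Bochner_Integration.integral_diff[OF conv_integrable[OF assms(1,3)] conv_integrable[OF assms(2,3)]])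

lemma conv_measurable:
  fixes f :: "'a::euclidean_space \<Rightarrow> 'b::euclidean_space"
  assumes "integrable lborel f" "\<rho> \<in> test_functions UNIV"
  shows "conv f \<rho> \<in> borel_measurable borel"
proof -
  have [measurable]: "\<rho> \<in> borel_measurable borel" by (rule test_borel[OF assms(2)])
  have [measurable]: "f \<in> borel_measurable borel" using assms(1) by auto
  have "(\<lambda>x. LBINT y. \<rho> (x - y) *\<^sub>R f y) \<in> borel_measurable borel"
    by (rule lborel.borel_measurable_lebesgue_integral) measurable
  then show ?thesis by (simp add: conv_def[abs_def])
qed

lemma bounded_gradient_Lipschitz:
  fixes \<rho> :: "'a::euclidean_space \<Rightarrow> real"
  assumes "\<And>x. norm (G x) \<le> B" "\<And>x. (\<rho> has_derivative (\<lambda>h. G x \<bullet> h)) (at x)"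
  shows "\<bar>\<rho> x - \<rho> y\<bar> \<le> B * norm (x - y)"
proof -
  have "norm (\<rho> x - \<rho> y) \<le> B * norm (x - y)"
  proof (rule differentiable_bound[of UNIV \<rho> "\<lambda>x h. G x \<bullet> h"])
    show "(\<rho> has_derivative (\<bullet>) (G x)) (at x within UNIV)" for x
      using assms(2) by simp
    show "onorm ((\<bullet>) (G x)) \<le> B" for x
    proof (rule onorm_le)
      fix h
      have "norm (G x \<bullet> h) \<le> norm (G x) * norm h"
        using Cauchy_Schwarz_ineq2[of "G x" h] by simp
      also have "\<dots> \<le> B * norm h" by (rule mult_right_mono[OF assms(1)]) simp
      finally show "norm (G x \<bullet> h) \<le> B * norm h" .
    qed
  qed auto
  then show ?thesis by simp
qed

text \<open>Differentiation under the integral sign: the difference quotients of \<open>\<rho>\<close> are bounded by its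
  Lipschitz constant, so dominated convergence applies.\<close>

lemma conv_has_derivative:
  fixes f :: "'a::euclidean_space \<Rightarrow> real"
  assumes f: "integrable lborel f" and r: "\<rho> \<in> test_functions UNIV"
  shows "(conv f \<rho> has_derivative (\<lambda>h. (LBINT y. f y *\<^sub>R grad \<rho> (x - y)) \<bullet> h)) (at x)"
proof -
  have sm: "smooth \<rho>" by (rule test_smooth[OF r])
  have [measurable]: "\<rho> \<in> borel_measurable borel" "grad \<rho> \<in> borel_measurable borel"
    by (rule test_borel[OF r])+
  have [measurable]: "f \<in> borel_measurable borel" using f by auto
  obtain B where B: "B > 0" "\<And>x. \<bar>\<rho> x\<bar> \<le> B" "\<And>x. norm (grad \<rho> x) \<le> B"
    using test_bounded[OF r] by blast
  let ?G = "LBINT y. f y *\<^sub>R grad \<rho> (x - y)"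
  have ig: "integrable lborel (\<lambda>y. f y *\<^sub>R grad \<rho> (x - y))"
  proof (rule Bochner_Integration.integrable_bound)
    show "integrable lborel (\<lambda>y. B * \<bar>f y\<bar>)" using f by simp
    show "AE y in lborel. norm (f y *\<^sub>R grad \<rho> (x - y)) \<le> norm (B * \<bar>f y\<bar>)"
      using mult_left_mono[OF B(3) abs_ge_zero] B(1) by (auto simp: abs_mult mult.commute[of B])
  qed measurable
  define R where "R h y = (\<rho> (x + h - y) - \<rho> (x - y) - grad \<rho> (x - y) \<bullet> h) / norm h * f y" for h y
  have eq: "(conv f \<rho> (x + h) - conv f \<rho> x - ?G \<bullet> h) / norm h = (LBINT y. R h y)" for h
  proof -
    have i1: "integrable lborel (\<lambda>y. \<rho> (x + h - y) * f y)" "integrable lborel (\<lambda>y. \<rho> (x - y) * f y)"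
      using conv_integrable[OF f r, of "x + h"] conv_integrable[OF f r, of x] by simp_all
    have i2: "integrable lborel (\<lambda>y. (f y *\<^sub>R grad \<rho> (x - y)) \<bullet> h)" by (rule integrable_inner_left) (rule ig)
    have "conv f \<rho> (x + h) - conv f \<rho> x - ?G \<bullet> h
        = (LBINT y. \<rho> (x + h - y) * f y - \<rho> (x - y) * f y - (f y *\<^sub>R grad \<rho> (x - y)) \<bullet> h)"
      unfolding conv_def integral_inner_left[OF ig, symmetric]
      by (subst Bochner_Integration.integral_diff[OF _ i2], intro Bochner_Integration.integrable_diff i1,
          subst Bochner_Integration.integral_diff[OF i1]) simp
    then have "(conv f \<rho> (x + h) - conv f \<rho> x - ?G \<bullet> h) / norm h
        = (LBINT y. (\<rho> (x + h - y) * f y - \<rho> (x - y) * f y - (f y *\<^sub>R grad \<rho> (x - y)) \<bullet> h) / norm h)"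
      by simp
    also have "\<dots> = (LBINT y. R h y)"
      by (rule Bochner_Integration.integral_cong) (auto simp: R_def field_simps)
    finally show ?thesis .
  qed
  have "((\<lambda>h. LBINT y. R h y) \<longlongrightarrow> 0) (at 0)"
    unfolding tendsto_at_iff_sequentially
  proof (intro allI impI, unfold o_def)
    fix X :: "nat \<Rightarrow> 'a" assume X: "\<forall>i. X i \<in> UNIV - {0}" "X \<longlonglongrightarrow> 0"
    have "(\<lambda>i. LBINT y. R (X i) y) \<longlonglongrightarrow> (\<integral>y. 0 \<partial>(lborel::'a measure))"
    proof (rule integral_dominated_convergence[where w = "\<lambda>y. 2 * B * \<bar>f y\<bar>"])
      show "integrable lborel (\<lambda>y. 2 * B * \<bar>f y\<bar>)" using f by simp
      show "AE y in lborel. (\<lambda>i. R (X i) y) \<longlonglongrightarrow> 0"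
      proof (rule AE_I2)
        fix y
        have "((\<lambda>h. norm (\<rho> (x - y + h) - \<rho> (x - y) - grad \<rho> (x - y) \<bullet> h) / norm h) \<longlongrightarrow> 0) (at 0)"
          using smooth_has_derivative[OF sm, of "x - y"] by (simp add: has_derivative_at)
        then have "(\<lambda>i. norm (\<rho> (x - y + X i) - \<rho> (x - y) - grad \<rho> (x - y) \<bullet> X i) / norm (X i)) \<longlonglongrightarrow> 0"
          using X unfolding tendsto_at_iff_sequentially by (auto simp: o_def)
        then have "(\<lambda>i. norm (\<rho> (x - y + X i) - \<rho> (x - y) - grad \<rho> (x - y) \<bullet> X i) / norm (X i) * \<bar>f y\<bar>) \<longlonglongrightarrow> 0 * \<bar>f y\<bar>"
          by (intro tendsto_mult tendsto_const)
        moreover have "norm (\<rho> (x - y + X i) - \<rho> (x - y) - grad \<rho> (x - y) \<bullet> X i) / norm (X i) * \<bar>f y\<bar>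
            = \<bar>R (X i) y\<bar>" for i
        proof -
          have "x + X i - y = x - y + X i" by simp
          then show ?thesis by (simp only: R_def abs_mult abs_divide abs_norm_cancel real_norm_def)
        qed
        ultimately show "(\<lambda>i. R (X i) y) \<longlonglongrightarrow> 0" by (simp add: tendsto_rabs_zero_iff)
      qed
      show "AE y in lborel. norm (R (X i) y) \<le> 2 * B * \<bar>f y\<bar>" for i
      proof (rule AE_I2)
        fix y
        have nz: "norm (X i) > 0" using X by simp
        have "\<bar>\<rho> (x + X i - y) - \<rho> (x - y)\<bar> \<le> B * norm (X i)"
          using bounded_gradient_Lipschitz[OF B(3) smooth_has_derivative[OF sm], of "x + X i - y" "x - y"] by simp
        moreover have "\<bar>grad \<rho> (x - y) \<bullet> X i\<bar> \<le> B * norm (X i)"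
          by (rule order_trans[OF Cauchy_Schwarz_ineq2]) (use B nz in \<open>auto intro: mult_right_mono\<close>)
        ultimately have "\<bar>\<rho> (x + X i - y) - \<rho> (x - y) - grad \<rho> (x - y) \<bullet> X i\<bar> / norm (X i) \<le> 2 * B"
          using nz by (simp add: divide_le_eq)
        then show "norm (R (X i) y) \<le> 2 * B * \<bar>f y\<bar>"
          using mult_right_mono[of _ "2 * B" "\<bar>f y\<bar>"]
          by (simp only: R_def abs_mult abs_divide abs_norm_cancel real_norm_def abs_ge_zero)
      qed
    qed (auto simp: R_def)
    then show "(\<lambda>i. LBINT y. R (X i) y) \<longlonglongrightarrow> 0" by simp
  qed
  then have "((\<lambda>h. \<bar>(conv f \<rho> (x + h) - conv f \<rho> x - ?G \<bullet> h) / norm h\<bar>) \<longlongrightarrow> 0) (at 0)"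
    unfolding eq by (rule tendsto_rabs_zero)
  then show ?thesis
    by (simp add: has_derivative_at bounded_linear_inner_right)
qed

lemma grad_conv:
  fixes f :: "'a::euclidean_space \<Rightarrow> real"
  assumes "integrable lborel f" "\<rho> \<in> test_functions UNIV"
  shows "grad (conv f \<rho>) x = (LBINT y. f y *\<^sub>R grad \<rho> (x - y))"
  by (rule grad_eqI[OF conv_has_derivative[OF assms]])

text \<open>The partial derivatives of \<open>conv f \<rho>\<close> are convolutions of \<open>f\<close> with partial derivatives of \<open>\<rho>\<close>, which are
  again test functions, so the order of differentiability can be raised step by step.\<close>

lemma smooth_conv:
  fixes f :: "'a::euclidean_space \<Rightarrow> real"
  assumes f: "integrable lborel f" and "\<rho> \<in> test_functions UNIV"
  shows "smooth (conv f \<rho>)"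
proof -
  have "Ck k (conv f \<rho>)" if "\<rho> \<in> test_functions UNIV" for k \<rho>
    using that
  proof (induction k arbitrary: \<rho>)
    case 0
    then show ?case
      using has_derivative_continuous[OF conv_has_derivative[OF f 0]] by (simp add: continuous_at_imp_continuous_on)
  next
    case (Suc k)
    show ?case
    proof (rule Ck_SucI[OF conv_has_derivative[OF f Suc.prems]])
      fix b :: 'a
      have [measurable]: "f \<in> borel_measurable borel" using f by auto
      obtain B where B: "B > 0" "\<And>x. \<bar>\<rho> x\<bar> \<le> B" "\<And>x. norm (grad \<rho> x) \<le> B"
        using test_bounded[OF Suc.prems] by blast
      have [measurable]: "grad \<rho> \<in> borel_measurable borel" by (rule test_borel[OF Suc.prems])
      have ig: "integrable lborel (\<lambda>y. f y *\<^sub>R grad \<rho> (x - y))" for x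
      proof (rule Bochner_Integration.integrable_bound)
        show "integrable lborel (\<lambda>y. B * \<bar>f y\<bar>)" using f by simp
        show "AE y in lborel. norm (f y *\<^sub>R grad \<rho> (x - y)) \<le> norm (B * \<bar>f y\<bar>)"
          using mult_left_mono[OF B(3) abs_ge_zero] B(1) by (auto simp: abs_mult mult.commute[of B])
      qed measurable
      have "(LBINT y. f y *\<^sub>R grad \<rho> (x - y)) \<bullet> b = conv f (\<lambda>x. grad \<rho> x \<bullet> b) x" for x
      proof -
        have "(LBINT y. f y *\<^sub>R grad \<rho> (x - y)) \<bullet> b = (LBINT y. (f y *\<^sub>R grad \<rho> (x - y)) \<bullet> b)"
          by (rule integral_inner_left[symmetric]) (rule ig)
        then show ?thesis by (simp add: conv_def mult.commute)
      qed
      then show "Ck k (\<lambda>x. (LBINT y. f y *\<^sub>R grad \<rho> (x - y)) \<bullet> b)"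
        using Suc.IH[OF test_grad_inner[OF Suc.prems, of b]] by simp
    qed
  qed
  with assms(2) show ?thesis by (simp add: smooth_def)
qed

lemma nn_integral_conv:
  fixes a :: "'a::euclidean_space \<Rightarrow> ennreal"
  assumes [measurable]: "a \<in> borel_measurable borel" "\<rho> \<in> borel_measurable borel"
  shows "(\<integral>\<^sup>+x. \<integral>\<^sup>+y. \<rho> (x - y) * a y \<partial>lborel \<partial>lborel) = (\<integral>\<^sup>+x. \<rho> x \<partial>lborel) * (\<integral>\<^sup>+y. a y \<partial>lborel)"
proof -
  have tr: "(\<integral>\<^sup>+x. \<rho> (x - y) \<partial>lborel) = (\<integral>\<^sup>+x. \<rho> x \<partial>lborel)" for y
    using nn_integral_affine[of \<rho> 1 "-y"] by simp
  have "(\<integral>\<^sup>+x. \<integral>\<^sup>+y. \<rho> (x - y) * a y \<partial>lborel \<partial>lborel) = (\<integral>\<^sup>+y. \<integral>\<^sup>+x. \<rho> (x - y) * a y \<partial>lborel \<partial>lborel)"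
    by (rule lborel_pair.Fubini') measurable
  also have "\<dots> = (\<integral>\<^sup>+y. (\<integral>\<^sup>+x. \<rho> x \<partial>lborel) * a y \<partial>lborel)"
    by (simp add: nn_integral_multc tr)
  finally show ?thesis by (simp add: nn_integral_cmult)
qed

lemma norm_conv_le:
  fixes f :: "'a::euclidean_space \<Rightarrow> 'b::euclidean_space"
  assumes "integrable lborel f" "\<rho> \<in> test_functions UNIV" "\<And>x. 0 \<le> \<rho> x"
  shows "ennreal (norm (conv f \<rho> x)) \<le> (\<integral>\<^sup>+y. ennreal (\<rho> (x - y)) * ennreal (norm (f y)) \<partial>lborel)"
proof -
  have "norm (conv f \<rho> x) \<le> (LBINT y. norm (\<rho> (x - y) *\<^sub>R f y))"
    unfolding conv_def by (rule integral_norm_bound)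
  then have "ennreal (norm (conv f \<rho> x)) \<le> ennreal (LBINT y. norm (\<rho> (x - y) *\<^sub>R f y))"
    by (rule ennreal_leI)
  also have "\<dots> = (\<integral>\<^sup>+y. ennreal (norm (\<rho> (x - y) *\<^sub>R f y)) \<partial>lborel)"
    by (rule nn_integral_eq_integral[symmetric, OF integrable_norm[OF conv_integrable[OF assms(1,2)]]]) simp
  finally show ?thesis using assms(3) by (simp add: ennreal_mult')
qed

lemma conv_L1:
  fixes f :: "'a::euclidean_space \<Rightarrow> 'b::euclidean_space"
  assumes "integrable lborel f" "\<rho> \<in> test_functions UNIV" "\<And>x. 0 \<le> \<rho> x" "(LBINT x. \<rho> x) = 1"
  shows "integrable lborel (conv f \<rho>)" "(LBINT x. norm (conv f \<rho> x)) \<le> (LBINT x. norm (f x))"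
proof -
  have [measurable]: "\<rho> \<in> borel_measurable borel" by (rule test_borel[OF assms(2)])
  have [measurable]: "f \<in> borel_measurable borel" using assms(1) by auto
  have m [measurable]: "conv f \<rho> \<in> borel_measurable borel" by (rule conv_measurable[OF assms(1,2)])
  have r1: "(\<integral>\<^sup>+x. ennreal (\<rho> x) \<partial>lborel) = 1"
    using nn_integral_eq_integral[OF test_integrable(1)[OF assms(2)]] assms(3,4) by simp
  have "(\<integral>\<^sup>+x. ennreal (norm (conv f \<rho> x)) \<partial>lborel)
      \<le> (\<integral>\<^sup>+x. \<integral>\<^sup>+y. ennreal (\<rho> (x - y)) * ennreal (norm (f y)) \<partial>lborel \<partial>lborel)"
    by (intro nn_integral_mono norm_conv_le assms)
  also have "\<dots> = (\<integral>\<^sup>+x. ennreal (norm (f x)) \<partial>lborel)"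
    by (subst nn_integral_conv) (auto simp: r1)
  finally have le: "(\<integral>\<^sup>+x. ennreal (norm (conv f \<rho> x)) \<partial>lborel) \<le> (\<integral>\<^sup>+x. ennreal (norm (f x)) \<partial>lborel)" .
  have fin: "(\<integral>\<^sup>+x. ennreal (norm (f x)) \<partial>lborel) < \<infinity>" using assms(1) by (simp add: integrable_iff_bounded)
  show i: "integrable lborel (conv f \<rho>)"
    unfolding integrable_iff_bounded using le_less_trans[OF le fin] m by simp
  have "ennreal (LBINT x. norm (conv f \<rho> x)) \<le> ennreal (LBINT x. norm (f x))"
    using le i assms(1) by (simp add: nn_integral_eq_integral)
  then show "(LBINT x. norm (conv f \<rho> x)) \<le> (LBINT x. norm (f x))" by simp
qed

section \<open>Convergence of mollifications\<close>

definition moll :: "nat \<Rightarrow> 'a::euclidean_space \<Rightarrow> real" where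
  "moll n = mollifier (1 / real (Suc n))"

lemma moll_radius: "0 < 1 / real (Suc n)"
  by simp

lemma moll_test: "moll n \<in> test_functions UNIV"
  and moll_nonneg: "0 \<le> moll n x"
  and moll_zero: "1 / real (Suc n) \<le> norm x \<Longrightarrow> moll n x = 0"
  and moll_integral: "(LBINT x. moll n x) = 1"
  unfolding moll_def
  by (rule test_mollifier[OF moll_radius] mollifier_nonneg[OF moll_radius]
      integral_mollifier[OF moll_radius], (rule mollifier_zero[OF moll_radius], assumption)?)+

lemmas conv_moll_L1 = conv_L1[OF _ moll_test moll_nonneg moll_integral]

text \<open>A mollification is an average, here of values that are all close to \<open>c\<close>.\<close>

lemma conv_bounded:
  fixes f :: "'a::euclidean_space \<Rightarrow> 'b::euclidean_space"
  assumes f: "integrable lborel f" and r: "\<rho> \<in> test_functions UNIV" "\<And>x. 0 \<le> \<rho> x" "(LBINT x. \<rho> x) = 1"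
    and e: "\<And>y. \<rho> (x - y) \<noteq> 0 \<Longrightarrow> norm (f y - c) \<le> e"
  shows "norm (conv f \<rho> x - c) \<le> e"
proof -
  have i1: "integrable lborel (\<lambda>y. \<rho> (x - y) *\<^sub>R f y)" by (rule conv_integrable[OF f r(1)])
  have i0: "integrable lborel (\<lambda>y. \<rho> (x - y))" by (rule integrable_reflect[OF test_integrable(1)[OF r(1)]])
  have i2: "integrable lborel (\<lambda>y. \<rho> (x - y) *\<^sub>R c)" using i0 by simp
  have one: "(LBINT y. \<rho> (x - y)) = 1" using integral_reflect[OF test_integrable(1)[OF r(1)]] r(3) by simp
  then have "c = (LBINT y. \<rho> (x - y) *\<^sub>R c)" using i0 by simp
  then have "conv f \<rho> x - c = (LBINT y. \<rho> (x - y) *\<^sub>R (f y - c))"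
    unfolding conv_def scaleR_diff_right using Bochner_Integration.integral_diff[OF i1 i2] by simp
  then have "norm (conv f \<rho> x - c) \<le> (LBINT y. norm (\<rho> (x - y) *\<^sub>R (f y - c)))"
    using integral_norm_bound by metis
  also have "\<dots> \<le> (LBINT y. \<rho> (x - y) * e)"
  proof (rule integral_mono)
    show "integrable lborel (\<lambda>y. norm (\<rho> (x - y) *\<^sub>R (f y - c)))"
      unfolding scaleR_diff_right using i1 i2 by simp
    show "integrable lborel (\<lambda>y. \<rho> (x - y) * e)" using i0 by simp
    show "norm (\<rho> (x - y) *\<^sub>R (f y - c)) \<le> \<rho> (x - y) * e" for y
      using e[of y] r(2)[of "x - y"] by (cases "\<rho> (x - y) = 0") (auto intro: mult_left_mono)
  qed
  also have "\<dots> = e" using one by simp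
  finally show ?thesis .
qed

lemma conv_zero:
  assumes "\<And>y. \<rho> (x - y) \<noteq> 0 \<Longrightarrow> f y = 0"
  shows "conv f \<rho> x = 0"
proof -
  have "\<rho> (x - y) *\<^sub>R f y = 0" for y using assms[of y] by (cases "\<rho> (x - y) = 0") auto
  then show ?thesis unfolding conv_def by (simp only: integral_zero)
qed

lemma conv_moll_zero:
  assumes "\<And>y. dist x y < 1 / real (Suc n) \<Longrightarrow> f y = 0"
  shows "conv f (moll n) x = 0"
  by (rule conv_zero) (use assms moll_zero[of n] in \<open>force simp: dist_norm not_le[symmetric]\<close>)

lemma integrable_indicator_bounded:
  fixes A :: "'a::euclidean_space set"
  assumes "bounded A" "A \<in> sets borel"
  shows "integrable lborel (indicator A :: 'a \<Rightarrow> real)"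
  using assms emeasure_bounded_finite[OF assms(1)] by (simp add: integrable_indicator_iff)

text \<open>Compactly supported continuous functions are dense in \<open>L\<^sup>1\<close>: after truncating values and
  support, a measurable function is an almost everywhere limit of continuous ones, and these can be
  truncated in the same way so that dominated convergence applies.\<close>

lemma L1_dense_continuous:
  fixes f :: "'a::euclidean_space \<Rightarrow> 'b::euclidean_space"
  assumes f: "integrable lborel f" and "e > 0"
  obtains g R where "continuous_on UNIV g" "\<And>x. norm x \<ge> R \<Longrightarrow> g x = 0"
    "integrable lborel g" "(LBINT x. norm (f x - g x)) < e"
proof -
  have fm [measurable]: "f \<in> borel_measurable borel" using borel_measurable_integrable[OF f] by simp
  define T where "T n x = (if norm x \<le> real n \<and> norm (f x) \<le> real n then f x else 0)" for n x
  have Tm [measurable]: "T n \<in> borel_measurable borel" for n unfolding T_def[abs_def] by measurable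
  have "(\<lambda>n. LBINT x. norm (f x - T n x)) \<longlonglongrightarrow> (\<integral>x. 0 \<partial>(lborel::'a measure))"
  proof (rule integral_dominated_convergence[where w = "\<lambda>x. norm (f x)"])
    show "AE x in lborel. (\<lambda>n. norm (f x - T n x)) \<longlonglongrightarrow> 0"
    proof (rule AE_I2)
      fix x
      obtain N where N: "norm x \<le> real N" "norm (f x) \<le> real N"
        using real_arch_simple[of "max (norm x) (norm (f x))"] by auto
      have "norm (f x - T n x) = 0" if "n \<ge> N" for n
        using that N by (auto simp: T_def)
      then have "\<forall>\<^sub>F n in sequentially. 0 = norm (f x - T n x)"
        unfolding eventually_sequentially by metis
      then show "(\<lambda>n. norm (f x - T n x)) \<longlonglongrightarrow> 0"
        by (rule Lim_transform_eventually[OF tendsto_const])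
    qed
    show "AE x in lborel. norm (norm (f x - T n x)) \<le> norm (f x)" for n
      by (rule AE_I2) (auto simp: T_def)
  qed (use f in auto)
  then have "\<forall>\<^sub>F n in sequentially. (LBINT x. norm (f x - T n x)) < e / 2"
    using \<open>e > 0\<close> by (intro order_tendstoD(2)) auto
  then obtain n where n: "(LBINT x. norm (f x - T n x)) < e / 2"
    using eventually_happens by force
  have "T n \<in> borel_measurable lebesgue" by (simp add: measurable_completion)
  then have "T n measurable_on UNIV" by (intro lebesgue_measurable_imp_measurable_on) auto
  then obtain N G where N: "negligible N" and G: "\<And>k. continuous_on UNIV (G k)"
    and lim: "\<And>x. x \<notin> N \<Longrightarrow> (\<lambda>k. G k x) \<longlonglongrightarrow> T n x"
    unfolding measurable_on_def by auto
  define M where "M = real n + 1"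
  have M: "M > 0" by (simp add: M_def)
  (* cut off outside the ball of radius M and retract the values onto it *)
  define H where "H k x = max 0 (min 1 (M - norm x)) *\<^sub>R ((M / max M (norm (G k x))) *\<^sub>R G k x)" for k x
  have Hc: "continuous_on UNIV (H k)" for k
    unfolding H_def[abs_def] using M by (intro continuous_intros G) (auto simp: max_def)
  have H0: "H k x = 0" if "norm x \<ge> M" for k x
    using that by (simp add: H_def)
  have Hb: "norm (H k x) \<le> M * indicator (cball 0 M) x" for k x
  proof (cases "norm x \<le> M")
    case True
    have w: "norm ((M / max M (norm (G k x))) *\<^sub>R G k x) \<le> M"
      using M by (simp add: max_def divide_le_eq field_simps)
    have gen: "norm (a *\<^sub>R w) \<le> M" if "0 \<le> a" "a \<le> 1" "norm w \<le> M" for a and w :: 'b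
      using mult_mono[of a 1 "norm w" M] that by simp
    have "norm (H k x) \<le> M"
      unfolding H_def by (rule gen) (use w in auto)
    then show ?thesis using True by simp
  next
    case False
    then show ?thesis using H0[of x k] by simp
  qed
  have Hi: "integrable lborel (H k)" for k
    by (rule compact_support_integrable[OF Hc compact_cball[of 0 M]]) (use H0 in auto)
  have "(\<lambda>k. LBINT x. norm (T n x - H k x)) \<longlonglongrightarrow> (\<integral>x. 0 \<partial>(lborel::'a measure))"
  proof (rule integral_dominated_convergence[where w = "\<lambda>x. norm (f x) + M * indicator (cball 0 M) x"])
    show "integrable lborel (\<lambda>x. norm (f x) + M * indicator (cball 0 M) x)"
      using f by (intro Bochner_Integration.integrable_add integrable_mult_right integrable_indicator_bounded) auto
    have "AE x in lebesgue. x \<notin> N"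
      using N by (simp add: AE_not_in negligible_iff_null_sets)
    then have "AE x in lborel. x \<notin> N" by (simp add: AE_completion_iff)
    then show "AE x in lborel. (\<lambda>k. norm (T n x - H k x)) \<longlonglongrightarrow> 0"
    proof eventually_elim
      case (elim x)
      have "(\<lambda>k. H k x) \<longlonglongrightarrow> max 0 (min 1 (M - norm x)) *\<^sub>R ((M / max M (norm (T n x))) *\<^sub>R T n x)"
        unfolding H_def using M by (intro tendsto_intros lim elim) auto
      also have "max 0 (min 1 (M - norm x)) *\<^sub>R ((M / max M (norm (T n x))) *\<^sub>R T n x) = T n x"
        using M by (auto simp: T_def M_def max_def min_def)
      finally have "(\<lambda>k. norm (T n x - H k x)) \<longlonglongrightarrow> norm (T n x - T n x)"
        by (intro tendsto_intros)
      then show ?case by simp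
    qed
    have "norm (T n x) \<le> norm (f x)" for x by (simp add: T_def)
    then show "AE x in lborel. norm (norm (T n x - H k x)) \<le> norm (f x) + M * indicator (cball 0 M) x" for k
      using Hb by (intro AE_I2) (auto intro!: order_trans[OF norm_triangle_ineq4] add_mono)
    show "(\<lambda>x. norm (T n x - H k x)) \<in> borel_measurable lborel" for k
      using borel_measurable_integrable[OF Hi[of k]] by simp
  qed auto
  then have "\<forall>\<^sub>F k in sequentially. (LBINT x. norm (T n x - H k x)) < e / 2"
    using \<open>e > 0\<close> by (intro order_tendstoD(2)) auto
  then obtain k where k: "(LBINT x. norm (T n x - H k x)) < e / 2"
    using eventually_happens by force
  have Ti: "integrable lborel (T n)"
    by (rule Bochner_Integration.integrable_bound[OF f]) (auto simp: T_def intro!: AE_I2)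
  have "(LBINT x. norm (f x - H k x)) \<le> (LBINT x. norm (f x - T n x) + norm (T n x - H k x))"
  proof (rule integral_mono)
    show "norm (f x - H k x) \<le> norm (f x - T n x) + norm (T n x - H k x)" for x
      using norm_triangle_ineq[of "f x - T n x" "T n x - H k x"] by simp
  qed (intro integrable_norm Bochner_Integration.integrable_add Bochner_Integration.integrable_diff f Ti Hi)+
  also have "\<dots> = (LBINT x. norm (f x - T n x)) + (LBINT x. norm (T n x - H k x))"
    by (intro Bochner_Integration.integral_add integrable_norm Bochner_Integration.integrable_diff f Ti Hi)
  also have "\<dots> < e" using n k by simp
  finally show ?thesis
    using that[of "H k" M] Hc H0 Hi by blast
qed

text \<open>Pointwise convergence is continuity of \<open>g\<close>; the supports of all mollifications lie in one ball, which
  gives the dominating function.\<close>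

lemma conv_moll_L1_continuous:
  fixes g :: "'a::euclidean_space \<Rightarrow> 'b::euclidean_space"
  assumes g: "continuous_on UNIV g" "\<And>x. norm x \<ge> R \<Longrightarrow> g x = 0" "integrable lborel g"
  shows "(\<lambda>n. LBINT x. norm (conv g (moll n) x - g x)) \<longlonglongrightarrow> 0"
proof -
  obtain B where B: "B > 0" "\<And>x. norm (g x) \<le> B"
  proof (rule compact_support_bounded[OF g(1) compact_cball[of 0 R]])
    show "g x = 0" if "x \<notin> cball 0 R" for x using that g(2) by simp
  qed blast
  have r: "1 / real (Suc n) \<le> 1" for n by simp
  have "(\<lambda>n. LBINT x. norm (conv g (moll n) x - g x)) \<longlonglongrightarrow> (\<integral>x. 0 \<partial>(lborel::'a measure))"
  proof (rule integral_dominated_convergence[where w = "\<lambda>x. 2 * B * indicator (cball 0 (R + 1)) x"])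
    show "integrable lborel (\<lambda>x::'a. 2 * B * indicator (cball 0 (R + 1)) x)"
      by (intro integrable_mult_right integrable_indicator_bounded) auto
    show "(\<lambda>x. norm (conv g (moll n) x - g x)) \<in> borel_measurable lborel" for n
      using conv_moll_L1(1)[OF g(3), of n] g(3) by auto
    show "AE x in lborel. (\<lambda>n. norm (conv g (moll n) x - g x)) \<longlonglongrightarrow> 0"
    proof (rule AE_I2, rule LIMSEQ_I)
      fix x :: 'a and e :: real assume "e > 0"
      have "isCont g x" using g(1) by (simp add: continuous_on_eq_continuous_at)
      then obtain d where d: "d > 0" "\<And>y. dist y x < d \<Longrightarrow> dist (g y) (g x) < e / 2"
        using \<open>e > 0\<close> unfolding continuous_at_eps_delta by (metis half_gt_zero)
      obtain N where N: "1 / real (Suc N) < d" using d(1) nat_approx_posE by blast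
      have "norm (conv g (moll n) x - g x) \<le> e / 2" if "n \<ge> N" for n
      proof (rule conv_bounded[OF g(3) moll_test moll_nonneg moll_integral])
        fix y assume "moll n (x - y) \<noteq> 0"
        then have "norm (x - y) < 1 / real (Suc n)" using moll_zero[of n "x - y"] by force
        also have "\<dots> \<le> 1 / real (Suc N)" using that by (simp add: frac_le)
        finally have "dist y x < d" using N by (simp add: dist_norm norm_minus_commute)
        from d(2)[OF this] show "norm (g y - g x) \<le> e / 2" by (simp add: dist_norm)
      qed
      moreover have "e / 2 < e" using \<open>e > 0\<close> by simp
      ultimately have "norm (conv g (moll n) x - g x) < e" if "n \<ge> N" for n
        using that by (meson le_less_trans)
      then show "\<exists>N. \<forall>n\<ge>N. norm (norm (conv g (moll n) x - g x) - 0) < e"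
        by auto
    qed
    show "AE x in lborel. norm (norm (conv g (moll n) x - g x)) \<le> 2 * B * indicator (cball 0 (R + 1)) x" (is "AE x in _. ?P x") for n
    proof (rule AE_I2)
      fix x :: 'a
      show "?P x"
      proof (cases "norm x \<le> R + 1")
        case True
        have "norm (conv g (moll n) x - 0) \<le> B"
          by (rule conv_bounded[OF g(3) moll_test moll_nonneg moll_integral]) (simp add: B)
        then have "norm (conv g (moll n) x - g x) \<le> B + B"
          using B(2)[of x] by (intro order_trans[OF norm_triangle_ineq4] add_mono) auto
        then show ?thesis using True by simp
      next
        case False
        have "conv g (moll n) x = 0"
        proof (rule conv_moll_zero)
          fix y assume "dist x y < 1 / real (Suc n)"
          then have "norm (x - y) < 1" using r[of n] unfolding dist_norm by linarith
          then show "g y = 0" using False norm_triangle_ineq2[of x y] by (intro g(2)) linarith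
        qed
        moreover have "g x = 0" using False by (intro g(2)) auto
        ultimately show ?thesis using B(1) by (simp add: indicator_def)
      qed
    qed
  qed auto
  then show ?thesis by simp
qed

text \<open>Mollification does not increase the norm of \<open>L\<^sup>1\<close>, so that it suffices to approximate \<open>f\<close> by
  continuous functions.\<close>

lemma conv_moll_tendsto_L1:
  fixes f :: "'a::euclidean_space \<Rightarrow> 'b::euclidean_space"
  assumes f: "integrable lborel f"
  shows "(\<lambda>n. LBINT x. norm (conv f (moll n) x - f x)) \<longlonglongrightarrow> 0"
proof (rule LIMSEQ_I)
  fix e :: real assume "e > 0"
  then have "e / 3 > 0" by simp
  obtain g R where g: "continuous_on UNIV g" "\<And>x. norm x \<ge> R \<Longrightarrow> g x = 0" "integrable lborel g"
    "(LBINT x. norm (f x - g x)) < e / 3"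
    using L1_dense_continuous[OF f \<open>e / 3 > 0\<close>] by blast
  obtain N where N: "\<And>n. n \<ge> N \<Longrightarrow> norm ((LBINT x. norm (conv g (moll n) x - g x)) - 0) < e / 3"
    using LIMSEQ_D[OF conv_moll_L1_continuous[OF g(1,2,3)] \<open>e / 3 > 0\<close>] by blast
  have fg: "integrable lborel (\<lambda>x. f x - g x)" using f g(3) by simp
  have "(LBINT x. norm (conv f (moll n) x - f x)) < e" if "n \<ge> N" for n
  proof -
    let ?a = "\<lambda>x. norm (conv (\<lambda>x. f x - g x) (moll n) x)"
    let ?b = "\<lambda>x. norm (conv g (moll n) x - g x)"
    let ?c = "\<lambda>x. norm (f x - g x)"
    have ia: "integrable lborel ?a" by (intro integrable_norm conv_moll_L1(1) fg)
    have ib: "integrable lborel ?b" by (intro integrable_norm Bochner_Integration.integrable_diff conv_moll_L1(1) g(3))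
    have ic: "integrable lborel ?c" by (intro integrable_norm fg)
    have "(LBINT x. norm (conv f (moll n) x - f x)) \<le> (LBINT x. ?a x + ?b x + ?c x)"
    proof (rule integral_mono)
      show "integrable lborel (\<lambda>x. norm (conv f (moll n) x - f x))"
        by (intro integrable_norm Bochner_Integration.integrable_diff conv_moll_L1(1) f)
      show "integrable lborel (\<lambda>x. ?a x + ?b x + ?c x)" by (intro Bochner_Integration.integrable_add ia ib ic)
      fix x
      have eq: "conv f (moll n) x - f x = conv (\<lambda>x. f x - g x) (moll n) x + (conv g (moll n) x - g x) - (f x - g x)"
        by (simp add: conv_diff[OF f g(3) moll_test])
      show "norm (conv f (moll n) x - f x) \<le> ?a x + ?b x + ?c x"
        unfolding eq using norm_triangle_ineq4[of "conv (\<lambda>x. f x - g x) (moll n) x + (conv g (moll n) x - g x)" "f x - g x"]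
          norm_triangle_ineq[of "conv (\<lambda>x. f x - g x) (moll n) x" "conv g (moll n) x - g x"] by linarith
    qed
    also have "\<dots> = (LBINT x. ?a x) + (LBINT x. ?b x) + (LBINT x. ?c x)"
      using ia ib ic by simp
    also have "\<dots> < e"
      using conv_moll_L1(2)[OF fg, of n] g(4) N[OF that] by simp
    finally show ?thesis .
  qed
  then show "\<exists>N. \<forall>n\<ge>N. norm ((LBINT x. norm (conv f (moll n) x - f x)) - 0) < e"
    by (intro exI[of _ N]) simp
qed

lemma conv_moll_AE_subseq:
  fixes f :: "'a::euclidean_space \<Rightarrow> 'b::euclidean_space"
  assumes f: "integrable lborel f"
  obtains r :: "nat \<Rightarrow> nat" where "strict_mono r" "AE x in lborel. (\<lambda>n. conv f (moll (r n)) x) \<longlonglongrightarrow> f x"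
proof -
  have "integrable lborel (\<lambda>x. conv f (moll n) x - f x)" for n
    by (intro Bochner_Integration.integrable_diff conv_moll_L1(1) f)
  from tendsto_L1_AE_subseq[OF this conv_moll_tendsto_L1[OF f]]
  obtain r :: "nat \<Rightarrow> nat" where r: "strict_mono r" "AE x in lborel. (\<lambda>n. conv f (moll (r n)) x - f x) \<longlonglongrightarrow> 0"
    by blast
  from r(2) have "AE x in lborel. (\<lambda>n. conv f (moll (r n)) x) \<longlonglongrightarrow> f x"
    by eventually_elim (simp add: LIM_zero_iff)
  with r(1) show ?thesis by (rule that)
qed

lemma young_split:
  fixes a b q \<delta> :: real
  assumes "0 \<le> a" "0 \<le> b" "0 < \<delta>" "1 < q"
  shows "a * b \<le> \<delta> * b powr q + (1 / \<delta>) powr (1 / (q - 1)) * a powr (q / (q - 1))"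
proof (cases "a \<le> \<delta> * b powr (q - 1)")
  case True
  have "a * b \<le> \<delta> * b powr (q - 1) * b" using True assms by (intro mult_right_mono) auto
  also have "\<dots> = \<delta> * b powr q"
    using assms powr_mult_base[of b "q - 1"] by (simp add: mult.commute mult.left_commute)
  finally show ?thesis by (smt (verit) powr_ge_zero mult_nonneg_nonneg)
next
  case False
  then have a: "a > 0" using assms by (smt (verit) powr_ge_zero mult_nonneg_nonneg)
  have "b = (b powr (q - 1)) powr (1 / (q - 1))" using assms by (simp add: powr_powr)
  also have "\<dots> \<le> (a / \<delta>) powr (1 / (q - 1))"
    using False assms by (intro powr_mono2) (auto simp: field_simps)
  finally have "a * b \<le> a * (a / \<delta>) powr (1 / (q - 1))" using a by simp
  also have "\<dots> = (1 / \<delta>) powr (1 / (q - 1)) * (a * a powr (1 / (q - 1)))"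
    using a assms by (simp add: powr_divide field_simps)
  also have "a * a powr (1 / (q - 1)) = a powr (1 + 1 / (q - 1))"
    using a by (simp add: powr_mult_base)
  also have "1 + 1 / (q - 1) = q / (q - 1)" using assms by (simp add: field_simps)
  finally show ?thesis using assms by (smt (verit) powr_ge_zero mult_nonneg_nonneg)
qed

text \<open>Young's inequality under the convolution integral replaces the contraction property of
  mollification in \<open>L\<^sup>q\<close>: it bounds the pairing of \<open>W\<close> with all mollifications at once, by a bound that is
  small if first \<open>\<delta>\<close> and then \<open>W\<close> are.\<close>

lemma conv_pairing_bound:
  fixes W g :: "'a::euclidean_space \<Rightarrow> 'b::euclidean_space"
  assumes g: "integrable lborel g" and W [measurable]: "W \<in> borel_measurable borel"
    and s: "s = q / (q - 1)" and q: "1 < q" and d: "0 < \<delta>"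
    and iW: "integrable lborel (\<lambda>x. norm (W x) powr s)" and ig: "integrable lborel (\<lambda>x. norm (g x) powr q)"
  shows "integrable lborel (\<lambda>x. W x \<bullet> conv g (moll n) x)"
    "\<bar>LBINT x. W x \<bullet> conv g (moll n) x\<bar> \<le> \<delta> * (LBINT x. norm (g x) powr q)
      + (1 / \<delta>) powr (1 / (q - 1)) * (LBINT x. norm (W x) powr s)" (is "_ \<le> ?R")
proof -
  let ?\<rho> = "moll n :: 'a \<Rightarrow> real"
  let ?C = "(1 / \<delta>) powr (1 / (q - 1))"
  have [measurable]: "g \<in> borel_measurable borel" using borel_measurable_integrable[OF g] by simp
  have [measurable]: "?\<rho> \<in> borel_measurable borel" by (rule test_borel(1)[OF moll_test])
  have [measurable]: "conv g ?\<rho> \<in> borel_measurable borel" by (rule conv_measurable[OF g moll_test])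
  have r1: "(\<integral>\<^sup>+x. ennreal (?\<rho> x) \<partial>lborel) = 1"
  proof -
    have "(LBINT x. ?\<rho> x) = 1" by (rule moll_integral)
    then show ?thesis
      using nn_integral_eq_integral[OF test_integrable(1)[OF moll_test[of n, where 'a = 'a]]] by (simp add: moll_nonneg)
  qed
  have r2: "(\<integral>\<^sup>+y. ennreal (?\<rho> (x - y)) \<partial>lborel) = 1" for x
    using nn_integral_affine[of "\<lambda>y. ennreal (?\<rho> y)" "-1" x] r1 by simp
  have pt: "ennreal (norm (W x \<bullet> conv g ?\<rho> x))
      \<le> (\<integral>\<^sup>+y. ennreal (?\<rho> (x - y)) * ennreal (\<delta> * norm (g y) powr q) \<partial>lborel) + ennreal (?C * norm (W x) powr s)" for x
  proof -
    have "ennreal (norm (W x \<bullet> conv g ?\<rho> x)) \<le> ennreal (norm (W x) * norm (conv g ?\<rho> x))"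
      using Cauchy_Schwarz_ineq2[of "W x" "conv g ?\<rho> x"] by (intro ennreal_leI) simp
    also have "\<dots> \<le> ennreal (norm (W x)) * (\<integral>\<^sup>+y. ennreal (?\<rho> (x - y)) * ennreal (norm (g y)) \<partial>lborel)"
      using norm_conv_le[OF g moll_test moll_nonneg, of n x] by (auto simp: ennreal_mult intro: mult_left_mono)
    also have "\<dots> = (\<integral>\<^sup>+y. ennreal (norm (W x)) * (ennreal (?\<rho> (x - y)) * ennreal (norm (g y))) \<partial>lborel)"
      by (rule nn_integral_cmult[symmetric]) measurable
    also have "\<dots> \<le> (\<integral>\<^sup>+y. ennreal (?\<rho> (x - y)) * ennreal (\<delta> * norm (g y) powr q)
        + ennreal (?\<rho> (x - y)) * ennreal (?C * norm (W x) powr s) \<partial>lborel)"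
    proof (rule nn_integral_mono)
      fix y
      have "norm (W x) * norm (g y) \<le> \<delta> * norm (g y) powr q + ?C * norm (W x) powr s"
        unfolding s by (rule young_split) (use d q in auto)
      then have "?\<rho> (x - y) * (norm (W x) * norm (g y)) \<le> ?\<rho> (x - y) * (\<delta> * norm (g y) powr q + ?C * norm (W x) powr s)"
        by (rule mult_left_mono) (rule moll_nonneg)
      then have "ennreal (?\<rho> (x - y) * (norm (W x) * norm (g y)))
          \<le> ennreal (?\<rho> (x - y) * (\<delta> * norm (g y) powr q) + ?\<rho> (x - y) * (?C * norm (W x) powr s))"
        by (intro ennreal_leI) (simp add: algebra_simps)
      then show "ennreal (norm (W x)) * (ennreal (?\<rho> (x - y)) * ennreal (norm (g y)))
          \<le> ennreal (?\<rho> (x - y)) * ennreal (\<delta> * norm (g y) powr q) + ennreal (?\<rho> (x - y)) * ennreal (?C * norm (W x) powr s)"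
        using d moll_nonneg[of n "x - y"] by (simp add: ennreal_mult' ennreal_plus[symmetric] mult.left_commute del: ennreal_plus)
          (simp add: ennreal_mult'[symmetric] mult.left_commute)
    qed
    also have "\<dots> = (\<integral>\<^sup>+y. ennreal (?\<rho> (x - y)) * ennreal (\<delta> * norm (g y) powr q) \<partial>lborel) + ennreal (?C * norm (W x) powr s)"
      by (subst nn_integral_add) (auto simp: nn_integral_multc r2)
    finally show ?thesis .
  qed
  have "(\<integral>\<^sup>+x. ennreal (norm (W x \<bullet> conv g ?\<rho> x)) \<partial>lborel)
     \<le> (\<integral>\<^sup>+x. (\<integral>\<^sup>+y. ennreal (?\<rho> (x - y)) * ennreal (\<delta> * norm (g y) powr q) \<partial>lborel) + ennreal (?C * norm (W x) powr s) \<partial>lborel)"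
    by (rule nn_integral_mono[OF pt])
  also have "\<dots> = (\<integral>\<^sup>+x. (\<integral>\<^sup>+y. ennreal (?\<rho> (x - y)) * ennreal (\<delta> * norm (g y) powr q) \<partial>lborel) \<partial>lborel)
     + (\<integral>\<^sup>+x. ennreal (?C * norm (W x) powr s) \<partial>lborel)"
    by (rule nn_integral_add) measurable
  also have "(\<integral>\<^sup>+x. (\<integral>\<^sup>+y. ennreal (?\<rho> (x - y)) * ennreal (\<delta> * norm (g y) powr q) \<partial>lborel) \<partial>lborel)
     = (\<integral>\<^sup>+y. ennreal (\<delta> * norm (g y) powr q) \<partial>lborel)"
    by (subst nn_integral_conv) (auto simp: r1)
  also have "(\<integral>\<^sup>+y. ennreal (\<delta> * norm (g y) powr q) \<partial>lborel) = ennreal (\<delta> * (LBINT x. norm (g x) powr q))"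
    using ig d by (subst nn_integral_eq_integral) auto
  also have "(\<integral>\<^sup>+x. ennreal (?C * norm (W x) powr s) \<partial>lborel) = ennreal (?C * (LBINT x. norm (W x) powr s))"
    using iW by (subst nn_integral_eq_integral) auto
  finally have le: "(\<integral>\<^sup>+x. ennreal (norm (W x \<bullet> conv g ?\<rho> x)) \<partial>lborel) \<le> ennreal ?R"
    using d by (simp add: ennreal_plus[symmetric] del: ennreal_plus)
  show i: "integrable lborel (\<lambda>x. W x \<bullet> conv g ?\<rho> x)"
    unfolding integrable_iff_bounded using le_less_trans[OF le ennreal_less_top] by simp
  have "0 \<le> ?R" using d by simp
  moreover have "ennreal (LBINT x. norm (W x \<bullet> conv g ?\<rho> x)) \<le> ennreal ?R"
    using le nn_integral_eq_integral[OF integrable_norm[OF i]] by simp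
  ultimately have "(LBINT x. norm (W x \<bullet> conv g ?\<rho> x)) \<le> ?R" by simp
  then show "\<bar>LBINT x. W x \<bullet> conv g ?\<rho> x\<bar> \<le> ?R"
    by (intro order_trans[OF integral_abs_bound]) simp
qed

lemma pairing_bound:
  fixes W g :: "'a::euclidean_space \<Rightarrow> 'b::euclidean_space"
  assumes g: "g \<in> borel_measurable borel" and W [measurable]: "W \<in> borel_measurable borel"
    and s: "s = q / (q - 1)" and q: "1 < q" and d: "0 < \<delta>"
    and iW: "integrable lborel (\<lambda>x. norm (W x) powr s)" and ig: "integrable lborel (\<lambda>x. norm (g x) powr q)"
  shows "integrable lborel (\<lambda>x. W x \<bullet> g x)"
    "\<bar>LBINT x. W x \<bullet> g x\<bar> \<le> \<delta> * (LBINT x. norm (g x) powr q)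
      + (1 / \<delta>) powr (1 / (q - 1)) * (LBINT x. norm (W x) powr s)"
proof -
  let ?C = "(1 / \<delta>) powr (1 / (q - 1))"
  have [measurable]: "g \<in> borel_measurable borel" by (rule g)
  have le: "norm (W x \<bullet> g x) \<le> \<delta> * norm (g x) powr q + ?C * norm (W x) powr s" for x
  proof -
    have "norm (W x) * norm (g x) \<le> \<delta> * norm (g x) powr q + ?C * norm (W x) powr s"
      unfolding s by (rule young_split) (use d q in auto)
    then show ?thesis using Cauchy_Schwarz_ineq2[of "W x" "g x"] by simp
  qed
  have i: "integrable lborel (\<lambda>x. \<delta> * norm (g x) powr q + ?C * norm (W x) powr s)"
    using ig iW by simp
  show i2: "integrable lborel (\<lambda>x. W x \<bullet> g x)"
    by (rule Bochner_Integration.integrable_bound[OF i])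
      (use le in \<open>auto intro!: AE_I2 intro: order_trans[OF _ abs_ge_self]\<close>)
  have "\<bar>LBINT x. W x \<bullet> g x\<bar> \<le> (LBINT x. norm (W x \<bullet> g x))"
    using integral_norm_bound[of lborel "\<lambda>x. W x \<bullet> g x"] by simp
  also have "\<dots> \<le> (LBINT x. \<delta> * norm (g x) powr q + ?C * norm (W x) powr s)"
    by (rule integral_mono[OF integrable_norm[OF i2] i le])
  also have "\<dots> = \<delta> * (LBINT x. norm (g x) powr q) + ?C * (LBINT x. norm (W x) powr s)"
    using ig iW by simp
  finally show "\<bar>LBINT x. W x \<bullet> g x\<bar> \<le> \<delta> * (LBINT x. norm (g x) powr q)
      + ?C * (LBINT x. norm (W x) powr s)" .
qed

text \<open>Mollifications converge weakly in \<open>L\<^sup>q\<close>: where \<open>V\<close> is bounded this follows from convergence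
  in \<open>L\<^sup>1\<close>, and the part where \<open>V\<close> is large is small in the dual norm.\<close>

lemma pairing_conv_tendsto:
  fixes V g :: "'a::euclidean_space \<Rightarrow> 'b::euclidean_space"
  assumes g: "integrable lborel g" and V [measurable]: "V \<in> borel_measurable borel"
    and s: "s = q / (q - 1)" and q: "1 < q"
    and iV: "integrable lborel (\<lambda>x. norm (V x) powr s)" and ig: "integrable lborel (\<lambda>x. norm (g x) powr q)"
  shows "(\<lambda>n. LBINT x. V x \<bullet> conv g (moll n) x) \<longlonglongrightarrow> (LBINT x. V x \<bullet> g x)"
proof (rule LIMSEQ_I)
  fix e :: real assume e: "e > 0"
  have gm: "g \<in> borel_measurable borel" using borel_measurable_integrable[OF g] by simp
  note [measurable] = gm
  let ?I = "LBINT x. norm (g x) powr q"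
  have I0: "0 \<le> ?I" by simp
  define \<delta> where "\<delta> = e / (8 * (1 + ?I))"
  have "8 * (1 + ?I) > 0" by (intro mult_pos_pos add_pos_nonneg I0) simp_all
  then have d: "\<delta> > 0" unfolding \<delta>_def by (rule divide_pos_pos[OF e])
  have dI: "\<delta> * ?I \<le> e / 8"
  proof -
    have "0 < 1 + ?I" by (intro add_pos_nonneg I0) simp
    then have "?I / (1 + ?I) \<le> 1" by (simp add: pos_divide_le_eq)
    then have "e / 8 * (?I / (1 + ?I)) \<le> e / 8 * 1" using e by (intro mult_left_mono) auto
    then show ?thesis unfolding \<delta>_def by simp
  qed
  let ?C = "(1 / \<delta>) powr (1 / (q - 1))"
  define B where "B n x = indicator {x. real n < norm (V x)} x *\<^sub>R V x" for n :: nat and x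
  define S where "S n x = indicator {x. norm (V x) \<le> real n} x *\<^sub>R V x" for n :: nat and x
  have BS: "V x = S n x + B n x" for n x by (auto simp: B_def S_def indicator_def)
  have Bm [measurable]: "B n \<in> borel_measurable borel" for n unfolding B_def[abs_def] by measurable
  have Sm [measurable]: "S n \<in> borel_measurable borel" for n unfolding S_def[abs_def] by measurable
  have Ble: "norm (B n x) powr s \<le> norm (V x) powr s" for n x
    by (auto simp: B_def indicator_def)
  have Sle: "norm (S n x) powr s \<le> norm (V x) powr s" for n x
    by (auto simp: S_def indicator_def)
  have iB: "integrable lborel (\<lambda>x. norm (B n x) powr s)" for n
    by (rule Bochner_Integration.integrable_bound[OF iV]) (use Ble in auto)
  have iS: "integrable lborel (\<lambda>x. norm (S n x) powr s)" for n
    by (rule Bochner_Integration.integrable_bound[OF iV]) (use Sle in auto)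
  have "(\<lambda>n. LBINT x. norm (B n x) powr s) \<longlonglongrightarrow> (\<integral>x. 0 \<partial>(lborel::'a measure))"
  proof (rule integral_dominated_convergence[where w = "\<lambda>x. norm (V x) powr s"])
    show "AE x in lborel. (\<lambda>n. norm (B n x) powr s) \<longlonglongrightarrow> 0"
    proof (rule AE_I2)
      fix x
      obtain N where N: "norm (V x) \<le> real N" using real_arch_simple by blast
      have "0 = norm (B n x) powr s" if "n \<ge> N" for n
        using that N by (auto simp: B_def indicator_def)
      then have "\<forall>\<^sub>F n in sequentially. 0 = norm (B n x) powr s"
        unfolding eventually_sequentially by blast
      then show "(\<lambda>n. norm (B n x) powr s) \<longlonglongrightarrow> 0"
        by (rule Lim_transform_eventually[OF tendsto_const])
    qed
  qed (use iV Ble in auto)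
  then have "(\<lambda>n. ?C * (LBINT x. norm (B n x) powr s)) \<longlonglongrightarrow> ?C * 0"
    by (intro tendsto_mult tendsto_const) simp
  then have "\<forall>\<^sub>F n in sequentially. ?C * (LBINT x. norm (B n x) powr s) < e / 8"
    using e by (intro order_tendstoD(2)) auto
  then obtain N where N: "?C * (LBINT x. norm (B N x) powr s) < e / 8"
    using eventually_happens by force
  have "(\<lambda>n. real N * (LBINT x. norm (conv g (moll n) x - g x))) \<longlonglongrightarrow> real N * 0"
    by (intro tendsto_mult tendsto_const conv_moll_tendsto_L1 g)
  then have "\<forall>\<^sub>F n in sequentially. real N * (LBINT x. norm (conv g (moll n) x - g x)) < e / 8"
    using e by (intro order_tendstoD(2)) auto
  then obtain n0 where n0: "\<And>n. n \<ge> n0 \<Longrightarrow> real N * (LBINT x. norm (conv g (moll n) x - g x)) < e / 8"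
    unfolding eventually_sequentially by blast
  have "\<bar>(LBINT x. V x \<bullet> conv g (moll n) x) - (LBINT x. V x \<bullet> g x)\<bar> < e" if n: "n \<ge> n0" for n
  proof -
    note c1 = conv_pairing_bound[OF g Bm s q d iB ig, of N n]
    note c2 = conv_pairing_bound(1)[OF g Sm s q d iS ig, of N n]
    note p1 = pairing_bound[OF gm Bm s q d iB ig, of N]
    note p2 = pairing_bound(1)[OF gm Sm s q d iS ig, of N]
    have "\<bar>LBINT x. S N x \<bullet> (conv g (moll n) x - g x)\<bar> \<le> (LBINT x. norm (S N x \<bullet> (conv g (moll n) x - g x)))"
      using integral_norm_bound[of lborel "\<lambda>x. S N x \<bullet> (conv g (moll n) x - g x)"] by simp
    also have "\<dots> \<le> (LBINT x. real N * norm (conv g (moll n) x - g x))"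
    proof (rule integral_mono)
      show "integrable lborel (\<lambda>x. norm (S N x \<bullet> (conv g (moll n) x - g x)))"
        unfolding inner_diff_right using c2 p2 by simp
      show "integrable lborel (\<lambda>x. real N * norm (conv g (moll n) x - g x))"
        by (intro integrable_mult_right integrable_norm Bochner_Integration.integrable_diff conv_moll_L1(1) g)
      fix x
      have "norm (S N x) \<le> real N" by (auto simp: S_def indicator_def)
      then have "norm (S N x) * norm (conv g (moll n) x - g x) \<le> real N * norm (conv g (moll n) x - g x)"
        by (rule mult_right_mono) simp
      then show "norm (S N x \<bullet> (conv g (moll n) x - g x)) \<le> real N * norm (conv g (moll n) x - g x)"
        using Cauchy_Schwarz_ineq2[of "S N x" "conv g (moll n) x - g x"] by simp
    qed
    also have "\<dots> < e / 8" using n0[OF n] by simp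
    finally have 1: "\<bar>LBINT x. S N x \<bullet> (conv g (moll n) x - g x)\<bar> < e / 8" .
    have "(LBINT x. V x \<bullet> conv g (moll n) x) = (LBINT x. S N x \<bullet> conv g (moll n) x) + (LBINT x. B N x \<bullet> conv g (moll n) x)"
      using c1(1) c2 by (simp add: BS[of _ N] inner_add_left)
    moreover have "(LBINT x. V x \<bullet> g x) = (LBINT x. S N x \<bullet> g x) + (LBINT x. B N x \<bullet> g x)"
      using p1(1) p2 by (simp add: BS[of _ N] inner_add_left)
    moreover have "(LBINT x. S N x \<bullet> (conv g (moll n) x - g x))
        = (LBINT x. S N x \<bullet> conv g (moll n) x) - (LBINT x. S N x \<bullet> g x)"
      unfolding inner_diff_right using c2 p2 by simp
    ultimately show ?thesis using 1 c1(2) p1(2) N dI e by linarith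
  qed
  then show "\<exists>n0. \<forall>n\<ge>n0. norm ((LBINT x. V x \<bullet> conv g (moll n) x) - (LBINT x. V x \<bullet> g x)) < e"
    by auto
qed

section \<open>Cutoff functions\<close>

lemma conv_nonneg:
  fixes f :: "'a::euclidean_space \<Rightarrow> real"
  assumes "\<And>x. 0 \<le> f x" "\<And>x. 0 \<le> \<rho> x"
  shows "0 \<le> conv f \<rho> x"
  unfolding conv_def using assms by simp

text \<open>Mollifying the indicator of a neighbourhood gives a cutoff function whose gradient is bounded
  by the integral of the gradient of the mollifier, hence by a constant over the width.\<close>

lemma cutoff_exists:
  fixes K :: "'a::euclidean_space set"
  assumes K: "compact K" and e: "\<epsilon> > 0"
  obtains \<eta> where "\<eta> \<in> test_functions {x. \<exists>k\<in>K. dist k x \<le> 3 * \<epsilon>}"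
    "\<And>x. 0 \<le> \<eta> x" "\<And>x. \<eta> x \<le> 1" "\<And>x k. k \<in> K \<Longrightarrow> dist k x < \<epsilon> \<Longrightarrow> \<eta> x = 1"
    "\<And>x. norm (grad \<eta> x) \<le> mollifier_const TYPE('a) / \<epsilon>"
proof -
  define S where "S = {x + y |x y. x \<in> K \<and> y \<in> cball 0 (2 * \<epsilon>)}"
  have Sc: "compact S" unfolding S_def by (rule compact_sums[OF K compact_cball])
  have S_iff: "x \<in> S \<longleftrightarrow> (\<exists>k\<in>K. dist k x \<le> 2 * \<epsilon>)" for x
  proof
    assume "\<exists>k\<in>K. dist k x \<le> 2 * \<epsilon>"
    then obtain k where "k \<in> K" "norm (x - k) \<le> 2 * \<epsilon>" by (auto simp: dist_norm norm_minus_commute)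
    then show "x \<in> S" unfolding S_def by (intro CollectI exI[of _ k] exI[of _ "x - k"]) auto
  next
    assume "x \<in> S"
    then obtain k y where "x = k + y" "k \<in> K" "norm y \<le> 2 * \<epsilon>" by (auto simp: S_def)
    then show "\<exists>k\<in>K. dist k x \<le> 2 * \<epsilon>" by (intro bexI[of _ k]) (auto simp: dist_norm)
  qed
  let ?f = "indicator S :: 'a \<Rightarrow> real"
  let ?r = "mollifier \<epsilon> :: 'a \<Rightarrow> real"
  define \<eta> where "\<eta> = conv ?f ?r"
  have fi: "integrable lborel ?f"
    by (rule integrable_indicator_bounded) (use Sc in \<open>auto simp: compact_imp_bounded borel_compact\<close>)
  have r: "?r \<in> test_functions UNIV" "\<And>x. 0 \<le> ?r x" "(LBINT x. ?r x) = 1"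
    by (rule test_mollifier[OF e] mollifier_nonneg[OF e] integral_mollifier[OF e])+
  have near: "dist x y < \<epsilon>" if "?r (x - y) \<noteq> 0" for x y
    using that mollifier_zero[OF e, of "x - y"] by (force simp: dist_norm)
  have zero: "\<eta> x = 0" if "\<forall>k\<in>K. 3 * \<epsilon> < dist k x" for x
    unfolding \<eta>_def
  proof (rule conv_zero)
    fix y assume "?r (x - y) \<noteq> 0"
    then have "dist x y < \<epsilon>" by (rule near)
    then have "2 * \<epsilon> < dist k y" if "k \<in> K" for k
      using that \<open>\<forall>k\<in>K. 3 * \<epsilon> < dist k x\<close> dist_triangle[of k x y] by (force simp: dist_commute)
    then show "?f y = 0" by (force simp: S_iff indicator_def)
  qed
  have sm: "smooth \<eta>" unfolding \<eta>_def by (rule smooth_conv[OF fi r(1)])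
  show ?thesis
  proof (rule that)
    show "\<eta> \<in> test_functions {x. \<exists>k\<in>K. dist k x \<le> 3 * \<epsilon>}"
    proof (rule test_functionsI[OF sm])
      show "compact {x + y |x y. x \<in> K \<and> y \<in> cball 0 (3 * \<epsilon>)}" by (rule compact_sums[OF K compact_cball])
      show "{x + y |x y. x \<in> K \<and> y \<in> cball 0 (3 * \<epsilon>)} \<subseteq> {x. \<exists>k\<in>K. dist k x \<le> 3 * \<epsilon>}"
      proof safe
        fix k y assume "k \<in> K" "y \<in> cball (0::'a) (3 * \<epsilon>)"
        then show "\<exists>ka\<in>K. dist ka (k + y) \<le> 3 * \<epsilon>" by (intro bexI[of _ k]) (auto simp: dist_norm)
      qed
      fix x assume *: "x \<notin> {x + y |x y. x \<in> K \<and> y \<in> cball 0 (3 * \<epsilon>)}"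
      show "\<eta> x = 0"
      proof (rule zero, intro ballI, rule ccontr)
        fix k assume "k \<in> K" "\<not> 3 * \<epsilon> < dist k x"
        then have "x = k + (x - k)" "x - k \<in> cball 0 (3 * \<epsilon>)" by (auto simp: dist_norm norm_minus_commute)
        with * \<open>k \<in> K\<close> show False by blast
      qed
    qed
    show "0 \<le> \<eta> x" for x unfolding \<eta>_def by (rule conv_nonneg) (auto intro: r)
    show "\<eta> x \<le> 1" for x
    proof -
      have "norm (\<eta> x - 0) \<le> 1"
        unfolding \<eta>_def by (rule conv_bounded[OF fi r]) (auto simp: indicator_def)
      then show ?thesis by simp
    qed
    show "\<eta> x = 1" if "k \<in> K" "dist k x < \<epsilon>" for x k
    proof -
      have "norm (\<eta> x - 1) \<le> 0"
        unfolding \<eta>_def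
      proof (rule conv_bounded[OF fi r])
        fix y assume "?r (x - y) \<noteq> 0"
        then have "dist k y \<le> 2 * \<epsilon>" using near[of x y] that dist_triangle[of k y x] by simp
        then have "y \<in> S" using that by (auto simp: S_iff)
        then show "norm (?f y - 1) \<le> 0" by simp
      qed
      then show ?thesis by simp
    qed
    show "norm (grad \<eta> x) \<le> mollifier_const TYPE('a) / \<epsilon>" for x
    proof -
      have ir: "integrable lborel (\<lambda>y. grad ?r (x - y))" by (rule integrable_reflect[OF test_integrable(2)[OF r(1)]])
      have "norm (grad \<eta> x) \<le> (LBINT y. norm (grad ?r (x - y)))"
        unfolding \<eta>_def grad_conv[OF fi r(1)]
      proof (rule order_trans[OF integral_norm_bound], rule integral_mono)
        show "integrable lborel (\<lambda>y. norm (?f y *\<^sub>R grad ?r (x - y)))"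
          by (rule integrable_norm, rule integrable_mult_indicator[OF _ ir]) (use Sc in \<open>simp add: borel_compact\<close>)
      qed (use ir in \<open>auto simp: indicator_def\<close>)
      also have "\<dots> = mollifier_const TYPE('a) / \<epsilon>"
        using integral_reflect[OF integrable_norm[OF test_integrable(2)[OF r(1)]]] integral_grad_mollifier[OF e, where 'a = 'a] by simp
      finally show ?thesis .
    qed
  qed
qed

lemma grad_locally_const:
  assumes "open V" "x \<in> V" "\<And>y. y \<in> V \<Longrightarrow> f y = c"
  shows "grad f x = 0"
proof (rule grad_eqI)
  have "((\<lambda>x. c) has_derivative (\<lambda>h. 0)) (at x)" by simp
  then have "(f has_derivative (\<lambda>h. 0)) (at x)"
    by (rule has_derivative_transform_within_open[OF _ assms(1,2)]) (simp add: assms(3))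
  then show "(f has_derivative (\<bullet>) 0) (at x)" by (rule has_derivative_eq_rhs) (simp add: fun_eq_iff)
qed

text \<open>That \<open>\<eta>\<close> is constant on a whole neighbourhood of \<open>K\<close> makes its gradient vanish on \<open>K\<close>.\<close>

lemma cutoff_compact:
  fixes K U :: "'a::euclidean_space set"
  assumes "compact K" "open U" "K \<subseteq> U"
  obtains \<eta> V where "\<eta> \<in> test_functions U" "\<And>x. 0 \<le> \<eta> x" "\<And>x. \<eta> x \<le> 1"
    "open V" "K \<subseteq> V" "V \<subseteq> U" "\<And>x. x \<in> V \<Longrightarrow> \<eta> x = 1" "\<And>x. x \<in> V \<Longrightarrow> grad \<eta> x = 0"
proof -
  obtain d where d: "d > 0" "(\<Union>x\<in>K. ball x d) \<subseteq> U"
    using compact_subset_open_imp_ball_epsilon_subset[OF assms] by blast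
  then have e: "d / 6 > 0" by simp
  obtain \<eta> where \<eta>: "\<eta> \<in> test_functions {x. \<exists>k\<in>K. dist k x \<le> 3 * (d / 6)}"
    "\<And>x. 0 \<le> \<eta> x" "\<And>x. \<eta> x \<le> 1" "\<And>x k. k \<in> K \<Longrightarrow> dist k x < d / 6 \<Longrightarrow> \<eta> x = 1"
    "\<And>x. norm (grad \<eta> x) \<le> mollifier_const TYPE('a) / (d / 6)"
    using cutoff_exists[OF assms(1) e] by blast
  let ?V = "\<Union>k\<in>K. ball k (d / 6)"
  have 1: "\<eta> x = 1" if "x \<in> ?V" for x using that \<eta>(4) by auto
  show ?thesis
  proof (rule that[of \<eta> ?V])
    show "\<eta> \<in> test_functions U"
    proof (rule test_mono[OF \<eta>(1)])
      show "{x. \<exists>k\<in>K. dist k x \<le> 3 * (d / 6)} \<subseteq> U" using d by force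
    qed
    show "?V \<subseteq> U" using d by force
    show "K \<subseteq> ?V" using d(1) by force
    show "grad \<eta> x = 0" if "x \<in> ?V" for x
      by (rule grad_locally_const[of ?V]) (use that 1 in auto)
  qed (use \<eta> 1 in auto)
qed

section \<open>Weak gradients on the whole space\<close>

definition Wgrad :: "('a::euclidean_space \<Rightarrow> real) \<Rightarrow> ('a \<Rightarrow> 'a) \<Rightarrow> bool" where
  "Wgrad f v \<longleftrightarrow> integrable lborel f \<and> integrable lborel v \<and>
     (\<forall>\<phi>\<in>test_functions UNIV. (LBINT x. f x *\<^sub>R grad \<phi> x) = - (LBINT x. \<phi> x *\<^sub>R v x))"

lemma WgradD:
  assumes "Wgrad f v"
  shows "integrable lborel f" "integrable lborel v"
    "\<phi> \<in> test_functions UNIV \<Longrightarrow> (LBINT x. f x *\<^sub>R grad \<phi> x) = - (LBINT x. \<phi> x *\<^sub>R v x)"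
    "f \<in> borel_measurable borel" "v \<in> borel_measurable borel"
  using assms borel_measurable_integrable[of lborel f] borel_measurable_integrable[of lborel v]
  by (auto simp: Wgrad_def)

lemma Wgrad_cong:
  assumes W: "Wgrad f v" and F: "F \<in> borel_measurable borel" "AE x in lborel. f x = F x"
    and G: "G \<in> borel_measurable borel" "AE x in lborel. v x = G x"
  shows "Wgrad F G"
  unfolding Wgrad_def
proof (intro conjI ballI)
  note [measurable] = WgradD(4)[OF W] WgradD(5)[OF W] F(1) G(1)
  show "integrable lborel F"
    by (rule integrable_cong_AE_imp[OF WgradD(1)[OF W]]) (use F in auto)
  show "integrable lborel G"
    by (rule integrable_cong_AE_imp[OF WgradD(2)[OF W]]) (use G in auto)
  fix \<phi> :: "'a \<Rightarrow> real" assume t: "\<phi> \<in> test_functions UNIV"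
  note [measurable] = test_borel[OF t]
  have "(LBINT x. F x *\<^sub>R grad \<phi> x) = (LBINT x. f x *\<^sub>R grad \<phi> x)"
    by (rule integral_cong_AE) (use F(2) in auto)
  moreover have "(LBINT x. \<phi> x *\<^sub>R G x) = (LBINT x. \<phi> x *\<^sub>R v x)"
    by (rule integral_cong_AE) (use G(2) in auto)
  ultimately show "(LBINT x. F x *\<^sub>R grad \<phi> x) = - (LBINT x. \<phi> x *\<^sub>R G x)"
    using WgradD(3)[OF W t] by simp
qed

lemma grad_conv_Wgrad:
  assumes W: "Wgrad f v" and r: "\<rho> \<in> test_functions UNIV"
  shows "grad (conv f \<rho>) x = conv v \<rho> x"
proof -
  have t: "(\<lambda>y. \<rho> (x + (-1) *\<^sub>R y)) \<in> test_functions UNIV" by (rule test_affine[OF r]) simp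
  have g: "grad (\<lambda>y. \<rho> (x + (-1) *\<^sub>R y)) y = (-1) *\<^sub>R grad \<rho> (x + (-1) *\<^sub>R y)" for y
    by (rule grad_affine[OF test_smooth[OF r]])
  have "(LBINT y. f y *\<^sub>R ((-1) *\<^sub>R grad \<rho> (x + (-1) *\<^sub>R y))) = - (LBINT y. \<rho> (x + (-1) *\<^sub>R y) *\<^sub>R v y)"
    using WgradD(3)[OF W t] unfolding g .
  then show ?thesis
    unfolding grad_conv[OF WgradD(1)[OF W] r] conv_def by simp
qed

text \<open>The integral of a difference quotient vanishes by translation invariance; so does its limit.\<close>

lemma integral_gradient_zero:
  fixes \<Psi> :: "'a::euclidean_space \<Rightarrow> real"
  assumes D: "\<And>x. (\<Psi> has_derivative (\<lambda>h. G x \<bullet> h)) (at x)" and G: "continuous_on UNIV G"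
    and K: "compact K" "\<And>x. x \<notin> K \<Longrightarrow> \<Psi> x = 0" "\<And>x. x \<notin> K \<Longrightarrow> G x = 0"
  shows "(LBINT x. G x) = 0"
proof (rule euclidean_eqI)
  fix b :: 'a assume b: "b \<in> Basis"
  have Gi: "integrable lborel G" by (rule compact_support_integrable[OF G K(1,3)])
  have \<Psi>c: "continuous_on UNIV \<Psi>"
    using has_derivative_continuous[OF D] by (simp add: continuous_at_imp_continuous_on)
  have \<Psi>i: "integrable lborel \<Psi>" by (rule compact_support_integrable[OF \<Psi>c K(1,2)])
  obtain B where B: "B > 0" "\<And>x. norm (G x) \<le> B"
    using compact_support_bounded[OF G K(1,3)] by blast
  define t where "t n = 1 / real (Suc n)" for n
  have t: "0 < t n" "t n \<le> 1" for n by (auto simp: t_def)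
  have tl: "t \<longlonglongrightarrow> 0" unfolding t_def[abs_def] by (rule LIMSEQ_Suc[OF lim_1_over_n])
  define Q where "Q n x = (\<Psi> (t n *\<^sub>R b + 1 *\<^sub>R x) - \<Psi> x) / t n" for n x
  have Q0: "(LBINT x. Q n x) = 0" for n
    unfolding Q_def
    using integral_affine[OF \<Psi>i, of 1 "t n *\<^sub>R b"] integrable_affine[OF \<Psi>i, of 1 "t n *\<^sub>R b"] \<Psi>i by simp
  define L where "L = {x + y |x y. x \<in> K \<and> y \<in> cball (0::'a) 1}"
  have L: "compact L" unfolding L_def by (rule compact_sums[OF K(1) compact_cball])
  have "(\<lambda>n. LBINT x. Q n x) \<longlonglongrightarrow> (LBINT x. G x \<bullet> b)"
  proof (rule integral_dominated_convergence[where w = "\<lambda>x. B * indicator L x"])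
    show "integrable lborel (\<lambda>x. B * indicator L x)"
      by (intro integrable_mult_right integrable_indicator_bounded) (use L in \<open>auto simp: compact_imp_bounded borel_compact\<close>)
    have [measurable]: "G \<in> borel_measurable borel" using borel_measurable_integrable[OF Gi] by simp
    have [measurable]: "\<Psi> \<in> borel_measurable borel" using borel_measurable_integrable[OF \<Psi>i] by simp
    show "(\<lambda>x. G x \<bullet> b) \<in> borel_measurable lborel" by measurable
    show "Q n \<in> borel_measurable lborel" for n unfolding Q_def[abs_def] by measurable
    show "AE x in lborel. (\<lambda>n. Q n x) \<longlonglongrightarrow> G x \<bullet> b"
    proof (rule AE_I2)
      fix x
      have l: "((\<lambda>h. norm (\<Psi> (x + h) - \<Psi> x - G x \<bullet> h) / norm h) \<longlongrightarrow> 0) (at 0)"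
        using D[of x] by (simp add: has_derivative_at)
      have "(\<lambda>n. t n *\<^sub>R b) \<longlonglongrightarrow> 0" using tendsto_scaleR[OF tl tendsto_const, of b] by simp
      moreover have "t n *\<^sub>R b \<noteq> 0" for n using t(1)[of n] b by (auto simp: nonzero_Basis)
      ultimately have "(\<lambda>n. norm (\<Psi> (x + t n *\<^sub>R b) - \<Psi> x - G x \<bullet> (t n *\<^sub>R b)) / norm (t n *\<^sub>R b)) \<longlonglongrightarrow> 0"
        by (intro filterlim_compose[OF l] filterlim_atI) auto
      moreover have "norm (\<Psi> (x + t n *\<^sub>R b) - \<Psi> x - G x \<bullet> (t n *\<^sub>R b)) / norm (t n *\<^sub>R b) = \<bar>Q n x - G x \<bullet> b\<bar>" for n
      proof -
        have "Q n x - G x \<bullet> b = (\<Psi> (x + t n *\<^sub>R b) - \<Psi> x - G x \<bullet> (t n *\<^sub>R b)) / t n"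
          using t(1)[of n] by (simp add: Q_def field_simps add.commute)
        then show ?thesis using t(1)[of n] b by (simp add: abs_divide)
      qed
      ultimately have "(\<lambda>n. Q n x - G x \<bullet> b) \<longlonglongrightarrow> 0" by (simp add: tendsto_rabs_zero_iff)
      then show "(\<lambda>n. Q n x) \<longlonglongrightarrow> G x \<bullet> b" by (rule LIM_zero_cancel)
    qed
    show "AE x in lborel. norm (Q n x) \<le> B * indicator L x" for n
    proof (rule AE_I2)
      fix x
      show "norm (Q n x) \<le> B * indicator L x"
      proof (cases "x \<in> L")
        case True
        have "\<bar>\<Psi> (t n *\<^sub>R b + 1 *\<^sub>R x) - \<Psi> x\<bar> \<le> B * norm (t n *\<^sub>R b + 1 *\<^sub>R x - x)"
          by (rule bounded_gradient_Lipschitz[OF B(2) D])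
        then show ?thesis using True t(1)[of n] b by (simp add: Q_def abs_divide divide_le_eq)
      next
        case False
        have "x \<notin> K"
        proof
          assume "x \<in> K"
          then have "x + 0 \<in> L" unfolding L_def by (intro CollectI exI[of _ x] exI[of _ 0]) auto
          with False show False by simp
        qed
        moreover have "t n *\<^sub>R b + 1 *\<^sub>R x \<notin> K"
        proof
          assume *: "t n *\<^sub>R b + 1 *\<^sub>R x \<in> K"
          have "x = (t n *\<^sub>R b + 1 *\<^sub>R x) + (- t n *\<^sub>R b)" by simp
          moreover have "- t n *\<^sub>R b \<in> cball 0 1" using t[of n] b by simp
          ultimately have "x \<in> L" unfolding L_def using * by blast
          with False show False by simp
        qed
        ultimately show ?thesis using False K(2) by (simp add: Q_def)
      qed
    qed
  qed
  then have "(LBINT x. G x \<bullet> b) = 0" using Q0 LIMSEQ_unique[OF tendsto_const] by fastforce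
  then show "(LBINT x. G x) \<bullet> b = 0 \<bullet> b" using Gi by simp
qed

lemma integration_by_parts_C1:
  fixes f :: "'a::euclidean_space \<Rightarrow> real"
  assumes D: "\<And>x. (f has_derivative (\<lambda>h. G x \<bullet> h)) (at x)" and G: "continuous_on UNIV G"
    and p: "\<phi> \<in> test_functions UNIV"
  shows "(LBINT x. f x *\<^sub>R grad \<phi> x) = - (LBINT x. \<phi> x *\<^sub>R G x)"
    "integrable lborel (\<lambda>x. f x *\<^sub>R grad \<phi> x)" "integrable lborel (\<lambda>x. \<phi> x *\<^sub>R G x)"
proof -
  obtain K where K: "smooth \<phi>" "compact K" "\<And>x. x \<notin> K \<Longrightarrow> \<phi> x = 0" "\<And>x. x \<notin> K \<Longrightarrow> grad \<phi> x = 0"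
    using p by (rule test_functionsE) blast
  have fc: "continuous_on UNIV f"
    using has_derivative_continuous[OF D] by (simp add: continuous_at_imp_continuous_on)
  note c = continuous_on_grad[OF K(1)] smooth_continuous[OF K(1)]
  show i1: "integrable lborel (\<lambda>x. f x *\<^sub>R grad \<phi> x)"
    by (rule compact_support_integrable[OF continuous_on_scaleR[OF fc c(1)] K(2)]) (simp add: K(4))
  show i2: "integrable lborel (\<lambda>x. \<phi> x *\<^sub>R G x)"
    by (rule compact_support_integrable[OF continuous_on_scaleR[OF c(2) G] K(2)]) (simp add: K(3))
  have "(LBINT x. f x *\<^sub>R grad \<phi> x + \<phi> x *\<^sub>R G x) = 0"
  proof (rule integral_gradient_zero[where \<Psi> = "\<lambda>x. f x * \<phi> x" and K = K])
    show "((\<lambda>x. f x * \<phi> x) has_derivative (\<bullet>) (f x *\<^sub>R grad \<phi> x + \<phi> x *\<^sub>R G x)) (at x)" for x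
      by (rule has_derivative_eq_rhs[OF has_derivative_mult[OF D smooth_has_derivative[OF K(1)]]])
        (auto simp: inner_add_left fun_eq_iff)
    show "continuous_on UNIV (\<lambda>x. f x *\<^sub>R grad \<phi> x + \<phi> x *\<^sub>R G x)"
      by (intro continuous_intros fc c G)
  qed (auto simp: K)
  then show "(LBINT x. f x *\<^sub>R grad \<phi> x) = - (LBINT x. \<phi> x *\<^sub>R G x)"
    using i1 i2 by (simp add: eq_neg_iff_add_eq_0)
qed

lemma L1_integral_tendsto:
  fixes u :: "nat \<Rightarrow> 'a::euclidean_space \<Rightarrow> 'b::euclidean_space"
  assumes "\<And>n. integrable lborel (u n)" "integrable lborel f"
    and "(\<lambda>n. LBINT x. norm (u n x - f x)) \<longlonglongrightarrow> 0"
  shows "(\<lambda>n. LBINT x. u n x) \<longlonglongrightarrow> (LBINT x. f x)"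
proof -
  have "norm ((LBINT x. u n x) - (LBINT x. f x)) \<le> (LBINT x. norm (u n x - f x))" for n
    using integral_norm_bound[of lborel "\<lambda>x. u n x - f x"] assms(1)[of n] assms(2) by simp
  then have "(\<lambda>n. (LBINT x. u n x) - (LBINT x. f x)) \<longlonglongrightarrow> 0"
    by (intro Lim_null_comparison[OF _ assms(3)]) auto
  then show ?thesis by (rule LIM_zero_cancel)
qed

text \<open>The classical chain rule and integration by parts hold for the mollifications of \<open>f\<close>.  In the limit the
  factor \<open>g\<close> converges almost everywhere along a subsequence and is bounded, and the gradients converge in \<open>L\<^sup>1\<close>.\<close>

lemma chain_rule_C1:
  fixes f :: "'a::euclidean_space \<Rightarrow> real"
  assumes W: "Wgrad f v" and p: "\<phi> \<in> test_functions UNIV"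
    and F: "\<And>t. (F has_real_derivative g t) (at t)" and g: "continuous_on UNIV g" "\<And>t. \<bar>g t\<bar> \<le> C"
  shows "(LBINT x. F (f x) *\<^sub>R grad \<phi> x) = - (LBINT x. \<phi> x *\<^sub>R (g (f x) *\<^sub>R v x))"
proof -
  note fi = WgradD(1)[OF W] and vi = WgradD(2)[OF W]
  note [measurable] = WgradD(4)[OF W] WgradD(5)[OF W] test_borel[OF p]
  obtain B where B: "B > 0" "\<And>x. \<bar>\<phi> x\<bar> \<le> B" "\<And>x. norm (grad \<phi> x) \<le> B"
    using test_bounded[OF p] by blast
  have C0: "0 \<le> C" using g(2)[of 0] by simp
  have [measurable]: "g \<in> borel_measurable borel" by (rule borel_measurable_continuous_onI[OF g(1)])
  have Fc: "continuous_on UNIV F"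
    using DERIV_isCont[OF F] by (simp add: continuous_at_imp_continuous_on)
  have [measurable]: "F \<in> borel_measurable borel" by (rule borel_measurable_continuous_onI[OF Fc])
  have Lip: "\<bar>F s - F t\<bar> \<le> C * \<bar>s - t\<bar>" for s t
    using bounded_gradient_Lipschitz[where \<rho> = F and G = g and B = C, of s t] F g(2)
    by (simp add: has_field_derivative_def)
  obtain r :: "nat \<Rightarrow> nat" where r: "strict_mono r" "AE x in lborel. (\<lambda>n. conv f (moll (r n)) x) \<longlonglongrightarrow> f x"
    using conv_moll_AE_subseq[OF fi] by blast
  define fn where "fn n = conv f (moll (r n))" for n
  define vn where "vn n = conv v (moll (r n))" for n
  have fni: "integrable lborel (fn n)" for n unfolding fn_def by (rule conv_moll_L1(1)[OF fi])
  have vni: "integrable lborel (vn n)" for n unfolding vn_def by (rule conv_moll_L1(1)[OF vi])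
  have [measurable]: "fn n \<in> borel_measurable borel" for n using borel_measurable_integrable[OF fni[of n]] by simp
  have [measurable]: "vn n \<in> borel_measurable borel" for n using borel_measurable_integrable[OF vni[of n]] by simp
  have sm: "smooth (fn n)" for n unfolding fn_def by (rule smooth_conv[OF fi moll_test])
  have gr: "grad (fn n) = vn n" for n unfolding fn_def vn_def by (rule ext, rule grad_conv_Wgrad[OF W moll_test])
  have Df: "((\<lambda>x. F (fn n x)) has_derivative (\<lambda>h. (g (fn n x) *\<^sub>R vn n x) \<bullet> h)) (at x)" for n x
  proof -
    have "(F has_derivative (\<lambda>h. g (fn n x) * h)) (at (fn n x))"
      using F[of "fn n x"] by (simp add: has_field_derivative_def)
    from has_derivative_compose[OF smooth_has_derivative[OF sm] this]
    show ?thesis by (simp add: gr)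
  qed
  have Gc: "continuous_on UNIV (\<lambda>x. g (fn n x) *\<^sub>R vn n x)" for n
    using continuous_on_grad[OF sm[of n]] unfolding gr
    by (intro continuous_on_scaleR continuous_on_compose2[OF g(1) smooth_continuous[OF sm]]) auto
  note parts = integration_by_parts_C1[OF Df Gc p]
  have lim1: "(\<lambda>n. LBINT x. F (fn n x) *\<^sub>R grad \<phi> x) \<longlonglongrightarrow> (LBINT x. F (f x) *\<^sub>R grad \<phi> x)"
  proof (rule L1_integral_tendsto[OF parts(2)])
    have bd: "norm (F (f x) *\<^sub>R grad \<phi> x) \<le> \<bar>F 0\<bar> * norm (grad \<phi> x) + C * B * \<bar>f x\<bar>" for x
    proof -
      have "\<bar>F (f x)\<bar> \<le> \<bar>F 0\<bar> + C * \<bar>f x\<bar>" using Lip[of "f x" 0] by simp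
      then have "\<bar>F (f x)\<bar> * norm (grad \<phi> x) \<le> (\<bar>F 0\<bar> + C * \<bar>f x\<bar>) * norm (grad \<phi> x)"
        by (rule mult_right_mono) simp
      also have "\<dots> \<le> \<bar>F 0\<bar> * norm (grad \<phi> x) + C * \<bar>f x\<bar> * B"
        using B(3)[of x] C0 by (simp add: distrib_right mult_left_mono)
      finally show ?thesis by (simp add: mult_ac)
    qed
    show "integrable lborel (\<lambda>x. F (f x) *\<^sub>R grad \<phi> x)"
    proof (rule Bochner_Integration.integrable_bound)
      show "integrable lborel (\<lambda>x. \<bar>F 0\<bar> * norm (grad \<phi> x) + C * B * \<bar>f x\<bar>)"
        using test_integrable(2)[OF p] fi by simp
    qed (use bd in \<open>auto intro!: AE_I2 intro: order_trans[OF _ abs_ge_self]\<close>)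
    have "(\<lambda>n. C * B * (LBINT x. norm (conv f (moll (r n)) x - f x))) \<longlonglongrightarrow> C * B * 0"
      using LIMSEQ_subseq_LIMSEQ[OF conv_moll_tendsto_L1[OF fi] r(1)]
      by (intro tendsto_mult tendsto_const) (simp add: o_def)
    moreover have le: "norm (LBINT x. norm (F (fn n x) *\<^sub>R grad \<phi> x - F (f x) *\<^sub>R grad \<phi> x))
        \<le> C * B * (LBINT x. norm (conv f (moll (r n)) x - f x))" for n
    proof -
      have "(LBINT x. norm (F (fn n x) *\<^sub>R grad \<phi> x - F (f x) *\<^sub>R grad \<phi> x))
        \<le> (LBINT x. C * B * norm (fn n x - f x))"
      proof (rule integral_mono)
        show "integrable lborel (\<lambda>x. C * B * norm (fn n x - f x))" using fni fi by simp
        show "integrable lborel (\<lambda>x. norm (F (fn n x) *\<^sub>R grad \<phi> x - F (f x) *\<^sub>R grad \<phi> x))"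
          using parts(2) \<open>integrable lborel (\<lambda>x. F (f x) *\<^sub>R grad \<phi> x)\<close> by simp
        show "norm (F (fn n x) *\<^sub>R grad \<phi> x - F (f x) *\<^sub>R grad \<phi> x) \<le> C * B * norm (fn n x - f x)" for x
          unfolding scaleR_diff_left[symmetric] norm_scaleR
          using mult_mono[OF Lip[of "fn n x" "f x"] B(3)[of x]] C0 by (simp add: mult_ac)
      qed
      then show ?thesis by (simp add: fn_def)
    qed
    ultimately show "(\<lambda>n. LBINT x. norm (F (fn n x) *\<^sub>R grad \<phi> x - F (f x) *\<^sub>R grad \<phi> x)) \<longlonglongrightarrow> 0"
      by (intro Lim_null_comparison[OF always_eventually[OF allI[OF le]]]) simp
  qed
  have lim2: "(\<lambda>n. LBINT x. \<phi> x *\<^sub>R (g (fn n x) *\<^sub>R vn n x)) \<longlonglongrightarrow> (LBINT x. \<phi> x *\<^sub>R (g (f x) *\<^sub>R v x))"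
  proof (rule L1_integral_tendsto[OF parts(3)])
    have bd: "\<bar>\<phi> x\<bar> * \<bar>g t\<bar> \<le> B * C" for x t
      by (intro mult_mono B(2) g(2)) (use B in auto)
    show i: "integrable lborel (\<lambda>x. \<phi> x *\<^sub>R g (f x) *\<^sub>R v x)"
      unfolding scaleR_scaleR
      by (rule integrable_bounded_mult[OF vi, where B = "B * C"]) (use bd in \<open>auto simp: abs_mult\<close>)
    have "(\<lambda>n. LBINT x. \<bar>g (fn n x) - g (f x)\<bar> * norm (v x)) \<longlonglongrightarrow> (\<integral>x. 0 \<partial>(lborel :: 'a measure))"
    proof (rule integral_dominated_convergence[where w = "\<lambda>x. 2 * C * norm (v x)"])
      show "AE x in lborel. (\<lambda>n. \<bar>g (fn n x) - g (f x)\<bar> * norm (v x)) \<longlonglongrightarrow> 0"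
        using r(2)
      proof eventually_elim
        case (elim x)
        have "isCont g (f x)" using g(1) by (simp add: continuous_on_eq_continuous_at)
        then have "(\<lambda>n. g (fn n x)) \<longlonglongrightarrow> g (f x)" unfolding fn_def by (rule isCont_tendsto_compose[OF _ elim])
        then have "(\<lambda>n. \<bar>g (fn n x) - g (f x)\<bar> * norm (v x)) \<longlonglongrightarrow> \<bar>g (f x) - g (f x)\<bar> * norm (v x)"
          by (intro tendsto_intros)
        then show ?case by simp
      qed
      show "AE x in lborel. norm (\<bar>g (fn n x) - g (f x)\<bar> * norm (v x)) \<le> 2 * C * norm (v x)" (is "AE x in _. ?P x") for n
      proof (rule AE_I2)
        fix x
        have "\<bar>g (fn n x) - g (f x)\<bar> \<le> 2 * C" using g(2)[of "fn n x"] g(2)[of "f x"] by linarith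
        then show "?P x"
          by (simp add: mult_right_mono)
      qed
    qed (use vi in auto)
    then have l1: "(\<lambda>n. B * C * (LBINT x. norm (conv v (moll (r n)) x - v x))
        + B * (LBINT x. \<bar>g (fn n x) - g (f x)\<bar> * norm (v x))) \<longlonglongrightarrow> B * C * 0 + B * 0"
      using LIMSEQ_subseq_LIMSEQ[OF conv_moll_tendsto_L1[OF vi] r(1)]
      by (intro tendsto_intros) (simp_all add: o_def)
    have le: "norm (LBINT x. norm (\<phi> x *\<^sub>R (g (fn n x) *\<^sub>R vn n x) - \<phi> x *\<^sub>R (g (f x) *\<^sub>R v x)))
        \<le> B * C * (LBINT x. norm (conv v (moll (r n)) x - v x))
        + B * (LBINT x. \<bar>g (fn n x) - g (f x)\<bar> * norm (v x))" for n
    proof -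
      have j1: "integrable lborel (\<lambda>x. norm (vn n x - v x))" using vni vi by simp
      have j2: "integrable lborel (\<lambda>x. \<bar>g (fn n x) - g (f x)\<bar> * norm (v x))"
      proof -
        have "\<bar>\<bar>g (fn n x) - g (f x)\<bar>\<bar> \<le> 2 * C" for x using g(2)[of "fn n x"] g(2)[of "f x"] by linarith
        then show ?thesis
          using integrable_bounded_mult[OF integrable_norm[OF vi], of "\<lambda>x. \<bar>g (fn n x) - g (f x)\<bar>" "2 * C"] by simp
      qed
      have "(LBINT x. norm (\<phi> x *\<^sub>R (g (fn n x) *\<^sub>R vn n x) - \<phi> x *\<^sub>R (g (f x) *\<^sub>R v x)))
        \<le> (LBINT x. B * C * norm (vn n x - v x) + B * (\<bar>g (fn n x) - g (f x)\<bar> * norm (v x)))"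
      proof (rule integral_mono)
        show "integrable lborel (\<lambda>x. norm (\<phi> x *\<^sub>R (g (fn n x) *\<^sub>R vn n x) - \<phi> x *\<^sub>R (g (f x) *\<^sub>R v x)))"
          using parts(3) i by simp
        show "integrable lborel (\<lambda>x. B * C * norm (vn n x - v x) + B * (\<bar>g (fn n x) - g (f x)\<bar> * norm (v x)))"
          using j1 j2 by simp
        fix x
        have "\<phi> x *\<^sub>R (g (fn n x) *\<^sub>R vn n x) - \<phi> x *\<^sub>R (g (f x) *\<^sub>R v x)
          = (\<phi> x * g (fn n x)) *\<^sub>R (vn n x - v x) + (\<phi> x * (g (fn n x) - g (f x))) *\<^sub>R v x"
          by (simp add: algebra_simps)
        then have "norm (\<phi> x *\<^sub>R (g (fn n x) *\<^sub>R vn n x) - \<phi> x *\<^sub>R (g (f x) *\<^sub>R v x))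
          \<le> \<bar>\<phi> x\<bar> * \<bar>g (fn n x)\<bar> * norm (vn n x - v x) + \<bar>\<phi> x\<bar> * (\<bar>g (fn n x) - g (f x)\<bar> * norm (v x))"
          using norm_triangle_ineq[of "(\<phi> x * g (fn n x)) *\<^sub>R (vn n x - v x)" "(\<phi> x * (g (fn n x) - g (f x))) *\<^sub>R v x"]
          by (simp add: abs_mult mult.assoc)
        also have "\<dots> \<le> B * C * norm (vn n x - v x) + B * (\<bar>g (fn n x) - g (f x)\<bar> * norm (v x))"
          by (intro add_mono mult_right_mono bd B(2)) auto
        finally show "norm (\<phi> x *\<^sub>R (g (fn n x) *\<^sub>R vn n x) - \<phi> x *\<^sub>R (g (f x) *\<^sub>R v x))
          \<le> B * C * norm (vn n x - v x) + B * (\<bar>g (fn n x) - g (f x)\<bar> * norm (v x))" .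
      qed
      also have "\<dots> = B * C * (LBINT x. norm (vn n x - v x)) + B * (LBINT x. \<bar>g (fn n x) - g (f x)\<bar> * norm (v x))"
        using j1 j2 by simp
      finally show ?thesis by (simp add: vn_def)
    qed
    show "(\<lambda>n. LBINT x. norm (\<phi> x *\<^sub>R (g (fn n x) *\<^sub>R vn n x) - \<phi> x *\<^sub>R (g (f x) *\<^sub>R v x))) \<longlonglongrightarrow> 0"
      by (rule Lim_null_comparison[OF always_eventually[OF allI[OF le]]]) (use l1 in simp)
  qed
  show ?thesis
    by (rule LIMSEQ_unique[OF lim1[unfolded parts(1)] tendsto_minus[OF lim2]])
qed

section \<open>The chain rule for Lipschitz functions\<close>

text \<open>The primitive of \<open>g\<close> vanishing at the origin.\<close>

definition prim :: "(real \<Rightarrow> real) \<Rightarrow> real \<Rightarrow> real" where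
  "prim g t = (LBINT s. (if 0 \<le> s \<and> s \<le> t then g s else if t \<le> s \<and> s < 0 then - g s else 0))"

definition bounded_Borel :: "(real \<Rightarrow> real) \<Rightarrow> real \<Rightarrow> bool" where
  "bounded_Borel g C \<longleftrightarrow> g \<in> borel_measurable borel \<and> (\<forall>t. \<bar>g t\<bar> \<le> C)"

lemma bounded_BorelD:
  assumes "bounded_Borel g C"
  shows "g \<in> borel_measurable borel" "\<bar>g t\<bar> \<le> C" "0 \<le> C"
  using assms by (auto simp: bounded_Borel_def intro: order_trans[OF abs_ge_zero])

lemma integrable_indicator_interval: "integrable lborel (\<lambda>s. C * indicator {a..b::real} s :: real)"
  by (intro integrable_mult_right integrable_indicator_bounded) auto

lemma prim_integrable:
  assumes "bounded_Borel g C"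
  shows "integrable lborel (\<lambda>s. if 0 \<le> s \<and> s \<le> t then g s else if t \<le> s \<and> s < 0 then - g s else (0::real))"
proof (rule Bochner_Integration.integrable_bound[OF integrable_indicator_interval[of C "-\<bar>t\<bar>" "\<bar>t\<bar>"]])
  note [measurable] = bounded_BorelD(1)[OF assms]
  show "(\<lambda>s. if 0 \<le> s \<and> s \<le> t then g s else if t \<le> s \<and> s < 0 then - g s else 0) \<in> borel_measurable lborel"
    by measurable
  show "AE s in lborel. norm (if 0 \<le> s \<and> s \<le> t then g s else if t \<le> s \<and> s < 0 then - g s else 0)
      \<le> norm (C * indicator {-\<bar>t\<bar>..\<bar>t\<bar>} s)"
    using bounded_BorelD(2,3)[OF assms] by (intro AE_I2) (auto simp: indicator_def)
qed

lemma prim_bound: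
  assumes "bounded_Borel g C"
  shows "\<bar>prim g t\<bar> \<le> 2 * C * \<bar>t\<bar>"
proof -
  have "\<bar>prim g t\<bar> \<le> (LBINT s. \<bar>if 0 \<le> s \<and> s \<le> t then g s else if t \<le> s \<and> s < 0 then - g s else (0::real)\<bar>)"
    unfolding prim_def by (rule integral_abs_bound)
  also have "\<dots> \<le> (LBINT s. C * indicator {-\<bar>t\<bar>..\<bar>t\<bar>} s)"
  proof (rule integral_mono[OF integrable_abs[OF prim_integrable[OF assms]] integrable_indicator_interval])
    show "\<bar>if 0 \<le> s \<and> s \<le> t then g s else if t \<le> s \<and> s < 0 then - g s else (0::real)\<bar> \<le> C * indicator {-\<bar>t\<bar>..\<bar>t\<bar>} s" for s
      using bounded_BorelD(2,3)[OF assms] by (auto simp: indicator_def)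
  qed
  also have "\<dots> = 2 * C * \<bar>t\<bar>" by simp
  finally show ?thesis .
qed

lemma prim_measurable:
  assumes "g \<in> borel_measurable borel"
  shows "prim g \<in> borel_measurable borel"
proof -
  note [measurable] = assms
  show ?thesis unfolding prim_def[abs_def]
    by (rule lborel.borel_measurable_lebesgue_integral) measurable
qed

lemma prim_add:
  assumes "bounded_Borel g C" "bounded_Borel h D"
  shows "prim (\<lambda>s. a * g s + b * h s) t = a * prim g t + b * prim h t"
proof -
  have "prim (\<lambda>s. a * g s + b * h s) t = (LBINT s. a * (if 0 \<le> s \<and> s \<le> t then g s else if t \<le> s \<and> s < 0 then - g s else 0)
     + b * (if 0 \<le> s \<and> s \<le> t then h s else if t \<le> s \<and> s < 0 then - h s else 0))"
    unfolding prim_def by (rule Bochner_Integration.integral_cong) (auto simp: algebra_simps)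
  then show ?thesis
    using prim_integrable[OF assms(1), of t] prim_integrable[OF assms(2), of t] by (simp add: prim_def)
qed

lemma prim_limit:
  assumes "\<And>n. bounded_Borel (g n) C" "\<And>t. (\<lambda>n. g n t) \<longlonglongrightarrow> h t"
  shows "(\<lambda>n. prim (g n) t) \<longlonglongrightarrow> prim h t"
  unfolding prim_def
proof (rule integral_dominated_convergence[OF _ _ integrable_indicator_interval[of C "-\<bar>t\<bar>" "\<bar>t\<bar>"]])
  note [measurable] = bounded_BorelD(1)[OF assms(1)]
  have [measurable]: "h \<in> borel_measurable borel"
    by (rule borel_measurable_LIMSEQ_real[of borel g]) (use assms(2) in auto)
  show "(\<lambda>s. if 0 \<le> s \<and> s \<le> t then h s else if t \<le> s \<and> s < 0 then - h s else 0) \<in> borel_measurable lborel"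
    by measurable
  show "(\<lambda>s. if 0 \<le> s \<and> s \<le> t then g n s else if t \<le> s \<and> s < 0 then - g n s else 0) \<in> borel_measurable lborel" for n
    by measurable
  show "AE s in lborel. (\<lambda>n. if 0 \<le> s \<and> s \<le> t then g n s else if t \<le> s \<and> s < 0 then - g n s else 0)
      \<longlonglongrightarrow> (if 0 \<le> s \<and> s \<le> t then h s else if t \<le> s \<and> s < 0 then - h s else 0)"
    by (intro AE_I2) (auto intro: assms(2) tendsto_minus)
  show "AE s in lborel. norm (if 0 \<le> s \<and> s \<le> t then g n s else if t \<le> s \<and> s < 0 then - g n s else 0)
      \<le> C * indicator {-\<bar>t\<bar>..\<bar>t\<bar>} s" for n
    using bounded_BorelD(2,3)[OF assms(1)] by (intro AE_I2) (auto simp: indicator_def)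
qed

text \<open>A continuous function that is differentiable off a finite set is recovered from its derivative.\<close>

lemma prim_eqI:
  assumes g: "bounded_Borel g C" and F: "continuous_on UNIV F" and S: "finite S"
    and D: "\<And>t. t \<notin> S \<Longrightarrow> (F has_real_derivative g t) (at t)"
  shows "prim g t = F t - F 0"
proof -
  have ftc: "(LBINT s. indicator {a..b} s *\<^sub>R g s) = F b - F a" if "a \<le> b" for a b
  proof -
    have "set_integrable lborel {a..b} g"
      unfolding set_integrable_def
    proof (rule Bochner_Integration.integrable_bound[OF integrable_indicator_interval[of C a b]])
      note [measurable] = bounded_BorelD(1)[OF g]
      show "(\<lambda>x. indicat_real {a..b} x *\<^sub>R g x) \<in> borel_measurable lborel" by measurable
    qed (use bounded_BorelD(2,3)[OF g] in \<open>auto simp: indicator_def intro!: AE_I2\<close>)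
    then have "(LINT s:{a..b}|lborel. g s) = integral {a..b} g" by (rule set_borel_integral_eq_integral(2))
    moreover have "(g has_integral (F b - F a)) {a..b}"
      by (rule fundamental_theorem_of_calculus_interior_strong[OF S that])
        (use D F in \<open>auto simp: has_real_derivative_iff_has_vector_derivative[symmetric] intro: continuous_on_subset\<close>)
    ultimately show ?thesis by (simp add: set_lebesgue_integral_def integral_unique)
  qed
  show ?thesis
  proof (cases "0 \<le> t")
    case True
    have "prim g t = (LBINT s. indicator {0..t} s *\<^sub>R g s)"
      unfolding prim_def by (rule Bochner_Integration.integral_cong) (use True in \<open>auto simp: indicator_def\<close>)
    then show ?thesis using ftc[OF True] by simp
  next
    case False
    have "prim g t = (LBINT s. - (indicator {t..0} s *\<^sub>R g s))"
      unfolding prim_def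
    proof (rule integral_cong_AE)
      note [measurable] = bounded_BorelD(1)[OF g]
      show "(\<lambda>s. if 0 \<le> s \<and> s \<le> t then g s else if t \<le> s \<and> s < 0 then - g s else 0) \<in> borel_measurable lborel"
        by measurable
      show "(\<lambda>s. - (indicat_real {t..0} s *\<^sub>R g s)) \<in> borel_measurable lborel" by measurable
      show "AE s in lborel. (if 0 \<le> s \<and> s \<le> t then g s else if t \<le> s \<and> s < 0 then - g s else 0)
          = - (indicat_real {t..0} s *\<^sub>R g s)"
        using AE_lborel_singleton[of "0::real"] by eventually_elim (use False in \<open>auto simp: indicator_def\<close>)
    qed
    then show ?thesis using ftc[of t 0] False by simp
  qed
qed

text \<open>The fundamental theorem of calculus for \<open>prim\<close>, on both sides of the origin.\<close>

lemma prim_derivative: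
  assumes g: "bounded_Borel g C" "continuous_on UNIV g"
  shows "(prim g has_real_derivative g t) (at t)"
proof -
  define a where "a = - \<bar>t\<bar> - 1"
  define b where "b = \<bar>t\<bar> + 1"
  have ab: "a < t" "t < b" "a < 0" "0 < b" by (auto simp: a_def b_def)
  have gc: "continuous_on {a..b} g" by (rule continuous_on_subset[OF g(2)]) auto
  define F where "F x = integral {a..x} g" for x
  have FD: "(F has_vector_derivative g x) (at x)" if "a < x" "x < b" for x
  proof -
    have "(F has_vector_derivative g x) (at x within {a..b})"
      unfolding F_def by (rule integral_has_vector_derivative[OF gc]) (use that in auto)
    then show ?thesis
      using at_within_interior[of x "{a..b}"] that by simp
  qed
  have eq: "prim g x = F x - F 0" if x: "a < x" "x < b" for x
  proof -
    have diff: "(LBINT s. indicator {c..d} s *\<^sub>R g s) = F d - F c" if "a < c" "c \<le> d" "d < b" for c d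
    proof -
      have "set_integrable lborel {c..d} g"
        by (rule borel_integrable_atLeastAtMost') (rule continuous_on_subset[OF g(2)], simp)
      then have "(LINT s:{c..d}|lborel. g s) = integral {c..d} g" by (rule set_borel_integral_eq_integral(2))
      moreover have "(g has_integral (F d - F c)) {c..d}"
        by (rule fundamental_theorem_of_calculus[OF that(2)])
          (use that FD in \<open>auto intro: has_vector_derivative_at_within\<close>)
      ultimately show ?thesis by (simp add: set_lebesgue_integral_def integral_unique)
    qed
    show ?thesis
    proof (cases "0 \<le> x")
      case True
      have "prim g x = (LBINT s. indicator {0..x} s *\<^sub>R g s)"
        unfolding prim_def by (rule Bochner_Integration.integral_cong) (use True in \<open>auto simp: indicator_def\<close>)
      then show ?thesis using diff[of 0 x] ab x True by simp
    next
      case False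
      have "prim g x = (LBINT s. - (indicator {x..0} s *\<^sub>R g s))"
        unfolding prim_def
      proof (rule integral_cong_AE)
        note [measurable] = bounded_BorelD(1)[OF g(1)]
        show "(\<lambda>s. if 0 \<le> s \<and> s \<le> x then g s else if x \<le> s \<and> s < 0 then - g s else 0) \<in> borel_measurable lborel"
          by measurable
        show "(\<lambda>s. - (indicat_real {x..0} s *\<^sub>R g s)) \<in> borel_measurable lborel" by measurable
        show "AE s in lborel. (if 0 \<le> s \<and> s \<le> x then g s else if x \<le> s \<and> s < 0 then - g s else 0)
            = - (indicat_real {x..0} s *\<^sub>R g s)"
          using AE_lborel_singleton[of "0::real"] by eventually_elim (use False in \<open>auto simp: indicator_def\<close>)
      qed
      then show ?thesis using diff[of x 0] ab x False by simp
    qed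
  qed
  have "((\<lambda>x. F x - F 0) has_real_derivative g t) (at t)"
    using FD[OF ab(1,2)] unfolding has_real_derivative_iff_has_vector_derivative[symmetric]
    by (auto intro!: derivative_eq_intros)
  then show ?thesis
    by (rule has_field_derivative_transform_within_open[of _ _ _ "{a<..<b}"]) (use ab eq in auto)
qed

text \<open>The chain rule for the primitive of \<open>g\<close>, tested with one fixed test function.  As a condition
  on \<open>g\<close> it is linear and stable under bounded pointwise limits; hence it passes from continuous
  functions to indicators of intervals, by a Dynkin argument to indicators of Borel sets, and finally
  to all bounded Borel functions.\<close>

definition chain_rule_for :: "('a::euclidean_space \<Rightarrow> real) \<Rightarrow> ('a \<Rightarrow> 'a) \<Rightarrow> ('a \<Rightarrow> real) \<Rightarrow> (real \<Rightarrow> real) \<Rightarrow> bool" where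
  "chain_rule_for f v \<phi> g \<longleftrightarrow>
    (LBINT x. prim g (f x) *\<^sub>R grad \<phi> x) = - (LBINT x. \<phi> x *\<^sub>R (g (f x) *\<^sub>R v x))"

lemma chain_integrable:
  assumes W: "Wgrad f v" and p: "\<phi> \<in> test_functions UNIV" and g: "bounded_Borel g C"
  shows "integrable lborel (\<lambda>x. prim g (f x) *\<^sub>R grad \<phi> x)" "integrable lborel (\<lambda>x. \<phi> x *\<^sub>R (g (f x) *\<^sub>R v x))"
    "\<exists>B>0. (\<forall>x. norm (prim g (f x) *\<^sub>R grad \<phi> x) \<le> 2 * C * B * \<bar>f x\<bar>) \<and>
       (\<forall>x. norm (\<phi> x *\<^sub>R (g (f x) *\<^sub>R v x)) \<le> C * B * norm (v x))"
proof -
  note [measurable] = WgradD(4)[OF W] WgradD(5)[OF W] test_borel[OF p] bounded_BorelD(1)[OF g]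
    prim_measurable[OF bounded_BorelD(1)[OF g]]
  obtain B where B: "B > 0" "\<And>x. \<bar>\<phi> x\<bar> \<le> B" "\<And>x. norm (grad \<phi> x) \<le> B"
    using test_bounded[OF p] by blast
  have 1: "norm (prim g (f x) *\<^sub>R grad \<phi> x) \<le> 2 * C * B * \<bar>f x\<bar>" for x
    using mult_mono[OF prim_bound[OF g, of "f x"] B(3)[of x]] bounded_BorelD(3)[OF g]
    by (simp add: mult_ac)
  have 2: "norm (\<phi> x *\<^sub>R (g (f x) *\<^sub>R v x)) \<le> C * B * norm (v x)" for x
  proof -
    have "\<bar>\<phi> x\<bar> * \<bar>g (f x)\<bar> * norm (v x) \<le> B * C * norm (v x)"
      by (intro mult_right_mono mult_mono B bounded_BorelD[OF g]) (use B in auto)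
    then show ?thesis by (simp add: abs_mult mult_ac)
  qed
  show "integrable lborel (\<lambda>x. prim g (f x) *\<^sub>R grad \<phi> x)"
  proof (rule Bochner_Integration.integrable_bound)
    show "integrable lborel (\<lambda>x. 2 * C * B * \<bar>f x\<bar>)" using WgradD(1)[OF W] by simp
  qed (use 1 in \<open>auto intro!: AE_I2 intro: order_trans[OF _ abs_ge_self]\<close>)
  show "integrable lborel (\<lambda>x. \<phi> x *\<^sub>R (g (f x) *\<^sub>R v x))"
  proof (rule Bochner_Integration.integrable_bound)
    show "integrable lborel (\<lambda>x. C * B * norm (v x))" using WgradD(2)[OF W] by simp
  qed (use 2 in \<open>auto intro!: AE_I2 intro: order_trans[OF _ abs_ge_self]\<close>)
  show "\<exists>B>0. (\<forall>x. norm (prim g (f x) *\<^sub>R grad \<phi> x) \<le> 2 * C * B * \<bar>f x\<bar>) \<and>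
       (\<forall>x. norm (\<phi> x *\<^sub>R (g (f x) *\<^sub>R v x)) \<le> C * B * norm (v x))"
    using 1 2 B(1) by blast
qed

lemma bounded_Borel_lin:
  assumes "bounded_Borel g C" "bounded_Borel h D"
  shows "bounded_Borel (\<lambda>t. a * g t + b * h t) (\<bar>a\<bar> * C + \<bar>b\<bar> * D)"
proof -
  have "\<bar>a * g t + b * h t\<bar> \<le> \<bar>a\<bar> * C + \<bar>b\<bar> * D" for t
  proof -
    have "\<bar>a * g t\<bar> \<le> \<bar>a\<bar> * C" "\<bar>b * h t\<bar> \<le> \<bar>b\<bar> * D"
      unfolding abs_mult by (intro mult_left_mono bounded_BorelD[OF assms(1)] bounded_BorelD[OF assms(2)] abs_ge_zero)+
    then show ?thesis by linarith
  qed
  moreover have "(\<lambda>t. a * g t + b * h t) \<in> borel_measurable borel"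
    using bounded_BorelD(1)[OF assms(1)] bounded_BorelD(1)[OF assms(2)] by measurable
  ultimately show ?thesis by (simp add: bounded_Borel_def)
qed

lemma chain_lin:
  assumes W: "Wgrad f v" and p: "\<phi> \<in> test_functions UNIV" and g: "bounded_Borel g C" and h: "bounded_Borel h D"
    and "chain_rule_for f v \<phi> g" "chain_rule_for f v \<phi> h"
  shows "chain_rule_for f v \<phi> (\<lambda>t. a * g t + b * h t)"
proof -
  note ig = chain_integrable(1,2)[OF W p g] and ih = chain_integrable(1,2)[OF W p h]
  have "(LBINT x. prim (\<lambda>t. a * g t + b * h t) (f x) *\<^sub>R grad \<phi> x)
      = (LBINT x. a *\<^sub>R (prim g (f x) *\<^sub>R grad \<phi> x) + b *\<^sub>R (prim h (f x) *\<^sub>R grad \<phi> x))"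
    by (simp add: prim_add[OF g h] scaleR_add_left)
  also have "\<dots> = a *\<^sub>R (LBINT x. prim g (f x) *\<^sub>R grad \<phi> x) + b *\<^sub>R (LBINT x. prim h (f x) *\<^sub>R grad \<phi> x)"
    using ig ih by (simp del: scaleR_scaleR)
  also have "\<dots> = - (a *\<^sub>R (LBINT x. \<phi> x *\<^sub>R (g (f x) *\<^sub>R v x)) + b *\<^sub>R (LBINT x. \<phi> x *\<^sub>R (h (f x) *\<^sub>R v x)))"
    using assms(5,6) by (simp add: chain_rule_for_def)
  also have "\<dots> = - (LBINT x. a *\<^sub>R (\<phi> x *\<^sub>R (g (f x) *\<^sub>R v x)) + b *\<^sub>R (\<phi> x *\<^sub>R (h (f x) *\<^sub>R v x)))"
    using ig ih by (simp del: scaleR_scaleR)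
  also have "\<dots> = - (LBINT x. \<phi> x *\<^sub>R ((a * g (f x) + b * h (f x)) *\<^sub>R v x))"
    by (simp add: algebra_simps)
  finally show ?thesis by (simp add: chain_rule_for_def)
qed

lemma chain_limit:
  assumes W: "Wgrad f v" and p: "\<phi> \<in> test_functions UNIV" and g: "\<And>n. bounded_Borel (g n) C"
    and ch: "\<And>n. chain_rule_for f v \<phi> (g n)" and lim: "\<And>t. (\<lambda>n. g n t) \<longlonglongrightarrow> h t"
  shows "chain_rule_for f v \<phi> h"
proof -
  note [measurable] = WgradD(4)[OF W] WgradD(5)[OF W] test_borel[OF p] bounded_BorelD(1)[OF g]
    prim_measurable[OF bounded_BorelD(1)[OF g]]
  have hm: "h \<in> borel_measurable borel"
    by (rule borel_measurable_LIMSEQ_real[of borel g]) (use lim bounded_BorelD(1)[OF g] in auto)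
  note [measurable] = hm prim_measurable[OF hm]
  obtain B where B: "B > 0" "\<And>x. \<bar>\<phi> x\<bar> \<le> B" "\<And>x. norm (grad \<phi> x) \<le> B"
    using test_bounded[OF p] by blast
  have 1: "norm (prim (g n) (f x) *\<^sub>R grad \<phi> x) \<le> 2 * C * B * \<bar>f x\<bar>" for n x
    using mult_mono[OF prim_bound[OF g, of n "f x"] B(3)[of x]] bounded_BorelD(3)[OF g]
    by (simp add: mult_ac)
  have 2: "norm (\<phi> x *\<^sub>R (g n (f x) *\<^sub>R v x)) \<le> C * B * norm (v x)" for n x
  proof -
    have "\<bar>\<phi> x\<bar> * \<bar>g n (f x)\<bar> * norm (v x) \<le> B * C * norm (v x)"
      by (intro mult_right_mono mult_mono B bounded_BorelD[OF g]) (use B in auto)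
    then show ?thesis by (simp add: abs_mult mult_ac)
  qed
  have l1: "(\<lambda>n. LBINT x. prim (g n) (f x) *\<^sub>R grad \<phi> x) \<longlonglongrightarrow> (LBINT x. prim h (f x) *\<^sub>R grad \<phi> x)"
  proof (rule integral_dominated_convergence[where w = "\<lambda>x. 2 * C * B * \<bar>f x\<bar>"])
    show "AE x in lborel. (\<lambda>n. prim (g n) (f x) *\<^sub>R grad \<phi> x) \<longlonglongrightarrow> prim h (f x) *\<^sub>R grad \<phi> x"
      by (intro AE_I2 tendsto_scaleR tendsto_const prim_limit[OF g lim])
  qed (use WgradD(1)[OF W] 1 in auto)
  have l2: "(\<lambda>n. LBINT x. \<phi> x *\<^sub>R (g n (f x) *\<^sub>R v x)) \<longlonglongrightarrow> (LBINT x. \<phi> x *\<^sub>R (h (f x) *\<^sub>R v x))"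
  proof (rule integral_dominated_convergence[where w = "\<lambda>x. C * B * norm (v x)"])
    show "AE x in lborel. (\<lambda>n. \<phi> x *\<^sub>R (g n (f x) *\<^sub>R v x)) \<longlonglongrightarrow> \<phi> x *\<^sub>R (h (f x) *\<^sub>R v x)"
      by (intro AE_I2 tendsto_scaleR tendsto_const lim)
  qed (use WgradD(2)[OF W] 2 in auto)
  show ?thesis
    unfolding chain_rule_for_def
    by (rule LIMSEQ_unique[OF l1[unfolded ch[unfolded chain_rule_for_def]] tendsto_minus[OF l2]])
qed

lemma chain_continuous:
  assumes W: "Wgrad f v" and p: "\<phi> \<in> test_functions UNIV" and g: "bounded_Borel g C" "continuous_on UNIV g"
  shows "chain_rule_for f v \<phi> g"
  unfolding chain_rule_for_def
  by (rule chain_rule_C1[OF W p prim_derivative[OF g] g(2) bounded_BorelD(2)[OF g(1)]])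

lemma bounded_Borel_indicator: "A \<in> sets borel \<Longrightarrow> bounded_Borel (indicator A) 1"
  by (auto simp: bounded_Borel_def indicator_def)

lemma chain_indicator:
  assumes W: "Wgrad f v" and p: "\<phi> \<in> test_functions UNIV" and A: "A \<in> sets borel"
  shows "chain_rule_for f v \<phi> (indicator A)"
proof -
  let ?G = "range (\<lambda>a::real. {a<..})"
  have sb: "sets (borel :: real measure) = sigma_sets UNIV ?G"
    by (subst borel_Ioi) (simp add: sets_measure_of)
  have "Int_stable ?G"
    unfolding Int_stable_def
  proof safe
    fix a b :: real
    have "{a<..} \<inter> {b<..} = {max a b<..}" by auto
    then show "{a<..} \<inter> {b<..} \<in> ?G" by simp
  qed
  moreover have "?G \<subseteq> Pow UNIV" by simp
  moreover have "A \<in> sigma_sets UNIV ?G" using A sb by simp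
  ultimately show ?thesis
  proof (induction A rule: sigma_sets_induct_disjoint)
    case (basic A)
    then obtain a where A: "A = {a<..}" by auto
    define g where "g n t = min 1 (max 0 (real n * (t - a)))" for n t
    show ?case unfolding A
    proof (rule chain_limit[OF W p, of g 1])
      have gc: "continuous_on UNIV (g n)" for n
        unfolding g_def[abs_def] by (intro continuous_intros)
      show b: "bounded_Borel (g n) 1" for n
        using borel_measurable_continuous_onI[OF gc] by (auto simp: bounded_Borel_def g_def)
      show "chain_rule_for f v \<phi> (g n)" for n by (rule chain_continuous[OF W p b gc])
      show "(\<lambda>n. g n t) \<longlonglongrightarrow> indicator {a<..} t" for t
      proof (cases "t > a")
        case True
        obtain N where N: "1 < real N * (t - a)" using reals_Archimedean3[of "t - a"] True by auto
        have "1 = g n t" if "n \<ge> N" for n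
        proof -
          have "real N * (t - a) \<le> real n * (t - a)" using that True by (intro mult_right_mono) auto
          then show ?thesis using N by (simp add: g_def)
        qed
        then have "\<forall>\<^sub>F n in sequentially. 1 = g n t" unfolding eventually_sequentially by blast
        then show ?thesis using True by (simp add: Lim_transform_eventually[OF tendsto_const])
      next
        case False
        then have "real n * (t - a) \<le> 0" for n by (simp add: mult_nonneg_nonpos)
        then have "g n t = 0" for n by (simp add: g_def max_absorb1)
        then show ?thesis using False by simp
      qed
    qed
  next
    case empty
    have "bounded_Borel (\<lambda>t. 0) 0" by (simp add: bounded_Borel_def)
    from chain_continuous[OF W p this] show ?case by simp
  next
    case (compl A)
    have A: "A \<in> sets borel" using compl(1) sb by simp
    have b1: "bounded_Borel (\<lambda>t. 1) 1" by (simp add: bounded_Borel_def)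
    have "chain_rule_for f v \<phi> (\<lambda>t. 1 * 1 + (-1) * indicator A t)"
      by (rule chain_lin[OF W p b1 bounded_Borel_indicator[OF A] chain_continuous[OF W p b1] compl(2)]) simp
    moreover have "(\<lambda>t. 1 * 1 + (-1) * indicator A t) = (indicator (UNIV - A) :: real \<Rightarrow> real)"
      by (auto simp: indicator_def)
    ultimately show ?case by simp
  next
    case (union A)
    have A: "A i \<in> sets borel" for i using union(2) sb by auto
    have part: "chain_rule_for f v \<phi> (indicator (\<Union>i<n. A i))" for n
    proof (induction n)
      case 0
      have "bounded_Borel (\<lambda>t. 0) 0" by (simp add: bounded_Borel_def)
      from chain_continuous[OF W p this] show ?case by simp
    next
      case (Suc n)
      have "(\<Union>i<n. A i) \<in> sets borel" using A by auto
      from chain_lin[OF W p bounded_Borel_indicator[OF this] bounded_Borel_indicator[OF A[of n]] Suc union(3), of 1 1]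
      have "chain_rule_for f v \<phi> (\<lambda>t. 1 * indicator (\<Union>i<n. A i) t + 1 * indicator (A n) t)" .
      moreover have "(\<lambda>t. 1 * indicator (\<Union>i<n. A i) t + 1 * indicator (A n) t) = (indicator (\<Union>i<Suc n. A i) :: real \<Rightarrow> real)"
      proof
        fix t
        have "\<not> (t \<in> A n \<and> t \<in> (\<Union>i<n. A i))"
        proof safe
          fix i assume i: "t \<in> A n" "i < n" "t \<in> A i"
          from i(2) have "i \<noteq> n" by simp
          then have "A i \<inter> A n = {}" by (rule disjoint_family_onD[OF union(1) UNIV_I UNIV_I])
          with i(1,3) show False by (metis IntI empty_iff)
        qed
        moreover have "t \<in> (\<Union>i<Suc n. A i) \<longleftrightarrow> t \<in> (\<Union>i<n. A i) \<or> t \<in> A n"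
          by (auto simp: less_Suc_eq)
        ultimately show "1 * indicator (\<Union>i<n. A i) t + 1 * indicator (A n) t = (indicator (\<Union>i<Suc n. A i) t :: real)"
          unfolding indicator_def by (cases "t \<in> A n"; cases "t \<in> (\<Union>i<n. A i)") simp_all
      qed
      ultimately show ?case by simp
    qed
    show ?case
    proof (rule chain_limit[OF W p, of "\<lambda>n. indicator (\<Union>i<n. A i)" 1])
      show "bounded_Borel (indicator (\<Union>i<n. A i)) 1" for n
        by (rule bounded_Borel_indicator) (use A in auto)
      show "(\<lambda>n. indicator (\<Union>i<n. A i) t) \<longlonglongrightarrow> indicat_real (\<Union> (range A)) t" for t
        by (rule LIMSEQ_indicator_UN)
    qed (rule part)
  qed
qed

lemma chain_bounded_Borel:
  assumes W: "Wgrad f v" and p: "\<phi> \<in> test_functions UNIV" and g: "bounded_Borel g C"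
  shows "chain_rule_for f v \<phi> g"
proof -
  have "\<exists>F. (\<forall>i. simple_function borel (F i)) \<and> (\<forall>x\<in>space borel. (\<lambda>i. F i x) \<longlonglongrightarrow> g x) \<and>
      (\<forall>i. \<forall>x\<in>space borel. dist (F i x) 0 \<le> 2 * dist (g x) 0)"
    by (rule borel_measurable_implies_sequence_metric[OF bounded_BorelD(1)[OF g]])
  then obtain F where F: "\<And>i. simple_function borel (F i)" "\<And>x. (\<lambda>i. F i x) \<longlonglongrightarrow> g x" "\<And>i x. \<bar>F i x\<bar> \<le> 2 * \<bar>g x\<bar>"
    by auto
  have Fb: "bounded_Borel (F i) (2 * C)" for i
  proof -
    have "\<bar>F i t\<bar> \<le> 2 * C" for t using F(3)[of i t] bounded_BorelD(2)[OF g, of t] by linarith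
    then show ?thesis
      using borel_measurable_simple_function[OF F(1)[of i]] by (simp add: bounded_Borel_def)
  qed
  have "chain_rule_for f v \<phi> (F i)" for i
  proof -
    have meas: "F i -` {y} \<in> sets borel" for y
      using simple_functionD(2)[OF F(1)[of i]] by simp
    have "finite Y \<Longrightarrow> chain_rule_for f v \<phi> (\<lambda>t. \<Sum>y\<in>Y. y * indicator (F i -` {y}) t) \<and>
        (\<exists>D. bounded_Borel (\<lambda>t. \<Sum>y\<in>Y. y * indicator (F i -` {y}) t) D)" for Y :: "real set"
    proof (induction Y rule: finite_induct)
      case empty
      have "bounded_Borel (\<lambda>t. 0) 0" by (simp add: bounded_Borel_def)
      with chain_continuous[OF W p this] show ?case by auto
    next
      case (insert y Y)
      then obtain D where D: "bounded_Borel (\<lambda>t. \<Sum>y\<in>Y. y * indicator (F i -` {y}) t) D"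
        and c: "chain_rule_for f v \<phi> (\<lambda>t. \<Sum>y\<in>Y. y * indicator (F i -` {y}) t)" by blast
      have eq: "(\<lambda>t. \<Sum>y\<in>insert y Y. y * indicator (F i -` {y}) t)
          = (\<lambda>t. y * indicator (F i -` {y}) t + 1 * (\<Sum>y\<in>Y. y * indicator (F i -` {y}) t))"
        by (rule ext) (simp only: sum.insert[OF insert(1,2)] mult_1)
      show ?case unfolding eq
        using chain_lin[OF W p bounded_Borel_indicator[OF meas] D chain_indicator[OF W p meas] c, of y y 1]
          bounded_Borel_lin[OF bounded_Borel_indicator[OF meas] D, of y y 1] by blast
    qed
    moreover have "finite (range (F i))" using simple_functionD(1)[OF F(1)[of i]] by simp
    moreover have "(\<lambda>t. \<Sum>y\<in>range (F i). y * indicator (F i -` {y}) t) = F i"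
    proof
      fix t
      have "(\<Sum>y\<in>range (F i). y * indicator (F i -` {y}) t) = (\<Sum>y\<in>range (F i). if y = F i t then y else 0)"
        by (rule sum.cong) (auto simp: indicator_def)
      also have "\<dots> = F i t" using \<open>finite (range (F i))\<close> by (subst sum.delta) auto
      finally show "(\<Sum>y\<in>range (F i). y * indicator (F i -` {y}) t) = F i t" .
    qed
    ultimately show ?thesis by metis
  qed
  from chain_limit[OF W p Fb this F(2)] show ?thesis .
qed

section \<open>Local weak gradients\<close>

text \<open>Weak gradients are defined through Lebesgue measurable functions, whereas translations and Fubini's theorem
  are applied to Borel functions; the two are exchanged almost everywhere.\<close>

lemma lebesgue_Borel_representative:
  fixes h :: "'a::euclidean_space \<Rightarrow> 'b::euclidean_space"
  assumes "h \<in> borel_measurable lebesgue"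
  obtains h' where "h' \<in> borel_measurable borel" "AE x in lborel. h x = h' x"
proof -
  have "\<exists>g. g \<in> borel_measurable lborel \<and> (AE x in lborel. h x \<bullet> b = g x)" for b
    using completion_ex_borel_measurable_real[of "\<lambda>x. h x \<bullet> b" lborel] assms by auto
  then obtain g where g: "\<And>b. g b \<in> borel_measurable lborel" "\<And>b. AE x in lborel. h x \<bullet> b = g b x"
    by metis
  note [measurable] = g(1)
  show ?thesis
  proof (rule that)
    have "(\<lambda>x. \<Sum>b\<in>Basis. g b x *\<^sub>R b) \<in> borel_measurable lborel" by measurable
    then show "(\<lambda>x. \<Sum>b\<in>Basis. g b x *\<^sub>R b) \<in> borel_measurable borel" by simp
    have "AE x in lborel. \<forall>b\<in>Basis. h x \<bullet> b = g b x"
      by (rule AE_finite_allI) (auto intro: g)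
    then show "AE x in lborel. h x = (\<Sum>b\<in>Basis. g b x *\<^sub>R b)"
    proof eventually_elim
      case (elim x)
      have "h x = (\<Sum>b\<in>Basis. (h x \<bullet> b) *\<^sub>R b)" by (rule euclidean_representation[symmetric])
      also have "\<dots> = (\<Sum>b\<in>Basis. g b x *\<^sub>R b)" by (rule sum.cong) (use elim in auto)
      finally show ?case .
    qed
  qed
qed

lemma Borel_lebesgue: "f \<in> borel_measurable borel \<Longrightarrow> f \<in> borel_measurable lebesgue"
  by (simp add: measurable_completion)

lemma integral_representative:
  fixes h :: "'a::euclidean_space \<Rightarrow> 'b::euclidean_space"
  assumes "h \<in> borel_measurable lebesgue" "h' \<in> borel_measurable borel" "AE x in lborel. h x = h' x"
  shows "(\<integral>x. h x \<partial>lebesgue) = (LBINT x. h' x)" "integrable lebesgue h \<longleftrightarrow> integrable lborel h'"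
proof -
  have ae: "AE x in lebesgue. h x = h' x" using assms(3) by (simp add: AE_completion_iff)
  have "(\<integral>x. h x \<partial>lebesgue) = (\<integral>x. h' x \<partial>lebesgue)"
    by (rule integral_cong_AE[OF assms(1) Borel_lebesgue[OF assms(2)] ae])
  then show "(\<integral>x. h x \<partial>lebesgue) = (LBINT x. h' x)"
    using assms(2) by (simp add: integral_completion)
  have "integrable lebesgue h \<longleftrightarrow> integrable lebesgue h'"
    by (rule integrable_cong_AE[OF assms(1) Borel_lebesgue[OF assms(2)] ae])
  then show "integrable lebesgue h \<longleftrightarrow> integrable lborel h'"
    using assms(2) by (simp add: integrable_completion)
qed

lemma Lp_loc_measurable: "f \<in> Lp_loc m U \<Longrightarrow> (\<lambda>x. indicator U x *\<^sub>R f x) \<in> borel_measurable lebesgue"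
  by (simp add: Lp_loc_def set_borel_measurable_def)

lemma Lp_loc_1_integrable:
  fixes f :: "'a::euclidean_space \<Rightarrow> 'b::euclidean_space"
  assumes f: "f \<in> Lp_loc 1 U" and K: "compact K" "K \<subseteq> U"
  shows "integrable lebesgue (\<lambda>x. indicator K x *\<^sub>R f x)"
proof -
  have Ks: "K \<in> sets lebesgue" using K(1) by (simp add: borel_compact sets_completionI_sets)
  have n: "integrable lebesgue (\<lambda>x. indicator K x *\<^sub>R (norm (f x) powr 1))"
    using f K by (simp add: Lp_loc_def set_integrable_def)
  have "(\<lambda>x. indicator K x *\<^sub>R (indicator U x *\<^sub>R f x)) \<in> borel_measurable lebesgue"
    using Ks by (intro borel_measurable_scaleR borel_measurable_indicator Lp_loc_measurable[OF f])
  also have "(\<lambda>x. indicator K x *\<^sub>R (indicator U x *\<^sub>R f x)) = (\<lambda>x. indicator K x *\<^sub>R f x)"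
    using K(2) by (auto simp: indicator_def fun_eq_iff)
  finally show ?thesis
    by (rule Bochner_Integration.integrable_bound[OF n]) (auto simp: indicator_def)
qed

lemma Lp_loc_1I:
  fixes f :: "'a::euclidean_space \<Rightarrow> 'b::euclidean_space"
  assumes "(\<lambda>x. indicator U x *\<^sub>R f x) \<in> borel_measurable lebesgue"
    and "\<And>K. compact K \<Longrightarrow> K \<subseteq> U \<Longrightarrow> integrable lebesgue (\<lambda>x. indicator K x *\<^sub>R f x)"
  shows "f \<in> Lp_loc 1 U"
  unfolding Lp_loc_def set_borel_measurable_def set_integrable_def
proof (safe intro!: assms(1))
  fix K assume "compact K" "K \<subseteq> U"
  from integrable_norm[OF assms(2)[OF this]]
  show "integrable lebesgue (\<lambda>x. indicat_real K x *\<^sub>R norm (f x) powr 1)"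
    by (rule Bochner_Integration.integrable_cong[THEN iffD1, rotated -1]) (auto simp: indicator_def)
qed

lemma Lp_loc_1_mult_integrable:
  fixes f :: "'a::euclidean_space \<Rightarrow> 'b::euclidean_space" and \<eta> :: "'a \<Rightarrow> real"
  assumes f: "f \<in> Lp_loc 1 U" and \<eta>: "\<eta> \<in> test_functions U"
  shows "integrable lebesgue (\<lambda>x. indicator U x *\<^sub>R (\<eta> x *\<^sub>R f x))"
proof -
  obtain K where K: "compact K" "K \<subseteq> U" "\<And>x. x \<notin> K \<Longrightarrow> \<eta> x = 0"
    using \<eta> by (rule test_functionsE) blast
  obtain B where B: "B > 0" "\<And>x. \<bar>\<eta> x\<bar> \<le> B" "\<And>x. norm (grad \<eta> x) \<le> B"
    using test_bounded[OF \<eta>] by blast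
  show ?thesis
  proof (rule Bochner_Integration.integrable_bound)
    show "integrable lebesgue (\<lambda>x. B * norm (indicator K x *\<^sub>R f x))"
      by (intro integrable_mult_right integrable_norm Lp_loc_1_integrable[OF f K(1,2)])
    have "(\<lambda>x. \<eta> x *\<^sub>R (indicator U x *\<^sub>R f x)) \<in> borel_measurable lebesgue"
      by (intro borel_measurable_scaleR Borel_lebesgue[OF test_borel(1)[OF \<eta>]] Lp_loc_measurable[OF f])
    then show "(\<lambda>x. indicator U x *\<^sub>R (\<eta> x *\<^sub>R f x)) \<in> borel_measurable lebesgue"
      by (simp add: mult.commute)
    show "AE x in lebesgue. norm (indicator U x *\<^sub>R (\<eta> x *\<^sub>R f x)) \<le> norm (B * norm (indicator K x *\<^sub>R f x))"
      using B K by (intro AE_I2) (auto simp: indicator_def abs_mult intro!: mult_right_mono)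
  qed
qed

text \<open>Since the identity of a weak gradient is tested componentwise, vector valued fields can be
  paired with components of test functions.\<close>

lemma Lp_loc_1_grad_integrable:
  fixes f :: "'a::euclidean_space \<Rightarrow> real"
  assumes f: "f \<in> Lp_loc 1 U" and \<eta>: "\<eta> \<in> test_functions U"
  shows "integrable lebesgue (\<lambda>x. indicator U x *\<^sub>R (f x *\<^sub>R grad \<eta> x))"
proof -
  have "integrable lebesgue (\<lambda>x. \<Sum>b\<in>Basis. (indicator U x *\<^sub>R ((grad \<eta> x \<bullet> b) *\<^sub>R f x)) *\<^sub>R b)"
    by (intro Bochner_Integration.integrable_sum integrable_scaleR_left Lp_loc_1_mult_integrable[OF f test_grad_inner[OF \<eta>]])
  also have "(\<lambda>x. \<Sum>b\<in>Basis. (indicator U x *\<^sub>R ((grad \<eta> x \<bullet> b) *\<^sub>R f x)) *\<^sub>R b)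
      = (\<lambda>x. indicator U x *\<^sub>R (f x *\<^sub>R grad \<eta> x))"
  proof
    fix x
    have "(\<Sum>b\<in>Basis. (indicator U x *\<^sub>R ((grad \<eta> x \<bullet> b) *\<^sub>R f x)) *\<^sub>R b)
        = (indicator U x * f x) *\<^sub>R (\<Sum>b\<in>Basis. (grad \<eta> x \<bullet> b) *\<^sub>R b)"
      by (simp add: scaleR_sum_right mult_ac)
    then show "(\<Sum>b\<in>Basis. (indicator U x *\<^sub>R ((grad \<eta> x \<bullet> b) *\<^sub>R f x)) *\<^sub>R b) = indicator U x *\<^sub>R (f x *\<^sub>R grad \<eta> x)"
      by (simp add: euclidean_representation)
  qed
  finally show ?thesis .
qed

text \<open>Multiplication by a cutoff function turns a local weak gradient into one on the whole space, to
  which mollification applies.\<close>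

lemma local_to_global:
  fixes f :: "'a::euclidean_space \<Rightarrow> real"
  assumes f: "has_weak_gradient U f v" and \<eta>: "\<eta> \<in> test_functions U"
  obtains f' v' where "Wgrad f' v'" "AE x in lborel. f' x = indicator U x * (\<eta> x * f x)"
    "AE x in lborel. v' x = indicator U x *\<^sub>R (\<eta> x *\<^sub>R v x + f x *\<^sub>R grad \<eta> x)"
proof -
  have fL: "f \<in> Lp_loc 1 U" and vL: "v \<in> Lp_loc 1 U" using f by (auto simp: has_weak_gradient_def)
  define F where "F x = indicator U x *\<^sub>R (\<eta> x *\<^sub>R f x)" for x
  define G where "G x = indicator U x *\<^sub>R (\<eta> x *\<^sub>R v x)" for x
  define H where "H x = indicator U x *\<^sub>R (f x *\<^sub>R grad \<eta> x)" for x
  have F: "integrable lebesgue F" unfolding F_def[abs_def] by (rule Lp_loc_1_mult_integrable[OF fL \<eta>])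
  have G: "integrable lebesgue G" unfolding G_def[abs_def] by (rule Lp_loc_1_mult_integrable[OF vL \<eta>])
  have H: "integrable lebesgue H" unfolding H_def[abs_def] by (rule Lp_loc_1_grad_integrable[OF fL \<eta>])
  obtain f' where f': "f' \<in> borel_measurable borel" "AE x in lborel. F x = f' x"
    using lebesgue_Borel_representative[OF borel_measurable_integrable[OF F]] by blast
  have GH: "integrable lebesgue (\<lambda>x. G x + H x)" using G H by simp
  obtain v' where v': "v' \<in> borel_measurable borel" "AE x in lborel. G x + H x = v' x"
    using lebesgue_Borel_representative[OF borel_measurable_integrable[OF GH]] by blast
  have "Wgrad f' v'"
    unfolding Wgrad_def
  proof (intro conjI ballI)
    show "integrable lborel f'"
      using integral_representative(2)[OF borel_measurable_integrable[OF F] f'] F by simp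
    show "integrable lborel v'"
      using integral_representative(2)[OF borel_measurable_integrable[OF GH] v'] GH by simp
    fix \<phi> :: "'a \<Rightarrow> real" assume \<phi>: "\<phi> \<in> test_functions UNIV"
    have \<phi>\<eta>: "(\<lambda>x. \<phi> x * \<eta> x) \<in> test_functions U" by (rule test_mult[OF \<eta> test_smooth[OF \<phi>]])
    have gr: "grad (\<lambda>x. \<phi> x * \<eta> x) x = \<phi> x *\<^sub>R grad \<eta> x + \<eta> x *\<^sub>R grad \<phi> x" for x
      by (rule grad_mult[OF smooth_differentiable[OF test_smooth[OF \<phi>]] smooth_differentiable[OF test_smooth[OF \<eta>]]])
    have id: "(\<integral>x. indicator U x *\<^sub>R (f x *\<^sub>R grad (\<lambda>x. \<phi> x * \<eta> x) x) \<partial>lebesgue)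
        = - (\<integral>x. indicator U x *\<^sub>R ((\<phi> x * \<eta> x) *\<^sub>R v x) \<partial>lebesgue)"
      using f \<phi>\<eta> by (auto simp: has_weak_gradient_def set_lebesgue_integral_def)
    obtain B where B: "B > 0" "\<And>x. \<bar>\<phi> x\<bar> \<le> B" "\<And>x. norm (grad \<phi> x) \<le> B"
      using test_bounded[OF \<phi>] by blast
    note pm = Borel_lebesgue[OF test_borel(1)[OF \<phi>]] Borel_lebesgue[OF test_borel(2)[OF \<phi>]]
    have m1: "(\<lambda>x. F x *\<^sub>R grad \<phi> x) \<in> borel_measurable lebesgue"
      by (intro borel_measurable_scaleR pm borel_measurable_integrable[OF F])
    have m2: "(\<lambda>x. \<phi> x *\<^sub>R G x) \<in> borel_measurable lebesgue"
      by (intro borel_measurable_scaleR pm borel_measurable_integrable[OF G])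
    have m3: "(\<lambda>x. \<phi> x *\<^sub>R H x) \<in> borel_measurable lebesgue"
      by (intro borel_measurable_scaleR pm borel_measurable_integrable[OF H])
    have i1: "integrable lebesgue (\<lambda>x. F x *\<^sub>R grad \<phi> x)"
      by (rule Bochner_Integration.integrable_bound[OF integrable_mult_right[OF integrable_norm[OF F], of B] m1])
        (use B in \<open>auto simp: abs_mult mult.commute[of B] intro!: AE_I2 mult_left_mono\<close>)
    have i2: "integrable lebesgue (\<lambda>x. \<phi> x *\<^sub>R G x)"
      by (rule Bochner_Integration.integrable_bound[OF integrable_mult_right[OF integrable_norm[OF G], of B] m2])
        (use B in \<open>auto simp: abs_mult intro!: AE_I2 mult_right_mono\<close>)
    have i3: "integrable lebesgue (\<lambda>x. \<phi> x *\<^sub>R H x)"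
      by (rule Bochner_Integration.integrable_bound[OF integrable_mult_right[OF integrable_norm[OF H], of B] m3])
        (use B in \<open>auto simp: abs_mult intro!: AE_I2 mult_right_mono\<close>)
    have "(\<integral>x. F x *\<^sub>R grad \<phi> x \<partial>lebesgue) + (\<integral>x. \<phi> x *\<^sub>R H x \<partial>lebesgue)
        = (\<integral>x. F x *\<^sub>R grad \<phi> x + \<phi> x *\<^sub>R H x \<partial>lebesgue)" using i1 i3 by simp
    also have "\<dots> = (\<integral>x. indicator U x *\<^sub>R (f x *\<^sub>R grad (\<lambda>x. \<phi> x * \<eta> x) x) \<partial>lebesgue)"
      unfolding F_def H_def gr by (rule Bochner_Integration.integral_cong) (simp_all add: algebra_simps)
    also have "\<dots> = - (\<integral>x. \<phi> x *\<^sub>R G x \<partial>lebesgue)"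
      unfolding id by (simp add: G_def mult_ac)
    finally have "(\<integral>x. F x *\<^sub>R grad \<phi> x \<partial>lebesgue) = - ((\<integral>x. \<phi> x *\<^sub>R G x \<partial>lebesgue) + (\<integral>x. \<phi> x *\<^sub>R H x \<partial>lebesgue))"
      by (simp add: algebra_simps)
    also have "\<dots> = - (\<integral>x. \<phi> x *\<^sub>R (G x + H x) \<partial>lebesgue)"
      using i2 i3 by (simp add: scaleR_add_right)
    also have "(\<integral>x. \<phi> x *\<^sub>R (G x + H x) \<partial>lebesgue) = (LBINT x. \<phi> x *\<^sub>R v' x)"
    proof (rule integral_representative(1))
      show "(\<lambda>x. \<phi> x *\<^sub>R (G x + H x)) \<in> borel_measurable lebesgue"
        by (intro borel_measurable_scaleR pm borel_measurable_integrable[OF GH])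
      show "(\<lambda>x. \<phi> x *\<^sub>R v' x) \<in> borel_measurable borel"
        by (intro borel_measurable_scaleR test_borel[OF \<phi>] v'(1))
      show "AE x in lborel. \<phi> x *\<^sub>R (G x + H x) = \<phi> x *\<^sub>R v' x" using v'(2) by eventually_elim simp
    qed
    also have "(\<integral>x. F x *\<^sub>R grad \<phi> x \<partial>lebesgue) = (LBINT x. f' x *\<^sub>R grad \<phi> x)"
    proof (rule integral_representative(1)[OF m1])
      show "(\<lambda>x. f' x *\<^sub>R grad \<phi> x) \<in> borel_measurable borel"
        by (intro borel_measurable_scaleR test_borel[OF \<phi>] f'(1))
      show "AE x in lborel. F x *\<^sub>R grad \<phi> x = f' x *\<^sub>R grad \<phi> x" using f'(2) by eventually_elim simp
    qed
    finally show "(LBINT x. f' x *\<^sub>R grad \<phi> x) = - (LBINT x. \<phi> x *\<^sub>R v' x)" .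
  qed
  moreover have "AE x in lborel. f' x = indicator U x * (\<eta> x * f x)"
    using f'(2) by eventually_elim (simp add: F_def)
  moreover have "AE x in lborel. v' x = indicator U x *\<^sub>R (\<eta> x *\<^sub>R v x + f x *\<^sub>R grad \<eta> x)"
    using v'(2) by eventually_elim (simp add: G_def H_def scaleR_add_right)
  ultimately show ?thesis by (rule that)
qed

lemma conv_moll_zero_imp_AE_zero:
  fixes f :: "'a::euclidean_space \<Rightarrow> 'b::euclidean_space"
  assumes f: "integrable lborel f" and z: "\<And>n x. conv f (moll n) x = 0"
  shows "AE x in lborel. f x = 0"
proof -
  have "(\<lambda>n::nat. LBINT x. norm (f x)) \<longlonglongrightarrow> 0"
    using conv_moll_tendsto_L1[OF f] by (simp add: z)
  then have "(LBINT x. norm (f x)) = 0" using LIMSEQ_unique tendsto_const by blast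
  then show ?thesis using integral_nonneg_eq_0_iff_AE[OF integrable_norm[OF f]] by simp
qed

lemma AE_all_compact:
  fixes U :: "'a::euclidean_space set"
  assumes U: "open U" and K: "\<And>K. compact K \<Longrightarrow> K \<subseteq> U \<Longrightarrow> AE x in lebesgue. x \<in> K \<longrightarrow> P x"
  shows "AE x in lebesgue. x \<in> U \<longrightarrow> P x"
proof -
  obtain C where C: "\<And>n. compact (C n)" "\<And>n. C n \<subseteq> U" "\<And>n. C n \<subseteq> interior (C (Suc n))"
    "\<Union> (range C) = U" "\<And>K. compact K \<Longrightarrow> K \<subseteq> U \<Longrightarrow> \<exists>N. \<forall>n\<ge>N. K \<subseteq> C n"
    using open_Union_compact_subsets[OF U] by blast
  have "AE x in lebesgue. \<forall>n::nat. x \<in> C n \<longrightarrow> P x"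
    unfolding AE_all_countable using K C(1,2) by blast
  then show ?thesis by eventually_elim (use C(4) in blast)
qed

text \<open>The fundamental lemma of the calculus of variations: the value at \<open>x\<close> of a mollification of \<open>\<eta> f\<close> is the
  integral of \<open>f\<close> against the test function \<open>\<lambda>y. moll n (x - y) * \<eta> y\<close>.\<close>

lemma AE_zero_if_test_zero:
  fixes f :: "'a::euclidean_space \<Rightarrow> 'b::euclidean_space"
  assumes U: "open U" and f: "f \<in> Lp_loc 1 U"
    and z: "\<And>\<phi>. \<phi> \<in> test_functions U \<Longrightarrow> (LINT x:U|lebesgue. \<phi> x *\<^sub>R f x) = 0"
  shows "AE x in lebesgue. x \<in> U \<longrightarrow> f x = 0"
proof (rule AE_all_compact[OF U])
  fix K assume K: "compact K" "K \<subseteq> U"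
  obtain \<eta> V where \<eta>: "\<eta> \<in> test_functions U" "\<And>x. 0 \<le> \<eta> x" "\<And>x. \<eta> x \<le> 1"
    "open V" "K \<subseteq> V" "V \<subseteq> U" "\<And>x. x \<in> V \<Longrightarrow> \<eta> x = 1" "\<And>x. x \<in> V \<Longrightarrow> grad \<eta> x = 0"
    using cutoff_compact[OF K(1) U K(2)] by blast
  define F where "F x = indicator U x *\<^sub>R (\<eta> x *\<^sub>R f x)" for x
  have F: "integrable lebesgue F" unfolding F_def[abs_def] by (rule Lp_loc_1_mult_integrable[OF f \<eta>(1)])
  obtain f' where f': "f' \<in> borel_measurable borel" "AE x in lborel. F x = f' x"
    using lebesgue_Borel_representative[OF borel_measurable_integrable[OF F]] by blast
  have fi: "integrable lborel f'"
    using integral_representative(2)[OF borel_measurable_integrable[OF F] f'] F by simp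
  have "conv f' (moll n) x = 0" for n x
  proof -
    have t: "(\<lambda>y. moll n (x - y)) \<in> test_functions UNIV"
      using test_affine[OF moll_test, of "-1" n x] by simp
    have "conv f' (moll n) x = (\<integral>y. moll n (x - y) *\<^sub>R F y \<partial>lebesgue)"
      unfolding conv_def
    proof (rule integral_representative(1)[symmetric])
      show "(\<lambda>y. moll n (x - y) *\<^sub>R F y) \<in> borel_measurable lebesgue"
        by (intro borel_measurable_scaleR Borel_lebesgue[OF test_borel(1)[OF t]] borel_measurable_integrable[OF F])
      show "(\<lambda>y. moll n (x - y) *\<^sub>R f' y) \<in> borel_measurable borel"
        by (intro borel_measurable_scaleR test_borel(1)[OF t] f'(1))
      show "AE y in lborel. moll n (x - y) *\<^sub>R F y = moll n (x - y) *\<^sub>R f' y"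
        using f'(2) by eventually_elim simp
    qed
    also have "\<dots> = (LINT y:U|lebesgue. (moll n (x - y) * \<eta> y) *\<^sub>R f y)"
      unfolding set_lebesgue_integral_def F_def by (simp add: mult_ac)
    also have "\<dots> = 0" by (rule z[OF test_mult[OF \<eta>(1) test_smooth[OF t]]])
    finally show ?thesis .
  qed
  from conv_moll_zero_imp_AE_zero[OF fi this] have "AE x in lborel. f' x = 0" .
  with f'(2) have "AE x in lborel. x \<in> K \<longrightarrow> f x = 0"
  proof eventually_elim
    case (elim x)
    show ?case
    proof
      assume "x \<in> K"
      then have "x \<in> U" "\<eta> x = 1" using \<eta> K by auto
      then show "f x = 0" using elim by (simp add: F_def)
    qed
  qed
  then show "AE x in lebesgue. x \<in> K \<longrightarrow> f x = 0" by (simp add: AE_completion_iff)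
qed

lemma Lp_loc_1_lin:
  fixes f g :: "'a::euclidean_space \<Rightarrow> 'b::euclidean_space"
  assumes "f \<in> Lp_loc 1 U" "g \<in> Lp_loc 1 U"
  shows "(\<lambda>x. f x - g x) \<in> Lp_loc 1 U"
proof (rule Lp_loc_1I)
  show "(\<lambda>x. indicator U x *\<^sub>R (f x - g x)) \<in> borel_measurable lebesgue"
    unfolding scaleR_diff_right
    by (rule borel_measurable_diff[OF Lp_loc_measurable[OF assms(1)] Lp_loc_measurable[OF assms(2)]])
  show "integrable lebesgue (\<lambda>x. indicator K x *\<^sub>R (f x - g x))" if "compact K" "K \<subseteq> U" for K
    unfolding scaleR_diff_right
    by (intro Bochner_Integration.integrable_diff Lp_loc_1_integrable[OF _ that] assms)
qed

lemma weak_gradient_diff: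
  assumes f: "has_weak_gradient U f v" and g: "has_weak_gradient U g w"
  shows "has_weak_gradient U (\<lambda>x. f x - g x) (\<lambda>x. v x - w x)"
  unfolding has_weak_gradient_def
proof (intro conjI ballI)
  have L: "f \<in> Lp_loc 1 U" "g \<in> Lp_loc 1 U" "v \<in> Lp_loc 1 U" "w \<in> Lp_loc 1 U"
    using f g by (auto simp: has_weak_gradient_def)
  show "(\<lambda>x. f x - g x) \<in> Lp_loc 1 U" "(\<lambda>x. v x - w x) \<in> Lp_loc 1 U"
    by (intro Lp_loc_1_lin L)+
  fix \<phi> assume \<phi>: "\<phi> \<in> test_functions U"
  have "(LINT x:U|lebesgue. (f x - g x) *\<^sub>R grad \<phi> x)
    = (LINT x:U|lebesgue. f x *\<^sub>R grad \<phi> x) - (LINT x:U|lebesgue. g x *\<^sub>R grad \<phi> x)"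
    unfolding set_lebesgue_integral_def scaleR_diff_left scaleR_diff_right
    by (rule Bochner_Integration.integral_diff) (rule Lp_loc_1_grad_integrable[OF L(1) \<phi>] Lp_loc_1_grad_integrable[OF L(2) \<phi>])+
  moreover have "(LINT x:U|lebesgue. \<phi> x *\<^sub>R (v x - w x))
    = (LINT x:U|lebesgue. \<phi> x *\<^sub>R v x) - (LINT x:U|lebesgue. \<phi> x *\<^sub>R w x)"
    unfolding set_lebesgue_integral_def scaleR_diff_right
    by (rule Bochner_Integration.integral_diff) (rule Lp_loc_1_mult_integrable[OF L(3) \<phi>] Lp_loc_1_mult_integrable[OF L(4) \<phi>])+
  ultimately show "(LINT x:U|lebesgue. (f x - g x) *\<^sub>R grad \<phi> x) = - (LINT x:U|lebesgue. \<phi> x *\<^sub>R (v x - w x))"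
    using f g \<phi> by (simp add: has_weak_gradient_def)
qed

text \<open>The difference of two weak gradients annihilates all test functions.\<close>

lemma weak_gradient_unique:
  assumes U: "open U" and f: "has_weak_gradient U f v" "has_weak_gradient U f w"
  shows "AE x in lebesgue. x \<in> U \<longrightarrow> v x = w x"
proof -
  have L: "v \<in> Lp_loc 1 U" "w \<in> Lp_loc 1 U"
    using f by (auto simp: has_weak_gradient_def)
  have "AE x in lebesgue. x \<in> U \<longrightarrow> v x - w x = 0"
  proof (rule AE_zero_if_test_zero[OF U Lp_loc_1_lin[OF L]])
    fix \<phi> assume \<phi>: "\<phi> \<in> test_functions U"
    have "(LINT x:U|lebesgue. \<phi> x *\<^sub>R (v x - w x))
      = (LINT x:U|lebesgue. \<phi> x *\<^sub>R v x) - (LINT x:U|lebesgue. \<phi> x *\<^sub>R w x)"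
      unfolding set_lebesgue_integral_def scaleR_diff_right
      by (rule Bochner_Integration.integral_diff) (rule Lp_loc_1_mult_integrable[OF L(1) \<phi>] Lp_loc_1_mult_integrable[OF L(2) \<phi>])+
    moreover have "(LINT x:U|lebesgue. f x *\<^sub>R grad \<phi> x) = - (LINT x:U|lebesgue. \<phi> x *\<^sub>R v x)"
      "(LINT x:U|lebesgue. f x *\<^sub>R grad \<phi> x) = - (LINT x:U|lebesgue. \<phi> x *\<^sub>R w x)"
      using f \<phi> by (simp_all add: has_weak_gradient_def)
    ultimately show "(LINT x:U|lebesgue. \<phi> x *\<^sub>R (v x - w x)) = 0" by simp
  qed
  then show ?thesis by simp
qed

lemma weak_gradient_const:
  fixes U :: "'a::euclidean_space set"
  assumes U: "open U"
  shows "has_weak_gradient U (\<lambda>x. c) (\<lambda>x. 0)"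
  unfolding has_weak_gradient_def
proof (intro conjI ballI)
  from U have Us: "U \<in> sets lebesgue" by (simp add: sets_completionI_sets)
  show "(\<lambda>x. c) \<in> Lp_loc 1 U"
  proof (rule Lp_loc_1I)
    show "(\<lambda>x. indicat_real U x *\<^sub>R c) \<in> borel_measurable lebesgue" using Us by simp
    show "integrable lebesgue (\<lambda>x. indicat_real K x *\<^sub>R c)" if "compact K" for K :: "'a set"
    proof -
      have "integrable lborel (\<lambda>x::'a. c * indicator K x)"
        by (intro integrable_mult_right integrable_indicator_bounded)
          (use that in \<open>auto simp: compact_imp_bounded borel_compact\<close>)
      then show ?thesis
        using integrable_completion[of "\<lambda>x::'a. c * indicator K x" lborel] borel_compact[OF that]
        by (simp add: mult.commute)
    qed
  qed
  show "(\<lambda>x. 0) \<in> Lp_loc 1 U" by (rule Lp_loc_1I) simp_all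
  fix \<phi> :: "'a \<Rightarrow> real" assume \<phi>: "\<phi> \<in> test_functions U"
  obtain K where K: "smooth \<phi>" "compact K" "K \<subseteq> U" "\<And>x. x \<notin> K \<Longrightarrow> \<phi> x = 0" "\<And>x. x \<notin> K \<Longrightarrow> grad \<phi> x = 0"
    using \<phi> by (rule test_functionsE) blast
  have "(LBINT x. grad \<phi> x) = 0"
    by (rule integral_gradient_zero[OF smooth_has_derivative[OF K(1)] continuous_on_grad[OF K(1)] K(2,4,5)])
  moreover have "(LINT x:U|lebesgue. c *\<^sub>R grad \<phi> x) = (LBINT x. c *\<^sub>R grad \<phi> x)"
  proof -
    have "(\<lambda>x. indicat_real U x *\<^sub>R c *\<^sub>R grad \<phi> x) = (\<lambda>x. c *\<^sub>R grad \<phi> x)"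
      using K(3,5) by (auto simp: indicator_def fun_eq_iff)
    then show ?thesis
      unfolding set_lebesgue_integral_def
      using test_borel(2)[OF \<phi>] by (simp add: integral_completion)
  qed
  ultimately show "(LINT x:U|lebesgue. c *\<^sub>R grad \<phi> x) = - (LINT x:U|lebesgue. \<phi> x *\<^sub>R 0)"
    by (simp add: set_lebesgue_integral_def)
qed

lemma Lp_loc_1_subset:
  fixes h :: "'a::euclidean_space \<Rightarrow> 'b::euclidean_space"
  assumes h: "h \<in> Lp_loc 1 U" and V: "open V" "V \<subseteq> U"
  shows "h \<in> Lp_loc 1 V"
proof (rule Lp_loc_1I)
  have Vs: "V \<in> sets lebesgue" using V by (simp add: sets_completionI_sets)
  have "(\<lambda>x. indicator V x *\<^sub>R (indicator U x *\<^sub>R h x)) \<in> borel_measurable lebesgue"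
    using Vs by (intro borel_measurable_scaleR borel_measurable_indicator Lp_loc_measurable[OF h])
  also have "(\<lambda>x. indicator V x *\<^sub>R (indicator U x *\<^sub>R h x)) = (\<lambda>x. indicator V x *\<^sub>R h x)"
    using V(2) by (auto simp: indicator_def fun_eq_iff)
  finally show "(\<lambda>x. indicator V x *\<^sub>R h x) \<in> borel_measurable lebesgue" .
qed (use Lp_loc_1_integrable[OF h] V(2) in blast)

lemma weak_gradient_subset:
  fixes f :: "'a::euclidean_space \<Rightarrow> real"
  assumes f: "has_weak_gradient U f v" and V: "open V" "V \<subseteq> U"
  shows "has_weak_gradient V f v"
proof -
  show ?thesis
    unfolding has_weak_gradient_def
  proof (intro conjI ballI)
    show "f \<in> Lp_loc 1 V" "v \<in> Lp_loc 1 V" using f by (auto simp: has_weak_gradient_def intro: Lp_loc_1_subset[OF _ V])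
    fix \<phi> assume \<phi>: "\<phi> \<in> test_functions V"
    have e1: "(LINT x:V|lebesgue. f x *\<^sub>R grad \<phi> x) = (LINT x:U|lebesgue. f x *\<^sub>R grad \<phi> x)"
      unfolding set_lebesgue_integral_def
      by (rule Bochner_Integration.integral_cong) (use V(2) test_zero[OF \<phi>] in \<open>auto simp: indicator_def\<close>)
    have e2: "(LINT x:V|lebesgue. \<phi> x *\<^sub>R v x) = (LINT x:U|lebesgue. \<phi> x *\<^sub>R v x)"
      unfolding set_lebesgue_integral_def
      by (rule Bochner_Integration.integral_cong) (use V(2) test_zero[OF \<phi>] in \<open>auto simp: indicator_def\<close>)
    show "(LINT x:V|lebesgue. f x *\<^sub>R grad \<phi> x) = - (LINT x:V|lebesgue. \<phi> x *\<^sub>R v x)"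
      unfolding e1 e2 using f test_mono[OF \<phi> V(2)] by (simp add: has_weak_gradient_def)
  qed
qed

text \<open>On the support of a test function \<open>f\<close> agrees with its product with a cutoff function.\<close>

lemma chain_rule:
  fixes f :: "'a::euclidean_space \<Rightarrow> real"
  assumes U: "open U" and f: "has_weak_gradient U f v" and g: "bounded_Borel g C"
  shows "has_weak_gradient U (\<lambda>x. prim g (f x)) (\<lambda>x. g (f x) *\<^sub>R v x)"
proof -
  have Us: "U \<in> sets lebesgue" using U by (simp add: sets_completionI_sets)
  have fL: "f \<in> Lp_loc 1 U" and vL: "v \<in> Lp_loc 1 U" using f by (auto simp: has_weak_gradient_def)
  note gm = bounded_BorelD(1)[OF g] and pm = prim_measurable[OF bounded_BorelD(1)[OF g]]
  have comp: "(\<lambda>x. indicator U x *\<^sub>R k (f x)) \<in> borel_measurable lebesgue" if "k \<in> borel_measurable borel"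
    for k :: "real \<Rightarrow> real"
  proof -
    have "(\<lambda>x. indicator U x *\<^sub>R k (indicator U x *\<^sub>R f x)) \<in> borel_measurable lebesgue"
      using Us by (intro borel_measurable_scaleR borel_measurable_indicator measurable_compose[OF Lp_loc_measurable[OF fL] that])
    also have "(\<lambda>x. indicator U x *\<^sub>R k (indicator U x *\<^sub>R f x)) = (\<lambda>x. indicator U x *\<^sub>R k (f x))"
      by (auto simp: indicator_def)
    finally show ?thesis .
  qed
  show ?thesis
    unfolding has_weak_gradient_def
  proof (intro conjI ballI)
    show "(\<lambda>x. prim g (f x)) \<in> Lp_loc 1 U"
    proof (rule Lp_loc_1I[OF comp[OF pm]])
      fix K assume K: "compact K" "K \<subseteq> U"
      then have Ks: "K \<in> sets lebesgue" by (simp add: borel_compact sets_completionI_sets)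
      show "integrable lebesgue (\<lambda>x. indicator K x *\<^sub>R prim g (f x))"
      proof (rule Bochner_Integration.integrable_bound)
        show "integrable lebesgue (\<lambda>x. 2 * C * norm (indicator K x *\<^sub>R f x))"
          by (intro integrable_mult_right integrable_norm Lp_loc_1_integrable[OF fL K])
        have "(\<lambda>x. indicator K x *\<^sub>R (indicator U x *\<^sub>R prim g (f x))) \<in> borel_measurable lebesgue"
          using Ks by (intro borel_measurable_scaleR borel_measurable_indicator comp[OF pm])
        also have "(\<lambda>x. indicator K x *\<^sub>R (indicator U x *\<^sub>R prim g (f x))) = (\<lambda>x. indicator K x *\<^sub>R prim g (f x))"
          using K(2) by (auto simp: indicator_def fun_eq_iff)
        finally show "(\<lambda>x. indicator K x *\<^sub>R prim g (f x)) \<in> borel_measurable lebesgue" .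
        show "AE x in lebesgue. norm (indicator K x *\<^sub>R prim g (f x)) \<le> norm (2 * C * norm (indicator K x *\<^sub>R f x))"
          using prim_bound[OF g] bounded_BorelD(3)[OF g] by (intro AE_I2) (auto simp: indicator_def abs_mult)
      qed
    qed
    show "(\<lambda>x. g (f x) *\<^sub>R v x) \<in> Lp_loc 1 U"
    proof (rule Lp_loc_1I)
      have "(\<lambda>x. (indicator U x *\<^sub>R g (f x)) *\<^sub>R (indicator U x *\<^sub>R v x)) \<in> borel_measurable lebesgue"
        by (intro borel_measurable_scaleR comp[OF gm] Lp_loc_measurable[OF vL])
      also have "(\<lambda>x. (indicator U x *\<^sub>R g (f x)) *\<^sub>R (indicator U x *\<^sub>R v x)) = (\<lambda>x. indicator U x *\<^sub>R (g (f x) *\<^sub>R v x))"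
        by (auto simp: indicator_def)
      finally show m: "(\<lambda>x. indicator U x *\<^sub>R (g (f x) *\<^sub>R v x)) \<in> borel_measurable lebesgue" .
      fix K assume K: "compact K" "K \<subseteq> U"
      then have Ks: "K \<in> sets lebesgue" by (simp add: borel_compact sets_completionI_sets)
      show "integrable lebesgue (\<lambda>x. indicator K x *\<^sub>R (g (f x) *\<^sub>R v x))"
      proof (rule Bochner_Integration.integrable_bound)
        show "integrable lebesgue (\<lambda>x. C * norm (indicator K x *\<^sub>R v x))"
          by (intro integrable_mult_right integrable_norm Lp_loc_1_integrable[OF vL K])
        have "(\<lambda>x. indicator K x *\<^sub>R (indicator U x *\<^sub>R (g (f x) *\<^sub>R v x))) \<in> borel_measurable lebesgue"
          using Ks by (intro borel_measurable_scaleR borel_measurable_indicator m)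
        also have "(\<lambda>x. indicator K x *\<^sub>R (indicator U x *\<^sub>R (g (f x) *\<^sub>R v x))) = (\<lambda>x. indicator K x *\<^sub>R (g (f x) *\<^sub>R v x))"
          using K(2) by (auto simp: indicator_def fun_eq_iff)
        finally show "(\<lambda>x. indicator K x *\<^sub>R (g (f x) *\<^sub>R v x)) \<in> borel_measurable lebesgue" .
        show "AE x in lebesgue. norm (indicator K x *\<^sub>R (g (f x) *\<^sub>R v x)) \<le> norm (C * norm (indicator K x *\<^sub>R v x))"
          using bounded_BorelD(2,3)[OF g] by (intro AE_I2) (auto simp: indicator_def abs_mult intro!: mult_right_mono)
      qed
    qed
    fix \<phi> :: "'a \<Rightarrow> real" assume \<phi>: "\<phi> \<in> test_functions U"
    obtain K where K: "smooth \<phi>" "compact K" "K \<subseteq> U" "\<And>x. x \<notin> K \<Longrightarrow> \<phi> x = 0" "\<And>x. x \<notin> K \<Longrightarrow> grad \<phi> x = 0"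
      using \<phi> by (rule test_functionsE) blast
    obtain \<eta> V where \<eta>: "\<eta> \<in> test_functions U" "\<And>x. 0 \<le> \<eta> x" "\<And>x. \<eta> x \<le> 1"
      "open V" "K \<subseteq> V" "V \<subseteq> U" "\<And>x. x \<in> V \<Longrightarrow> \<eta> x = 1" "\<And>x. x \<in> V \<Longrightarrow> grad \<eta> x = 0"
      using cutoff_compact[OF K(2) U K(3)] by blast
    obtain f' v' where W: "Wgrad f' v'" and f': "AE x in lborel. f' x = indicator U x * (\<eta> x * f x)"
      and v': "AE x in lborel. v' x = indicator U x *\<^sub>R (\<eta> x *\<^sub>R v x + f x *\<^sub>R grad \<eta> x)"
      using local_to_global[OF f \<eta>(1)] by blast
    have \<phi>U: "\<phi> \<in> test_functions UNIV" by (rule test_mono[OF \<phi>]) simp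
    have "chain_rule_for f' v' \<phi> g" by (rule chain_bounded_Borel[OF W \<phi>U g])
    moreover have "(LINT x:U|lebesgue. prim g (f x) *\<^sub>R grad \<phi> x) = (LBINT x. prim g (f' x) *\<^sub>R grad \<phi> x)"
      unfolding set_lebesgue_integral_def
    proof (rule integral_representative(1))
      have "(\<lambda>x. (indicator U x *\<^sub>R prim g (f x)) *\<^sub>R grad \<phi> x) \<in> borel_measurable lebesgue"
        by (intro borel_measurable_scaleR comp[OF pm] Borel_lebesgue[OF test_borel(2)[OF \<phi>]])
      then show "(\<lambda>x. indicator U x *\<^sub>R (prim g (f x) *\<^sub>R grad \<phi> x)) \<in> borel_measurable lebesgue" by simp
      show "(\<lambda>x. prim g (f' x) *\<^sub>R grad \<phi> x) \<in> borel_measurable borel"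
        by (intro borel_measurable_scaleR measurable_compose[OF WgradD(4)[OF W] pm] test_borel(2)[OF \<phi>])
      show "AE x in lborel. indicator U x *\<^sub>R (prim g (f x) *\<^sub>R grad \<phi> x) = prim g (f' x) *\<^sub>R grad \<phi> x"
        using f'
      proof eventually_elim
        case (elim x)
        show ?case
        proof (cases "x \<in> K")
          case True
          then have "x \<in> U" "\<eta> x = 1" using K \<eta> by auto
          then show ?thesis using elim by simp
        qed (simp add: K(5))
      qed
    qed
    moreover have "(LINT x:U|lebesgue. \<phi> x *\<^sub>R (g (f x) *\<^sub>R v x)) = (LBINT x. \<phi> x *\<^sub>R (g (f' x) *\<^sub>R v' x))"
      unfolding set_lebesgue_integral_def
    proof (rule integral_representative(1))
      have "(\<lambda>x. \<phi> x *\<^sub>R ((indicator U x *\<^sub>R g (f x)) *\<^sub>R (indicator U x *\<^sub>R v x))) \<in> borel_measurable lebesgue"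
        by (intro borel_measurable_scaleR comp[OF gm] Lp_loc_measurable[OF vL] Borel_lebesgue[OF test_borel(1)[OF \<phi>]])
      also have "(\<lambda>x. \<phi> x *\<^sub>R ((indicator U x *\<^sub>R g (f x)) *\<^sub>R (indicator U x *\<^sub>R v x)))
          = (\<lambda>x. indicator U x *\<^sub>R (\<phi> x *\<^sub>R (g (f x) *\<^sub>R v x)))"
        by (auto simp: indicator_def)
      finally show "(\<lambda>x. indicator U x *\<^sub>R (\<phi> x *\<^sub>R (g (f x) *\<^sub>R v x))) \<in> borel_measurable lebesgue" .
      show "(\<lambda>x. \<phi> x *\<^sub>R (g (f' x) *\<^sub>R v' x)) \<in> borel_measurable borel"
        by (intro borel_measurable_scaleR measurable_compose[OF WgradD(4)[OF W] gm] test_borel(1)[OF \<phi>] WgradD(5)[OF W])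
      show "AE x in lborel. indicator U x *\<^sub>R (\<phi> x *\<^sub>R (g (f x) *\<^sub>R v x)) = \<phi> x *\<^sub>R (g (f' x) *\<^sub>R v' x)"
        using f' v'
      proof eventually_elim
        case (elim x)
        show ?case
        proof (cases "x \<in> K")
          case True
          then have "x \<in> U" "\<eta> x = 1" "grad \<eta> x = 0" using K \<eta> by auto
          then show ?thesis using elim by simp
        qed (simp add: K(4))
      qed
    qed
    ultimately show "(LINT x:U|lebesgue. prim g (f x) *\<^sub>R grad \<phi> x) = - (LINT x:U|lebesgue. \<phi> x *\<^sub>R (g (f x) *\<^sub>R v x))"
      by (simp add: chain_rule_for_def)
  qed
qed

text \<open>The primitive of the indicator of a null set is zero, so its weak gradient is zero as well.\<close>

lemma weak_gradient_zero_on_null_preimage: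
  fixes f :: "'a::euclidean_space \<Rightarrow> real"
  assumes U: "open U" and f: "has_weak_gradient U f v" and N: "N \<in> null_sets lborel"
  shows "AE x in lebesgue. x \<in> U \<longrightarrow> f x \<in> N \<longrightarrow> v x = 0"
proof -
  have Nb: "N \<in> sets borel" using N by (auto simp: null_sets_def)
  have "prim (indicator N) t = 0" for t
  proof -
    have "prim (indicator N) t = (\<integral>s. 0 \<partial>(lborel :: real measure))"
      unfolding prim_def
    proof (rule integral_cong_AE)
      note [measurable] = Nb
      show "(\<lambda>s. if 0 \<le> s \<and> s \<le> t then indicat_real N s else if t \<le> s \<and> s < 0 then - indicat_real N s else 0) \<in> borel_measurable lborel"
        by measurable
      show "AE s in lborel. (if 0 \<le> s \<and> s \<le> t then indicat_real N s else if t \<le> s \<and> s < 0 then - indicat_real N s else 0) = 0"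
        using AE_not_in[OF N] by eventually_elim (auto simp: indicator_def)
    qed simp
    then show ?thesis by simp
  qed
  with chain_rule[OF U f bounded_Borel_indicator[OF Nb]]
  have "has_weak_gradient U (\<lambda>x. 0) (\<lambda>x. indicator N (f x) *\<^sub>R v x)" by simp
  from weak_gradient_unique[OF U this weak_gradient_const[OF U]]
  show ?thesis by eventually_elim (auto simp: indicator_def)
qed

lemma weak_gradient_id: "has_weak_gradient UNIV (\<lambda>t::real. t) (\<lambda>t. 1)"
  unfolding has_weak_gradient_def
proof (intro conjI ballI)
  have L: "k \<in> Lp_loc 1 UNIV" if k: "continuous_on UNIV k" for k :: "real \<Rightarrow> real"
  proof (rule Lp_loc_1I)
    show "(\<lambda>x. indicat_real UNIV x *\<^sub>R k x) \<in> borel_measurable lebesgue"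
      using Borel_lebesgue[OF borel_measurable_continuous_onI[OF k]] by simp
    fix K :: "real set" assume K: "compact K"
    have "integrable lborel (\<lambda>x. indicator K x *\<^sub>R k x)"
      using borel_integrable_compact[OF K continuous_on_subset[OF k]] by simp
    moreover have "(\<lambda>x. indicator K x *\<^sub>R k x) \<in> borel_measurable borel"
      using borel_measurable_continuous_onI[OF k] borel_compact[OF K] by simp
    ultimately show "integrable lebesgue (\<lambda>x. indicat_real K x *\<^sub>R k x)"
      by (simp add: integrable_completion)
  qed
  show "(\<lambda>t::real. t) \<in> Lp_loc 1 UNIV" "(\<lambda>t::real. 1::real) \<in> Lp_loc 1 UNIV"
    by (intro L continuous_intros)+
  fix \<phi> :: "real \<Rightarrow> real" assume \<phi>: "\<phi> \<in> test_functions UNIV"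
  have "(LBINT x. x *\<^sub>R grad \<phi> x) = - (LBINT x. \<phi> x *\<^sub>R 1)"
    by (rule integration_by_parts_C1(1)[where G = "\<lambda>_. 1", OF _ _ \<phi>]) (auto intro!: derivative_eq_intros)
  moreover have "(\<lambda>x. x * grad \<phi> x) \<in> borel_measurable borel"
    using test_borel(2)[OF \<phi>] by simp
  ultimately show "(LINT x:UNIV|lebesgue. x *\<^sub>R grad \<phi> x) = - (LINT x:UNIV|lebesgue. \<phi> x *\<^sub>R 1)"
    using test_borel[OF \<phi>] by (simp add: set_lebesgue_integral_def integral_completion)
qed

section \<open>An inequality of Faber-Krahn type\<close>

lemma nn_integral_translate:
  fixes a :: "'a::euclidean_space \<Rightarrow> ennreal"
  assumes "a \<in> borel_measurable borel"
  shows "(\<integral>\<^sup>+x. a (x + y) \<partial>lborel) = (\<integral>\<^sup>+x. a x \<partial>lborel)"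
  using nn_integral_affine[OF assms, of 1 y] by (simp add: add.commute)

text \<open>Integrate the derivative along the segment from \<open>x\<close> to \<open>x + y\<close> and exchange the integrals.\<close>

lemma smooth_translation_L1:
  fixes f :: "'a::euclidean_space \<Rightarrow> real"
  assumes f: "smooth f" and fi: "integrable lborel f" and gi: "integrable lborel (grad f)"
  shows "(LBINT x. \<bar>f (x + y) - f x\<bar>) \<le> norm y * (LBINT x. norm (grad f x))"
proof -
  have gc: "continuous_on UNIV (grad f)" by (rule continuous_on_grad[OF f])
  note [measurable] = borel_measurable_continuous_onI[OF gc] borel_measurable_continuous_onI[OF smooth_continuous[OF f]]
  have pt: "ennreal \<bar>f (x + y) - f x\<bar> \<le> (\<integral>\<^sup>+t. indicator {0..1} t * ennreal (norm y * norm (grad f (x + t *\<^sub>R y))) \<partial>lborel)" for x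
  proof -
    let ?d = "\<lambda>t. grad f (x + t *\<^sub>R y) \<bullet> y"
    have dc: "continuous_on UNIV ?d"
      by (intro continuous_intros continuous_on_compose2[OF gc]) auto
    have "((\<lambda>t. f (x + t *\<^sub>R y)) has_vector_derivative ?d t) (at t within {0..1})" for t
    proof -
      have "((\<lambda>t. x + t *\<^sub>R y) has_derivative (\<lambda>h. h *\<^sub>R y)) (at t within {0..1})"
        by (auto intro!: derivative_eq_intros)
      from has_derivative_compose[OF this smooth_has_derivative[OF f]]
      show ?thesis by (simp add: has_vector_derivative_def)
    qed
    then have "(?d has_integral (f (x + 1 *\<^sub>R y) - f (x + 0 *\<^sub>R y))) {0..1}"
      by (intro fundamental_theorem_of_calculus) auto
    moreover have si: "set_integrable lborel {0..1} ?d"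
      by (rule borel_integrable_atLeastAtMost') (rule continuous_on_subset[OF dc], simp)
    ultimately have eq: "f (x + y) - f x = (LINT t:{0..1}|lborel. ?d t)"
      by (simp add: set_borel_integral_eq_integral(2) integral_unique)
    have "\<bar>f (x + y) - f x\<bar> \<le> (LBINT t. norm (indicator {0..1} t *\<^sub>R ?d t))"
      unfolding eq set_lebesgue_integral_def real_norm_def[symmetric] by (rule integral_norm_bound)
    then have "ennreal \<bar>f (x + y) - f x\<bar> \<le> ennreal (LBINT t. norm (indicator {0..1} t *\<^sub>R ?d t))"
      by (rule ennreal_leI)
    also have "\<dots> = (\<integral>\<^sup>+t. ennreal (norm (indicator {0..1} t *\<^sub>R ?d t)) \<partial>lborel)"
      using si unfolding set_integrable_def by (intro nn_integral_eq_integral[symmetric] integrable_norm) auto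
    also have "\<dots> \<le> (\<integral>\<^sup>+t. indicator {0..1} t * ennreal (norm y * norm (grad f (x + t *\<^sub>R y))) \<partial>lborel)"
    proof (rule nn_integral_mono)
      fix t :: real
      show "ennreal (norm (indicator {0..1} t *\<^sub>R ?d t)) \<le> indicator {0..1} t * ennreal (norm y * norm (grad f (x + t *\<^sub>R y)))"
        using Cauchy_Schwarz_ineq2[of "grad f (x + t *\<^sub>R y)" y]
        by (cases "t \<in> {0..1}") (auto simp: mult.commute intro: ennreal_leI)
    qed
    finally show ?thesis .
  qed
  have i1: "integrable lborel (\<lambda>x. f (x + y))" using integrable_affine[OF fi, of 1 y] by (simp add: add.commute)
  have "(\<integral>\<^sup>+x. ennreal \<bar>f (x + y) - f x\<bar> \<partial>lborel)
      \<le> (\<integral>\<^sup>+x. (\<integral>\<^sup>+t. indicator {0..1} t * ennreal (norm y * norm (grad f (x + t *\<^sub>R y))) \<partial>lborel) \<partial>lborel)"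
    by (rule nn_integral_mono[OF pt])
  also have "\<dots> = (\<integral>\<^sup>+t. (\<integral>\<^sup>+x. indicator {0..1} t * ennreal (norm y * norm (grad f (x + t *\<^sub>R y))) \<partial>lborel) \<partial>(lborel :: real measure))"
    by (rule lborel_pair.Fubini'[symmetric]) measurable
  also have "\<dots> = (\<integral>\<^sup>+t. indicator {0..1::real} t * (\<integral>\<^sup>+x. ennreal (norm y * norm (grad f x)) \<partial>lborel) \<partial>lborel)"
  proof (rule nn_integral_cong)
    fix t :: real
    have "(\<integral>\<^sup>+x. indicator {0..1} t * ennreal (norm y * norm (grad f (x + t *\<^sub>R y))) \<partial>lborel)
        = indicator {0..1} t * (\<integral>\<^sup>+x. ennreal (norm y * norm (grad f (x + t *\<^sub>R y))) \<partial>lborel)"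
      by (rule nn_integral_cmult) measurable
    also have "(\<integral>\<^sup>+x. ennreal (norm y * norm (grad f (x + t *\<^sub>R y))) \<partial>lborel) = (\<integral>\<^sup>+x. ennreal (norm y * norm (grad f x)) \<partial>lborel)"
      by (rule nn_integral_translate) measurable
    finally show "(\<integral>\<^sup>+x. indicator {0..1} t * ennreal (norm y * norm (grad f (x + t *\<^sub>R y))) \<partial>lborel)
        = indicator {0..1} t * (\<integral>\<^sup>+x. ennreal (norm y * norm (grad f x)) \<partial>lborel)" .
  qed
  also have "\<dots> = (\<integral>\<^sup>+x. ennreal (norm y * norm (grad f x)) \<partial>lborel)"
    by (simp add: nn_integral_multc)
  also have "\<dots> = ennreal (norm y * (LBINT x. norm (grad f x)))"
    using gi by (subst nn_integral_eq_integral) auto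
  finally have "(\<integral>\<^sup>+x. ennreal \<bar>f (x + y) - f x\<bar> \<partial>lborel) \<le> ennreal (norm y * (LBINT x. norm (grad f x)))" .
  then show ?thesis
    using i1 fi by (subst (asm) nn_integral_eq_integral) (auto simp: ennreal_le_iff)
qed

lemma translation_L1:
  assumes W: "Wgrad f v"
  shows "(LBINT x. \<bar>f (x + y) - f x\<bar>) \<le> norm y * (LBINT x. norm (v x))"
proof -
  note fi = WgradD(1)[OF W] and vi = WgradD(2)[OF W]
  have tr: "integrable lborel (\<lambda>x. g (x + y))" "(LBINT x. g (x + y)) = (LBINT x. g x)"
    if "integrable lborel g" for g :: "'a \<Rightarrow> real"
    using integrable_affine[OF that, of 1 y] integral_affine[OF that, of 1 y] by (simp_all add: add.commute)
  have "(LBINT x. \<bar>f (x + y) - f x\<bar>)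
      \<le> norm y * (LBINT x. norm (v x)) + 2 * (LBINT x. norm (conv f (moll n) x - f x))" for n
  proof -
    let ?g = "conv f (moll n)"
    have gi: "integrable lborel ?g" by (rule conv_moll_L1(1)[OF fi])
    have gr: "grad ?g = conv v (moll n)" by (rule ext, rule grad_conv_Wgrad[OF W moll_test])
    have di: "integrable lborel (\<lambda>x. \<bar>?g x - f x\<bar>)" using gi fi by simp
    have "(LBINT x. \<bar>f (x + y) - f x\<bar>)
       \<le> (LBINT x. \<bar>?g (x + y) - ?g x\<bar> + \<bar>?g (x + y) - f (x + y)\<bar> + \<bar>?g x - f x\<bar>)"
      by (rule integral_mono) (use tr(1)[OF fi] tr(1)[OF gi] tr(1)[OF di] fi gi di in auto)
    also have "\<dots> = (LBINT x. \<bar>?g (x + y) - ?g x\<bar>) + (LBINT x. \<bar>?g (x + y) - f (x + y)\<bar>) + (LBINT x. \<bar>?g x - f x\<bar>)"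
      using tr(1)[OF fi] tr(1)[OF gi] tr(1)[OF di] fi gi di by simp
    also have "(LBINT x. \<bar>?g (x + y) - f (x + y)\<bar>) = (LBINT x. \<bar>?g x - f x\<bar>)"
      by (rule tr(2)[OF di])
    also have "(LBINT x. \<bar>?g (x + y) - ?g x\<bar>) \<le> norm y * (LBINT x. norm (grad ?g x))"
      by (rule smooth_translation_L1[OF smooth_conv[OF fi moll_test] gi]) (simp add: gr conv_moll_L1(1)[OF vi])
    also have "\<dots> \<le> norm y * (LBINT x. norm (v x))"
      unfolding gr by (intro mult_left_mono conv_moll_L1(2)[OF vi]) simp
    finally show ?thesis by simp
  qed
  moreover have "(\<lambda>n. norm y * (LBINT x. norm (v x)) + 2 * (LBINT x. norm (conv f (moll n) x - f x)))
      \<longlonglongrightarrow> norm y * (LBINT x. norm (v x)) + 2 * 0"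
    by (intro tendsto_intros conv_moll_tendsto_L1 fi)
  ultimately show ?thesis
    by (intro LIMSEQ_le_const[where X = "\<lambda>n. norm y * (LBINT x. norm (v x)) + 2 * (LBINT x. norm (conv f (moll n) x - f x))"]) auto
qed

text \<open>A function vanishing off \<open>A\<close> is compared with its translates by the points \<open>y\<close> of a cube of volume
  at least twice that of \<open>A\<close>.  For every \<open>x\<close> at least half of these translates have \<open>x + y\<close> outside
  \<open>A\<close>, so the average of the translation differences is at least half of the integral of \<open>\<bar>f\<bar>\<close>.\<close>

lemma Faber_Krahn_cube:
  fixes f :: "'a::euclidean_space \<Rightarrow> real"
  assumes W: "Wgrad f v" and A: "A \<in> sets borel" "emeasure lborel A < \<infinity>"
    and f0: "AE x in lborel. x \<notin> A \<longrightarrow> f x = 0" and L: "0 < L" "2 * measure lborel A \<le> L ^ DIM('a)"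
  shows "(LBINT x. \<bar>f x\<bar>) \<le> 2 * real DIM('a) * L * (LBINT x. norm (v x))"
proof -
  note fi = WgradD(1)[OF W] and vi = WgradD(2)[OF W]
  note [measurable] = WgradD(4)[OF W] A(1)
  define g where "g x = indicator A x * f x" for x
  have gm [measurable]: "g \<in> borel_measurable borel" unfolding g_def[abs_def] by measurable
  have gf: "AE x in lborel. g x = f x" using f0 by eventually_elim (auto simp: g_def indicator_def)
  have Wg: "Wgrad g v"
    by (rule Wgrad_cong[OF W gm _ WgradD(5)[OF W]]) (use gf in \<open>auto elim: eventually_mono\<close>)
  note gi = WgradD(1)[OF Wg]
  let ?n = "real DIM('a)" and ?V = "LBINT x. norm (v x)"
  define Q where "Q = cbox (0::'a) (L *\<^sub>R One)"
  have Qm [measurable]: "Q \<in> sets borel" by (simp add: Q_def)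
  have Q: "emeasure lborel Q = ennreal (L ^ DIM('a))"
    unfolding Q_def using L(1) by (subst emeasure_lborel_cbox) auto
  have Qn: "norm y \<le> ?n * L" if "y \<in> Q" for y
  proof -
    have "norm y \<le> (\<Sum>b\<in>Basis. \<bar>y \<bullet> b\<bar>)" by (rule norm_le_l1)
    also have "\<dots> \<le> (\<Sum>b\<in>(Basis::'a set). L)"
      using that by (intro sum_mono) (auto simp: Q_def mem_box)
    finally show ?thesis by simp
  qed
  have half: "ennreal (L ^ DIM('a) / 2) \<le> (\<integral>\<^sup>+y. indicator Q y * indicator {y. x + y \<notin> A} y \<partial>lborel)" for x
  proof -
    have eA: "emeasure lborel {y. x + y \<in> A} = emeasure lborel A"
    proof -
      have "(\<integral>\<^sup>+y. indicator A (y + x) \<partial>lborel) = (\<integral>\<^sup>+y. indicator A y \<partial>lborel)"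
        by (rule nn_integral_translate) measurable
      moreover have "(\<integral>\<^sup>+y. indicator A (y + x) \<partial>lborel) = (\<integral>\<^sup>+y. indicator {y. x + y \<in> A} y \<partial>lborel)"
        by (rule nn_integral_cong) (auto simp: indicator_def add.commute)
      ultimately show ?thesis by simp
    qed
    have "ennreal (L ^ DIM('a) / 2) \<le> ennreal (L ^ DIM('a)) - ennreal (measure lborel A)"
      using L by (subst ennreal_minus) (auto intro: ennreal_leI)
    also have "\<dots> = emeasure lborel Q - emeasure lborel {y. x + y \<in> A}"
      using A(2) by (simp add: Q eA emeasure_eq_ennreal_measure)
    also have "\<dots> \<le> emeasure lborel (Q - {y. x + y \<in> A})"
    proof -
      have Tm: "{y. x + y \<in> A} \<in> sets lborel" by measurable
      have Dm: "Q - {y. x + y \<in> A} \<in> sets lborel" using Tm Qm by (simp add: sets.Diff)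
      have "emeasure lborel Q \<le> emeasure lborel ({y. x + y \<in> A} \<union> (Q - {y. x + y \<in> A}))"
        by (rule emeasure_mono) (use Tm Dm in auto)
      also have "\<dots> \<le> emeasure lborel {y. x + y \<in> A} + emeasure lborel (Q - {y. x + y \<in> A})"
        by (rule emeasure_subadditive[OF Tm Dm])
      finally show ?thesis
        using A(2) by (auto simp: ennreal_minus_le_iff eA)
    qed
    also have "\<dots> = (\<integral>\<^sup>+y. indicator (Q - {y. x + y \<in> A}) y \<partial>lborel)" by simp
    also have "\<dots> = (\<integral>\<^sup>+y. indicator Q y * indicator {y. x + y \<notin> A} y \<partial>lborel)"
      by (rule nn_integral_cong) (auto simp: indicator_def)
    finally show ?thesis .
  qed
  have "ennreal (L ^ DIM('a) / 2) * ennreal (LBINT x. \<bar>g x\<bar>) = (\<integral>\<^sup>+x. ennreal \<bar>g x\<bar> * ennreal (L ^ DIM('a) / 2) \<partial>lborel)"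
    using gi by (simp add: nn_integral_multc nn_integral_eq_integral mult.commute)
  also have "\<dots> \<le> (\<integral>\<^sup>+x. (\<integral>\<^sup>+y. indicator Q y * ennreal \<bar>g (x + y) - g x\<bar> \<partial>lborel) \<partial>lborel)"
  proof (rule nn_integral_mono)
    fix x
    have "ennreal \<bar>g x\<bar> * ennreal (L ^ DIM('a) / 2) \<le> ennreal \<bar>g x\<bar> * (\<integral>\<^sup>+y. indicator Q y * indicator {y. x + y \<notin> A} y \<partial>lborel)"
      by (intro mult_left_mono half) simp
    also have "\<dots> = (\<integral>\<^sup>+y. ennreal \<bar>g x\<bar> * (indicator Q y * indicator {y. x + y \<notin> A} y) \<partial>lborel)"
      by (rule nn_integral_cmult[symmetric]) measurable
    also have "\<dots> \<le> (\<integral>\<^sup>+y. indicator Q y * ennreal \<bar>g (x + y) - g x\<bar> \<partial>lborel)"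
      by (rule nn_integral_mono) (auto simp: indicator_def g_def)
    finally show "ennreal \<bar>g x\<bar> * ennreal (L ^ DIM('a) / 2) \<le> (\<integral>\<^sup>+y. indicator Q y * ennreal \<bar>g (x + y) - g x\<bar> \<partial>lborel)" .
  qed
  also have "\<dots> = (\<integral>\<^sup>+y. (\<integral>\<^sup>+x. indicator Q y * ennreal \<bar>g (x + y) - g x\<bar> \<partial>lborel) \<partial>lborel)"
    by (rule lborel_pair.Fubini'[symmetric]) measurable
  also have "\<dots> \<le> (\<integral>\<^sup>+y. indicator Q y * ennreal (?n * L * ?V) \<partial>lborel)"
  proof (rule nn_integral_mono)
    fix y
    show "(\<integral>\<^sup>+x. indicator Q y * ennreal \<bar>g (x + y) - g x\<bar> \<partial>lborel) \<le> indicator Q y * ennreal (?n * L * ?V)"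
    proof (cases "y \<in> Q")
      case True
      have "integrable lborel (\<lambda>x. g (x + y))" using integrable_affine[OF gi, of 1 y] by (simp add: add.commute)
      then have "(\<integral>\<^sup>+x. ennreal \<bar>g (x + y) - g x\<bar> \<partial>lborel) = ennreal (LBINT x. \<bar>g (x + y) - g x\<bar>)"
        using gi by (intro nn_integral_eq_integral) auto
      also have "\<dots> \<le> ennreal (norm y * ?V)" by (intro ennreal_leI translation_L1 Wg)
      also have "\<dots> \<le> ennreal (?n * L * ?V)" using Qn[OF True] by (intro ennreal_leI mult_right_mono) auto
      finally show ?thesis using True by simp
    qed simp
  qed
  also have "\<dots> = ennreal (L ^ DIM('a)) * ennreal (?n * L * ?V)"
    by (simp add: nn_integral_multc Q)
  finally have "ennreal (L ^ DIM('a) / 2 * (LBINT x. \<bar>g x\<bar>)) \<le> ennreal (L ^ DIM('a) * (?n * L * ?V))"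
    using L(1) by (simp add: ennreal_mult'[symmetric])
  then have "L ^ DIM('a) / 2 * (LBINT x. \<bar>g x\<bar>) \<le> L ^ DIM('a) * (?n * L * ?V)"
    using L(1) by (subst (asm) ennreal_le_iff) auto
  then have "(LBINT x. \<bar>g x\<bar>) \<le> 2 * ?n * L * ?V"
    using L(1) by (simp add: field_simps)
  moreover have "(LBINT x. \<bar>g x\<bar>) = (LBINT x. \<bar>f x\<bar>)"
    by (rule integral_cong_AE) (use gf in auto)
  ultimately show ?thesis by simp
qed

text \<open>The edge of the cube is chosen so that its volume is exactly twice that of \<open>A\<close>.\<close>

lemma Faber_Krahn:
  fixes f :: "'a::euclidean_space \<Rightarrow> real"
  assumes W: "Wgrad f v" and A: "A \<in> sets borel" "emeasure lborel A < \<infinity>"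
    and f0: "AE x in lborel. x \<notin> A \<longrightarrow> f x = 0"
  shows "(LBINT x. \<bar>f x\<bar>) \<le> 4 * real DIM('a) * measure lborel A powr (1 / real DIM('a)) * (LBINT x. norm (v x))"
proof (cases "measure lborel A = 0")
  case True
  then have "A \<in> null_sets lborel" using A by (auto simp: null_sets_def emeasure_eq_ennreal_measure)
  then have "AE x in lborel. x \<notin> A" by (rule AE_not_in)
  then have "AE x in lborel. \<bar>f x\<bar> = 0" using f0 by eventually_elim simp
  then have "(LBINT x. \<bar>f x\<bar>) = 0" by (rule integral_eq_zero_AE)
  then show ?thesis by simp
next
  case False
  then have pos: "measure lborel A > 0" by (simp add: zero_less_measure_iff)
  let ?n = "real DIM('a)"
  have n: "?n \<ge> 1" using DIM_positive[where 'a = 'a] by linarith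
  define L where "L = (2 * measure lborel A) powr (1 / ?n)"
  have L: "L > 0" using pos by (simp add: L_def)
  have "L ^ DIM('a) = L powr ?n" using L by (simp add: powr_realpow)
  also have "\<dots> = 2 * measure lborel A" using pos n by (simp add: L_def powr_powr)
  finally have "(LBINT x. \<bar>f x\<bar>) \<le> 2 * ?n * L * (LBINT x. norm (v x))"
    by (intro Faber_Krahn_cube[OF W A f0 L]) simp
  also have "L \<le> 2 * measure lborel A powr (1 / ?n)"
  proof -
    have "2 powr (1 / ?n) \<le> (2::real) powr 1" using n by (intro powr_mono) auto
    then show ?thesis using pos by (simp add: L_def powr_mult)
  qed
  then have "2 * ?n * L * (LBINT x. norm (v x)) \<le> 2 * ?n * (2 * measure lborel A powr (1 / ?n)) * (LBINT x. norm (v x))"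
    by (intro mult_right_mono mult_left_mono) auto
  finally show ?thesis by simp
qed

section \<open>The supersolution inequality\<close>

lemma weak_gradient_cong:
  fixes f :: "'a::euclidean_space \<Rightarrow> real"
  assumes U: "open U" and f: "has_weak_gradient U f v"
    and ff': "AE x in lebesgue. x \<in> U \<longrightarrow> f x = f' x" and vv': "AE x in lebesgue. x \<in> U \<longrightarrow> v x = v' x"
    and m: "(\<lambda>x. indicator U x *\<^sub>R f' x) \<in> borel_measurable lebesgue" "(\<lambda>x. indicator U x *\<^sub>R v' x) \<in> borel_measurable lebesgue"
  shows "has_weak_gradient U f' v'"
proof -
  have fL: "f \<in> Lp_loc 1 U" and vL: "v \<in> Lp_loc 1 U" using f by (auto simp: has_weak_gradient_def)
  have L1: "f' \<in> Lp_loc 1 U"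
  proof (rule Lp_loc_1I[OF m(1)])
    fix K assume K: "compact K" "K \<subseteq> U"
    then have Ks: "K \<in> sets lebesgue" by (simp add: borel_compact sets_completionI_sets)
    have "(\<lambda>x. indicator K x *\<^sub>R (indicator U x *\<^sub>R f' x)) \<in> borel_measurable lebesgue"
      using Ks by (intro borel_measurable_scaleR borel_measurable_indicator m)
    also have "(\<lambda>x. indicator K x *\<^sub>R (indicator U x *\<^sub>R f' x)) = (\<lambda>x. indicator K x *\<^sub>R f' x)"
      using K(2) by (auto simp: indicator_def fun_eq_iff)
    finally have *: "(\<lambda>x. indicator K x *\<^sub>R f' x) \<in> borel_measurable lebesgue" .
    have "AE x in lebesgue. indicator K x *\<^sub>R f x = indicator K x *\<^sub>R f' x"
      using ff' by eventually_elim (use K(2) in \<open>auto simp: indicator_def\<close>)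
    from integrable_cong_AE_imp[OF Lp_loc_1_integrable[OF fL K] * this]
    show "integrable lebesgue (\<lambda>x. indicator K x *\<^sub>R f' x)" .
  qed
  have L2: "v' \<in> Lp_loc 1 U"
  proof (rule Lp_loc_1I[OF m(2)])
    fix K assume K: "compact K" "K \<subseteq> U"
    then have Ks: "K \<in> sets lebesgue" by (simp add: borel_compact sets_completionI_sets)
    have "(\<lambda>x. indicator K x *\<^sub>R (indicator U x *\<^sub>R v' x)) \<in> borel_measurable lebesgue"
      using Ks by (intro borel_measurable_scaleR borel_measurable_indicator m)
    also have "(\<lambda>x. indicator K x *\<^sub>R (indicator U x *\<^sub>R v' x)) = (\<lambda>x. indicator K x *\<^sub>R v' x)"
      using K(2) by (auto simp: indicator_def fun_eq_iff)
    finally have *: "(\<lambda>x. indicator K x *\<^sub>R v' x) \<in> borel_measurable lebesgue" .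
    have "AE x in lebesgue. indicator K x *\<^sub>R v x = indicator K x *\<^sub>R v' x"
      using vv' by eventually_elim (use K(2) in \<open>auto simp: indicator_def\<close>)
    from integrable_cong_AE_imp[OF Lp_loc_1_integrable[OF vL K] * this]
    show "integrable lebesgue (\<lambda>x. indicator K x *\<^sub>R v' x)" .
  qed
  show ?thesis
    unfolding has_weak_gradient_def
  proof (intro conjI ballI L1 L2)
    fix \<phi> assume \<phi>: "\<phi> \<in> test_functions U"
    have "(LINT x:U|lebesgue. f x *\<^sub>R grad \<phi> x) = (LINT x:U|lebesgue. f' x *\<^sub>R grad \<phi> x)"
      unfolding set_lebesgue_integral_def
    proof (rule integral_cong_AE)
      show "AE x in lebesgue. indicator U x *\<^sub>R f x *\<^sub>R grad \<phi> x = indicator U x *\<^sub>R f' x *\<^sub>R grad \<phi> x"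
        using ff' by eventually_elim (auto simp: indicator_def)
    qed (rule borel_measurable_integrable[OF Lp_loc_1_grad_integrable[OF fL \<phi>]]
        borel_measurable_integrable[OF Lp_loc_1_grad_integrable[OF L1 \<phi>]])+
    moreover have "(LINT x:U|lebesgue. \<phi> x *\<^sub>R v x) = (LINT x:U|lebesgue. \<phi> x *\<^sub>R v' x)"
      unfolding set_lebesgue_integral_def
    proof (rule integral_cong_AE)
      show "AE x in lebesgue. indicator U x *\<^sub>R \<phi> x *\<^sub>R v x = indicator U x *\<^sub>R \<phi> x *\<^sub>R v' x"
        using vv' by eventually_elim (auto simp: indicator_def)
    qed (rule borel_measurable_integrable[OF Lp_loc_1_mult_integrable[OF vL \<phi>]]
        borel_measurable_integrable[OF Lp_loc_1_mult_integrable[OF L2 \<phi>]])+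
    ultimately show "(LINT x:U|lebesgue. f' x *\<^sub>R grad \<phi> x) = - (LINT x:U|lebesgue. \<phi> x *\<^sub>R v' x)"
      using f \<phi> by (simp add: has_weak_gradient_def)
  qed
qed

lemma trunc_simps:
  assumes "0 < k"
  shows "\<bar>t\<bar> \<le> k \<Longrightarrow> trunc k t = t" "\<bar>trunc k t\<bar> \<le> k" "k \<le> m \<Longrightarrow> trunc k (trunc m t) = trunc k t"
    "k \<le> m \<Longrightarrow> (\<bar>trunc m t\<bar> < k) = (\<bar>t\<bar> < k)"
  using assms by (auto simp: trunc_def max_def min_def abs_if split: if_splits)

lemma bounded_Borel_open_interval: "bounded_Borel (indicator {a<..<b}) 1"
  by (rule bounded_Borel_indicator) simp

lemma trunc_continuous: "continuous_on UNIV (trunc k)"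
  unfolding trunc_def[abs_def] by (intro continuous_intros)

lemma prim_trunc:
  assumes k: "0 < k"
  shows "prim (indicator {-k<..<k}) t = trunc k t"
proof -
  have "prim (indicator {-k<..<k}) t = trunc k t - trunc k 0"
  proof (rule prim_eqI[OF bounded_Borel_open_interval trunc_continuous, of "{-k, k}"])
    fix t assume "t \<notin> {-k, k}"
    then consider "t < -k" | "-k < t" "t < k" | "k < t" by force
    then show "(trunc k has_real_derivative indicator {-k<..<k} t) (at t)"
    proof cases
      case 1
      have "((\<lambda>_. -k) has_real_derivative 0) (at t)" by simp
      then have "(trunc k has_real_derivative 0) (at t)"
        by (rule has_field_derivative_transform_within_open[of _ _ _ "{..<-k}"]) (use 1 k in \<open>auto simp: trunc_def\<close>)
      then show ?thesis using 1 by simp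
    next
      case 2
      have "((\<lambda>t. t) has_real_derivative 1) (at t)" by simp
      then have "(trunc k has_real_derivative 1) (at t)"
        by (rule has_field_derivative_transform_within_open[of _ _ _ "{-k<..<k}"]) (use 2 k in \<open>auto simp: trunc_def\<close>)
      then show ?thesis using 2 by simp
    next
      case 3
      have "((\<lambda>_. k) has_real_derivative 0) (at t)" by simp
      then have "(trunc k has_real_derivative 0) (at t)"
        by (rule has_field_derivative_transform_within_open[of _ _ _ "{k<..}"]) (use 3 k in \<open>auto simp: trunc_def\<close>)
      then show ?thesis using 3 by simp
    qed
  qed simp
  then show ?thesis using k by (simp add: trunc_def)
qed

text \<open>A truncation of a truncation at a higher level: \<open>trunc k\<close> is the primitive of the indicator of an
  interval, so the chain rule applies.\<close>

lemma weak_gradient_trunc: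
  assumes U: "open U" and f: "has_weak_gradient U (trunc m \<circ> u) v" and k: "0 < k" "k \<le> m"
  shows "has_weak_gradient U (trunc k \<circ> u) (\<lambda>x. indicator {x. \<bar>u x\<bar> < k} x *\<^sub>R v x)"
proof -
  have "has_weak_gradient U (\<lambda>x. prim (indicator {-k<..<k}) ((trunc m \<circ> u) x))
      (\<lambda>x. indicator {-k<..<k} ((trunc m \<circ> u) x) *\<^sub>R v x)"
    by (rule chain_rule[OF U f bounded_Borel_open_interval])
  moreover have "indicator {-k<..<k} (trunc m (u x)) = (indicator {x. \<bar>u x\<bar> < k} x :: real)" for x
    using trunc_simps(4)[OF k(1,2), of "u x"] by (auto simp: indicator_def)
  ultimately show ?thesis
    using trunc_simps(3)[OF k(1,2)] by (simp add: prim_trunc[OF k(1)] o_def)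
qed

text \<open>The weak gradients of two truncations agree where both truncations are inactive, so they can be
  glued along the level sets of \<open>u\<close>.\<close>

lemma generalized_gradient_exists:
  fixes u :: "'a::euclidean_space \<Rightarrow> real"
  assumes U: "open U" and um: "set_borel_measurable lebesgue U u" and W: "\<And>k. 0 < k \<Longrightarrow> trunc k \<circ> u \<in> W1_loc q U"
  shows "\<exists>v. has_generalized_gradient U u v"
proof -
  have "\<exists>v. has_weak_gradient U (trunc (real (Suc i)) \<circ> u) v" for i
    using W[of "real (Suc i)"] by (auto simp: W1_loc_def)
  then obtain vs where vs: "\<And>i. has_weak_gradient U (trunc (real (Suc i)) \<circ> u) (vs i)" by metis
  (* the truncation at height lev x + 1 is inactive at x *)
  define lev where "lev x = nat \<lfloor>\<bar>u x\<bar>\<rfloor>" for x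
  define v where "v x = vs (lev x) x" for x
  have lev: "\<bar>u x\<bar> < real (Suc (lev x))" for x
    unfolding lev_def by (simp add: add.commute) linarith
  have vL: "vs i \<in> Lp_loc 1 U" for i using vs[of i] by (simp add: has_weak_gradient_def)
  have um': "(\<lambda>x. indicator U x *\<^sub>R u x) \<in> borel_measurable lebesgue"
    using um by (simp add: set_borel_measurable_def)
  have vm: "(\<lambda>x. indicator U x *\<^sub>R v x) \<in> borel_measurable lebesgue"
  proof -
    have "(\<lambda>x. (\<lambda>i x. indicator U x *\<^sub>R vs i x) (nat \<lfloor>\<bar>indicator U x *\<^sub>R u x\<bar>\<rfloor>) x) \<in> borel_measurable lebesgue"
    proof (rule measurable_compose_countable)
      show "(\<lambda>x. nat \<lfloor>\<bar>indicator U x *\<^sub>R u x\<bar>\<rfloor>) \<in> lebesgue \<rightarrow>\<^sub>M count_space UNIV"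
        using um' by measurable
    qed (rule Lp_loc_measurable[OF vL])
    also have "(\<lambda>x. (\<lambda>i x. indicator U x *\<^sub>R vs i x) (nat \<lfloor>\<bar>indicator U x *\<^sub>R u x\<bar>\<rfloor>) x) = (\<lambda>x. indicator U x *\<^sub>R v x)"
      by (auto simp: v_def lev_def indicator_def)
    finally show ?thesis .
  qed
  have agree: "AE x in lebesgue. x \<in> U \<longrightarrow> \<bar>u x\<bar> < real (Suc i) \<longrightarrow> vs i x = vs j x" if "i \<le> j" for i j
  proof -
    have "has_weak_gradient U (trunc (real (Suc i)) \<circ> u) (\<lambda>x. indicator {x. \<bar>u x\<bar> < real (Suc i)} x *\<^sub>R vs j x)"
      by (rule weak_gradient_trunc[OF U vs[of j]]) (use that in auto)
    from weak_gradient_unique[OF U vs[of i] this] show ?thesis by eventually_elim auto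
  qed
  have "has_weak_gradient U (trunc k \<circ> u) (\<lambda>x. indicator {x. \<bar>u x\<bar> < k} x *\<^sub>R v x)" if k: "k > 0" for k
  proof -
    define M where "M = nat \<lceil>k\<rceil>"
    have M: "k \<le> real (Suc M)" "k \<le> real M" unfolding M_def by linarith+
    have wM: "has_weak_gradient U (trunc k \<circ> u) (\<lambda>x. indicator {x. \<bar>u x\<bar> < k} x *\<^sub>R vs M x)"
      by (rule weak_gradient_trunc[OF U vs[of M] k M(1)])
    show ?thesis
    proof (rule weak_gradient_cong[OF U wM])
      show "AE x in lebesgue. x \<in> U \<longrightarrow> (trunc k \<circ> u) x = (trunc k \<circ> u) x" by simp
      have "AE x in lebesgue. \<forall>i\<in>{..M}. x \<in> U \<longrightarrow> \<bar>u x\<bar> < real (Suc i) \<longrightarrow> vs i x = vs M x"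
        by (rule AE_finite_allI) (use agree in auto)
      then show "AE x in lebesgue. x \<in> U \<longrightarrow> indicator {x. \<bar>u x\<bar> < k} x *\<^sub>R vs M x = indicator {x. \<bar>u x\<bar> < k} x *\<^sub>R v x"
      proof eventually_elim
        case (elim x)
        show ?case
        proof (cases "\<bar>u x\<bar> < k")
          case True
          then have "\<bar>u x\<bar> < real M" using M(2) by simp
          then have "lev x \<le> M" unfolding lev_def by linarith
          then have mem: "lev x \<in> {..M}" by simp
          show ?thesis
          proof
            assume "x \<in> U"
            have "vs (lev x) x = vs M x" by (rule elim[rule_format, OF mem \<open>x \<in> U\<close> lev])
            then show "indicator {x. \<bar>u x\<bar> < k} x *\<^sub>R vs M x = indicator {x. \<bar>u x\<bar> < k} x *\<^sub>R v x"
              by (simp add: v_def)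
          qed
        qed simp
      qed
      show "(\<lambda>x. indicat_real U x *\<^sub>R (trunc k \<circ> u) x) \<in> borel_measurable lebesgue"
        by (rule Lp_loc_measurable[of _ 1]) (rule conjunct1[OF wM[unfolded has_weak_gradient_def]])
      have "(\<lambda>x. indicator {t. \<bar>t\<bar> < k} (indicator U x *\<^sub>R u x) *\<^sub>R (indicator U x *\<^sub>R v x)) \<in> borel_measurable lebesgue"
        by (intro borel_measurable_scaleR vm measurable_compose[OF um' borel_measurable_indicator]) measurable
      also have "(\<lambda>x. indicator {t. \<bar>t\<bar> < k} (indicator U x *\<^sub>R u x) *\<^sub>R (indicator U x *\<^sub>R v x))
          = (\<lambda>x. indicator U x *\<^sub>R (indicator {x. \<bar>u x\<bar> < k} x *\<^sub>R v x))"
        by (auto simp: indicator_def fun_eq_iff)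
      finally show "(\<lambda>x. indicator U x *\<^sub>R (indicator {x. \<bar>u x\<bar> < k} x *\<^sub>R v x)) \<in> borel_measurable lebesgue" .
    qed
  qed
  then show ?thesis
    using vm by (auto simp: has_generalized_gradient_def set_borel_measurable_def)
qed

lemma integral_AE_Borel:
  fixes h :: "'a::euclidean_space \<Rightarrow> 'b::euclidean_space"
  assumes h': "h' \<in> borel_measurable borel" and ae: "AE x in lebesgue. h x = h' x"
  shows "(\<integral>x. h x \<partial>lebesgue) = (LBINT x. h' x)" "integrable lebesgue h \<longleftrightarrow> integrable lborel h'"
proof -
  have "AE x in lebesgue. h' x = h x" using ae by eventually_elim simp
  then have "h \<in> borel_measurable lebesgue" by (rule borel_measurable_AE[OF Borel_lebesgue[OF h']])
  moreover have "AE x in lborel. h x = h' x" using ae by (simp add: AE_completion_iff)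
  ultimately show "(\<integral>x. h x \<partial>lebesgue) = (LBINT x. h' x)" "integrable lebesgue h \<longleftrightarrow> integrable lborel h'"
    using integral_representative[OF _ h'] by blast+
qed

lemma pq_flux_measurable [measurable]: "pq_flux p q \<in> borel_measurable borel"
  unfolding pq_flux_def[abs_def] by measurable

lemma prim_const_outside:
  assumes R: "0 < R" and g: "\<forall>t. R < \<bar>t\<bar> \<longrightarrow> g t = 0"
  shows "R \<le> t \<Longrightarrow> prim g t = prim g R" "t \<le> - R \<Longrightarrow> prim g t = prim g (- R)"
  unfolding prim_def using assms
  by (auto intro!: Bochner_Integration.integral_cong)

text \<open>The measure terms have a sign for nonnegative \<open>h\<close> and \<open>\<phi>\<close>, which turns the renormalized identity into
  an inequality without them.  The functions \<open>u\<close> and \<open>D\<close> are Borel representatives of the solution and of its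
  generalized gradient.\<close>

definition renorm_super :: "real \<Rightarrow> real \<Rightarrow> 'a::euclidean_space set \<Rightarrow> ('a \<Rightarrow> real) \<Rightarrow> ('a \<Rightarrow> 'a) \<Rightarrow> bool" where
  "renorm_super p q \<Omega> u D \<longleftrightarrow> u \<in> borel_measurable borel \<and> D \<in> borel_measurable borel \<and>
    (\<forall>k>0. has_weak_gradient \<Omega> (trunc k \<circ> u) (\<lambda>x. indicator {x. \<bar>u x\<bar> < k} x *\<^sub>R D x)) \<and>
    (\<forall>k>0. \<forall>K. compact K \<longrightarrow> K \<subseteq> \<Omega> \<longrightarrow>
       integrable lborel (\<lambda>x. indicator K x * (indicator {x. \<bar>u x\<bar> < k} x * norm (D x) powr q))) \<and>
    (\<forall>g C R h \<phi>. bounded_Borel g C \<longrightarrow> (\<forall>t. R < \<bar>t\<bar> \<longrightarrow> g t = 0) \<longrightarrow> continuous_on UNIV h \<longrightarrow>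
       (\<forall>t. h t = h 0 + prim g t) \<longrightarrow> (\<forall>t. 0 \<le> h t) \<longrightarrow> \<phi> \<in> test_functions \<Omega> \<longrightarrow> (\<forall>x. 0 \<le> \<phi> x) \<longrightarrow>
       integrable lborel (\<lambda>x. (pq_flux p q (D x) \<bullet> grad \<phi> x) * h (u x)) \<and>
       0 \<le> (LBINT x. (norm (D x) powr p + norm (D x) powr q) * g (u x) * \<phi> x)
         + (LBINT x. (pq_flux p q (D x) \<bullet> grad \<phi> x) * h (u x)))"

text \<open>These functions are admissible in the renormalized identity.  They are constant off a bounded interval, which
  makes the values at infinity available.\<close>

lemma W1_infty_prim:
  assumes g: "bounded_Borel g C" and R: "0 < R" "\<forall>t. R < \<bar>t\<bar> \<longrightarrow> g t = 0"
    and h: "continuous_on UNIV h" "\<And>t. h t = h 0 + prim g t"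
  shows "h \<in> W1_infty" "has_weak_gradient UNIV h g" "(h \<longlongrightarrow> h R) at_top" "(h \<longlongrightarrow> h (- R)) at_bot"
proof -
  note out = prim_const_outside[where g = g, OF R]
  have "has_weak_gradient UNIV (\<lambda>t. prim g t) (\<lambda>t. g t *\<^sub>R 1)"
    by (rule chain_rule[OF open_UNIV weak_gradient_id g])
  from weak_gradient_diff[OF this weak_gradient_const[OF open_UNIV, of "- h 0"]]
  have "has_weak_gradient UNIV (\<lambda>t. prim g t + h 0) g" by simp
  also have "(\<lambda>t. prim g t + h 0) = h" by (rule ext) (simp add: h(2)[symmetric] add.commute)
  finally show wg: "has_weak_gradient UNIV h g" .
  have top: "h t = h R" if "R \<le> t" for t using h(2)[of t] h(2)[of R] out(1)[OF that] by simp
  have bot: "h t = h (- R)" if "t \<le> - R" for t using h(2)[of t] h(2)[of "- R"] out(2)[OF that] by simp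
  show "(h \<longlongrightarrow> h R) at_top"
    by (rule tendsto_eventually, rule eventually_mono[OF eventually_ge_at_top[of R]], rule top)
  show "(h \<longlongrightarrow> h (- R)) at_bot"
    by (rule tendsto_eventually, rule eventually_mono[OF eventually_le_at_bot[of "- R"]], rule bot)
  have "\<bar>h t\<bar> \<le> \<bar>h 0\<bar> + 2 * C * R" for t
  proof -
    define s where "s = max (- R) (min R t)"
    have "h t = h s" using top[of t] bot[of t] R(1) by (cases "R \<le> t"; cases "t \<le> - R") (auto simp: s_def max_def min_def)
    also have "\<bar>h s\<bar> \<le> \<bar>h 0\<bar> + \<bar>prim g s\<bar>" using h(2)[of s] by simp
    also have "\<bar>prim g s\<bar> \<le> 2 * C * \<bar>s\<bar>" by (rule prim_bound[OF g])
    also have "\<dots> \<le> 2 * C * R"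
      using bounded_BorelD(3)[OF g] R(1) by (intro mult_left_mono) (auto simp: s_def)
    finally show ?thesis by simp
  qed
  then have "bounded (range h)" by (auto simp: bounded_iff)
  then show "h \<in> W1_infty"
    using h(1) wg bounded_BorelD(2)[OF g] by (auto simp: W1_infty_def intro!: exI[of _ g] exI[of _ C])
qed

text \<open>The weak gradient that the definition attaches to \<open>h\<close> agrees with \<open>g\<close> off a null set \<open>N\<close>.  Where \<open>u\<close> takes values
  in \<open>N\<close> its gradient vanishes, so composing with \<open>u\<close> does no harm.\<close>

lemma renormalized_representative:
  fixes \<Omega> :: "'a::euclidean_space set"
  assumes O: "open \<Omega>" and sol: "local_renormalized_solution p q \<Omega> \<mu> u"
  obtains u0 D where "renorm_super p q \<Omega> u0 D" "AE x in lebesgue. x \<in> \<Omega> \<longrightarrow> u0 x = u x"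
    "\<And>m K. 1 \<le> m \<Longrightarrow> (q < real DIM('a) \<longrightarrow> m < real DIM('a) / (real DIM('a) - q)) \<Longrightarrow> compact K \<Longrightarrow> K \<subseteq> \<Omega> \<Longrightarrow>
       integrable lborel (\<lambda>x. indicator K x * \<bar>u0 x\<bar> powr ((q - 1) * m))"
proof -
  have Ob [measurable]: "\<Omega> \<in> sets borel" using O by simp
  define Du where "Du = generalized_grad \<Omega> u"
  have um: "set_borel_measurable lebesgue \<Omega> u"
    and uW: "\<And>k. 0 < k \<Longrightarrow> trunc k \<circ> u \<in> W1_loc q \<Omega>"
    and uL: "\<And>m. 1 \<le> m \<Longrightarrow> (q < real DIM('a) \<longrightarrow> m < real DIM('a) / (real DIM('a) - q)) \<Longrightarrow>
        (\<lambda>x. \<bar>u x\<bar> powr (q - 1)) \<in> Lp_loc m \<Omega>"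
    using sol by (auto simp: local_renormalized_solution_def)
  obtain \<mu>0 \<mu>s v where key: "\<And>h \<phi>. h \<in> W1_infty \<Longrightarrow> (\<exists>R. AE t in lebesgue. R < \<bar>t\<bar> \<longrightarrow> weak_grad UNIV h t = 0) \<Longrightarrow>
      \<phi> \<in> test_functions \<Omega> \<Longrightarrow>
      set_integrable lebesgue \<Omega> (\<lambda>x. (pq_flux p q (Du x) \<bullet> grad \<phi> x) * h (u x)) \<and>
      (LINT x:\<Omega>|lebesgue. (norm (Du x) powr p + norm (Du x) powr q) * weak_grad UNIV h (u x) * \<phi> x)
      + (LINT x:\<Omega>|lebesgue. (pq_flux p q (Du x) \<bullet> grad \<phi> x) * h (u x))
      = (LINT x|completion \<mu>0. extend_ereal h (v x) * \<phi> x) + Lim at_top h * (LINT x|\<mu>s. \<phi> x)"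
    using sol unfolding local_renormalized_solution_def Let_def Du_def by blast
  have G: "has_generalized_gradient \<Omega> u Du"
    unfolding Du_def generalized_grad_def by (rule someI_ex[OF generalized_gradient_exists[OF O um uW]])
  have Gk: "has_weak_gradient \<Omega> (trunc k \<circ> u) (\<lambda>x. indicator {x. \<bar>u x\<bar> < k} x *\<^sub>R Du x)" if "0 < k" for k
    using G that by (simp add: has_generalized_gradient_def)
  obtain u0 where u0 [measurable]: "u0 \<in> borel_measurable borel" and u0_ae: "AE x in lborel. indicator \<Omega> x *\<^sub>R u x = u0 x"
    using lebesgue_Borel_representative[of "\<lambda>x. indicator \<Omega> x *\<^sub>R u x"] um by (auto simp: set_borel_measurable_def)
  obtain D where D [measurable]: "D \<in> borel_measurable borel" and D_ae: "AE x in lborel. indicator \<Omega> x *\<^sub>R Du x = D x"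
    using lebesgue_Borel_representative[of "\<lambda>x. indicator \<Omega> x *\<^sub>R Du x"] G
    by (auto simp: has_generalized_gradient_def set_borel_measurable_def)
  have ae: "AE x in lebesgue. indicator \<Omega> x *\<^sub>R u x = u0 x \<and> indicator \<Omega> x *\<^sub>R Du x = D x"
    using u0_ae D_ae by (simp add: AE_completion_iff)
  have aeO: "AE x in lebesgue. x \<in> \<Omega> \<longrightarrow> u x = u0 x \<and> Du x = D x"
    using ae by eventually_elim auto
  have F1: "has_weak_gradient \<Omega> (trunc k \<circ> u0) (\<lambda>x. indicator {x. \<bar>u0 x\<bar> < k} x *\<^sub>R D x)" if k: "0 < k" for k
  proof (rule weak_gradient_cong[OF O Gk[OF k]])
    show "AE x in lebesgue. x \<in> \<Omega> \<longrightarrow> (trunc k \<circ> u) x = (trunc k \<circ> u0) x" using aeO by eventually_elim auto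
    show "AE x in lebesgue. x \<in> \<Omega> \<longrightarrow> indicator {x. \<bar>u x\<bar> < k} x *\<^sub>R Du x = indicator {x. \<bar>u0 x\<bar> < k} x *\<^sub>R D x"
      using aeO by eventually_elim (auto simp: indicator_def)
    have [measurable]: "trunc k \<in> borel_measurable borel"
      by (rule borel_measurable_continuous_onI[OF trunc_continuous])
    show "(\<lambda>x. indicat_real \<Omega> x *\<^sub>R (trunc k \<circ> u0) x) \<in> borel_measurable lebesgue"
      by (rule Borel_lebesgue) (unfold o_def, measurable)
    show "(\<lambda>x. indicat_real \<Omega> x *\<^sub>R indicat_real {x. \<bar>u0 x\<bar> < k} x *\<^sub>R D x) \<in> borel_measurable lebesgue"
      by (rule Borel_lebesgue) measurable
  qed
  have F2: "integrable lborel (\<lambda>x. indicator K x * (indicator {x. \<bar>u0 x\<bar> < k} x * norm (D x) powr q))"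
    if k: "0 < k" and K: "compact K" "K \<subseteq> \<Omega>" for k K
  proof -
    have [measurable]: "K \<in> sets borel" by (rule borel_compact[OF K(1)])
    obtain w where w: "w \<in> Lp_loc q \<Omega>" "has_weak_gradient \<Omega> (trunc k \<circ> u) w"
      using uW[OF k] by (auto simp: W1_loc_def)
    have i: "integrable lebesgue (\<lambda>x. indicator K x *\<^sub>R (norm (w x) powr q))"
      using w(1) K by (auto simp: Lp_loc_def set_integrable_def)
    have "AE x in lebesgue. indicator K x *\<^sub>R (norm (w x) powr q) = indicator K x * (indicator {x. \<bar>u0 x\<bar> < k} x * norm (D x) powr q)"
      using aeO weak_gradient_unique[OF O w(2) Gk[OF k]]
      by eventually_elim (use K(2) in \<open>auto simp: indicator_def\<close>)
    from integral_AE_Borel(2)[OF _ this] i show ?thesis by simp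
  qed
  have F3: "integrable lborel (\<lambda>x. indicator K x * \<bar>u0 x\<bar> powr ((q - 1) * m))"
    if m: "1 \<le> m" "q < real DIM('a) \<longrightarrow> m < real DIM('a) / (real DIM('a) - q)" and K: "compact K" "K \<subseteq> \<Omega>" for m K
  proof -
    have [measurable]: "K \<in> sets borel" by (rule borel_compact[OF K(1)])
    have i: "integrable lebesgue (\<lambda>x. indicator K x *\<^sub>R (norm (\<bar>u x\<bar> powr (q - 1)) powr m))"
      using uL[OF m] K by (auto simp: Lp_loc_def set_integrable_def)
    have "AE x in lebesgue. indicator K x *\<^sub>R (norm (\<bar>u x\<bar> powr (q - 1)) powr m) = indicator K x * \<bar>u0 x\<bar> powr ((q - 1) * m)"
      using aeO by eventually_elim (use K(2) in \<open>auto simp: indicator_def powr_powr\<close>)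
    from integral_AE_Borel(2)[OF _ this] i show ?thesis by simp
  qed
  have F4: "integrable lborel (\<lambda>x. (pq_flux p q (D x) \<bullet> grad \<phi> x) * h (u0 x)) \<and>
       0 \<le> (LBINT x. (norm (D x) powr p + norm (D x) powr q) * g (u0 x) * \<phi> x)
         + (LBINT x. (pq_flux p q (D x) \<bullet> grad \<phi> x) * h (u0 x))"
    if g: "bounded_Borel g C" and gR: "\<forall>t. R < \<bar>t\<bar> \<longrightarrow> g t = 0" and hc: "continuous_on UNIV h" and hp: "\<forall>t. h t = h 0 + prim g t"
      and h0: "\<forall>t. 0 \<le> h t" and \<phi>: "\<phi> \<in> test_functions \<Omega>" and \<phi>0: "\<forall>x. 0 \<le> \<phi> x" for g C R h \<phi>
  proof -
    have R1: "0 < \<bar>R\<bar> + 1" by simp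
    have gR': "\<forall>t. \<bar>R\<bar> + 1 < \<bar>t\<bar> \<longrightarrow> g t = 0"
    proof safe
      fix t assume "\<bar>R\<bar> + 1 < \<bar>t\<bar>"
      then have "R < \<bar>t\<bar>" using abs_ge_self[of R] by linarith
      then show "g t = 0" using gR by blast
    qed
    note W = W1_infty_prim[where g = g, OF g R1 gR' hc hp[rule_format]]
    have wg: "has_weak_gradient UNIV h (weak_grad UNIV h)"
      unfolding weak_grad_def by (rule someI[where P = "has_weak_gradient UNIV h", OF W(2)])
    have "AE t in lebesgue. weak_grad UNIV h t = g t"
      using weak_gradient_unique[OF open_UNIV wg W(2)] by simp
    then have wgg: "AE t in lborel. weak_grad UNIV h t = g t" by (simp add: AE_completion_iff)
    then obtain N where N: "N \<in> null_sets lborel" "\<And>t. t \<notin> N \<Longrightarrow> weak_grad UNIV h t = g t"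
      by (auto elim!: AE_E3)
    have "AE t in lebesgue. \<bar>R\<bar> + 1 < \<bar>t\<bar> \<longrightarrow> weak_grad UNIV h t = 0"
      using \<open>AE t in lebesgue. weak_grad UNIV h t = g t\<close> by eventually_elim (use gR' in auto)
    note k = key[OF W(1) exI[of "\<lambda>R. AE t in lebesgue. R < \<bar>t\<bar> \<longrightarrow> weak_grad UNIV h t = 0", OF this] \<phi>]
    note [measurable] = test_borel[OF \<phi>] bounded_BorelD(1)[OF g] borel_measurable_continuous_onI[OF hc]
    have zero: "AE x in lebesgue. x \<in> \<Omega> \<longrightarrow> u x \<in> N \<longrightarrow> Du x = 0"
    proof -
      have "AE x in lebesgue. \<forall>i::nat. x \<in> \<Omega> \<longrightarrow> trunc (real (Suc i)) (u x) \<in> N \<longrightarrow> indicator {x. \<bar>u x\<bar> < real (Suc i)} x *\<^sub>R Du x = 0"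
        unfolding AE_all_countable
        using weak_gradient_zero_on_null_preimage[OF O Gk N(1)] by (simp add: o_def)
      then show ?thesis
      proof eventually_elim
        case (elim x)
        obtain i :: nat where i: "\<bar>u x\<bar> < real i" using reals_Archimedean2 by blast
        then have "trunc (real (Suc i)) (u x) = u x" by (intro trunc_simps(1)) auto
        then show ?case using elim[rule_format, of i] i by simp
      qed
    qed
    have e1: "(LINT x:\<Omega>|lebesgue. (norm (Du x) powr p + norm (Du x) powr q) * weak_grad UNIV h (u x) * \<phi> x)
        = (LBINT x. (norm (D x) powr p + norm (D x) powr q) * g (u0 x) * \<phi> x)"
      unfolding set_lebesgue_integral_def
    proof (rule integral_AE_Borel(1))
      show "AE x in lebesgue. indicator \<Omega> x *\<^sub>R ((norm (Du x) powr p + norm (Du x) powr q) * weak_grad UNIV h (u x) * \<phi> x)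
          = (norm (D x) powr p + norm (D x) powr q) * g (u0 x) * \<phi> x"
        using aeO zero
      proof eventually_elim
        case (elim x)
        show ?case
        proof (cases "x \<in> \<Omega>")
          case True
          then show ?thesis using elim N(2)[of "u x"] by (cases "u x \<in> N") auto
        next
          case False
          then show ?thesis using test_zero[OF \<phi>] by simp
        qed
      qed
    qed measurable
    have ae2: "AE x in lebesgue. indicator \<Omega> x *\<^sub>R ((pq_flux p q (Du x) \<bullet> grad \<phi> x) * h (u x))
          = (pq_flux p q (D x) \<bullet> grad \<phi> x) * h (u0 x)"
      using aeO
    proof eventually_elim
      case (elim x)
      then show ?case using test_zero[OF \<phi>] by (cases "x \<in> \<Omega>") auto
    qed
    have m2: "(\<lambda>x. (pq_flux p q (D x) \<bullet> grad \<phi> x) * h (u0 x)) \<in> borel_measurable borel" by measurable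
    have e2: "(LINT x:\<Omega>|lebesgue. (pq_flux p q (Du x) \<bullet> grad \<phi> x) * h (u x))
        = (LBINT x. (pq_flux p q (D x) \<bullet> grad \<phi> x) * h (u0 x))"
      unfolding set_lebesgue_integral_def by (rule integral_AE_Borel(1)[OF m2 ae2])
    have i2: "integrable lborel (\<lambda>x. (pq_flux p q (D x) \<bullet> grad \<phi> x) * h (u0 x))"
      using k integral_AE_Borel(2)[OF m2 ae2] by (simp add: set_integrable_def)
    have L: "Lim at_top h = h (\<bar>R\<bar> + 1)" "Lim at_bot h = h (- (\<bar>R\<bar> + 1))"
      by (rule tendsto_Lim[OF _ W(3)] tendsto_Lim[OF _ W(4)], simp)+
    have "0 \<le> extend_ereal h y" for y using h0 by (auto simp: extend_ereal_def L)
    then have "0 \<le> (LINT x|completion \<mu>0. extend_ereal h (v x) * \<phi> x)"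
      using \<phi>0 by (intro Bochner_Integration.integral_nonneg) auto
    moreover have "0 \<le> Lim at_top h * (LINT x|\<mu>s. \<phi> x)"
      using h0 \<phi>0 by (intro mult_nonneg_nonneg Bochner_Integration.integral_nonneg) (auto simp: L)
    ultimately show ?thesis using k i2 unfolding e1 e2 by linarith
  qed
  show ?thesis
  proof (rule that)
    show "renorm_super p q \<Omega> u0 D"
      unfolding renorm_super_def
      by (intro conjI allI impI u0 D F1 F2) (assumption | rule F4[THEN conjunct1] F4[THEN conjunct2])+
    show "AE x in lebesgue. x \<in> \<Omega> \<longrightarrow> u0 x = u x" using aeO by eventually_elim auto
  qed (rule F3)
qed

section \<open>Energy estimates\<close>

lemma integral_incseq_bounded:
  fixes f :: "nat \<Rightarrow> 'a::euclidean_space \<Rightarrow> real"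
  assumes i: "\<And>n. integrable lborel (f n)" and m: "\<And>x. incseq (\<lambda>n. f n x)" and l: "\<And>x. (\<lambda>n. f n x) \<longlonglongrightarrow> g x"
    and g: "g \<in> borel_measurable borel" and b: "\<And>n. (LBINT x. f n x) \<le> C"
  shows "integrable lborel g" "(LBINT x. g x) \<le> C"
proof -
  have inc: "incseq (\<lambda>n. LBINT x. f n x)"
    using m by (auto simp: incseq_def intro!: integral_mono i)
  obtain L where L: "(\<lambda>n. LBINT x. f n x) \<longlonglongrightarrow> L"
    using incseq_convergent[OF inc, of C] b by blast
  show gi: "integrable lborel g"
    by (rule integrable_monotone_convergence[of lborel f, OF i _ _ L]) (use m l g in \<open>auto simp: incseq_def mono_def\<close>)
  have "(LBINT x. g x) = L"
    by (rule integral_monotone_convergence[of lborel f, OF i _ _ L]) (use m l g in \<open>auto simp: incseq_def mono_def\<close>)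
  moreover have "L \<le> C" by (rule LIMSEQ_le_const2[OF L]) (use b in auto)
  ultimately show "(LBINT x. g x) \<le> C" by simp
qed

text \<open>Integrate Young's inequality for \<open>f\<close> and \<open>g\<close> divided by their integrals.\<close>

lemma Hoelder_interpolation:
  fixes f g :: "'a::euclidean_space \<Rightarrow> real"
  assumes f: "integrable lborel f" "\<And>x. 0 \<le> f x" and g: "integrable lborel g" "\<And>x. 0 \<le> g x"
    and a: "0 < \<alpha>" "\<alpha> < 1"
  shows "integrable lborel (\<lambda>x. f x powr \<alpha> * g x powr (1 - \<alpha>))"
    "(LBINT x. f x powr \<alpha> * g x powr (1 - \<alpha>)) \<le> (LBINT x. f x) powr \<alpha> * (LBINT x. g x) powr (1 - \<alpha>)"
proof -
  have [measurable]: "f \<in> borel_measurable borel" "g \<in> borel_measurable borel"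
    using borel_measurable_integrable[OF f(1)] borel_measurable_integrable[OF g(1)] by simp_all
  have young: "s powr \<alpha> * t powr (1 - \<alpha>) \<le> \<alpha> * s + (1 - \<alpha>) * t" if "0 \<le> s" "0 \<le> t" for s t :: real
  proof (cases "s = 0 \<or> t = 0")
    case True
    then show ?thesis using that a by auto
  next
    case False
    then show ?thesis using that a by (intro Youngs_inequality_0) auto
  qed
  show i: "integrable lborel (\<lambda>x. f x powr \<alpha> * g x powr (1 - \<alpha>))"
  proof (rule Bochner_Integration.integrable_bound)
    show "integrable lborel (\<lambda>x. \<alpha> * f x + (1 - \<alpha>) * g x)" using f(1) g(1) by simp
    show "AE x in lborel. norm (f x powr \<alpha> * g x powr (1 - \<alpha>)) \<le> norm (\<alpha> * f x + (1 - \<alpha>) * g x)"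
      using young[OF f(2) g(2)] by (intro AE_I2) (auto intro: order_trans[OF _ abs_ge_self])
  qed measurable
  let ?F = "LBINT x. f x" and ?G = "LBINT x. g x"
  have F0: "0 \<le> ?F" using f(2) by simp
  have G0: "0 \<le> ?G" using g(2) by simp
  show "(LBINT x. f x powr \<alpha> * g x powr (1 - \<alpha>)) \<le> ?F powr \<alpha> * ?G powr (1 - \<alpha>)"
  proof (cases "?F = 0 \<or> ?G = 0")
    case True
    then have "(AE x in lborel. f x = 0) \<or> (AE x in lborel. g x = 0)"
      using integral_nonneg_eq_0_iff_AE[OF f(1)] integral_nonneg_eq_0_iff_AE[OF g(1)] f(2) g(2) by auto
    then have "AE x in lborel. f x powr \<alpha> * g x powr (1 - \<alpha>) = 0"
    proof
      assume "AE x in lborel. f x = 0"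
      then show ?thesis by eventually_elim simp
    next
      assume "AE x in lborel. g x = 0"
      then show ?thesis by eventually_elim simp
    qed
    then have "(LBINT x. f x powr \<alpha> * g x powr (1 - \<alpha>)) = 0" by (rule integral_eq_zero_AE)
    then show ?thesis by simp
  next
    case False
    then have pos: "0 < ?F" "0 < ?G" using F0 G0 by auto
    have eq: "f x powr \<alpha> * g x powr (1 - \<alpha>) = (?F powr \<alpha> * ?G powr (1 - \<alpha>)) * ((f x / ?F) powr \<alpha> * (g x / ?G) powr (1 - \<alpha>))" for x
      using pos f(2)[of x] g(2)[of x] by (simp add: powr_divide)
    have cancel: "c \<noteq> 0 \<Longrightarrow> inverse c * (c * t) = t" for c t :: real by simp
    have "(LBINT x. (f x / ?F) powr \<alpha> * (g x / ?G) powr (1 - \<alpha>)) \<le> (LBINT x. \<alpha> * (f x / ?F) + (1 - \<alpha>) * (g x / ?G))"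
    proof (rule integral_mono)
      have "integrable lborel (\<lambda>x. inverse (?F powr \<alpha> * ?G powr (1 - \<alpha>)) * (f x powr \<alpha> * g x powr (1 - \<alpha>)))"
        using i by simp
      also have "(\<lambda>x. inverse (?F powr \<alpha> * ?G powr (1 - \<alpha>)) * (f x powr \<alpha> * g x powr (1 - \<alpha>)))
          = (\<lambda>x. (f x / ?F) powr \<alpha> * (g x / ?G) powr (1 - \<alpha>))"
      proof
        fix x
        have "?F powr \<alpha> * ?G powr (1 - \<alpha>) \<noteq> 0" using pos by simp
        then show "inverse (?F powr \<alpha> * ?G powr (1 - \<alpha>)) * (f x powr \<alpha> * g x powr (1 - \<alpha>))
          = (f x / ?F) powr \<alpha> * (g x / ?G) powr (1 - \<alpha>)"
          unfolding eq by (rule cancel)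
      qed
      finally show "integrable lborel (\<lambda>x. (f x / ?F) powr \<alpha> * (g x / ?G) powr (1 - \<alpha>))" .
      show "integrable lborel (\<lambda>x. \<alpha> * (f x / ?F) + (1 - \<alpha>) * (g x / ?G))" using f(1) g(1) by simp
      show "(f x / ?F) powr \<alpha> * (g x / ?G) powr (1 - \<alpha>) \<le> \<alpha> * (f x / ?F) + (1 - \<alpha>) * (g x / ?G)" for x
        using pos f(2)[of x] g(2)[of x] by (intro young) auto
    qed
    also have "\<dots> = \<alpha> * (?F / ?F) + (1 - \<alpha>) * (?G / ?G)" using f(1) g(1) by simp
    also have "\<dots> = 1" using pos by simp
    finally have le: "(LBINT x. (f x / ?F) powr \<alpha> * (g x / ?G) powr (1 - \<alpha>)) \<le> 1" .
    have "(LBINT x. f x powr \<alpha> * g x powr (1 - \<alpha>))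
        = (?F powr \<alpha> * ?G powr (1 - \<alpha>)) * (LBINT x. (f x / ?F) powr \<alpha> * (g x / ?G) powr (1 - \<alpha>))"
      by (subst eq) simp
    also have "\<dots> \<le> (?F powr \<alpha> * ?G powr (1 - \<alpha>)) * 1" by (intro mult_left_mono le) simp
    finally show ?thesis by simp
  qed
qed

lemma prim_zero: "prim (\<lambda>_. 0) t = 0"
  unfolding prim_def by (rule integral_eq_zero_AE) auto

definition clip :: "real \<Rightarrow> real \<Rightarrow> real" where
  "clip M s = min M (max 0 s)"

text \<open>Functions of \<open>k - t\<close> clipped to an interval are primitives; the exceptional points are the two corners.\<close>

lemma prim_clip:
  assumes M: "0 < M" and G: "continuous_on {0..M} G" and D: "\<And>s. 0 < s \<Longrightarrow> s < M \<Longrightarrow> (G has_real_derivative G' s) (at s)"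
    and G'm [measurable]: "G' \<in> borel_measurable borel" and G'b: "\<And>s. 0 < s \<Longrightarrow> s < M \<Longrightarrow> \<bar>G' s\<bar> \<le> C" and C: "0 \<le> C"
  shows "bounded_Borel (\<lambda>t. if k - M < t \<and> t < k then - G' (k - t) else 0) C"
    "continuous_on UNIV (\<lambda>t. G (clip M (k - t)))"
    "prim (\<lambda>t. if k - M < t \<and> t < k then - G' (k - t) else 0) t = G (clip M (k - t)) - G (clip M (k - 0))"
proof -
  show bb: "bounded_Borel (\<lambda>t. if k - M < t \<and> t < k then - G' (k - t) else 0) C"
    unfolding bounded_Borel_def
  proof (intro conjI allI)
    show "(\<lambda>t. if k - M < t \<and> t < k then - G' (k - t) else 0) \<in> borel_measurable borel" by measurable
    show "\<bar>if k - M < t \<and> t < k then - G' (k - t) else 0\<bar> \<le> C" for t using G'b[of "k - t"] C by auto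
  qed
  show cont: "continuous_on UNIV (\<lambda>t. G (clip M (k - t)))"
  proof (rule continuous_on_compose2[OF G])
    show "continuous_on UNIV (\<lambda>t. clip M (k - t))" unfolding clip_def by (intro continuous_intros)
  qed (use M in \<open>auto simp: clip_def\<close>)
  show "prim (\<lambda>t. if k - M < t \<and> t < k then - G' (k - t) else 0) t = G (clip M (k - t)) - G (clip M (k - 0))"
  proof (rule prim_eqI[OF bb cont, of "{k - M, k}"])
    fix t assume "t \<notin> {k - M, k}"
    then consider "t < k - M" | "k - M < t" "t < k" | "k < t" by force
    then show "((\<lambda>t. G (clip M (k - t))) has_real_derivative (if k - M < t \<and> t < k then - G' (k - t) else 0)) (at t)"
    proof cases
      case 1
      have "((\<lambda>_. G M) has_real_derivative 0) (at t)" by simp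
      then have "((\<lambda>t. G (clip M (k - t))) has_real_derivative 0) (at t)"
        by (rule has_field_derivative_transform_within_open[of _ _ _ "{..<k - M}"]) (use 1 M in \<open>auto simp: clip_def min_def\<close>)
      then show ?thesis using 1 by simp
    next
      case 2
      have "((\<lambda>t. G (k - t)) has_real_derivative G' (k - t) * (0 - 1)) (at t)"
        by (rule DERIV_chain'[where f = "\<lambda>t. k - t" and g = G]) (use 2 in \<open>auto intro!: derivative_eq_intros D\<close>)
      then have "((\<lambda>t. G (k - t)) has_real_derivative - G' (k - t)) (at t)" by simp
      then have "((\<lambda>t. G (clip M (k - t))) has_real_derivative - G' (k - t)) (at t)"
        by (rule has_field_derivative_transform_within_open[of _ _ _ "{k - M<..<k}"]) (use 2 in \<open>auto simp: clip_def\<close>)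
      then show ?thesis using 2 by simp
    next
      case 3
      have "((\<lambda>_. G 0) has_real_derivative 0) (at t)" by simp
      then have "((\<lambda>t. G (clip M (k - t))) has_real_derivative 0) (at t)"
        by (rule has_field_derivative_transform_within_open[of _ _ _ "{k<..}"]) (use 3 M in \<open>auto simp: clip_def\<close>)
      then show ?thesis using 3 by simp
    qed
  qed simp
qed

lemma flux_bound:
  fixes \<xi> :: "'a::euclidean_space"
  assumes "1 < p" "p \<le> q"
  shows "norm (pq_flux p q \<xi>) \<le> 1 + 2 * norm \<xi> powr (q - 1)"
proof (cases "\<xi> = 0")
  case True
  then show ?thesis by (simp add: pq_flux_def)
next
  case False
  let ?a = "norm \<xi>"
  have a: "?a > 0" using False by simp
  have e: "?a powr (r - 2) * ?a = ?a powr (r - 1)" for r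
    using powr_mult_base[of ?a "r - 2"] a by (simp add: mult.commute)
  have "norm (pq_flux p q \<xi>) \<le> ?a powr (p - 2) * ?a + ?a powr (q - 2) * ?a"
    unfolding pq_flux_def by (rule order_trans[OF norm_triangle_ineq]) simp
  also have "\<dots> = ?a powr (p - 1) + ?a powr (q - 1)" by (simp add: e)
  also have "?a powr (p - 1) \<le> 1 + ?a powr (q - 1)"
  proof (cases "?a \<le> 1")
    case True
    then have "?a powr (p - 1) \<le> 1" using assms a by (intro powr_le1) auto
    then show ?thesis by (simp add: add_increasing2)
  next
    case False
    then have "?a powr (p - 1) \<le> ?a powr (q - 1)" using assms by (intro powr_mono) auto
    then show ?thesis by simp
  qed
  finally show ?thesis by simp
qed

locale supersolution =
  fixes p q :: real and \<Omega> :: "'a::euclidean_space set" and u :: "'a \<Rightarrow> real" and D :: "'a \<Rightarrow> 'a"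
  assumes open_dom: "open \<Omega>" and p1: "1 < p" and pq: "p \<le> q" and super: "renorm_super p q \<Omega> u D"
begin

lemma q1: "1 < q" using p1 pq by simp

lemma u_measurable [measurable]: "u \<in> borel_measurable borel"
  using super unfolding renorm_super_def by (elim conjE)

lemma D_measurable [measurable]: "D \<in> borel_measurable borel"
  using super unfolding renorm_super_def by (elim conjE)

lemma trunc_gradient: "0 < k \<Longrightarrow> has_weak_gradient \<Omega> (trunc k \<circ> u) (\<lambda>x. indicator {x. \<bar>u x\<bar> < k} x *\<^sub>R D x)"
proof -
  have "\<forall>k>0. has_weak_gradient \<Omega> (trunc k \<circ> u) (\<lambda>x. indicator {x. \<bar>u x\<bar> < k} x *\<^sub>R D x)"
    using super unfolding renorm_super_def by (elim conjE)
  then show "0 < k \<Longrightarrow> has_weak_gradient \<Omega> (trunc k \<circ> u) (\<lambda>x. indicator {x. \<bar>u x\<bar> < k} x *\<^sub>R D x)" by simp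
qed

lemma D_integrable: "0 < k \<Longrightarrow> compact K \<Longrightarrow> K \<subseteq> \<Omega> \<Longrightarrow>
    integrable lborel (\<lambda>x. indicator K x * (indicator {x. \<bar>u x\<bar> < k} x * norm (D x) powr q))"
proof -
  have "\<forall>k>0. \<forall>K. compact K \<longrightarrow> K \<subseteq> \<Omega> \<longrightarrow>
       integrable lborel (\<lambda>x. indicator K x * (indicator {x. \<bar>u x\<bar> < k} x * norm (D x) powr q))"
    using super unfolding renorm_super_def by (elim conjE)
  then show "0 < k \<Longrightarrow> compact K \<Longrightarrow> K \<subseteq> \<Omega> \<Longrightarrow>
    integrable lborel (\<lambda>x. indicator K x * (indicator {x. \<bar>u x\<bar> < k} x * norm (D x) powr q))" by simp
qed

lemma renorm_inequality:
  assumes "bounded_Borel g C" "\<forall>t. R < \<bar>t\<bar> \<longrightarrow> g t = 0" "continuous_on UNIV h" "\<forall>t. h t = h 0 + prim g t" "\<forall>t. 0 \<le> h t"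
    "\<phi> \<in> test_functions \<Omega>" "\<forall>x. 0 \<le> \<phi> x"
  shows "integrable lborel (\<lambda>x. (pq_flux p q (D x) \<bullet> grad \<phi> x) * h (u x))"
    "0 \<le> (LBINT x. (norm (D x) powr p + norm (D x) powr q) * g (u x) * \<phi> x)
         + (LBINT x. (pq_flux p q (D x) \<bullet> grad \<phi> x) * h (u x))"
proof -
  from super have "\<forall>g C R h \<phi>. bounded_Borel g C \<longrightarrow> (\<forall>t. R < \<bar>t\<bar> \<longrightarrow> g t = 0) \<longrightarrow> continuous_on UNIV h \<longrightarrow>
       (\<forall>t. h t = h 0 + prim g t) \<longrightarrow> (\<forall>t. 0 \<le> h t) \<longrightarrow> \<phi> \<in> test_functions \<Omega> \<longrightarrow> (\<forall>x. 0 \<le> \<phi> x) \<longrightarrow>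
       integrable lborel (\<lambda>x. (pq_flux p q (D x) \<bullet> grad \<phi> x) * h (u x)) \<and>
       0 \<le> (LBINT x. (norm (D x) powr p + norm (D x) powr q) * g (u x) * \<phi> x)
         + (LBINT x. (pq_flux p q (D x) \<bullet> grad \<phi> x) * h (u x))"
    unfolding renorm_super_def by (elim conjE)
  from this[rule_format, OF assms(1) assms(2)[rule_format] assms(3) assms(4)[rule_format] assms(5)[rule_format] assms(6) assms(7)[rule_format]]
  show "integrable lborel (\<lambda>x. (pq_flux p q (D x) \<bullet> grad \<phi> x) * h (u x))"
    "0 \<le> (LBINT x. (norm (D x) powr p + norm (D x) powr q) * g (u x) * \<phi> x)
         + (LBINT x. (pq_flux p q (D x) \<bullet> grad \<phi> x) * h (u x))" by auto
qed

text \<open>With \<open>h = 1\<close> and test functions that are affine on \<open>K\<close>, the integrability contained in the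
  definition says that the flux is locally integrable.\<close>

lemma flux_integrable:
  assumes K: "compact K" "K \<subseteq> \<Omega>"
  shows "integrable lborel (\<lambda>x. indicator K x * norm (pq_flux p q (D x)))"
proof -
  have Kb [measurable]: "K \<in> sets borel" by (rule borel_compact[OF K(1)])
  obtain \<eta> V where \<eta>: "\<eta> \<in> test_functions \<Omega>" "\<And>x. 0 \<le> \<eta> x" "\<And>x. \<eta> x \<le> 1"
    "open V" "K \<subseteq> V" "V \<subseteq> \<Omega>" "\<And>x. x \<in> V \<Longrightarrow> \<eta> x = 1" "\<And>x. x \<in> V \<Longrightarrow> grad \<eta> x = 0"
    using cutoff_compact[OF K(1) open_dom K(2)] by blast
  obtain S where S: "smooth \<eta>" "compact S" "S \<subseteq> \<Omega>" "\<And>x. x \<notin> S \<Longrightarrow> \<eta> x = 0"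
    using \<eta>(1) by (rule test_functionsE) blast
  obtain M where M: "\<And>x. x \<in> S \<Longrightarrow> norm x \<le> M"
    using compact_imp_bounded[OF S(2)] by (auto simp: bounded_iff)
  have comp: "integrable lborel (\<lambda>x. indicator K x * \<bar>pq_flux p q (D x) \<bullet> b\<bar>)" if b: "b \<in> Basis" for b
  proof -
    (* affine with gradient b, and nonnegative on the support S of the cutoff *)
    define \<psi> where "\<psi> = (\<lambda>x. x \<bullet> b + M)"
    have s\<psi>: "smooth \<psi>" unfolding \<psi>_def by (intro smooth_add smooth_inner smooth_const)
    have g\<psi>: "grad \<psi> x = b" for x
      by (rule grad_eqI) (auto simp: \<psi>_def inner_commute intro!: derivative_eq_intros)
    define \<phi> where "\<phi> = (\<lambda>x. \<psi> x * \<eta> x)"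
    have t: "\<phi> \<in> test_functions \<Omega>" unfolding \<phi>_def by (rule test_mult[OF \<eta>(1) s\<psi>])
    have nn: "\<forall>x. 0 \<le> \<phi> x"
    proof
      fix x
      show "0 \<le> \<phi> x"
      proof (cases "x \<in> S")
        case True
        have "\<bar>x \<bullet> b\<bar> \<le> norm x" using b by (rule Basis_le_norm)
        then have "0 \<le> \<psi> x" using M[OF True] unfolding \<psi>_def by linarith
        then show ?thesis using \<eta>(2)[of x] by (simp add: \<phi>_def)
      qed (simp add: \<phi>_def S(4))
    qed
    have gr: "grad \<phi> x = b" if "x \<in> K" for x
    proof -
      have "grad \<phi> x = \<psi> x *\<^sub>R grad \<eta> x + \<eta> x *\<^sub>R grad \<psi> x"
        unfolding \<phi>_def by (rule grad_mult[OF smooth_differentiable[OF s\<psi>] smooth_differentiable[OF S(1)]])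
      then show ?thesis using that \<eta>(5,7,8) g\<psi> by auto
    qed
    have bb: "bounded_Borel (\<lambda>t. 0) 0" by (simp add: bounded_Borel_def)
    have "integrable lborel (\<lambda>x. (pq_flux p q (D x) \<bullet> grad \<phi> x) * 1)"
      by (rule renorm_inequality(1)[OF bb _ _ _ _ t nn, of 0 "\<lambda>_. 1"]) (auto simp: prim_zero)
    then have "integrable lborel (\<lambda>x. indicator K x *\<^sub>R \<bar>pq_flux p q (D x) \<bullet> grad \<phi> x\<bar>)"
      by (intro integrable_mult_indicator integrable_abs) auto
    also have "(\<lambda>x. indicator K x *\<^sub>R \<bar>pq_flux p q (D x) \<bullet> grad \<phi> x\<bar>) = (\<lambda>x. indicator K x * \<bar>pq_flux p q (D x) \<bullet> b\<bar>)"
      using gr by (auto simp: indicator_def)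
    finally show ?thesis .
  qed
  show ?thesis
  proof (rule Bochner_Integration.integrable_bound)
    show "integrable lborel (\<lambda>x. \<Sum>b\<in>Basis. indicator K x * \<bar>pq_flux p q (D x) \<bullet> b\<bar>)"
      by (rule Bochner_Integration.integrable_sum) (rule comp)
    show "AE x in lborel. norm (indicator K x * norm (pq_flux p q (D x))) \<le> norm (\<Sum>b\<in>Basis. indicator K x * \<bar>pq_flux p q (D x) \<bullet> b\<bar>)" (is "AE x in _. ?P x")
    proof (rule AE_I2)
      fix x
      have "norm (pq_flux p q (D x)) \<le> (\<Sum>b\<in>Basis. \<bar>pq_flux p q (D x) \<bullet> b\<bar>)" by (rule norm_le_l1)
      then show "?P x"
        by (cases "x \<in> K") (auto intro: order_trans[OF _ abs_ge_self])
    qed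
  qed measurable
qed

end

context supersolution
begin

text \<open>The energy estimate with the weight \<open>(1 + k - u) powr - (1 + \<tau>)\<close> on the set where \<open>u < k\<close>.
  The function \<open>h\<close> behind it is bounded, so that the flux, which is only known to be locally integrable,
  controls the error when the truncation at height \<open>M\<close> is removed.  Afterwards the gradient on the
  right is absorbed by Young's inequality.\<close>

lemma weighted_energy:
  fixes N :: nat
  assumes \<tau>: "0 < \<tau>" and N: "q \<le> real N" and \<phi>: "\<phi> \<in> test_functions \<Omega>" "\<And>x. 0 \<le> \<phi> x" "\<And>x. \<phi> x \<le> 1"
    and B: "compact B" "B \<subseteq> \<Omega>" "\<And>x. x \<notin> B \<Longrightarrow> \<phi> x = 0" "\<And>x. x \<notin> B \<Longrightarrow> grad \<phi> x = 0"
    and \<Lambda>: "1 \<le> \<Lambda>" "\<And>x. norm (grad \<phi> x) \<le> \<Lambda>"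
    and I: "integrable lborel (\<lambda>x. indicator ({x. u x < k} \<inter> B) x * (1 + (k - u x)) powr ((1 + \<tau>) * (q - 1)))"
  shows "integrable lborel (\<lambda>x. indicator {x. u x < k} x * ((1 + (k - u x)) powr (- (1 + \<tau>)) * norm (D x) powr q * \<phi> x ^ N))"
    "(LBINT x. indicator {x. u x < k} x * ((1 + (k - u x)) powr (- (1 + \<tau>)) * norm (D x) powr q * \<phi> x ^ N))
      \<le> 2 * (real N / \<tau> + 2 powr (q - 1) * (2 * (real N / \<tau>)) powr q) * \<Lambda> powr q
        * (LBINT x. indicator ({x. u x < k} \<inter> B) x * (1 + (k - u x)) powr ((1 + \<tau>) * (q - 1)))"
proof -
  have N0: "N \<noteq> 0" using N q1 by (intro notI) simp
  have N1: "N \<ge> 1" using N0 by simp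
  let ?X = "\<lambda>x. indicator {x. u x < k} x * ((1 + (k - u x)) powr (- (1 + \<tau>)) * norm (D x) powr q * \<phi> x ^ N)"
  let ?I = "\<lambda>x. indicator ({x. u x < k} \<inter> B) x * (1 + (k - u x)) powr ((1 + \<tau>) * (q - 1))"
  define J where "J x = indicator ({x. u x < k} \<inter> B) x * (real N / \<tau> * \<Lambda> * \<phi> x ^ (N - 1) * norm (pq_flux p q (D x)))" for x
  note [measurable] = test_borel[OF \<phi>(1)] borel_compact[OF B(1)]
  have \<phi>N: "(\<lambda>x. \<phi> x ^ N) \<in> test_functions \<Omega>" by (rule test_power[OF \<phi>(1) N0])
  have grN: "grad (\<lambda>x. \<phi> x ^ N) x = (real N * \<phi> x ^ (N - 1)) *\<^sub>R grad \<phi> x" for x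
    by (rule grad_power[OF smooth_differentiable[OF test_smooth[OF \<phi>(1)]]])
  have Ji: "integrable lborel J"
  proof (rule Bochner_Integration.integrable_bound)
    show "integrable lborel (\<lambda>x. (real N / \<tau> * \<Lambda>) * (indicator B x * norm (pq_flux p q (D x))))"
      using flux_integrable[OF B(1,2)] by simp
    show "J \<in> borel_measurable lborel" unfolding J_def[abs_def] by measurable
    show "AE x in lborel. norm (J x) \<le> norm ((real N / \<tau> * \<Lambda>) * (indicator B x * norm (pq_flux p q (D x))))" (is "AE x in _. ?P x")
    proof (rule AE_I2)
      fix x
      have "\<phi> x ^ (N - 1) \<le> 1" using \<phi>(2,3)[of x] by (rule power_le_one)
      then have "real N / \<tau> * \<Lambda> * \<phi> x ^ (N - 1) * norm (pq_flux p q (D x)) \<le> real N / \<tau> * \<Lambda> * 1 * norm (pq_flux p q (D x))"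
        using \<tau> \<Lambda> by (intro mult_right_mono mult_left_mono) auto
      then show "?P x"
        using \<tau> \<Lambda> \<phi>(2)[of x] by (auto simp: J_def indicator_def)
    qed
  qed
  define f where "f n x = (if k - real (Suc n) < u x \<and> u x < k then (1 + (k - u x)) powr (- (1 + \<tau>)) else 0) * norm (D x) powr q * \<phi> x ^ N" for n x
  have fi: "integrable lborel (f n)" and fJ: "(LBINT x. f n x) \<le> (LBINT x. J x)" for n
  proof -
    define M where "M = real (Suc n)"
    have M: "0 < M" by (simp add: M_def)
    (* a primitive of the weight that stays below 1 / \<tau> *)
    define G where "G s = (1 - (1 + s) powr (- \<tau>)) / \<tau>" for s
    define G' where "G' s = (1 + s) powr (- (1 + \<tau>))" for s :: real
    have G: "continuous_on {0..M} G"
      unfolding G_def by (intro continuous_intros) (use \<tau> in auto)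
    have GD: "(G has_real_derivative G' s) (at s)" if "0 < s" "s < M" for s
    proof -
      have "((\<lambda>s. (1 + s) powr (- \<tau>)) has_real_derivative (- \<tau>) * (1 + s) powr (- \<tau> - 1) * 1) (at s)"
        using that by (auto intro!: derivative_eq_intros)
      then have "(G has_real_derivative (0 - (- \<tau>) * (1 + s) powr (- \<tau> - 1) * 1) / \<tau>) (at s)"
        unfolding G_def[abs_def] by (intro DERIV_cdivide DERIV_diff DERIV_const)
      moreover have "- \<tau> - 1 = - (1 + \<tau>)" by simp
      ultimately show ?thesis using \<tau> by (simp add: G'_def)
    qed
    have G'm: "G' \<in> borel_measurable borel" unfolding G'_def[abs_def] by measurable
    have G'b: "\<bar>G' s\<bar> \<le> 1" if "0 < s" for s
    proof -
      have "(1 + s) powr (- (1 + \<tau>)) \<le> 1 powr (- (1 + \<tau>))" using that \<tau> by (intro powr_mono2') auto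
      then show ?thesis by (simp add: G'_def)
    qed
    define g where "g t = (if k - M < t \<and> t < k then - G' (k - t) else 0)" for t
    define h where "h t = G (clip M (k - t))" for t
    note pc = prim_clip[OF M G GD G'm G'b zero_le_one, of k]
    have gb: "bounded_Borel g 1" using pc(1) by (simp add: g_def[abs_def])
    have hc: "continuous_on UNIV h" using pc(2) by (simp add: h_def[abs_def])
    have hp: "\<forall>t. h t = h 0 + prim g t" using pc(3) by (simp add: h_def g_def[abs_def])
    have c0: "0 \<le> clip M s" for s using M by (auto simp: clip_def)
    have G0: "0 \<le> G s \<and> G s \<le> 1 / \<tau>" if "0 \<le> s" for s
    proof -
      have "(1 + s) powr (- \<tau>) \<le> 1 powr (- \<tau>)" using that \<tau> by (intro powr_mono2') auto
      moreover have "0 \<le> (1 + s) powr (- \<tau>)" by simp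
      ultimately show ?thesis using \<tau> by (simp add: G_def divide_le_cancel)
    qed
    have h0: "\<forall>t. 0 \<le> h t" using G0 c0 by (simp add: h_def)
    have hS: "\<bar>h t\<bar> \<le> (1 / \<tau>) * indicator {..<k} t" for t
    proof (cases "t < k")
      case True
      then show ?thesis using G0[OF c0[of "k - t"]] by (simp add: h_def)
    next
      case False
      then have "clip M (k - t) = 0" using M by (simp add: clip_def)
      then show ?thesis using False by (simp add: h_def G_def)
    qed
    have gR: "\<forall>t. \<bar>k\<bar> + M < \<bar>t\<bar> \<longrightarrow> g t = 0" by (auto simp: g_def)
    have nn: "\<forall>x. 0 \<le> \<phi> x ^ N" using \<phi>(2) by simp
    note ri = renorm_inequality[OF gb gR hc hp h0 \<phi>N nn]
    have fg: "f n x = - (g (u x) * norm (D x) powr q * \<phi> x ^ N)" for x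
      by (simp add: f_def g_def G'_def M_def)
    let ?K = "\<bar>k\<bar> + M"
    have K0: "0 < ?K" using M by simp
    have g_le: "\<bar>g (u x)\<bar> * \<phi> x ^ N \<le> indicator B x * indicator {x. \<bar>u x\<bar> < ?K} x" for x
    proof (cases "x \<in> B \<and> k - M < u x \<and> u x < k")
      case True
      then have "\<bar>u x\<bar> < ?K" by linarith
      moreover have "\<bar>g (u x)\<bar> * \<phi> x ^ N \<le> 1 * 1"
        using bounded_BorelD(2)[OF gb, of "u x"] power_le_one[OF \<phi>(2,3), of x N] nn by (intro mult_mono) auto
      ultimately show ?thesis using True by simp
    next
      case False
      then have "g (u x) = 0 \<or> \<phi> x ^ N = 0" using B(3)[of x] N0 by (auto simp: g_def)
      then have z: "\<bar>g (u x)\<bar> * \<phi> x ^ N = 0" by (simp only: mult_eq_0_iff abs_eq_0)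
      show ?thesis unfolding z by (simp add: indicator_def)
    qed
    have [measurable]: "g \<in> borel_measurable borel" by (rule bounded_BorelD(1)[OF gb])
    have iq: "integrable lborel (\<lambda>x. norm (D x) powr q * g (u x) * \<phi> x ^ N)"
    proof (rule Bochner_Integration.integrable_bound[OF D_integrable[OF K0 B(1,2)]])
      show "AE x in lborel. norm (norm (D x) powr q * g (u x) * \<phi> x ^ N)
          \<le> norm (indicator B x * (indicator {x. \<bar>u x\<bar> < ?K} x * norm (D x) powr q))" (is "AE x in _. ?P x")
      proof (rule AE_I2)
        fix x
        show "?P x"
          using mult_right_mono[OF g_le[of x], of "norm (D x) powr q"] nn by (simp add: abs_mult mult_ac)
      qed
    qed measurable
    have ip: "integrable lborel (\<lambda>x. norm (D x) powr p * g (u x) * \<phi> x ^ N)"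
    proof (rule Bochner_Integration.integrable_bound)
      show "integrable lborel (\<lambda>x. indicator B x + indicator B x * (indicator {x. \<bar>u x\<bar> < ?K} x * norm (D x) powr q))"
        by (intro Bochner_Integration.integrable_add D_integrable[OF K0 B(1,2)] integrable_indicator_bounded)
          (use B(1) in \<open>auto simp: compact_imp_bounded\<close>)
      show "AE x in lborel. norm (norm (D x) powr p * g (u x) * \<phi> x ^ N)
          \<le> norm (indicator B x + indicator B x * (indicator {x. \<bar>u x\<bar> < ?K} x * norm (D x) powr q))" (is "AE x in _. ?P x")
      proof (rule AE_I2)
        fix x
        have "norm (D x) powr p \<le> 1 + norm (D x) powr q"
        proof (cases "norm (D x) \<le> 1")
          case True
          then have "norm (D x) powr p \<le> 1" using p1 by (intro powr_le1) auto
          then show ?thesis by (simp add: add_increasing2)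
        next
          case False
          then have "norm (D x) powr p \<le> norm (D x) powr q" using pq by (intro powr_mono) auto
          then show ?thesis by simp
        qed
        then have "norm (D x) powr p * (\<bar>g (u x)\<bar> * \<phi> x ^ N)
            \<le> (1 + norm (D x) powr q) * (indicator B x * indicator {x. \<bar>u x\<bar> < ?K} x)"
          using nn by (intro mult_mono g_le) auto
        also have "\<dots> \<le> indicator B x + indicator B x * (indicator {x. \<bar>u x\<bar> < ?K} x * norm (D x) powr q)"
          by (auto simp: indicator_def)
        finally show "?P x"
          using nn by (simp add: abs_mult mult_ac)
      qed
    qed measurable
    show "integrable lborel (f n)" unfolding fg using iq by (simp add: mult_ac)
    (* the part of the energy with exponent p has the same sign and is dropped *)
    have p_neg: "(LBINT x. norm (D x) powr p * g (u x) * \<phi> x ^ N) \<le> 0"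
    proof -
      have "0 \<le> (LBINT x. - (norm (D x) powr p * g (u x) * \<phi> x ^ N))"
      proof (rule Bochner_Integration.integral_nonneg)
        fix x
        have "g (u x) \<le> 0" by (auto simp: g_def G'_def)
        then show "0 \<le> - (norm (D x) powr p * g (u x) * \<phi> x ^ N)"
          using nn by (simp add: mult_nonpos_nonneg mult_nonneg_nonpos)
      qed
      then show ?thesis by simp
    qed
    have "(LBINT x. (norm (D x) powr p + norm (D x) powr q) * g (u x) * \<phi> x ^ N)
        = (LBINT x. norm (D x) powr p * g (u x) * \<phi> x ^ N) + (LBINT x. norm (D x) powr q * g (u x) * \<phi> x ^ N)"
      using ip iq by (simp add: distrib_right)
    moreover have "(LBINT x. f n x) = - (LBINT x. norm (D x) powr q * g (u x) * \<phi> x ^ N)"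
      unfolding fg by (simp add: mult_ac)
    ultimately have "(LBINT x. f n x) \<le> (LBINT x. (pq_flux p q (D x) \<bullet> grad (\<lambda>x. \<phi> x ^ N) x) * h (u x))"
      using ri(2) p_neg by linarith
    also have "\<dots> \<le> (LBINT x. J x)"
    proof (rule integral_mono[OF ri(1) Ji])
      fix x
      show "(pq_flux p q (D x) \<bullet> grad (\<lambda>x. \<phi> x ^ N) x) * h (u x) \<le> J x"
      proof (cases "u x < k \<and> x \<in> B")
        case True
        have "\<bar>pq_flux p q (D x) \<bullet> grad (\<lambda>x. \<phi> x ^ N) x\<bar> \<le> norm (pq_flux p q (D x)) * norm (grad (\<lambda>x. \<phi> x ^ N) x)"
          by (rule Cauchy_Schwarz_ineq2)
        also have "norm (grad (\<lambda>x. \<phi> x ^ N) x) = real N * \<phi> x ^ (N - 1) * norm (grad \<phi> x)"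
          using \<phi>(2)[of x] by (simp add: grN)
        also have "\<dots> \<le> real N * \<phi> x ^ (N - 1) * \<Lambda>"
          using \<phi>(2)[of x] by (intro mult_left_mono \<Lambda>) auto
        finally have "\<bar>pq_flux p q (D x) \<bullet> grad (\<lambda>x. \<phi> x ^ N) x\<bar> \<le> norm (pq_flux p q (D x)) * (real N * \<phi> x ^ (N - 1) * \<Lambda>)"
          by (simp add: mult_left_mono)
        moreover have "\<bar>h (u x)\<bar> \<le> 1 / \<tau>" using hS[of "u x"] True by simp
        ultimately have "\<bar>(pq_flux p q (D x) \<bullet> grad (\<lambda>x. \<phi> x ^ N) x) * h (u x)\<bar>
            \<le> (norm (pq_flux p q (D x)) * (real N * \<phi> x ^ (N - 1) * \<Lambda>)) * (1 / \<tau>)"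
          unfolding abs_mult using \<phi>(2)[of x] \<Lambda>(1) by (intro mult_mono) auto
        also have "\<dots> = J x" using True by (simp add: J_def)
        finally show ?thesis by linarith
      next
        case False
        then have "h (u x) = 0 \<or> grad (\<lambda>x. \<phi> x ^ N) x = 0"
          using hS[of "u x"] B(4)[of x] by (auto simp: grN)
        moreover have "0 \<le> J x" using \<tau> \<Lambda> \<phi>(2)[of x] by (auto simp: J_def indicator_def)
        ultimately show ?thesis by auto
      qed
    qed
    finally show "(LBINT x. f n x) \<le> (LBINT x. J x)" .
  qed
  have Xm: "?X \<in> borel_measurable borel" by measurable
  have finc: "incseq (\<lambda>n. f n x)" for x
    using \<phi>(2)[of x] by (auto simp: incseq_def f_def intro!: mult_right_mono)
  have flim: "(\<lambda>n. f n x) \<longlonglongrightarrow> ?X x" for x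
  proof -
    obtain m :: nat where m: "k - u x < real m" using reals_Archimedean2 by blast
    have "?X x = f n x" if "n \<ge> m" for n
    proof -
      have "k - real (Suc n) < u x" using that m by simp
      then show ?thesis by (simp add: f_def)
    qed
    then have "\<forall>\<^sub>F n in sequentially. ?X x = f n x" unfolding eventually_sequentially by blast
    then show ?thesis by (rule Lim_transform_eventually[OF tendsto_const])
  qed
  show Xi: "integrable lborel ?X" by (rule integral_incseq_bounded(1)[OF fi finc flim Xm fJ])
  have XJ: "(LBINT x. ?X x) \<le> (LBINT x. J x)" by (rule integral_incseq_bounded(2)[OF fi finc flim Xm fJ])
  define cc where "cc = real N / \<tau>"
  define C1 where "C1 = cc + 2 powr (q - 1) * (2 * cc) powr q"
  have c0: "0 < cc" using N1 \<tau> by (simp add: cc_def)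
  have \<Lambda>q: "\<Lambda> \<le> \<Lambda> powr q" using powr_mono[of 1 q \<Lambda>] \<Lambda>(1) q1 by simp
  have "(LBINT x. J x) \<le> (LBINT x. (1/2) * ?X x + (C1 * \<Lambda> powr q) * ?I x)"
  proof (rule integral_mono[OF Ji])
    show "integrable lborel (\<lambda>x. (1/2) * ?X x + (C1 * \<Lambda> powr q) * ?I x)"
      by (intro Bochner_Integration.integrable_add integrable_mult_right Xi I)
    fix x
    show "J x \<le> (1/2) * ?X x + (C1 * \<Lambda> powr q) * ?I x"
    proof (cases "u x < k \<and> x \<in> B")
      case False
      have "0 \<le> ?X x" using \<phi>(2)[of x] by (auto simp: indicator_def)
      then show ?thesis using False by (simp add: J_def)
    next
      case True
      define b where "b = 1 + (k - u x)"
      have b: "b \<ge> 1" using True by (simp add: b_def)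
      let ?d = "norm (D x)"
      let ?w = "b powr (- (1 + \<tau>))"
      (* the conjugate powers of a and c are the integrand of the energy and a multiple of that of the excess *)
      define a where "a = (?w * \<phi> x ^ N) powr ((q - 1) / q) * ?d powr (q - 1)"
      define c where "c = 2 * cc * \<Lambda> * ?w powr (- ((q - 1) / q))"
      have w0: "?w > 0" using b by simp
      have ex: "0 < (q - 1) / q" "(q - 1) / q < 1" using q1 by auto
      have phi: "\<phi> x ^ (N - 1) \<le> (\<phi> x ^ N) powr ((q - 1) / q)"
      proof (cases "\<phi> x = 0")
        case True
        have "N - 1 \<noteq> 0" using N q1 by auto
        then have "\<phi> x ^ (N - 1) = 0" using True by (simp only: power_0_left if_False)
        then show ?thesis by (simp only: powr_ge_zero)
      next
        case False
        then have p0: "0 < \<phi> x" using \<phi>(2)[of x] by simp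
        have "\<phi> x ^ (N - 1) = \<phi> x powr real (N - 1)" using p0 by (simp add: powr_realpow)
        also have "\<dots> \<le> \<phi> x powr (real N * ((q - 1) / q))"
        proof (rule powr_mono')
          have "real N * ((q - 1) / q) = real N - real N / q" using q1 by (simp add: field_simps)
          also have "\<dots> \<le> real N - 1" using N q1 by (simp add: field_simps)
          finally show "real N * ((q - 1) / q) \<le> real (N - 1)" using N1 by (simp add: of_nat_diff)
        qed (use p0 \<phi>(3)[of x] in auto)
        also have "\<dots> = (\<phi> x ^ N) powr ((q - 1) / q)" using p0 by (simp add: powr_powr powr_realpow[symmetric])
        finally show ?thesis .
      qed
      have "2 * cc * \<Lambda> * \<phi> x ^ (N - 1) * ?d powr (q - 1) \<le> 2 * cc * \<Lambda> * (\<phi> x ^ N) powr ((q - 1) / q) * ?d powr (q - 1)"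
        using c0 \<Lambda>(1) by (intro mult_right_mono mult_left_mono phi) auto
      also have "\<dots> = a * c"
      proof -
        have "?w powr ((q - 1) / q) * ?w powr (- ((q - 1) / q)) = 1"
          using w0 by (simp add: powr_minus)
        then have "(\<phi> x ^ N) powr ((q - 1) / q) * (?w powr ((q - 1) / q) * ?w powr (- ((q - 1) / q))) = (\<phi> x ^ N) powr ((q - 1) / q)"
          by simp
        then show ?thesis
          using w0 \<phi>(2)[of x] unfolding a_def c_def by (simp only: powr_mult mult_ac)
      qed
      also have "\<dots> \<le> 2 powr (q - 1) * c powr q + (1 / 2 powr (q - 1)) powr (1 / (q - 1)) * a powr (q / (q - 1))"
        by (rule young_split) (use q1 c0 \<Lambda>(1) in \<open>auto simp: a_def c_def\<close>)
      also have "(1 / 2 powr (q - 1)) powr (1 / (q - 1)) = 1 / 2"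
        using q1 by (simp add: powr_divide powr_powr)
      also have "a powr (q / (q - 1)) = ?w * \<phi> x ^ N * ?d powr q"
        using q1 w0 \<phi>(2)[of x] by (simp add: a_def powr_mult powr_powr powr_one)
      also have "c powr q = (2 * cc) powr q * \<Lambda> powr q * b powr ((1 + \<tau>) * (q - 1))"
      proof -
        have "c powr q = (2 * cc) powr q * \<Lambda> powr q * (?w powr (- ((q - 1) / q))) powr q"
          using c0 \<Lambda>(1) by (simp add: c_def powr_mult)
        also have "(?w powr (- ((q - 1) / q))) powr q = b powr ((1 + \<tau>) * (q - 1))"
        proof -
          have "- (1 + \<tau>) * (- ((q - 1) / q)) * q = (1 + \<tau>) * (q - 1)"
            using q1 by (simp add: field_simps)
          then show ?thesis by (simp only: powr_powr)
        qed
        finally show ?thesis .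
      qed
      finally have main: "2 * cc * \<Lambda> * \<phi> x ^ (N - 1) * ?d powr (q - 1)
          \<le> 2 powr (q - 1) * ((2 * cc) powr q * \<Lambda> powr q * b powr ((1 + \<tau>) * (q - 1))) + 1 / 2 * (?w * \<phi> x ^ N * ?d powr q)" .
      have bg: "1 \<le> b powr ((1 + \<tau>) * (q - 1))" using b \<tau> q1 by (intro ge_one_powr_ge_zero) auto
      have "\<Lambda> * \<phi> x ^ (N - 1) \<le> \<Lambda> powr q * b powr ((1 + \<tau>) * (q - 1))"
        using \<Lambda>q bg \<Lambda>(1) power_le_one[OF \<phi>(2,3), of x "N - 1"] \<phi>(2)[of x]
        by (intro mult_mono) auto
      then have first: "cc * \<Lambda> * \<phi> x ^ (N - 1) \<le> cc * (\<Lambda> powr q * b powr ((1 + \<tau>) * (q - 1)))"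
        using c0 by (simp only: mult.assoc mult_le_cancel_left_pos)
      have "J x = cc * \<Lambda> * \<phi> x ^ (N - 1) * norm (pq_flux p q (D x))" using True by (simp add: J_def cc_def)
      also have "\<dots> \<le> cc * \<Lambda> * \<phi> x ^ (N - 1) * (1 + 2 * ?d powr (q - 1))"
        using c0 \<Lambda>(1) \<phi>(2)[of x] by (intro mult_left_mono flux_bound p1 pq) auto
      also have "\<dots> = cc * \<Lambda> * \<phi> x ^ (N - 1) + 2 * cc * \<Lambda> * \<phi> x ^ (N - 1) * ?d powr (q - 1)"
        by (simp add: distrib_left mult_ac)
      also have "\<dots> \<le> cc * (\<Lambda> powr q * b powr ((1 + \<tau>) * (q - 1)))
          + (2 powr (q - 1) * ((2 * cc) powr q * \<Lambda> powr q * b powr ((1 + \<tau>) * (q - 1))) + 1 / 2 * (?w * \<phi> x ^ N * ?d powr q))"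
        by (intro add_mono first main)
      also have "\<dots> = (1/2) * ?X x + (C1 * \<Lambda> powr q) * ?I x"
        using True by (simp add: C1_def b_def algebra_simps)
      finally show ?thesis .
    qed
  qed
  also have "\<dots> = (1/2) * (LBINT x. ?X x) + (C1 * \<Lambda> powr q) * (LBINT x. ?I x)"
    by (subst Bochner_Integration.integral_add[OF integrable_mult_right[OF Xi] integrable_mult_right[OF I]]) simp
  finally have "(LBINT x. ?X x) \<le> 2 * (C1 * \<Lambda> powr q * (LBINT x. ?I x))" using XJ by linarith
  then show "(LBINT x. ?X x) \<le> 2 * (real N / \<tau> + 2 powr (q - 1) * (2 * (real N / \<tau>)) powr q) * \<Lambda> powr q * (LBINT x. ?I x)"
    by (simp only: C1_def cc_def mult.assoc)
qed

end

context supersolution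
begin

lemma clip_gradient:
  fixes M k \<theta> :: real
  assumes M: "0 < M" and \<theta>: "0 < \<theta>"
  defines "F \<equiv> \<lambda>t. (1 + clip M (k - t)) powr \<theta> - 1"
    and "g \<equiv> \<lambda>t. if k - M < t \<and> t < k then - (\<theta> * (1 + (k - t)) powr (\<theta> - 1)) else 0"
  shows "has_weak_gradient \<Omega> (\<lambda>x. F (u x)) (\<lambda>x. g (u x) *\<^sub>R D x)"
proof -
  let ?G = "\<lambda>s. (1 + s) powr \<theta> - 1" and ?G' = "\<lambda>s. \<theta> * (1 + s) powr (\<theta> - 1)"
  let ?C = "\<theta> * (1 + M) powr \<bar>\<theta> - 1\<bar>"
  have Gc: "continuous_on {0..M} ?G" by (intro continuous_intros) auto
  have GD: "(?G has_real_derivative ?G' s) (at s)" if "0 < s" for s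
    using that by (auto intro!: derivative_eq_intros)
  have Gm: "?G' \<in> borel_measurable borel" by measurable
  have Gb: "\<bar>?G' s\<bar> \<le> ?C" if "0 < s" "s < M" for s
  proof -
    have "(1 + s) powr (\<theta> - 1) \<le> (1 + s) powr \<bar>\<theta> - 1\<bar>" using that by (intro powr_mono) auto
    also have "\<dots> \<le> (1 + M) powr \<bar>\<theta> - 1\<bar>" using that by (intro powr_mono2) auto
    finally show ?thesis using \<theta> by (simp add: abs_mult)
  qed
  have C0: "0 \<le> ?C" using \<theta> by simp
  note pc = prim_clip[OF M Gc GD Gm Gb C0, of k]
  have gb: "bounded_Borel g ?C" using pc(1) by (simp add: g_def)
  have Fp: "prim g t = F t - F 0" for t using pc(3)[of t] by (simp add: F_def g_def)
  let ?m = "\<bar>k\<bar> + M"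
  have m0: "0 < ?m" using M by simp
  have "has_weak_gradient \<Omega> (\<lambda>x. prim g ((trunc ?m \<circ> u) x)) (\<lambda>x. g ((trunc ?m \<circ> u) x) *\<^sub>R (indicator {x. \<bar>u x\<bar> < ?m} x *\<^sub>R D x))"
    by (rule chain_rule[OF open_dom trunc_gradient[OF m0] gb])
  from weak_gradient_diff[OF this weak_gradient_const[OF open_dom, of "- F 0"]]
  have "has_weak_gradient \<Omega> (\<lambda>x. prim g (trunc ?m (u x)) - (- F 0)) (\<lambda>x. g (trunc ?m (u x)) *\<^sub>R (indicator {x. \<bar>u x\<bar> < ?m} x *\<^sub>R D x) - 0)"
    by (simp only: o_def)
  moreover have "(\<lambda>x. prim g (trunc ?m (u x)) - (- F 0)) = (\<lambda>x. F (u x))"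
  proof
    fix x
    have "F (trunc ?m (u x)) = F (u x)" using M by (auto simp: F_def clip_def trunc_def max_def min_def)
    then show "prim g (trunc ?m (u x)) - (- F 0) = F (u x)" by (simp add: Fp)
  qed
  moreover have "(\<lambda>x. g (trunc ?m (u x)) *\<^sub>R (indicator {x. \<bar>u x\<bar> < ?m} x *\<^sub>R D x) - 0) = (\<lambda>x. g (u x) *\<^sub>R D x)"
  proof
    fix x
    show "g (trunc ?m (u x)) *\<^sub>R (indicator {x. \<bar>u x\<bar> < ?m} x *\<^sub>R D x) - 0 = g (u x) *\<^sub>R D x"
    proof (cases "\<bar>u x\<bar> < ?m")
      case True
      then show ?thesis using trunc_simps(1)[OF m0, of "u x"] by simp
    next
      case False
      then have "g (u x) = 0" by (auto simp: g_def)
      then show ?thesis using False by simp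
    qed
  qed
  ultimately show ?thesis by simp
qed

text \<open>One step of De Giorgi's iteration.  The weighted energy controls \<open>(1 + k - u) powr \<theta>\<close> with
  \<open>\<theta> = q - 1 - \<tau>\<close> in terms of the larger power \<open>(1 + \<tau>) * (q - 1)\<close>; the latter is interpolated between
  \<open>\<theta>\<close> and a power \<open>\<sigma>\<close> that is known to be integrable.  The exponent of \<open>Y\<close> on the right is larger than one
  as soon as \<open>\<alpha>/q < 1/n\<close>.\<close>

lemma de_giorgi_step:
  fixes N :: nat and \<sigma> \<alpha> \<tau> k :: real
  assumes \<tau>: "0 < \<tau>" "\<tau> < q - 1" and N: "q \<le> real N"
    and \<phi>: "\<phi> \<in> test_functions \<Omega>" "\<And>x. 0 \<le> \<phi> x" "\<And>x. \<phi> x \<le> 1"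
    and B: "compact B" "B \<subseteq> \<Omega>" "\<And>x. x \<notin> B \<Longrightarrow> \<phi> x = 0" "\<And>x. x \<notin> B \<Longrightarrow> grad \<phi> x = 0"
    and \<Lambda>: "1 \<le> \<Lambda>" "\<And>x. norm (grad \<phi> x) \<le> \<Lambda>"
    and l: "0 < \<alpha>" "\<alpha> < 1" "(1 + \<tau>) * (q - 1) = (1 - \<alpha>) * (q - 1 - \<tau>) + \<alpha> * \<sigma>" and \<sigma>: "q - 1 - \<tau> \<le> \<sigma>"
    and I: "integrable lborel (\<lambda>x. indicator ({x. u x < k} \<inter> B) x * (1 + (k - u x)) powr \<sigma>)"
      "(LBINT x. indicator ({x. u x < k} \<inter> B) x * (1 + (k - u x)) powr \<sigma>) \<le> K"
  defines "Y \<equiv> LBINT x. indicator ({x. u x < k} \<inter> B) x * (1 + (k - u x)) powr (q - 1 - \<tau>)"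
    and "C0 \<equiv> 2 * (real N / \<tau> + 2 powr (q - 1) * (2 * (real N / \<tau>)) powr q)"
  shows "integrable lborel (\<lambda>x. indicator {x. u x < k} x * ((1 + (k - u x)) powr (q - 1 - \<tau>) - 1) * \<phi> x ^ N)"
    "(LBINT x. indicator {x. u x < k} x * ((1 + (k - u x)) powr (q - 1 - \<tau>) - 1) * \<phi> x ^ N)
      \<le> 4 * real DIM('a) * ((q - 1 - \<tau>) * C0 powr (1 / q) + real N) * \<Lambda> * K powr (\<alpha> / q)
        * Y powr (1 + 1 / real DIM('a) - \<alpha> / q)"
proof -
  define \<theta> where "\<theta> = q - 1 - \<tau>"
  have \<theta>: "0 < \<theta>" "\<theta> \<le> \<sigma>" using \<tau> \<sigma> by (auto simp: \<theta>_def)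
  let ?n = "real DIM('a)"
  have n: "?n \<ge> 1" using DIM_positive[where 'a = 'a] by linarith
  have N0: "N \<noteq> 0" using N q1 by (intro notI) simp
  note [measurable] = test_borel[OF \<phi>(1)] borel_compact[OF B(1)]
  define A where "A = {x. u x < k} \<inter> B"
  have Am [measurable]: "A \<in> sets borel" unfolding A_def by measurable
  have Bfin: "emeasure lborel B < \<infinity>" by (rule emeasure_bounded_finite[OF compact_imp_bounded[OF B(1)]])
  have "emeasure lborel A \<le> emeasure lborel B" by (rule emeasure_mono) (auto simp: A_def)
  then have Afin: "emeasure lborel A < \<infinity>" using Bfin by (rule le_less_trans)
  let ?P = "\<lambda>e x. indicator A x * (1 + (k - u x)) powr e"
  have P0: "0 \<le> ?P e x" for e x by (simp add: indicator_def)
  have I': "integrable lborel (?P \<sigma>)" "(LBINT x. ?P \<sigma> x) \<le> K"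
    using I by (simp_all add: A_def)
  have Y: "Y = (LBINT x. ?P \<theta> x)" by (simp add: Y_def A_def \<theta>_def)
  have P_mono: "?P e x \<le> ?P e' x" if "e \<le> e'" for e e' x
    using that by (auto simp: A_def indicator_def intro!: powr_mono)
  have Pi: "integrable lborel (?P e)" if "e \<le> \<sigma>" for e
  proof (rule Bochner_Integration.integrable_bound[OF I'(1)])
    show "AE x in lborel. norm (?P e x) \<le> norm (?P \<sigma> x)"
      using P_mono[OF that] P0 by (intro AE_I2) (simp only: real_norm_def abs_of_nonneg)
  qed measurable
  have Y0: "0 \<le> Y" unfolding Y by (rule Bochner_Integration.integral_nonneg) (rule P0)
  have YK: "Y \<le> K" unfolding Y
    by (rule order_trans[OF integral_mono[OF Pi[OF \<theta>(2)] I'(1)] I'(2)]) (rule P_mono[OF \<theta>(2)])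
  have AY: "measure lborel A \<le> Y"
  proof -
    have "measure lborel A = (LBINT x. indicator A x)" by simp
    also have "\<dots> \<le> Y" unfolding Y
    proof (rule integral_mono[OF _ Pi[OF \<theta>(2)]])
      show "integrable lborel (indicator A :: 'a \<Rightarrow> real)" using Afin by (simp add: integrable_indicator_iff)
      show "indicator A x \<le> ?P \<theta> x" for x
        using \<theta>(1) by (auto simp: A_def indicator_def intro!: ge_one_powr_ge_zero)
    qed
    finally show ?thesis .
  qed
  have inter: "integrable lborel (?P ((1 + \<tau>) * (q - 1)))"
    "(LBINT x. ?P ((1 + \<tau>) * (q - 1)) x) \<le> Y powr (1 - \<alpha>) * K powr \<alpha>"
  proof -
    have eq: "?P \<theta> x powr (1 - \<alpha>) * ?P \<sigma> x powr (1 - (1 - \<alpha>)) = ?P ((1 + \<tau>) * (q - 1)) x" for x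
    proof (cases "x \<in> A")
      case True
      then have "1 + (k - u x) > 0" by (simp add: A_def)
      then have "((1 + (k - u x)) powr \<theta>) powr (1 - \<alpha>) * ((1 + (k - u x)) powr \<sigma>) powr \<alpha> = (1 + (k - u x)) powr ((1 + \<tau>) * (q - 1))"
        unfolding l(3) \<theta>_def powr_powr powr_add[symmetric] by (simp add: mult.commute)
      then show ?thesis using True by simp
    qed simp
    have a: "0 < 1 - \<alpha>" "1 - \<alpha> < 1" using l by auto
    note H = Hoelder_interpolation[OF Pi[OF \<theta>(2)] P0 I'(1) P0 a]
    show "integrable lborel (?P ((1 + \<tau>) * (q - 1)))" using H(1) unfolding eq .
    have "(LBINT x. ?P ((1 + \<tau>) * (q - 1)) x) \<le> Y powr (1 - \<alpha>) * (LBINT x. ?P \<sigma> x) powr (1 - (1 - \<alpha>))"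
      using H(2) unfolding eq Y .
    also have "\<dots> \<le> Y powr (1 - \<alpha>) * K powr \<alpha>"
    proof -
      have "(LBINT x. ?P \<sigma> x) powr \<alpha> \<le> K powr \<alpha>"
        using l I'(2) by (intro powr_mono2 Bochner_Integration.integral_nonneg P0) auto
      then show ?thesis by (simp add: mult_left_mono)
    qed
    finally show "(LBINT x. ?P ((1 + \<tau>) * (q - 1)) x) \<le> Y powr (1 - \<alpha>) * K powr \<alpha>" .
  qed
  define X where "X x = indicator {x. u x < k} x * ((1 + (k - u x)) powr (- (1 + \<tau>)) * norm (D x) powr q * \<phi> x ^ N)" for x
  note we = weighted_energy[OF \<tau>(1) N \<phi> B \<Lambda> inter(1)[unfolded A_def]]
  have Xi: "integrable lborel X" using we(1) by (simp add: X_def[abs_def])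
  have X0: "0 \<le> X x" for x using \<phi>(2)[of x] by (simp add: X_def indicator_def)
  have C0: "0 \<le> C0" using \<tau> by (simp add: C0_def)
  have "(LBINT x. X x) \<le> C0 * \<Lambda> powr q * (LBINT x. ?P ((1 + \<tau>) * (q - 1)) x)"
    using we(2) by (simp add: X_def[abs_def] C0_def A_def)
  also have "\<dots> \<le> C0 * \<Lambda> powr q * (Y powr (1 - \<alpha>) * K powr \<alpha>)"
    by (intro mult_left_mono inter(2)) (use C0 in auto)
  finally have Xle: "(LBINT x. X x) \<le> C0 * \<Lambda> powr q * (Y powr (1 - \<alpha>) * K powr \<alpha>)" .
  have iq: "0 < 1 / q" "1 / q < 1" using q1 by auto
  (* up to \<theta>, a bound for the part of the gradient that contains D, split for Hoelder's inequality *)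
  define H where "H x = X x powr (1 / q) * ?P \<theta> x powr (1 - 1 / q)" for x
  note Ho = Hoelder_interpolation[OF Xi X0 Pi[OF \<theta>(2)] P0 iq]
  have Hi: "integrable lborel H" using Ho(1) by (simp add: H_def[abs_def])
  have "(LBINT x. H x) \<le> (LBINT x. X x) powr (1 / q) * Y powr (1 - 1 / q)"
    using Ho(2) by (simp add: H_def[abs_def] Y)
  also have "\<dots> \<le> (C0 * \<Lambda> powr q * (Y powr (1 - \<alpha>) * K powr \<alpha>)) powr (1 / q) * Y powr (1 - 1 / q)"
    by (intro mult_right_mono powr_mono2 Xle Bochner_Integration.integral_nonneg X0) (use q1 in auto)
  finally have Hle: "(LBINT x. H x) \<le> (C0 * \<Lambda> powr q * (Y powr (1 - \<alpha>) * K powr \<alpha>)) powr (1 / q) * Y powr (1 - 1 / q)" .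
  define R where "R = 4 * ?n * measure lborel A powr (1 / ?n) * (\<theta> * (LBINT x. H x) + real N * \<Lambda> * Y)"
  define f where "f i x = ((1 + clip (real (Suc i)) (k - u x)) powr \<theta> - 1) * \<phi> x ^ N" for i x
  have \<phi>N: "(\<lambda>x. \<phi> x ^ N) \<in> test_functions \<Omega>" by (rule test_power[OF \<phi>(1) N0])
  have grN: "grad (\<lambda>x. \<phi> x ^ N) x = (real N * \<phi> x ^ (N - 1)) *\<^sub>R grad \<phi> x" for x
    by (rule grad_power[OF smooth_differentiable[OF test_smooth[OF \<phi>(1)]]])
  have fi: "integrable lborel (f i)" and fR: "(LBINT x. f i x) \<le> R" for i
  proof -
    define M where "M = real (Suc i)"
    have M: "0 < M" by (simp add: M_def)
    define F where "F t = (1 + clip M (k - t)) powr \<theta> - 1" for t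
    define g where "g t = (if k - M < t \<and> t < k then - (\<theta> * (1 + (k - t)) powr (\<theta> - 1)) else 0)" for t
    have c0: "0 \<le> clip M s" for s using M by (auto simp: clip_def)
    have F0: "0 \<le> F t" for t
      using c0[of "k - t"] \<theta>(1) by (simp add: F_def ge_one_powr_ge_zero)
    have Fk: "F t = 0" if "k \<le> t" for t using that M by (simp add: F_def clip_def)
    have Fle: "F t \<le> (1 + (k - t)) powr \<theta>" if "t < k" for t
    proof -
      have "(1 + clip M (k - t)) powr \<theta> \<le> (1 + (k - t)) powr \<theta>"
        using that M \<theta>(1) by (intro powr_mono2) (auto simp: clip_def)
      then show ?thesis by (simp add: F_def)
    qed
    have wg: "has_weak_gradient \<Omega> (\<lambda>x. F (u x)) (\<lambda>x. g (u x) *\<^sub>R D x)"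
      unfolding F_def g_def by (rule clip_gradient[OF M \<theta>(1)])
    obtain f' v' where W: "Wgrad f' v'" and f': "AE x in lborel. f' x = indicator \<Omega> x * (\<phi> x ^ N * F (u x))"
      and v': "AE x in lborel. v' x = indicator \<Omega> x *\<^sub>R (\<phi> x ^ N *\<^sub>R (g (u x) *\<^sub>R D x) + F (u x) *\<^sub>R grad (\<lambda>x. \<phi> x ^ N) x)"
      using local_to_global[OF wg \<phi>N] by blast
    have f'f: "AE x in lborel. f' x = f i x"
      using f'
    proof eventually_elim
      case (elim x)
      show ?case
      proof (cases "x \<in> \<Omega>")
        case True
        then show ?thesis using elim by (simp add: f_def F_def M_def mult.commute)
      next
        case False
        then have "\<phi> x ^ N = 0" using test_zero(1)[OF \<phi>(1) False] N0 by simp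
        then show ?thesis using elim False by (simp add: f_def)
      qed
    qed
    have fm: "f i \<in> borel_measurable lborel" unfolding f_def[abs_def] clip_def by measurable
    show fi: "integrable lborel (f i)"
      by (rule integrable_cong_AE_imp[OF WgradD(1)[OF W] fm f'f])
    have f0: "0 \<le> f i x" for x
      using F0[of "u x"] \<phi>(2)[of x] by (simp add: f_def F_def M_def)
    have "(LBINT x. f i x) = (LBINT x. \<bar>f' x\<bar>)"
    proof (rule integral_cong_AE)
      show "AE x in lborel. f i x = \<bar>f' x\<bar>"
        using f'f by eventually_elim (use f0 in simp)
    qed (use fm WgradD(4)[OF W] in auto)
    also have "\<dots> \<le> 4 * ?n * measure lborel A powr (1 / ?n) * (LBINT x. norm (v' x))"
    proof (rule Faber_Krahn[OF W Am Afin])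
      show "AE x in lborel. x \<notin> A \<longrightarrow> f' x = 0"
        using f'
      proof eventually_elim
        case (elim x)
        show ?case
        proof
          assume "x \<notin> A"
          then have "F (u x) = 0 \<or> \<phi> x ^ N = 0" using Fk[of "u x"] B(3)[of x] N0 by (auto simp: A_def)
          then show "f' x = 0" using elim by auto
        qed
      qed
    qed
    also have "\<dots> \<le> R"
      unfolding R_def
    proof (rule mult_left_mono)
      have "(LBINT x. norm (v' x)) \<le> (LBINT x. \<theta> * H x + real N * \<Lambda> * ?P \<theta> x)"
      proof (rule integral_mono_AE)
        show "integrable lborel (\<lambda>x. norm (v' x))" using WgradD(2)[OF W] by simp
        show "integrable lborel (\<lambda>x. \<theta> * H x + real N * \<Lambda> * ?P \<theta> x)"
          by (intro Bochner_Integration.integrable_add integrable_mult_right Hi Pi \<theta>(2))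
        show "AE x in lborel. norm (v' x) \<le> \<theta> * H x + real N * \<Lambda> * ?P \<theta> x"
          using v'
        proof eventually_elim
          case (elim x)
          have H0: "0 \<le> H x" by (simp add: H_def)
          have RHS0: "0 \<le> \<theta> * H x + real N * \<Lambda> * ?P \<theta> x"
            using H0 \<theta>(1) \<Lambda>(1) P0[of x \<theta>] by (intro add_nonneg_nonneg mult_nonneg_nonneg) auto
          show ?case
          proof (cases "x \<in> A \<and> x \<in> \<Omega>")
            case False
            have "v' x = 0"
            proof (cases "x \<in> \<Omega>")
              case True
              with False have "k \<le> u x \<or> x \<notin> B" by (auto simp: A_def)
              then show ?thesis
              proof
                assume "k \<le> u x"
                then show ?thesis using elim Fk[of "u x"] by (simp add: g_def)
              next
                assume "x \<notin> B"
                then have "\<phi> x ^ N = 0" "grad (\<lambda>x. \<phi> x ^ N) x = 0" using B(3,4)[of x] N0 by (simp_all add: grN)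
                then show ?thesis using elim by simp
              qed
            qed (use elim in simp)
            then show ?thesis using RHS0 by simp
          next
            case True
            define b where "b = 1 + (k - u x)"
            have b: "b \<ge> 1" using True by (simp add: b_def A_def)
            let ?d = "norm (D x)"
            have "norm (v' x) \<le> \<phi> x ^ N * (\<bar>g (u x)\<bar> * ?d) + F (u x) * (real N * \<phi> x ^ (N - 1) * norm (grad \<phi> x))"
            proof -
              have "v' x = \<phi> x ^ N *\<^sub>R (g (u x) *\<^sub>R D x) + F (u x) *\<^sub>R grad (\<lambda>x. \<phi> x ^ N) x"
                using elim True by simp
              then have "norm (v' x) \<le> norm (\<phi> x ^ N *\<^sub>R (g (u x) *\<^sub>R D x)) + norm (F (u x) *\<^sub>R grad (\<lambda>x. \<phi> x ^ N) x)"
                by (simp only: norm_triangle_ineq)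
              then show ?thesis using \<phi>(2)[of x] F0[of "u x"] by (simp add: grN abs_mult mult.assoc)
            qed
            moreover have "\<phi> x ^ N * (\<bar>g (u x)\<bar> * ?d) \<le> \<theta> * H x"
            proof -
              have gle: "\<bar>g (u x)\<bar> \<le> \<theta> * b powr (\<theta> - 1)" using \<theta>(1) by (auto simp: g_def b_def abs_mult)
              have phi: "\<phi> x ^ N \<le> (\<phi> x ^ N) powr (1 / q)"
              proof (cases "\<phi> x ^ N = 0")
                case False
                have p: "0 \<le> \<phi> x ^ N" "\<phi> x ^ N \<le> 1" using \<phi>(2,3)[of x] by (auto intro: power_le_one)
                have "(\<phi> x ^ N) powr 1 \<le> (\<phi> x ^ N) powr (1 / q)"
                  by (rule powr_mono') (use p q1 in auto)
                then show ?thesis using p by simp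
              next
                case True
                show ?thesis by (simp only: True powr_ge_zero)
              qed
              have "H x = (b powr (- (1 + \<tau>)) * ?d powr q * \<phi> x ^ N) powr (1 / q) * (b powr \<theta>) powr (1 - 1 / q)"
                using True by (simp add: H_def X_def b_def A_def)
              also have "\<dots> = b powr (- (1 + \<tau>) * (1 / q)) * b powr (\<theta> * (1 - 1 / q)) * (?d powr q) powr (1 / q) * (\<phi> x ^ N) powr (1 / q)"
                using b \<phi>(2)[of x] by (simp add: powr_mult powr_powr)
              also have "(?d powr q) powr (1 / q) = ?d" using q1 by (simp add: powr_powr)
              also have "b powr (- (1 + \<tau>) * (1 / q)) * b powr (\<theta> * (1 - 1 / q)) = b powr (\<theta> - 1)"
              proof -
                have "- (1 + \<tau>) * (1 / q) + \<theta> * (1 - 1 / q) = \<theta> - 1"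
                  using q1 by (simp add: \<theta>_def field_simps)
                then show ?thesis by (simp only: powr_add[symmetric])
              qed
              finally have Hx: "H x = b powr (\<theta> - 1) * ?d * (\<phi> x ^ N) powr (1 / q)" .
              have "\<phi> x ^ N * (\<bar>g (u x)\<bar> * ?d) \<le> (\<phi> x ^ N) powr (1 / q) * ((\<theta> * b powr (\<theta> - 1)) * ?d)"
                using \<phi>(2)[of x] by (intro mult_mono mult_right_mono phi gle) auto
              also have "\<dots> = \<theta> * H x" by (simp add: Hx mult_ac)
              finally show ?thesis .
            qed
            moreover have "F (u x) * (real N * \<phi> x ^ (N - 1) * norm (grad \<phi> x)) \<le> real N * \<Lambda> * ?P \<theta> x"
            proof -
              have F1: "F (u x) \<le> ?P \<theta> x" using True Fle[of "u x"] by (simp add: A_def)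
              have G1: "real N * \<phi> x ^ (N - 1) * norm (grad \<phi> x) \<le> real N * 1 * \<Lambda>"
                using \<phi>(2)[of x] power_le_one[OF \<phi>(2,3), of x "N - 1"] \<Lambda> by (intro mult_mono) auto
              have "F (u x) * (real N * \<phi> x ^ (N - 1) * norm (grad \<phi> x)) \<le> ?P \<theta> x * (real N * 1 * \<Lambda>)"
                by (rule mult_mono[OF F1 G1 P0]) (use \<phi>(2)[of x] in simp)
              then show ?thesis by (simp add: mult_ac)
            qed
            ultimately show ?thesis by linarith
          qed
        qed
      qed
      also have "\<dots> = \<theta> * (LBINT x. H x) + real N * \<Lambda> * Y"
        unfolding Y by (subst Bochner_Integration.integral_add[OF integrable_mult_right[OF Hi] integrable_mult_right[OF Pi[OF \<theta>(2)]]]) simp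
      finally show "(LBINT x. norm (v' x)) \<le> \<theta> * (LBINT x. H x) + real N * \<Lambda> * Y" .
    qed simp
    finally show "(LBINT x. f i x) \<le> R" .
  qed
  let ?L = "\<lambda>x. indicator {x. u x < k} x * ((1 + (k - u x)) powr \<theta> - 1) * \<phi> x ^ N"
  have Lm: "?L \<in> borel_measurable borel" by measurable
  have finc: "incseq (\<lambda>i. f i x)" for x
  proof -
    have "(1 + clip (real (Suc i)) (k - u x)) powr \<theta> \<le> (1 + clip (real (Suc j)) (k - u x)) powr \<theta>" if "i \<le> j" for i j
      using that \<theta>(1) by (intro powr_mono2) (auto simp: clip_def)
    then show ?thesis
      using \<phi>(2)[of x] by (auto simp: incseq_def f_def intro!: mult_right_mono)
  qed
  have flim: "(\<lambda>i. f i x) \<longlonglongrightarrow> ?L x" for x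
  proof -
    obtain m :: nat where m: "k - u x < real m" using reals_Archimedean2 by blast
    have "?L x = f i x" if "i \<ge> m" for i
    proof -
      have "k - u x \<le> real (Suc i)" using that m by simp
      then have "clip (real (Suc i)) (k - u x) = max 0 (k - u x)" by (simp add: clip_def)
      then show ?thesis by (cases "u x < k") (auto simp: f_def)
    qed
    then have "\<forall>\<^sub>F i in sequentially. ?L x = f i x" unfolding eventually_sequentially by blast
    then show ?thesis by (rule Lim_transform_eventually[OF tendsto_const])
  qed
  show "integrable lborel (\<lambda>x. indicator {x. u x < k} x * ((1 + (k - u x)) powr (q - 1 - \<tau>) - 1) * \<phi> x ^ N)"
    using integral_incseq_bounded(1)[OF fi finc flim Lm fR] by (simp add: \<theta>_def)
  have "(LBINT x. ?L x) \<le> R" by (rule integral_incseq_bounded(2)[OF fi finc flim Lm fR])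
  also have "R \<le> 4 * ?n * (\<theta> * C0 powr (1 / q) + real N) * \<Lambda> * K powr (\<alpha> / q) * Y powr (1 + 1 / ?n - \<alpha> / q)"
  proof (cases "Y = 0")
    case True
    then have "measure lborel A = 0" using AY measure_nonneg[of lborel A] by linarith
    then show ?thesis by (simp add: R_def True)
  next
    case False
    then have Yp: "0 < Y" using Y0 by simp
    then have Kp: "0 < K" using YK by simp
    have e1: "(C0 * \<Lambda> powr q * (Y powr (1 - \<alpha>) * K powr \<alpha>)) powr (1 / q) * Y powr (1 - 1 / q)
        = C0 powr (1 / q) * \<Lambda> * K powr (\<alpha> / q) * Y powr (1 - \<alpha> / q)"
    proof -
      have "(C0 * \<Lambda> powr q * (Y powr (1 - \<alpha>) * K powr \<alpha>)) powr (1 / q)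
          = C0 powr (1 / q) * (\<Lambda> powr q) powr (1 / q) * (Y powr (1 - \<alpha>)) powr (1 / q) * (K powr \<alpha>) powr (1 / q)"
        using C0 by (simp add: powr_mult mult.assoc)
      also have "(\<Lambda> powr q) powr (1 / q) = \<Lambda>" using \<Lambda>(1) q1 by (simp add: powr_powr)
      also have "(Y powr (1 - \<alpha>)) powr (1 / q) = Y powr ((1 - \<alpha>) * (1 / q))" by (simp add: powr_powr)
      also have "(K powr \<alpha>) powr (1 / q) = K powr (\<alpha> / q)" by (simp add: powr_powr)
      finally have "(C0 * \<Lambda> powr q * (Y powr (1 - \<alpha>) * K powr \<alpha>)) powr (1 / q) * Y powr (1 - 1 / q)
          = C0 powr (1 / q) * \<Lambda> * K powr (\<alpha> / q) * (Y powr ((1 - \<alpha>) * (1 / q)) * Y powr (1 - 1 / q))"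
        by (simp add: mult_ac)
      also have "Y powr ((1 - \<alpha>) * (1 / q)) * Y powr (1 - 1 / q) = Y powr (1 - \<alpha> / q)"
      proof -
        have "(1 - \<alpha>) * (1 / q) + (1 - 1 / q) = 1 - \<alpha> / q" using q1 by (simp add: field_simps)
        then show ?thesis by (simp only: powr_add[symmetric])
      qed
      finally show ?thesis .
    qed
    have e2: "Y \<le> K powr (\<alpha> / q) * Y powr (1 - \<alpha> / q)"
    proof -
      have "Y = Y powr (\<alpha> / q) * Y powr (1 - \<alpha> / q)" using Yp by (simp add: powr_add[symmetric])
      also have "\<dots> \<le> K powr (\<alpha> / q) * Y powr (1 - \<alpha> / q)"
        using Yp YK l q1 by (intro mult_right_mono powr_mono2) auto
      finally show ?thesis .
    qed
    have "\<theta> * (LBINT x. H x) + real N * \<Lambda> * Y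
        \<le> \<theta> * (C0 powr (1 / q) * \<Lambda> * K powr (\<alpha> / q) * Y powr (1 - \<alpha> / q)) + real N * \<Lambda> * (K powr (\<alpha> / q) * Y powr (1 - \<alpha> / q))"
      using \<theta>(1) \<Lambda>(1) Hle[unfolded e1] e2 by (intro add_mono mult_left_mono) auto
    also have "\<dots> = (\<theta> * C0 powr (1 / q) + real N) * \<Lambda> * K powr (\<alpha> / q) * Y powr (1 - \<alpha> / q)"
      by (simp add: algebra_simps)
    finally have e3: "\<theta> * (LBINT x. H x) + real N * \<Lambda> * Y
        \<le> (\<theta> * C0 powr (1 / q) + real N) * \<Lambda> * K powr (\<alpha> / q) * Y powr (1 - \<alpha> / q)" .
    have a1: "measure lborel A powr (1 / ?n) \<le> Y powr (1 / ?n)" using n by (intro powr_mono2 AY) auto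
    have H0: "0 \<le> \<theta> * (LBINT x. H x) + real N * \<Lambda> * Y"
      using \<theta>(1) \<Lambda>(1) Y0 by (intro add_nonneg_nonneg mult_nonneg_nonneg Bochner_Integration.integral_nonneg) (auto simp: H_def)
    have "R \<le> 4 * ?n * Y powr (1 / ?n) * ((\<theta> * C0 powr (1 / q) + real N) * \<Lambda> * K powr (\<alpha> / q) * Y powr (1 - \<alpha> / q))"
      unfolding R_def by (rule mult_mono[OF mult_left_mono[OF a1] e3 _ H0]) simp_all
    also have "\<dots> = 4 * ?n * (\<theta> * C0 powr (1 / q) + real N) * \<Lambda> * K powr (\<alpha> / q) * (Y powr (1 / ?n) * Y powr (1 - \<alpha> / q))"
      by (simp only: mult_ac)
    also have "Y powr (1 / ?n) * Y powr (1 - \<alpha> / q) = Y powr (1 + 1 / ?n - \<alpha> / q)"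
    proof -
      have "1 / ?n + (1 - \<alpha> / q) = 1 + 1 / ?n - \<alpha> / q" by simp
      then show ?thesis by (simp only: powr_add[symmetric])
    qed
    finally show ?thesis .
  qed
  finally show "(LBINT x. indicator {x. u x < k} x * ((1 + (k - u x)) powr (q - 1 - \<tau>) - 1) * \<phi> x ^ N)
      \<le> 4 * ?n * ((q - 1 - \<tau>) * C0 powr (1 / q) + real N) * \<Lambda> * K powr (\<alpha> / q) * Y powr (1 + 1 / ?n - \<alpha> / q)"
    by (simp add: \<theta>_def)
qed

end

section \<open>Local lower bounds by De Giorgi iteration\<close>

text \<open>By induction \<open>y j \<le> y 0 * (b powr (- (1 / \<beta>))) ^ j\<close>: raised to the power \<open>\<beta>\<close>, the geometric factor cancels the
  growth of \<open>b ^ j\<close>.\<close>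

lemma fast_geometric_convergence:
  fixes y :: "nat \<Rightarrow> real"
  assumes y0: "\<And>j. 0 \<le> y j" and step: "\<And>j. y (Suc j) \<le> C * b ^ j * y j powr (1 + \<beta>)"
    and C: "0 < C" and b: "1 < b" and \<beta>: "0 < \<beta>" and start: "C * y 0 powr \<beta> \<le> b powr (- (1 / \<beta>))"
  shows "y \<longlonglongrightarrow> 0"
proof -
  have le: "y j \<le> y 0 * (b powr (- (1 / \<beta>))) ^ j" for j
  proof (induction j)
    case (Suc j)
    let ?c = "b powr (- (1 / \<beta>))"
    have c: "0 < ?c" using b by simp
    have cb: "(?c ^ j) powr \<beta> = inverse (b ^ j)"
    proof -
      have "(?c ^ j) powr \<beta> = (?c powr real j) powr \<beta>" by (simp only: powr_realpow[OF c])
      also have "\<dots> = (?c powr \<beta>) powr real j" by (simp only: powr_powr mult_ac)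
      also have "\<dots> = (?c powr \<beta>) ^ j" using c by (intro powr_realpow) simp
      also have "?c powr \<beta> = b powr (- (1 / \<beta>) * \<beta>)" by (rule powr_powr)
      also have "\<dots> = inverse b" using b \<beta> by (simp add: powr_minus)
      finally show ?thesis by (simp add: power_inverse)
    qed
    have "y (Suc j) \<le> C * b ^ j * y j powr (1 + \<beta>)" by (rule step)
    also have "\<dots> \<le> C * b ^ j * (y 0 * ?c ^ j) powr (1 + \<beta>)"
      using C b \<beta> y0 Suc by (intro mult_left_mono powr_mono2) auto
    also have "(y 0 * ?c ^ j) powr (1 + \<beta>) = (y 0 * ?c ^ j) * (y 0 powr \<beta> * (?c ^ j) powr \<beta>)"
      using y0[of 0] c by (simp add: powr_mult_base[symmetric] powr_mult)
    also have "C * b ^ j * ((y 0 * ?c ^ j) * (y 0 powr \<beta> * (?c ^ j) powr \<beta>)) = (y 0 * ?c ^ j) * (C * y 0 powr \<beta>)"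
      using b by (simp add: cb field_simps)
    also have "\<dots> \<le> (y 0 * ?c ^ j) * ?c"
      using y0[of 0] c start by (intro mult_left_mono) auto
    finally show ?case by (simp add: mult_ac)
  qed simp
  have "b powr (- (1 / \<beta>)) < b powr 0" using b \<beta> by (intro powr_less_mono) auto
  then have "b powr (- (1 / \<beta>)) < 1" using b by simp
  then have "(\<lambda>j. y 0 * (b powr (- (1 / \<beta>))) ^ j) \<longlonglongrightarrow> y 0 * 0"
    by (intro tendsto_mult tendsto_const LIMSEQ_power_zero) simp
  then show ?thesis
    by (intro tendsto_sandwich[OF _ _ tendsto_const, of 0 y _ "\<lambda>j. y 0 * (b powr (- (1 / \<beta>))) ^ j"]) (use y0 le in auto)
qed

text \<open>The energy estimate controls \<open>b powr \<theta> - 1\<close> with \<open>b = 1 + (k - u)\<close>, which vanishes at the level \<open>k\<close>.  At a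
  level lower by \<open>x\<close> it dominates a multiple of \<open>b powr \<theta>\<close> that is linear in \<open>x\<close>.\<close>

lemma powr_minus_one_ge:
  fixes b x \<theta> :: real
  assumes x: "0 \<le> x" "x \<le> 1" and b: "1 + x \<le> b" and \<theta>: "0 < \<theta>"
  shows "\<theta> / (2 + \<theta>) * x * b powr \<theta> \<le> b powr \<theta> - 1"
proof -
  have "ln (inverse (1 + x)) \<le> inverse (1 + x) - 1" using x by (intro ln_le_minus_one) auto
  then have "1 - inverse (1 + x) \<le> ln (1 + x)" using x by (simp add: ln_inverse)
  moreover have "1 - inverse (1 + x) = x / (1 + x)" using x by (simp add: field_simps)
  ultimately have "x / (1 + x) \<le> ln (1 + x)" by simp
  moreover have "x / 2 \<le> x / (1 + x)" using x by (intro divide_left_mono) auto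
  ultimately have l: "x / 2 \<le> ln (1 + x)" by (rule order_trans[rotated])
  define y where "y = \<theta> * x / 2"
  have y: "0 \<le> y" "y \<le> \<theta> / 2" using x \<theta> by (auto simp: y_def mult_left_le)
  have "1 + y \<le> exp y" by (rule exp_ge_add_one_self)
  also have "y \<le> \<theta> * ln (1 + x)" using l \<theta> by (simp add: y_def)
  then have "exp y \<le> (1 + x) powr \<theta>" using x by (simp add: powr_def)
  also have "\<dots> \<le> b powr \<theta>" using x b \<theta> by (intro powr_mono2) auto
  finally have B: "1 + y \<le> b powr \<theta>" .
  have "\<theta> / (2 + \<theta>) * x = y / (1 + \<theta> / 2)" using \<theta> by (simp add: y_def field_simps)
  also have "\<dots> \<le> y / (1 + y)" using y by (intro divide_left_mono) auto
  finally have "\<theta> / (2 + \<theta>) * x * b powr \<theta> \<le> y / (1 + y) * b powr \<theta>" by (rule mult_right_mono) simp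
  also have "\<dots> = b powr \<theta> - b powr \<theta> / (1 + y)" using y by (simp add: field_simps)
  also have "\<dots> \<le> b powr \<theta> - 1" using B y by (simp add: field_simps)
  finally show ?thesis .
qed

text \<open>Integrability beyond the exponent \<open>q - 1\<close> is what the iteration gains from; the upper bound for \<open>\<sigma>\<close> makes \<open>\<theta>\<close>
  below positive.\<close>

locale integrable_supersolution = supersolution p q \<Omega> u D
  for p q :: real and \<Omega> :: "'a::euclidean_space set" and u D +
  fixes \<sigma> :: real
  assumes q_le: "q \<le> real DIM('a)" and \<sigma>: "q - 1 < \<sigma>" "\<sigma> < 2 * (q - 1)"
    and u_integrable: "\<And>K. compact K \<Longrightarrow> K \<subseteq> \<Omega> \<Longrightarrow> integrable lborel (\<lambda>x. indicator K x * \<bar>u x\<bar> powr \<sigma>)"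
begin

text \<open>With this value \<open>(1 + \<tau>) (q - 1) = (1 - \<alpha>) \<theta> + \<alpha> \<sigma>\<close> for \<open>\<alpha> = q / (n + 1)\<close>, and \<open>\<alpha> / q < 1 / n\<close> as the
  iteration requires.\<close>

definition \<tau> :: real where "\<tau> = (\<sigma> - (q - 1)) / real DIM('a)"

definition \<theta> :: real where "\<theta> = q - 1 - \<tau>"

lemma dim1: "1 \<le> real DIM('a)"
  using DIM_positive[where 'a = 'a] by linarith

lemma \<tau>_bounds: "0 < \<tau>" "\<tau> < q - 1"
proof -
  show "0 < \<tau>" using \<sigma> dim1 by (simp add: \<tau>_def)
  have "\<tau> \<le> (\<sigma> - (q - 1)) / 1" unfolding \<tau>_def using \<sigma> dim1 by (intro divide_left_mono) auto
  then show "\<tau> < q - 1" using \<sigma> by simp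
qed

lemma \<theta>_bounds: "0 < \<theta>" "\<theta> \<le> \<sigma>" "0 < \<sigma>"
  using \<tau>_bounds \<sigma> q1 by (auto simp: \<theta>_def)

lemma one_plus_u_integrable:
  assumes "compact K" "K \<subseteq> \<Omega>" and c: "0 \<le> c"
  shows "integrable lborel (\<lambda>x. indicator K x * (c + \<bar>u x\<bar>) powr \<sigma>)"
proof (rule Bochner_Integration.integrable_bound)
  note [measurable] = borel_compact[OF assms(1)]
  show "integrable lborel (\<lambda>x. 2 powr \<sigma> * (\<bar>c\<bar> powr \<sigma> * indicator K x + indicator K x * \<bar>u x\<bar> powr \<sigma>))"
    by (intro integrable_mult_right Bochner_Integration.integrable_add u_integrable assms integrable_indicator_bounded)
      (use assms(1) in \<open>auto simp: compact_imp_bounded\<close>)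
  show "(\<lambda>x. indicator K x * (c + \<bar>u x\<bar>) powr \<sigma>) \<in> borel_measurable lborel" by measurable
  show "AE x in lborel. norm (indicator K x * (c + \<bar>u x\<bar>) powr \<sigma>)
      \<le> norm (2 powr \<sigma> * (\<bar>c\<bar> powr \<sigma> * indicator K x + indicator K x * \<bar>u x\<bar> powr \<sigma>))" (is "AE x in _. ?P x")
  proof (rule AE_I2)
    fix x
    have a1: "\<bar>c + \<bar>u x\<bar>\<bar> \<le> 2 * max \<bar>c\<bar> \<bar>u x\<bar>" by simp
    have "(c + \<bar>u x\<bar>) powr \<sigma> = \<bar>c + \<bar>u x\<bar>\<bar> powr \<sigma>" using c by simp
    also have "\<dots> \<le> (2 * max \<bar>c\<bar> \<bar>u x\<bar>) powr \<sigma>" using a1 \<theta>_bounds by (intro powr_mono2) auto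
    also have "\<dots> = 2 powr \<sigma> * (max \<bar>c\<bar> \<bar>u x\<bar>) powr \<sigma>" by (simp add: powr_mult)
    also have "(max \<bar>c\<bar> \<bar>u x\<bar>) powr \<sigma> \<le> \<bar>c\<bar> powr \<sigma> + \<bar>u x\<bar> powr \<sigma>" by (simp add: max_def)
    finally have "(c + \<bar>u x\<bar>) powr \<sigma> \<le> 2 powr \<sigma> * (\<bar>c\<bar> powr \<sigma> + \<bar>u x\<bar> powr \<sigma>)" by simp
    then show "?P x"
      by (cases "x \<in> K") (auto intro: order_trans[OF _ abs_ge_self])
  qed
qed

lemma excess_integrable:
  assumes K: "compact K" "K \<subseteq> \<Omega>" and e: "0 \<le> e" "e \<le> \<sigma>"
  shows "integrable lborel (\<lambda>x. indicator ({x. u x < k} \<inter> K) x * (1 + (k - u x)) powr e)"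
proof (rule Bochner_Integration.integrable_bound)
  show "integrable lborel (\<lambda>x. indicator K x * (1 + \<bar>k\<bar> + \<bar>u x\<bar>) powr \<sigma>)"
    by (rule one_plus_u_integrable[OF K]) simp
  note [measurable] = borel_compact[OF K(1)]
  show "(\<lambda>x. indicator ({x. u x < k} \<inter> K) x * (1 + (k - u x)) powr e) \<in> borel_measurable lborel" by measurable
  show "AE x in lborel. norm (indicator ({x. u x < k} \<inter> K) x * (1 + (k - u x)) powr e)
      \<le> norm (indicator K x * (1 + \<bar>k\<bar> + \<bar>u x\<bar>) powr \<sigma>)" (is "AE x in _. ?P x")
  proof (rule AE_I2)
    fix x
    show "?P x"
    proof (cases "u x < k \<and> x \<in> K")
      case True
      then have "(1 + (k - u x)) powr e \<le> (1 + (k - u x)) powr \<sigma>" using e by (intro powr_mono) auto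
      also have "\<dots> \<le> (1 + \<bar>k\<bar> + \<bar>u x\<bar>) powr \<sigma>" using True \<theta>_bounds by (intro powr_mono2) auto
      finally show ?thesis using True by simp
    qed (auto simp: indicator_def)
  qed
qed

abbreviation excess :: "real \<Rightarrow> real \<Rightarrow> 'a set \<Rightarrow> real" where
  "excess e k K \<equiv> LBINT x. indicator ({x. u x < k} \<inter> K) x * (1 + (k - u x)) powr e"

lemma excess_mono:
  assumes K: "compact K" "K \<subseteq> \<Omega>" and K': "compact K'" "K' \<subseteq> K" and e: "0 \<le> e" "e \<le> \<sigma>" and k: "k' \<le> k"
  shows "excess e k' K' \<le> excess e k K"
proof (rule integral_mono[OF excess_integrable[OF K'(1) subset_trans[OF K'(2) K(2)] e] excess_integrable[OF K e]])
  fix x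
  show "indicator ({x. u x < k'} \<inter> K') x * (1 + (k' - u x)) powr e \<le> indicator ({x. u x < k} \<inter> K) x * (1 + (k - u x)) powr e"
    using K'(2) e k by (auto simp: indicator_def intro!: powr_mono2)
qed

text \<open>With the choice of \<open>\<tau>\<close> made above, the interpolation parameter of one step is \<open>q / (n + 1)\<close>, and the
  gain in the exponent is \<open>1 / n - 1 / (n + 1)\<close>.\<close>

lemma excess_step:
  fixes r r' \<rho> k k' :: real
  assumes r: "0 < \<rho>" "\<rho> \<le> r - r'" "\<rho> \<le> 3" "0 < r'" and B: "cball z r \<subseteq> \<Omega>" and k: "k' < k" "k - k' \<le> 1"
    and K: "excess \<sigma> k (cball z r) \<le> K"
  defines "n \<equiv> real DIM('a)"
  defines "c \<equiv> 4 * n * (\<theta> * (2 * (real (nat \<lceil>q\<rceil>) / \<tau> + 2 powr (q - 1) * (2 * (real (nat \<lceil>q\<rceil>) / \<tau>)) powr q)) powr (1 / q) + real (nat \<lceil>q\<rceil>))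
      * (3 * (1 + mollifier_const TYPE('a)))"
  shows "\<theta> / (2 + \<theta>) * (k - k') * excess \<theta> k' (cball z r')
    \<le> c / \<rho> * K powr (1 / (n + 1)) * excess \<theta> k (cball z r) powr (1 + 1 / n - 1 / (n + 1))"
proof -
  let ?N = "nat \<lceil>q\<rceil>" and ?mc = "mollifier_const TYPE('a)"
  have N: "q \<le> real ?N" by linarith
  have mc: "0 \<le> ?mc" by (rule mollifier_const_nonneg)
  have e: "0 < \<rho> / 3" using r by simp
  obtain \<eta> where \<eta>: "\<eta> \<in> test_functions {x. \<exists>y\<in>cball z r'. dist y x \<le> 3 * (\<rho> / 3)}"
    "\<And>x. 0 \<le> \<eta> x" "\<And>x. \<eta> x \<le> 1" "\<And>x y. y \<in> cball z r' \<Longrightarrow> dist y x < \<rho> / 3 \<Longrightarrow> \<eta> x = 1"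
    "\<And>x. norm (grad \<eta> x) \<le> ?mc / (\<rho> / 3)"
    by (rule cutoff_exists[OF compact_cball[of z r'] e]) blast
  have sub: "{x. \<exists>y\<in>cball z r'. dist y x \<le> 3 * (\<rho> / 3)} \<subseteq> cball z r"
  proof safe
    fix x y assume "y \<in> cball z r'" "dist y x \<le> 3 * (\<rho> / 3)"
    then have "dist z x \<le> r' + \<rho>" using dist_triangle[of z x y] by simp
    then show "x \<in> cball z r" using r by simp
  qed
  have \<eta>B: "\<eta> \<in> test_functions (cball z r)" by (rule test_mono[OF \<eta>(1) sub])
  have \<eta>O: "\<eta> \<in> test_functions \<Omega>" by (rule test_mono[OF \<eta>B B])
  have z: "\<eta> x = 0" "grad \<eta> x = 0" if "x \<notin> cball z r" for x
    by (rule test_zero[OF \<eta>B that])+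
  define \<Lambda> where "\<Lambda> = 3 * (1 + ?mc) / \<rho>"
  have \<Lambda>1: "1 \<le> \<Lambda>" using r mc by (simp add: \<Lambda>_def le_divide_eq)
  have \<Lambda>g: "norm (grad \<eta> x) \<le> \<Lambda>" for x
  proof -
    have "?mc / (\<rho> / 3) \<le> \<Lambda>" using r mc by (simp add: \<Lambda>_def divide_right_mono)
    then show ?thesis using \<eta>(5)[of x] by simp
  qed
  define a where "a = q / (n + 1)"
  have n1: "1 \<le> n" unfolding n_def by (rule dim1)
  have a: "0 < a" "a < 1" using q1 q_le n1 by (auto simp: a_def n_def)
  have aeq: "(1 + \<tau>) * (q - 1) = (1 - a) * (q - 1 - \<tau>) + a * \<sigma>"
  proof -
    have s: "\<sigma> = (q - 1) + n * \<tau>" using n1 by (simp add: \<tau>_def n_def)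
    have gen: "(1 - a) * (q - 1 - t) + a * ((q - 1) + n * t) = (q - 1 - t) + a * (n + 1) * t" for t
      by (simp add: algebra_simps)
    have "(1 - a) * (q - 1 - \<tau>) + a * \<sigma> = (q - 1 - \<tau>) + a * (n + 1) * \<tau>"
      using gen[of \<tau>] by (simp only: s[symmetric])
    also have "a * (n + 1) = q" using n1 by (simp add: a_def)
    finally show ?thesis by (simp add: algebra_simps)
  qed
  have \<theta>\<sigma>: "q - 1 - \<tau> \<le> \<sigma>" using \<theta>_bounds by (simp add: \<theta>_def)
  have e\<sigma>: "0 \<le> \<sigma>" "\<sigma> \<le> \<sigma>" using \<theta>_bounds by auto
  note st = de_giorgi_step[OF \<tau>_bounds N \<eta>O \<eta>(2,3) compact_cball B z \<Lambda>1 \<Lambda>g a aeq \<theta>\<sigma> excess_integrable[OF compact_cball B e\<sigma>, of k] K]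
  let ?f = "\<lambda>x. indicator {x. u x < k} x * ((1 + (k - u x)) powr (q - 1 - \<tau>) - 1) * \<eta> x ^ ?N"
  have sub2: "cball z r' \<subseteq> cball z r" using r by auto
  have "\<theta> / (2 + \<theta>) * (k - k') * excess \<theta> k' (cball z r')
      = (LBINT x. \<theta> / (2 + \<theta>) * (k - k') * (indicator ({x. u x < k'} \<inter> cball z r') x * (1 + (k' - u x)) powr \<theta>))"
    by simp
  also have "\<dots> \<le> (LBINT x. ?f x)"
  proof (rule integral_mono[OF _ st(1)])
    show "integrable lborel (\<lambda>x. \<theta> / (2 + \<theta>) * (k - k') * (indicator ({x. u x < k'} \<inter> cball z r') x * (1 + (k' - u x)) powr \<theta>))"
      using \<theta>_bounds by (intro integrable_mult_right excess_integrable compact_cball subset_trans[OF sub2 B]) auto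
    fix x
    show "\<theta> / (2 + \<theta>) * (k - k') * (indicator ({x. u x < k'} \<inter> cball z r') x * (1 + (k' - u x)) powr \<theta>) \<le> ?f x"
    proof (cases "u x < k' \<and> x \<in> cball z r'")
      case True
      then have \<eta>1: "\<eta> x = 1" using \<eta>(4)[of x x] e by auto
      have "\<theta> / (2 + \<theta>) * (k - k') * (1 + (k' - u x)) powr \<theta> \<le> \<theta> / (2 + \<theta>) * (k - k') * (1 + (k - u x)) powr \<theta>"
        using True k \<theta>_bounds by (intro mult_left_mono powr_mono2) auto
      also have "\<dots> \<le> (1 + (k - u x)) powr \<theta> - 1"
        using True k \<theta>_bounds by (intro powr_minus_one_ge) auto
      finally have "\<theta> / (2 + \<theta>) * (k - k') * (1 + (k' - u x)) powr \<theta> \<le> (1 + (k - u x)) powr \<theta> - 1" .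
      then show ?thesis using True k \<eta>1 by (simp add: \<theta>_def)
    next
      case False
      have "0 \<le> ?f x"
        using \<eta>(2)[of x] \<theta>_bounds by (auto simp: indicator_def \<theta>_def[symmetric] intro!: mult_nonneg_nonneg ge_one_powr_ge_zero)
      moreover have "indicator ({x. u x < k'} \<inter> cball z r') x = (0::real)" using False by (auto simp: indicator_def)
      ultimately show ?thesis by simp
    qed
  qed
  also note st(2)
  also have "a / q = 1 / (n + 1)" using q1 by (simp add: a_def)
  finally show ?thesis
    by (simp add: c_def n_def \<Lambda>_def \<theta>_def)
qed

text \<open>Both smallness conditions are scale invariant, which makes the constant \<open>\<nu>\<close> independent of the ball.\<close>

lemma lower_bound_from_small_excess:
  assumes \<kappa>: "0 < \<kappa>" and d: "0 < d" "d \<le> 1"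
  obtains \<nu> where "0 < \<nu>"
    "\<And>z r k. 0 < r \<Longrightarrow> r \<le> 1 \<Longrightarrow> cball z r \<subseteq> \<Omega> \<Longrightarrow> excess \<sigma> k (cball z r) \<le> \<kappa> * r ^ DIM('a) \<Longrightarrow>
       excess \<theta> k (cball z r) \<le> \<nu> * r ^ DIM('a) \<Longrightarrow> AE x in lborel. x \<in> ball z (r / 2) \<longrightarrow> k - d \<le> u x"
proof -
  define n where "n = real DIM('a)"
  have n1: "1 \<le> n" unfolding n_def by (rule dim1)
  define c where "c = 4 * n * (\<theta> * (2 * (real (nat \<lceil>q\<rceil>) / \<tau> + 2 powr (q - 1) * (2 * (real (nat \<lceil>q\<rceil>) / \<tau>)) powr q)) powr (1 / q) + real (nat \<lceil>q\<rceil>))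
      * (3 * (1 + mollifier_const TYPE('a)))"
  have c: "0 < c"
  proof -
    have "0 < real (nat \<lceil>q\<rceil>)" using q1 by simp
    then have "0 < \<theta> * (2 * (real (nat \<lceil>q\<rceil>) / \<tau> + 2 powr (q - 1) * (2 * (real (nat \<lceil>q\<rceil>) / \<tau>)) powr q)) powr (1 / q) + real (nat \<lceil>q\<rceil>)"
      using \<theta>_bounds by (intro add_nonneg_pos) auto
    then show ?thesis
      unfolding c_def using n1 mollifier_const_nonneg[where 'a = 'a] by (intro mult_pos_pos) auto
  qed
  define \<beta> where "\<beta> = 1 / n - 1 / (n + 1)"
  have \<beta>: "0 < \<beta>" using n1 by (simp add: \<beta>_def divide_strict_left_mono)
  define t where "t = \<theta> / (2 + \<theta>)"
  have t: "0 < t" using \<theta>_bounds by (simp add: t_def)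
  define C where "C = 8 * c / (t * d) * \<kappa> powr (1 / (n + 1))"
  have C: "0 < C" using c t d \<kappa> by (simp add: C_def)
  (* 4 is the growth rate: one factor 2 from the radii, one from the levels *)
  define \<nu> where "\<nu> = ((4::real) powr (- (1 / \<beta>)) / C) powr (1 / \<beta>)"
  have \<nu>: "0 < \<nu>" using C by (simp add: \<nu>_def)
  have \<nu>C: "C * \<nu> powr \<beta> = 4 powr (- (1 / \<beta>))" using C \<beta> by (simp add: \<nu>_def powr_powr)
  show ?thesis
  proof (rule that[OF \<nu>])
    fix z :: 'a and r k :: real
    assume r: "0 < r" "r \<le> 1" and B: "cball z r \<subseteq> \<Omega>" and K: "excess \<sigma> k (cball z r) \<le> \<kappa> * r ^ DIM('a)"
      and small: "excess \<theta> k (cball z r) \<le> \<nu> * r ^ DIM('a)"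
    (* levels decrease to k - d while radii decrease to r / 2 *)
    define kk where "kk j = k - d * (1 - (1/2) ^ j)" for j :: nat
    define rr where "rr j = r / 2 * (1 + (1/2) ^ j)" for j :: nat
    have h: "0 < (1/2::real) ^ j" "(1/2::real) ^ j \<le> 1" for j by (auto intro: power_le_one)
    have kkS: "kk j - kk (Suc j) = d / 2 * (1/2) ^ j" for j by (simp add: kk_def algebra_simps)
    have rrS: "rr j - rr (Suc j) = r / 4 * (1/2) ^ j" for j by (simp add: rr_def algebra_simps)
    have kkb: "k - d < kk j" "kk j \<le> k" for j using d h[of j] by (auto simp: kk_def mult_less_cancel_left2 algebra_simps)
    have rrb: "r / 2 < rr j" "rr j \<le> r" for j using r h[of j] by (auto simp: rr_def mult_le_cancel_left_pos field_simps)
    have sub: "cball z (rr j) \<subseteq> cball z r" for j using rrb(2)[of j] by auto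
    have subO: "cball z (rr j) \<subseteq> \<Omega>" for j using sub[of j] B by blast
    have rn: "r ^ DIM('a) = r powr n" using r by (simp add: n_def powr_realpow)
    define y where "y j = excess \<theta> (kk j) (cball z (rr j)) / r powr n" for j
    have ex0: "0 \<le> excess \<theta> (kk j) (cball z (rr j))" for j
      by (rule Bochner_Integration.integral_nonneg) (simp add: indicator_def)
    have rp: "0 < r powr n" using r by simp
    have exy: "excess \<theta> (kk j) (cball z (rr j)) = r powr n * y j" for j using rp r by (simp add: y_def)
    have y0: "0 \<le> y j" for j unfolding y_def using ex0[of j] by (rule divide_nonneg_nonneg) simp
    have "y \<longlonglongrightarrow> 0"
    proof (rule fast_geometric_convergence[OF y0 _ C _ \<beta>])
      show "(1::real) < 4" by simp
      have "y 0 \<le> \<nu>" using small r by (simp add: y_def kk_def rr_def rn divide_le_eq)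
      then have "y 0 powr \<beta> \<le> \<nu> powr \<beta>" using y0 \<beta> by (intro powr_mono2) auto
      then have "C * y 0 powr \<beta> \<le> C * \<nu> powr \<beta>" using C by simp
      then show "C * y 0 powr \<beta> \<le> 4 powr (- (1 / \<beta>))" using \<nu>C by simp
      fix j
      define \<rho> where "\<rho> = r / 4 * (1/2) ^ j"
      have \<rho>: "0 < \<rho>" "\<rho> \<le> rr j - rr (Suc j)" "\<rho> \<le> 3"
      proof -
        show "0 < \<rho>" using r h[of j] by (simp add: \<rho>_def)
        show "\<rho> \<le> rr j - rr (Suc j)" by (simp add: rrS \<rho>_def)
        have "r / 4 * (1/2) ^ j \<le> r / 4 * 1" using r h[of j] by (intro mult_left_mono) auto
        then have "\<rho> \<le> r / 4" by (simp only: \<rho>_def mult_1_right)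
        then show "\<rho> \<le> 3" using r by simp
      qed
      have r': "0 < rr (Suc j)" using rrb(1)[of "Suc j"] r by simp
      have dj: "0 < d / 2 * (1/2) ^ j" "d / 2 * (1/2) ^ j \<le> 1"
        using d h[of j] mult_mono[of "d / 2" 1 "(1/2) ^ j" 1] by auto
      have k': "kk (Suc j) < kk j" "kk j - kk (Suc j) \<le> 1" using dj kkS[of j] by auto
      have Kj: "excess \<sigma> (kk j) (cball z (rr j)) \<le> \<kappa> * r powr n"
      proof -
        have "excess \<sigma> (kk j) (cball z (rr j)) \<le> excess \<sigma> k (cball z r)"
          using \<theta>_bounds by (intro excess_mono[OF compact_cball B compact_cball sub _ _ kkb(2)]) auto
        then show ?thesis using K rn by simp
      qed
      have "t * (kk j - kk (Suc j)) * excess \<theta> (kk (Suc j)) (cball z (rr (Suc j)))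
          \<le> c / \<rho> * (\<kappa> * r powr n) powr (1 / (n + 1)) * excess \<theta> (kk j) (cball z (rr j)) powr (1 + \<beta>)"
        using excess_step[OF \<rho> r' subO k' Kj] unfolding t_def c_def n_def \<beta>_def by (simp add: add_diff_eq)
      then have "t * (d / 2 * (1/2) ^ j) * (r powr n * y (Suc j))
          \<le> c / \<rho> * (\<kappa> * r powr n) powr (1 / (n + 1)) * (r powr n * y j) powr (1 + \<beta>)"
        unfolding kkS exy .
      also have "(r powr n * y j) powr (1 + \<beta>) = r powr (n * (1 + \<beta>)) * y j powr (1 + \<beta>)"
        using y0[of j] by (simp add: powr_mult powr_powr)
      also have "(\<kappa> * r powr n) powr (1 / (n + 1)) = \<kappa> powr (1 / (n + 1)) * r powr (n / (n + 1))"
        using \<kappa> by (simp add: powr_mult powr_powr)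
      also have "c / \<rho> * (\<kappa> powr (1 / (n + 1)) * r powr (n / (n + 1))) * (r powr (n * (1 + \<beta>)) * y j powr (1 + \<beta>))
          = c * (4 * 2 ^ j) * \<kappa> powr (1 / (n + 1)) * y j powr (1 + \<beta>) * (inverse r * (r powr (n / (n + 1)) * r powr (n * (1 + \<beta>))))"
        using r by (simp add: \<rho>_def field_simps power_divide)
      also have "inverse r * (r powr (n / (n + 1)) * r powr (n * (1 + \<beta>))) = r powr n"
      proof -
        have "inverse r = r powr (- 1)" using r by (simp add: powr_minus)
        moreover have "- 1 + (n / (n + 1) + n * (1 + \<beta>)) = n"
        proof -
          have "n * \<beta> = 1 - n / (n + 1)" using n1 by (simp add: \<beta>_def right_diff_distrib)
          then show ?thesis by (simp add: distrib_left)
        qed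
        ultimately show ?thesis by (simp only: powr_add[symmetric])
      qed
      finally have "t * (d / 2 * (1/2) ^ j) * (r powr n * y (Suc j))
          \<le> c * (4 * 2 ^ j) * \<kappa> powr (1 / (n + 1)) * y j powr (1 + \<beta>) * r powr n" .
      then have "r powr n * (t * (d / 2 * (1/2) ^ j) * y (Suc j))
          \<le> r powr n * (c * (4 * 2 ^ j) * \<kappa> powr (1 / (n + 1)) * y j powr (1 + \<beta>))"
        by (simp only: mult_ac)
      then have "t * (d / 2 * (1/2) ^ j) * y (Suc j) \<le> c * (4 * 2 ^ j) * \<kappa> powr (1 / (n + 1)) * y j powr (1 + \<beta>)"
        using rp by (simp only: mult_le_cancel_left_pos)
      then have "y (Suc j) \<le> (c * (4 * 2 ^ j) * \<kappa> powr (1 / (n + 1)) * y j powr (1 + \<beta>)) / (t * (d / 2 * (1/2) ^ j))"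
        using t dj by (subst pos_le_divide_eq) (auto simp: mult.commute)
      also have "\<dots> = C * 4 ^ j * y j powr (1 + \<beta>)"
      proof -
        have "(4::real) ^ j = 2 ^ j * 2 ^ j" by (simp add: power_mult_distrib[symmetric])
        then show ?thesis using t d by (simp add: C_def field_simps power_divide)
      qed
      finally show "y (Suc j) \<le> C * 4 ^ j * y j powr (1 + \<beta>)" .
    qed
    then have lim: "(\<lambda>j. r powr n * y j) \<longlonglongrightarrow> r powr n * 0" by (intro tendsto_mult tendsto_const)
    define Z where "Z = {x. u x < k - d} \<inter> cball z (r / 2)"
    have Zm: "Z \<in> sets borel" unfolding Z_def by measurable
    have "emeasure lborel Z \<le> emeasure lborel (cball z (r / 2))" by (rule emeasure_mono) (auto simp: Z_def)
    also have "\<dots> < \<infinity>" by (rule emeasure_bounded_finite) simp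
    finally have Zfin: "emeasure lborel Z < \<infinity>" .
    have "measure lborel Z \<le> r powr n * y j" for j
    proof -
      have "measure lborel Z = (LBINT x. indicator Z x)" by simp
      also have "\<dots> \<le> excess \<theta> (kk j) (cball z (rr j))"
      proof (rule integral_mono)
        show "integrable lborel (indicator Z :: 'a \<Rightarrow> real)" using Zm Zfin by (simp add: integrable_indicator_iff)
        show "integrable lborel (\<lambda>x. indicator ({x. u x < kk j} \<inter> cball z (rr j)) x * (1 + (kk j - u x)) powr \<theta>)"
          using \<theta>_bounds by (intro excess_integrable compact_cball subO) auto
        fix x
        show "indicator Z x \<le> indicator ({x. u x < kk j} \<inter> cball z (rr j)) x * (1 + (kk j - u x)) powr \<theta>"
        proof (cases "x \<in> Z")
          case True
          then have "u x < kk j" "x \<in> cball z (rr j)" using kkb(1)[of j] rrb(1)[of j] by (auto simp: Z_def)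
          then show ?thesis using \<theta>_bounds(1) True by (simp add: ge_one_powr_ge_zero)
        qed (simp add: indicator_def)
      qed
      finally show ?thesis by (simp add: exy)
    qed
    then have "measure lborel Z \<le> r powr n * 0" by (intro LIMSEQ_le_const[OF lim]) auto
    then have "measure lborel Z = 0" using measure_nonneg[of lborel Z] by (intro antisym) simp_all
    then have "Z \<in> null_sets lborel" using Zm Zfin by (auto simp: null_sets_def emeasure_eq_ennreal_measure)
    then have "AE x in lborel. x \<notin> Z" by (rule AE_not_in)
    then show "AE x in lborel. x \<in> ball z (r / 2) \<longrightarrow> k - d \<le> u x"
      by eventually_elim (auto simp: Z_def)
  qed
qed

end

section \<open>The lower semicontinuous representative\<close>

lemma AE_locally:
  fixes S :: "'a::euclidean_space set"
  assumes "\<And>x. x \<in> S \<Longrightarrow> \<exists>r>0. AE y in lborel. y \<in> ball x r \<longrightarrow> P y"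
  shows "AE y in lborel. y \<in> S \<longrightarrow> P y"
proof -
  have "\<forall>x\<in>S. \<exists>r>0. AE y in lborel. y \<in> ball x r \<longrightarrow> P y" using assms by blast
  then obtain r where r: "\<forall>x\<in>S. 0 < r x \<and> (AE y in lborel. y \<in> ball x (r x) \<longrightarrow> P y)"
    by (rule bchoice[THEN exE])
  obtain F where F: "F \<subseteq> (\<lambda>x. ball x (r x)) ` S" "countable F" "\<Union>F = \<Union>((\<lambda>x. ball x (r x)) ` S)"
    by (rule Lindelof[of "(\<lambda>x. ball x (r x)) ` S"]) auto
  have "AE y in lborel. \<forall>B\<in>F. y \<in> B \<longrightarrow> P y"
    unfolding AE_ball_countable[OF F(2)] using F(1) r by blast
  then show ?thesis
  proof (eventually_elim, intro impI)
    fix y assume y: "\<forall>B\<in>F. y \<in> B \<longrightarrow> P y" "y \<in> S"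
    have "y \<in> ball y (r y)" using r y(2) by simp
    then have "y \<in> \<Union>F" unfolding F(3) using y(2) by blast
    then show "P y" using y(1) by blast
  qed
qed

text \<open>The largest lower semicontinuous function that is almost everywhere at most \<open>u\<close>.\<close>

definition ess_liminf :: "('a::euclidean_space \<Rightarrow> real) \<Rightarrow> 'a \<Rightarrow> ereal" where
  "ess_liminf u x = Sup {ereal a | a. \<exists>r>0. AE y in lborel. y \<in> ball x r \<longrightarrow> a \<le> u y}"

lemma ess_liminf_ge:
  assumes "0 < r" "AE y in lborel. y \<in> ball x r \<longrightarrow> a \<le> u y"
  shows "ereal a \<le> ess_liminf u x"
  unfolding ess_liminf_def by (rule Sup_upper) (use assms in blast)

lemma less_ess_liminfE:
  assumes "c < ess_liminf u x"
  obtains a r where "c < ereal a" "0 < r" "AE y in lborel. y \<in> ball x r \<longrightarrow> a \<le> u y"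
  using assms unfolding ess_liminf_def less_Sup_iff by blast

lemma ess_liminf_ge_on_open:
  assumes "open G" "x \<in> G" "AE y in lborel. y \<in> G \<longrightarrow> a \<le> u y"
  shows "ereal a \<le> ess_liminf u x"
proof -
  obtain r where r: "0 < r" "ball x r \<subseteq> G" using assms(1,2) by (rule openE)
  show ?thesis by (rule ess_liminf_ge[OF r(1)]) (use assms(3) r(2) in \<open>auto elim!: eventually_mono\<close>)
qed

lemma open_less_ess_liminf: "open {x. c < ess_liminf u x}"
  unfolding open_contains_ball
proof
  fix x assume "x \<in> {x. c < ess_liminf u x}"
  then have "c < ess_liminf u x" by simp
  then obtain a r where a: "c < ereal a" "0 < r" "AE y in lborel. y \<in> ball x r \<longrightarrow> a \<le> u y"
    by (rule less_ess_liminfE)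
  have "ball x r \<subseteq> {x. c < ess_liminf u x}"
  proof
    fix y assume "y \<in> ball x r"
    then have "ereal a \<le> ess_liminf u y" by (rule ess_liminf_ge_on_open[OF open_ball _ a(3)])
    then show "y \<in> {x. c < ess_liminf u x}" using a(1) by simp
  qed
  then show "\<exists>e>0. ball x e \<subseteq> {x. c < ess_liminf u x}" using a(2) by blast
qed

lemma ess_liminf_le_AE: "AE y in lborel. ess_liminf u y \<le> ereal (u y)"
proof -
  have "AE y in lborel. y \<in> {x. ereal b < ess_liminf u x} \<longrightarrow> b \<le> u y" for b
  proof (rule AE_locally)
    fix x assume "x \<in> {x. ereal b < ess_liminf u x}"
    then have "ereal b < ess_liminf u x" by simp
    then obtain a r where a: "ereal b < ereal a" "0 < r" "AE y in lborel. y \<in> ball x r \<longrightarrow> a \<le> u y"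
      by (rule less_ess_liminfE)
    have "AE y in lborel. y \<in> ball x r \<longrightarrow> b \<le> u y"
      using a(3) by eventually_elim (use a(1) in auto)
    then show "\<exists>r>0. AE y in lborel. y \<in> ball x r \<longrightarrow> b \<le> u y" using a(2) by blast
  qed
  then have "AE y in lborel. \<forall>b\<in>\<rat>. ereal b < ess_liminf u y \<longrightarrow> b \<le> u y"
    unfolding AE_ball_countable[OF countable_rat] by simp
  then show ?thesis
  proof eventually_elim
    fix y assume y: "\<forall>b\<in>\<rat>. ereal b < ess_liminf u y \<longrightarrow> b \<le> u y"
    show "ess_liminf u y \<le> ereal (u y)"
    proof (rule ccontr)
      assume "\<not> ess_liminf u y \<le> ereal (u y)"
      then have "ereal (u y) < ess_liminf u y" by simp
      then obtain c where c: "ereal (u y) < ereal c" "ereal c < ess_liminf u y"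
        by (rule ereal_dense2[THEN exE]) blast
      then have "u y < c" by simp
      then obtain b where b: "b \<in> \<rat>" "u y < b" "b < c" by (rule Rats_dense_in_real[THEN bexE]) blast
      have "ereal b < ess_liminf u y" using b(3) c(2) by (meson ereal_less_eq(3) less_imp_le order_le_less_trans)
      then show False using y b by auto
    qed
  qed
qed

text \<open>Almost every point outside \<open>A\<close> has density zero, at least along a sequence of radii: the
  mollifications of the indicator of \<open>A\<close> converge almost everywhere, and the mollifier dominates a
  multiple of the normalised indicator of a ball.\<close>

lemma AE_density_zero:
  fixes A :: "'a::euclidean_space set"
  assumes A: "A \<in> sets borel" "bounded A"
  shows "AE x in lborel. x \<notin> A \<longrightarrow> (\<forall>\<delta>>0. \<forall>R>0. \<exists>r. 0 < r \<and> r < R \<and> measure lborel (A \<inter> cball x r) \<le> \<delta> * r ^ DIM('a))"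
proof -
  note [measurable] = A(1)
  have fin: "emeasure lborel A < \<infinity>" using A(2) by (rule emeasure_bounded_finite)
  let ?f = "indicator A :: 'a \<Rightarrow> real"
  have int: "integrable lborel ?f" using A(1) fin by (simp add: integrable_indicator_iff)
  obtain s :: "nat \<Rightarrow> nat" where s: "strict_mono s" "AE x in lborel. (\<lambda>n. conv ?f (moll (s n)) x) \<longlonglongrightarrow> ?f x"
    by (rule conv_moll_AE_subseq[OF int]) blast
  (* bump is at least exp (- 4/3) on the ball of radius 1/2 *)
  define c where "c = inverse (bump_mass TYPE('a)) * exp (- (4/3))"
  have c: "0 < c" using bump_mass_pos[where 'a = 'a] by (simp add: c_def)
  have lower: "c * measure lborel (A \<inter> cball x (1 / (2 * real (Suc n)))) \<le> (1 / real (Suc n)) ^ DIM('a) * conv ?f (moll n) x" for x n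
  proof -
    let ?e = "1 / real (Suc n)"
    have e: "0 < ?e" by simp
    have m: "c \<le> ?e ^ DIM('a) * moll n z" if z: "norm z \<le> ?e / 2" for z :: 'a
    proof -
      define w where "w = inverse ?e *\<^sub>R z"
      have "norm w = real (Suc n) * norm z" by (simp only: w_def norm_scaleR) simp
      then have w: "norm w \<le> 1 / 2" using z by (simp add: field_simps)
      then have "w \<bullet> w \<le> (1/2) ^ 2" unfolding power2_norm_eq_inner[symmetric] by (intro power_mono) auto
      then have t: "3 / 4 \<le> 1 - w \<bullet> w" by (simp add: power2_eq_square)
      then have "inverse (1 - w \<bullet> w) \<le> inverse (3 / 4)" by (intro le_imp_inverse_le) auto
      then have "exp (- (4/3)) \<le> bump w" using t by (simp add: bump_def flat_def)
      then have "c \<le> inverse (bump_mass TYPE('a)) * bump w"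
        using bump_mass_pos[where 'a = 'a] unfolding c_def by (intro mult_left_mono) auto
      also have "\<dots> = ?e ^ DIM('a) * moll n z"
        using e by (simp add: moll_def mollifier_def w_def)
      finally show ?thesis .
    qed
    have i: "integrable lborel (\<lambda>y. moll n (x - y) *\<^sub>R ?f y)" by (rule conv_integrable[OF int moll_test])
    have fin': "emeasure lborel (A \<inter> cball x (?e / 2)) < \<infinity>"
      by (rule order_le_less_trans[OF emeasure_mono fin]) auto
    have "c * measure lborel (A \<inter> cball x (?e / 2)) = (LBINT y. c * indicator (A \<inter> cball x (?e / 2)) y)"
      by simp
    also have "\<dots> \<le> (LBINT y. ?e ^ DIM('a) * (moll n (x - y) *\<^sub>R ?f y))"
    proof (rule integral_mono)
      show "integrable lborel (\<lambda>y. c * indicator (A \<inter> cball x (?e / 2)) y)"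
        using fin' by (intro integrable_mult_right) (simp add: integrable_indicator_iff)
      show "integrable lborel (\<lambda>y. ?e ^ DIM('a) * (moll n (x - y) *\<^sub>R ?f y))"
        by (rule integrable_mult_right[OF i])
      fix y
      show "c * indicator (A \<inter> cball x (?e / 2)) y \<le> ?e ^ DIM('a) * (moll n (x - y) *\<^sub>R ?f y)"
        using m[of "x - y"] moll_nonneg[of n "x - y"] e by (auto simp: indicator_def dist_norm)
    qed
    also have "\<dots> = ?e ^ DIM('a) * conv ?f (moll n) x" by (simp add: conv_def)
    finally show ?thesis by (simp add: mult.commute)
  qed
  from s(2) show ?thesis
  proof (eventually_elim, intro impI allI)
    fix \<delta> R :: real and x :: 'a
    assume lim: "(\<lambda>n. conv ?f (moll (s n)) x) \<longlonglongrightarrow> ?f x" and x: "x \<notin> A" and \<delta>: "0 < \<delta>" and R: "0 < R"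
    define \<delta>' where "\<delta>' = c * \<delta> / 2 ^ DIM('a)"
    have \<delta>': "0 < \<delta>'" using c \<delta> by (simp add: \<delta>'_def)
    have "(\<lambda>n. conv ?f (moll (s n)) x) \<longlonglongrightarrow> 0" using lim x by simp
    then have e1: "\<forall>\<^sub>F n in sequentially. conv ?f (moll (s n)) x < \<delta>'" using \<delta>' by (rule order_tendstoD(2))
    obtain N :: nat where N: "1 / R < real N" using reals_Archimedean2 by blast
    have "\<forall>\<^sub>F n in sequentially. conv ?f (moll (s n)) x < \<delta>' \<and> N \<le> n"
      using e1 eventually_ge_at_top[of N] by (rule eventually_conj)
    then obtain n where n: "conv ?f (moll (s n)) x < \<delta>'" "N \<le> n"
      using eventually_happens'[OF sequentially_bot] by blast
    define r where "r = 1 / (2 * real (Suc (s n)))"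
    have "real N \<le> real (s n)" using n(2) seq_suble[OF s(1), of n] by simp
    moreover have "real (s n) < 2 * real (Suc (s n))" by simp
    ultimately have "1 / R < 2 * real (Suc (s n))" using N by (meson less_le_trans order_less_trans)
    then have r: "0 < r" "r < R" using R by (auto simp: r_def field_simps)
    have r2: "2 * r = 1 / real (Suc (s n))" by (simp add: r_def field_simps)
    have "c * measure lborel (A \<inter> cball x r) \<le> (2 * r) ^ DIM('a) * conv ?f (moll (s n)) x"
      by (rule lower[of x "s n", folded r_def r2])
    also have "\<dots> \<le> (2 * r) ^ DIM('a) * \<delta>'" using n(1) r by (intro mult_left_mono) auto
    also have "\<dots> = c * (\<delta> * r ^ DIM('a))" by (simp add: \<delta>'_def power_mult_distrib)
    finally have "measure lborel (A \<inter> cball x r) \<le> \<delta> * r ^ DIM('a)" using c by simp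
    then show "\<exists>r. 0 < r \<and> r < R \<and> measure lborel (A \<inter> cball x r) \<le> \<delta> * r ^ DIM('a)" using r by blast
  qed
qed

context integrable_supersolution
begin

text \<open>On a fixed ball the integral with exponent \<open>\<sigma>\<close> stays bounded as \<open>k \<rightarrow> -\<infinity>\<close>, and the one with
  exponent \<open>\<theta>\<close> tends to zero.\<close>

lemma locally_bounded_below:
  assumes "x0 \<in> \<Omega>"
  obtains r L where "0 < r" "ball x0 r \<subseteq> \<Omega>" "0 \<le> L" "AE x in lborel. x \<in> ball x0 r \<longrightarrow> - L \<le> u x"
proof -
  obtain e where e: "0 < e" "cball x0 e \<subseteq> \<Omega>" using open_dom assms open_contains_cball by blast
  define R where "R = min e 1"
  have R: "0 < R" "R \<le> 1" using e by (auto simp: R_def)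
  let ?K = "cball x0 R"
  have K: "?K \<subseteq> \<Omega>" using e(2) by (rule subset_trans[rotated]) (auto simp: R_def)
  define \<kappa> where "\<kappa> = excess \<sigma> 0 ?K / R ^ DIM('a) + 1"
  have ex0: "0 \<le> excess \<sigma> 0 ?K" by (rule Bochner_Integration.integral_nonneg) (simp add: indicator_def)
  have \<kappa>: "0 < \<kappa>" using ex0 R by (auto simp: \<kappa>_def intro!: add_nonneg_pos divide_nonneg_nonneg)
  obtain \<nu> where \<nu>: "0 < \<nu>"
    "\<And>z r k. 0 < r \<Longrightarrow> r \<le> 1 \<Longrightarrow> cball z r \<subseteq> \<Omega> \<Longrightarrow> excess \<sigma> k (cball z r) \<le> \<kappa> * r ^ DIM('a) \<Longrightarrow>
       excess \<theta> k (cball z r) \<le> \<nu> * r ^ DIM('a) \<Longrightarrow> AE x in lborel. x \<in> ball z (r / 2) \<longrightarrow> k - 1 \<le> u x"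
    by (rule lower_bound_from_small_excess[OF \<kappa> zero_less_one order_refl]) blast
  have "(\<lambda>i. excess \<theta> (- real i) ?K) \<longlonglongrightarrow> (\<integral>x. 0 \<partial>(lborel::'a measure))"
  proof (rule integral_dominated_convergence)
    show "integrable lborel (\<lambda>x. indicator ({x. u x < 0} \<inter> ?K) x * (1 + (0 - u x)) powr \<theta>)"
      using \<theta>_bounds by (intro excess_integrable compact_cball K) auto
    show "(\<lambda>x. indicator ({x. u x < - real i} \<inter> ?K) x * (1 + (- real i - u x)) powr \<theta>) \<in> borel_measurable lborel" for i
      using \<theta>_bounds by (intro borel_measurable_integrable excess_integrable compact_cball K) auto
    show "(\<lambda>_. 0) \<in> borel_measurable lborel" by simp
    show "AE x in lborel. (\<lambda>i. indicator ({x. u x < - real i} \<inter> ?K) x * (1 + (- real i - u x)) powr \<theta>) \<longlonglongrightarrow> 0" (is "AE x in _. ?P x")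
    proof (rule AE_I2)
      fix x
      obtain N :: nat where N: "- u x < real N" using reals_Archimedean2 by blast
      show "?P x"
      proof (rule tendsto_eventually, rule eventually_sequentiallyI[of N])
        fix i assume "N \<le> i"
        then have "\<not> u x < - real i" using N by linarith
        then show "indicator ({x. u x < - real i} \<inter> ?K) x * (1 + (- real i - u x)) powr \<theta> = 0" by simp
      qed
    qed
    show "AE x in lborel. norm (indicator ({x. u x < - real i} \<inter> ?K) x * (1 + (- real i - u x)) powr \<theta>)
        \<le> indicator ({x. u x < 0} \<inter> ?K) x * (1 + (0 - u x)) powr \<theta>" for i
      using \<theta>_bounds by (intro AE_I2) (auto simp: indicator_def intro!: powr_mono2)
  qed
  then have lim: "(\<lambda>i. excess \<theta> (- real i) ?K) \<longlonglongrightarrow> 0" by simp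
  have "0 < \<nu> * R ^ DIM('a)" using \<nu>(1) R by simp
  then obtain i where i: "excess \<theta> (- real i) ?K < \<nu> * R ^ DIM('a)"
    using eventually_happens'[OF sequentially_bot order_tendstoD(2)[OF lim]] by blast
  have "excess \<sigma> (- real i) ?K \<le> excess \<sigma> 0 ?K"
    using \<theta>_bounds by (intro excess_mono[OF compact_cball K compact_cball order_refl]) auto
  also have "\<dots> = excess \<sigma> 0 ?K / R ^ DIM('a) * R ^ DIM('a)" using R by simp
  also have "\<dots> \<le> \<kappa> * R ^ DIM('a)" using R by (intro mult_right_mono) (auto simp: \<kappa>_def)
  finally have "excess \<sigma> (- real i) ?K \<le> \<kappa> * R ^ DIM('a)" .
  then have "AE x in lborel. x \<in> ball x0 (R / 2) \<longrightarrow> - real i - 1 \<le> u x"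
    by (rule \<nu>(2)[OF R K]) (use i in simp)
  then have "AE x in lborel. x \<in> ball x0 (R / 2) \<longrightarrow> - (real i + 1) \<le> u x" by simp
  moreover have "ball x0 (R / 2) \<subseteq> \<Omega>" using K R by (intro subset_trans[OF _ K]) auto
  ultimately show ?thesis using R by (intro that[of "R / 2" "real i + 1"]) auto
qed

text \<open>Where \<open>u\<close> is bounded below, both excess integrals are comparable to the measure of the sublevel
  set, so that only its density has to be small.\<close>

lemma lower_bound_from_small_density:
  assumes L: "AE x in lborel. x \<in> G \<longrightarrow> - L \<le> u x" and d: "0 < d" "d \<le> 1"
  obtains \<nu> where "0 < \<nu>"
    "\<And>z r. 0 < r \<Longrightarrow> r \<le> 1 \<Longrightarrow> cball z r \<subseteq> \<Omega> \<Longrightarrow> cball z r \<subseteq> G \<Longrightarrow>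
       measure lborel ({x. u x < k} \<inter> cball z r) \<le> \<nu> * r ^ DIM('a) \<Longrightarrow> AE x in lborel. x \<in> ball z (r / 2) \<longrightarrow> k - d \<le> u x"
proof -
  define H where "H = 1 + max 0 (k + L)"
  have H: "1 \<le> H" by (simp add: H_def)
  define \<kappa> where "\<kappa> = H powr \<sigma> * unit_ball_vol (real DIM('a))"
  have \<kappa>: "0 < \<kappa>" using H by (simp add: \<kappa>_def)
  obtain \<nu> where \<nu>: "0 < \<nu>"
    "\<And>z r k. 0 < r \<Longrightarrow> r \<le> 1 \<Longrightarrow> cball z r \<subseteq> \<Omega> \<Longrightarrow> excess \<sigma> k (cball z r) \<le> \<kappa> * r ^ DIM('a) \<Longrightarrow>
       excess \<theta> k (cball z r) \<le> \<nu> * r ^ DIM('a) \<Longrightarrow> AE x in lborel. x \<in> ball z (r / 2) \<longrightarrow> k - d \<le> u x"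
    by (rule lower_bound_from_small_excess[OF \<kappa> d]) blast
  have bound: "excess e k (cball z r) \<le> H powr e * measure lborel ({x. u x < k} \<inter> cball z r)"
    if "cball z r \<subseteq> \<Omega>" "cball z r \<subseteq> G" and e: "0 \<le> e" "e \<le> \<sigma>" for e z r
  proof -
    have fin: "emeasure lborel ({x. u x < k} \<inter> cball z r) < \<infinity>"
      by (rule emeasure_bounded_finite) (rule bounded_subset[OF bounded_cball], blast)
    have "excess e k (cball z r) \<le> (LBINT x. H powr e * indicator ({x. u x < k} \<inter> cball z r) x)"
    proof (rule integral_mono_AE)
      show "integrable lborel (\<lambda>x. indicator ({x. u x < k} \<inter> cball z r) x * (1 + (k - u x)) powr e)"
        by (rule excess_integrable[OF compact_cball that(1) e])
      show "integrable lborel (\<lambda>x. H powr e * indicator ({x. u x < k} \<inter> cball z r) x)"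
        using fin by (intro integrable_mult_right) (simp add: integrable_indicator_iff)
      from L show "AE x in lborel. indicator ({x. u x < k} \<inter> cball z r) x * (1 + (k - u x)) powr e
          \<le> H powr e * indicator ({x. u x < k} \<inter> cball z r) x" (is "AE x in _. ?P x")
      proof eventually_elim
        fix x assume x: "x \<in> G \<longrightarrow> - L \<le> u x"
        show "?P x"
        proof (cases "u x < k \<and> x \<in> cball z r")
          case True
          then have "- L \<le> u x" using x that(2) by blast
          then have "(1 + (k - u x)) powr e \<le> H powr e"
            using True e by (intro powr_mono2) (auto simp: H_def)
          then show ?thesis using True by simp
        qed (auto simp: indicator_def)
      qed
    qed
    then show ?thesis by simp
  qed
  have pos: "0 < \<nu> / H powr \<theta>" using \<nu>(1) H by simp
  show ?thesis
  proof (rule that[OF pos])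
    fix z :: 'a and r :: real
    assume r: "0 < r" "r \<le> 1" and B: "cball z r \<subseteq> \<Omega>" "cball z r \<subseteq> G"
      and m: "measure lborel ({x. u x < k} \<inter> cball z r) \<le> \<nu> / H powr \<theta> * r ^ DIM('a)"
    have "measure lborel ({x. u x < k} \<inter> cball z r) \<le> measure lborel (cball z r)"
      by (rule measure_mono_fmeasurable) (auto intro!: fmeasurableI emeasure_bounded_finite)
    also have "\<dots> = unit_ball_vol (real DIM('a)) * r ^ DIM('a)" using r by (simp add: content_cball)
    finally have m1: "measure lborel ({x. u x < k} \<inter> cball z r) \<le> unit_ball_vol (real DIM('a)) * r ^ DIM('a)" .
    have "excess \<sigma> k (cball z r) \<le> H powr \<sigma> * measure lborel ({x. u x < k} \<inter> cball z r)"
      using \<theta>_bounds by (intro bound B) auto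
    also have "\<dots> \<le> \<kappa> * r ^ DIM('a)"
      using m1 unfolding \<kappa>_def mult.assoc by (rule mult_left_mono) simp
    finally have k1: "excess \<sigma> k (cball z r) \<le> \<kappa> * r ^ DIM('a)" .
    have "excess \<theta> k (cball z r) \<le> H powr \<theta> * measure lborel ({x. u x < k} \<inter> cball z r)"
      using \<theta>_bounds by (intro bound B) auto
    also have "\<dots> \<le> H powr \<theta> * (\<nu> / H powr \<theta> * r ^ DIM('a))"
      using m by (rule mult_left_mono) simp
    also have "\<dots> = \<nu> * r ^ DIM('a)" using H by simp
    finally have k2: "excess \<theta> k (cball z r) \<le> \<nu> * r ^ DIM('a)" .
    show "AE x in lborel. x \<in> ball z (r / 2) \<longrightarrow> k - d \<le> u x"
      by (rule \<nu>(2)[OF r B(1) k1 k2])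
  qed
qed

lemma ess_liminf_not_MInfty: "x \<in> \<Omega> \<Longrightarrow> ess_liminf u x \<noteq> -\<infinity>"
proof -
  assume "x \<in> \<Omega>"
  then obtain r L where r: "0 < r" "ball x r \<subseteq> \<Omega>" "0 \<le> L" "AE y in lborel. y \<in> ball x r \<longrightarrow> - L \<le> u y"
    by (rule locally_bounded_below)
  have "ereal (- L) \<le> ess_liminf u x" by (rule ess_liminf_ge[OF r(1,4)])
  then show ?thesis by auto
qed

text \<open>At almost every point with \<open>u \<ge> k\<close> some arbitrarily small ball contains little of the set \<open>u < k\<close>, and then
  \<open>u \<ge> k - d\<close> near the point.  Countably many \<open>k\<close> and \<open>d\<close> suffice.\<close>

lemma ess_liminf_ge_AE: "AE x in lborel. x \<in> \<Omega> \<longrightarrow> ereal (u x) \<le> ess_liminf u x"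
proof (rule AE_locally)
  fix x0 assume "x0 \<in> \<Omega>"
  then obtain R L where R: "0 < R" "ball x0 R \<subseteq> \<Omega>" "0 \<le> L" "AE y in lborel. y \<in> ball x0 R \<longrightarrow> - L \<le> u y"
    by (rule locally_bounded_below)
  have main: "AE x in lborel. x \<in> ball x0 R \<longrightarrow> k \<le> u x \<longrightarrow> ereal (k - d) \<le> ess_liminf u x"
    if d: "0 < d" "d \<le> 1" for k d
  proof -
    obtain \<nu> where \<nu>: "0 < \<nu>"
      "\<And>z r. 0 < r \<Longrightarrow> r \<le> 1 \<Longrightarrow> cball z r \<subseteq> \<Omega> \<Longrightarrow> cball z r \<subseteq> ball x0 R \<Longrightarrow>
       measure lborel ({x. u x < k} \<inter> cball z r) \<le> \<nu> * r ^ DIM('a) \<Longrightarrow> AE x in lborel. x \<in> ball z (r / 2) \<longrightarrow> k - d \<le> u x"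
      by (rule lower_bound_from_small_density[OF R(4) d, of k]) blast
    let ?A = "{x. u x < k} \<inter> ball x0 R"
    have "?A \<in> sets borel" by measurable
    moreover have "bounded ?A" by (rule bounded_subset[OF bounded_ball]) blast
    ultimately have "AE x in lborel. x \<notin> ?A \<longrightarrow>
        (\<forall>\<delta>>0. \<forall>R>0. \<exists>r. 0 < r \<and> r < R \<and> measure lborel (?A \<inter> cball x r) \<le> \<delta> * r ^ DIM('a))" (is "AE x in _. ?P x")
      by (rule AE_density_zero)
    then show ?thesis
    proof (eventually_elim, intro impI)
      fix x assume x: "?P x"
        "x \<in> ball x0 R" "k \<le> u x"
      obtain e where e: "0 < e" "cball x e \<subseteq> ball x0 R" using open_contains_cball[THEN iffD1, OF open_ball] x(2) by blast
      have "x \<notin> ?A" using x(3) by simp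
      then have "\<exists>r. 0 < r \<and> r < min e 1 \<and> measure lborel (?A \<inter> cball x r) \<le> \<nu> * r ^ DIM('a)"
        by (rule x(1)[rule_format]) (use \<nu>(1) e(1) in auto)
      then obtain r where r: "0 < r" "r < min e 1" "measure lborel (?A \<inter> cball x r) \<le> \<nu> * r ^ DIM('a)"
        by blast
      have sub: "cball x r \<subseteq> ball x0 R" using e(2) r(2) by (intro subset_trans[OF _ e(2)]) auto
      then have "?A \<inter> cball x r = {x. u x < k} \<inter> cball x r" by blast
      then have "AE y in lborel. y \<in> ball x (r / 2) \<longrightarrow> k - d \<le> u y"
        using r sub R(2) by (intro \<nu>(2)) auto
      then show "ereal (k - d) \<le> ess_liminf u x" using r(1) by (intro ess_liminf_ge[of "r / 2"]) auto
    qed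
  qed
  have "AE x in lborel. \<forall>k\<in>\<rat>. \<forall>j::nat\<in>UNIV. x \<in> ball x0 R \<longrightarrow> k \<le> u x \<longrightarrow> ereal (k - 1 / real (Suc j)) \<le> ess_liminf u x" (is "AE x in _. ?P x")
    unfolding AE_ball_countable[OF countable_rat] AE_ball_countable[OF countableI_type]
    by (intro ballI main) auto
  then have "AE x in lborel. x \<in> ball x0 R \<longrightarrow> ereal (u x) \<le> ess_liminf u x"
  proof (eventually_elim, intro impI)
    fix x assume x: "?P x"
      and xR: "x \<in> ball x0 R"
    show "ereal (u x) \<le> ess_liminf u x"
    proof (rule ereal_le_epsilon2)
      fix e :: real assume "0 < e"
      then have "u x - e / 2 < u x" by simp
      then obtain k where k: "k \<in> \<rat>" "u x - e / 2 < k" "k < u x" by (rule Rats_dense_in_real[THEN bexE]) blast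
      obtain j where j: "inverse (real (Suc j)) < e / 2" using \<open>0 < e\<close> reals_Archimedean[of "e / 2"] by auto
      have "ereal (u x - e) \<le> ereal (k - 1 / real (Suc j))" using k(2) j by (simp add: inverse_eq_divide)
      also have "\<dots> \<le> ess_liminf u x" using x k(1,3) xR by auto
      finally show "ereal (u x) \<le> ess_liminf u x + ereal e"
        by (cases "ess_liminf u x") auto
    qed
  qed
  then show "\<exists>r>0. AE y in lborel. y \<in> ball x0 r \<longrightarrow> ereal (u y) \<le> ess_liminf u y" using R(1) by blast
qed

lemma ess_liminf_eq_AE: "AE x in lborel. x \<in> \<Omega> \<longrightarrow> ess_liminf u x = ereal (u x)"
  using ess_liminf_ge_AE ess_liminf_le_AE[of u] by eventually_elim (auto intro: antisym)

end

section \<open>Monotonicity of the flux and admissible test functions\<close>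

text \<open>With \<open>a = norm \<xi>\<close>, \<open>b = norm \<zeta>\<close> and \<open>A\<close>, \<open>B\<close> their powers with exponent \<open>r - 2\<close>, the product equals
  \<open>(A a - B b) (a - b) + (A + B) (a b - \<xi> \<bullet> \<zeta>)\<close>.  Both terms are nonnegative, and if both vanish then \<open>\<xi> = \<zeta>\<close>.\<close>

lemma power_flux_strict_mono:
  fixes \<xi> \<zeta> :: "'a::euclidean_space"
  assumes r: "1 < r" and ne: "\<xi> \<noteq> \<zeta>"
  shows "0 < (norm \<xi> powr (r - 2) *\<^sub>R \<xi> - norm \<zeta> powr (r - 2) *\<^sub>R \<zeta>) \<bullet> (\<xi> - \<zeta>)"
proof -
  define a b where "a = norm \<xi>" and "b = norm \<zeta>"
  define A B where "A = a powr (r - 2)" and "B = b powr (r - 2)"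
  have nn: "0 \<le> a" "0 \<le> b" "0 \<le> A" "0 \<le> B" by (auto simp: a_def b_def A_def B_def)
  have xx: "\<xi> \<bullet> \<xi> = a * a" "\<zeta> \<bullet> \<zeta> = b * b"
    by (auto simp: a_def b_def power2_norm_eq_inner[symmetric] power2_eq_square)
  have E: "(norm \<xi> powr (r - 2) *\<^sub>R \<xi> - norm \<zeta> powr (r - 2) *\<^sub>R \<zeta>) \<bullet> (\<xi> - \<zeta>)
      = (A * a - B * b) * (a - b) + (A + B) * (a * b - \<xi> \<bullet> \<zeta>)"
    unfolding a_def[symmetric] b_def[symmetric] A_def[symmetric] B_def[symmetric]
    by (simp add: inner_diff_left inner_diff_right xx inner_commute[of \<zeta> \<xi>] algebra_simps)
  have Aa: "A * a = a powr (r - 1)"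
    using powr_mult_base[OF nn(1), of "r - 2"] by (simp add: A_def mult.commute)
  have Bb: "B * b = b powr (r - 1)"
    using powr_mult_base[OF nn(2), of "r - 2"] by (simp add: B_def mult.commute)
  have cs: "0 \<le> a * b - \<xi> \<bullet> \<zeta>" using norm_cauchy_schwarz[of \<xi> \<zeta>] by (simp add: a_def b_def)
  have t2: "0 \<le> (A + B) * (a * b - \<xi> \<bullet> \<zeta>)" using nn cs by simp
  show ?thesis
  proof (cases "a = b")
    case False
    have "0 < (a powr (r - 1) - b powr (r - 1)) * (a - b)"
    proof (cases "a < b")
      case True
      then have "a powr (r - 1) < b powr (r - 1)" using nn r by (intro powr_less_mono2) auto
      then show ?thesis using True by (intro mult_neg_neg) auto
    next
      case f: False
      then have "b powr (r - 1) < a powr (r - 1)" using nn r False by (intro powr_less_mono2) auto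
      then show ?thesis using f False by (intro mult_pos_pos) auto
    qed
    then show ?thesis unfolding E Aa Bb using t2 by simp
  next
    case True
    have a0: "0 < a"
    proof (rule ccontr)
      assume "\<not> 0 < a"
      then have "a = 0" "b = 0" using nn True by auto
      then show False using ne by (simp add: a_def b_def)
    qed
    have "0 < (\<xi> - \<zeta>) \<bullet> (\<xi> - \<zeta>)" using ne by simp
    also have "\<dots> = 2 * (a * b - \<xi> \<bullet> \<zeta>)"
      using True by (simp add: inner_diff_left inner_diff_right xx inner_commute[of \<zeta> \<xi>])
    finally have "0 < a * b - \<xi> \<bullet> \<zeta>" by simp
    moreover have "0 < A + B" using a0 nn by (simp add: A_def add_pos_nonneg)
    ultimately have "0 < (A + B) * (a * b - \<xi> \<bullet> \<zeta>)" by (intro mult_pos_pos)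
    then show ?thesis unfolding E using True by (simp add: A_def B_def)
  qed
qed

lemma pq_flux_strict_mono:
  fixes \<xi> \<zeta> :: "'a::euclidean_space"
  assumes "1 < p" "1 < q" "\<xi> \<noteq> \<zeta>"
  shows "0 < (pq_flux p q \<xi> - pq_flux p q \<zeta>) \<bullet> (\<xi> - \<zeta>)"
proof -
  have "(pq_flux p q \<xi> - pq_flux p q \<zeta>) \<bullet> (\<xi> - \<zeta>)
      = (norm \<xi> powr (p - 2) *\<^sub>R \<xi> - norm \<zeta> powr (p - 2) *\<^sub>R \<zeta>) \<bullet> (\<xi> - \<zeta>)
      + (norm \<xi> powr (q - 2) *\<^sub>R \<xi> - norm \<zeta> powr (q - 2) *\<^sub>R \<zeta>) \<bullet> (\<xi> - \<zeta>)"
    by (simp add: pq_flux_def inner_add_left inner_diff_left)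
  also have "0 < \<dots>" by (intro add_pos_pos power_flux_strict_mono assms)
  finally show ?thesis .
qed

text \<open>The exponent is conjugate to \<open>q\<close>, so the flux of a field in \<open>L\<^sup>q\<close> pairs with gradients in \<open>L\<^sup>q\<close>.\<close>

lemma flux_power_bound:
  fixes \<xi> :: "'a::euclidean_space"
  assumes p: "1 < p" "p \<le> q"
  shows "norm (pq_flux p q \<xi>) powr (q / (q - 1)) \<le> 3 powr (q / (q - 1)) * (1 + norm \<xi> powr q)"
proof -
  have q: "1 < q" using p by simp
  define t where "t = norm \<xi> powr (q - 1)"
  define s where "s = q / (q - 1)"
  have s: "0 < s" using q by (simp add: s_def)
  have "norm (pq_flux p q \<xi>) \<le> 3 * max 1 t" using flux_bound[OF p, of \<xi>] by (simp add: t_def)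
  then have "norm (pq_flux p q \<xi>) powr s \<le> (3 * max 1 t) powr s" using s by (intro powr_mono2) auto
  also have "\<dots> = 3 powr s * (max 1 t) powr s" by (simp add: powr_mult)
  also have "(max 1 t) powr s \<le> 1 + t powr s" by (simp add: max_def)
  also have "t powr s = norm \<xi> powr q" using q by (simp add: t_def s_def powr_powr)
  finally show ?thesis by (simp add: s_def)
qed

text \<open>A weak inequality tested with smooth functions extends to compactly supported Sobolev functions:
  their mollifications are admissible, and the pairings converge.\<close>

lemma weak_inequality_extends:
  fixes V :: "'a::euclidean_space \<Rightarrow> 'a"
  assumes q: "1 < q" and V [measurable]: "V \<in> borel_measurable borel"
    and iV: "\<And>K. compact K \<Longrightarrow> K \<subseteq> U \<Longrightarrow> integrable lborel (\<lambda>x. indicator K x * norm (V x) powr (q / (q - 1)))"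
    and weak: "\<And>\<phi>. \<phi> \<in> test_functions U \<Longrightarrow> \<forall>x. 0 \<le> \<phi> x \<Longrightarrow> 0 \<le> (LBINT x. V x \<bullet> grad \<phi> x)"
    and U: "open U" and E: "compact E" "E \<subseteq> U"
    and W: "Wgrad F G" and F: "\<And>x. 0 \<le> F x" "\<And>x. x \<notin> E \<Longrightarrow> F x = 0"
    and G: "\<And>x. x \<notin> E \<Longrightarrow> G x = 0" "integrable lborel (\<lambda>x. norm (G x) powr q)"
  shows "integrable lborel (\<lambda>x. V x \<bullet> G x)" "0 \<le> (LBINT x. V x \<bullet> G x)"
proof -
  obtain \<epsilon> where \<epsilon>: "0 < \<epsilon>" "(\<Union>x\<in>E. cball x \<epsilon>) \<subseteq> U"
    by (rule compact_subset_open_imp_cball_epsilon_subset[OF E(1) U E(2)])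
  define K where "K = {x + y |x y. x \<in> E \<and> y \<in> cball 0 \<epsilon>}"
  have Kc: "compact K" unfolding K_def by (rule compact_sums[OF E(1) compact_cball])
  have Kin: "y \<in> K" if "x \<in> E" "dist x y \<le> \<epsilon>" for x y
    unfolding K_def using that by (intro CollectI exI[of _ x] exI[of _ "y - x"]) (auto simp: dist_norm norm_minus_commute)
  have KU: "K \<subseteq> U"
  proof
    fix z assume "z \<in> K"
    then obtain x y where "x \<in> E" "norm y \<le> \<epsilon>" "z = x + y" by (auto simp: K_def)
    then have "z \<in> cball x \<epsilon>" by (simp add: dist_norm)
    then show "z \<in> U" using \<epsilon>(2) \<open>x \<in> E\<close> by blast
  qed
  have [measurable]: "K \<in> sets borel" by (rule borel_compact[OF Kc])
  have EK: "E \<subseteq> K" using Kin[of x x for x] \<epsilon>(1) by auto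
  define V1 where "V1 x = indicator K x *\<^sub>R V x" for x
  have V1m: "V1 \<in> borel_measurable borel" unfolding V1_def[abs_def] by measurable
  have "(\<lambda>x. norm (V1 x) powr (q / (q - 1))) = (\<lambda>x. indicator K x * norm (V x) powr (q / (q - 1)))"
    using q by (auto simp: V1_def indicator_def)
  then have iV1: "integrable lborel (\<lambda>x. norm (V1 x) powr (q / (q - 1)))" using iV[OF Kc KU] by simp
  have "G x = 0" if "x \<notin> K" for x using G(1)[of x] EK that by blast
  then have eq: "V1 x \<bullet> G x = V x \<bullet> G x" for x by (cases "x \<in> K") (auto simp: V1_def)
  show "integrable lborel (\<lambda>x. V x \<bullet> G x)"
    using pairing_bound(1)[OF WgradD(5)[OF W] V1m refl q zero_less_one iV1 G(2)] by (simp add: eq)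
  have lim: "(\<lambda>n. LBINT x. V1 x \<bullet> conv G (moll n) x) \<longlonglongrightarrow> (LBINT x. V x \<bullet> G x)"
    using pairing_conv_tendsto[OF WgradD(2)[OF W] V1m refl q iV1 G(2)] by (simp only: eq)
  obtain N :: nat where N: "1 / real (Suc N) < \<epsilon>" using reals_Archimedean[OF \<epsilon>(1)] by (auto simp: inverse_eq_divide)
  have "0 \<le> (LBINT x. V1 x \<bullet> conv G (moll n) x)" if n: "N \<le> n" for n
  proof -
    let ?\<psi> = "conv F (moll n)"
    have "1 / real (Suc n) \<le> 1 / real (Suc N)" using n by (intro divide_left_mono) auto
    then have n\<epsilon>: "1 / real (Suc n) < \<epsilon>" using N by simp
    have off: "y \<notin> E" if "x \<notin> K" "dist x y < 1 / real (Suc n)" for x y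
      using Kin[of y x] that n\<epsilon> by (auto simp: dist_commute)
    have z: "?\<psi> x = 0" "conv G (moll n) x = 0" if "x \<notin> K" for x
      using conv_moll_zero[of x n F] conv_moll_zero[of x n G] off[OF that] F(2) G(1) by blast+
    have t: "?\<psi> \<in> test_functions U"
      by (rule test_functionsI[OF smooth_conv[OF WgradD(1)[OF W] moll_test] Kc KU z(1)])
    have "\<forall>x. 0 \<le> ?\<psi> x" by (intro allI conv_nonneg F moll_nonneg)
    then have "0 \<le> (LBINT x. V x \<bullet> grad ?\<psi> x)" by (rule weak[OF t])
    also have "(\<lambda>x. V x \<bullet> grad ?\<psi> x) = (\<lambda>x. V1 x \<bullet> conv G (moll n) x)"
    proof
      fix x
      show "V x \<bullet> grad ?\<psi> x = V1 x \<bullet> conv G (moll n) x"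
        unfolding grad_conv_Wgrad[OF W moll_test] V1_def by (cases "x \<in> K") (auto simp: z(2))
    qed
    finally show ?thesis .
  qed
  then show "0 \<le> (LBINT x. V x \<bullet> G x)"
    by (intro LIMSEQ_le_const[OF lim]) blast
qed

context supersolution
begin

text \<open>The function \<open>h\<close> of the renormalized inequality is taken to be \<open>1\<close> below \<open>k\<close> and \<open>0\<close> above
  \<open>k + \<delta>\<close>.  It is decreasing, so the energy term has the good sign, and \<open>\<delta> \<rightarrow> 0\<close>.\<close>

lemma truncated_flux_nonneg:
  assumes \<phi>: "\<phi> \<in> test_functions \<Omega>" "\<forall>x. 0 \<le> \<phi> x"
  shows "0 \<le> (LBINT x. (indicator {x. u x \<le> k} x *\<^sub>R pq_flux p q (D x)) \<bullet> grad \<phi> x)"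
proof -
  note [measurable] = test_borel[OF \<phi>(1)]
  define \<delta> where "\<delta> n = 1 / real (Suc n)" for n
  have \<delta>: "0 < \<delta> n" for n by (simp add: \<delta>_def)
  define H where "H n t = clip (\<delta> n) (k + \<delta> n - t) / \<delta> n" for n t
  have Hb: "0 \<le> H n t" "H n t \<le> 1" for n t
    using \<delta>[of n] by (auto simp: H_def clip_def)
  have key: "integrable lborel (\<lambda>x. (pq_flux p q (D x) \<bullet> grad \<phi> x) * H n (u x))"
    "0 \<le> (LBINT x. (pq_flux p q (D x) \<bullet> grad \<phi> x) * H n (u x))" for n
  proof -
    let ?g = "\<lambda>t. if k + \<delta> n - \<delta> n < t \<and> t < k + \<delta> n then - (1 / \<delta> n) else 0"
    have G: "continuous_on {0..\<delta> n} (\<lambda>s. s / \<delta> n)" using \<delta>[of n] by (intro continuous_intros) auto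
    have D: "((\<lambda>s. s / \<delta> n) has_real_derivative 1 / \<delta> n) (at s)" for s
      using \<delta>[of n] by (auto intro!: derivative_eq_intros)
    have gm: "(\<lambda>s::real. 1 / \<delta> n) \<in> borel_measurable borel" by simp
    have C: "\<bar>1 / \<delta> n\<bar> \<le> 1 / \<delta> n" "0 \<le> 1 / \<delta> n" using \<delta>[of n] by auto
    note pc = prim_clip[OF \<delta>[of n] G D gm C, of "k + \<delta> n"]
    have R: "\<forall>t. \<bar>k\<bar> + \<delta> n < \<bar>t\<bar> \<longrightarrow> ?g t = 0" using \<delta>[of n] by auto
    have ht: "\<forall>t. H n t = H n 0 + prim ?g t" unfolding pc(3) H_def by simp
    have c: "continuous_on UNIV (H n)" using pc(2) unfolding H_def[abs_def] .
    have h0: "\<forall>t. 0 \<le> H n t" using Hb(1) by simp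
    note ri = renorm_inequality[OF pc(1) R c ht h0 \<phi>]
    show "integrable lborel (\<lambda>x. (pq_flux p q (D x) \<bullet> grad \<phi> x) * H n (u x))" by (rule ri(1))
    have "0 \<le> (LBINT x. - ((norm (D x) powr p + norm (D x) powr q) * ?g (u x) * \<phi> x))"
      using \<phi>(2) \<delta>[of n] by (intro Bochner_Integration.integral_nonneg) auto
    then have "(LBINT x. (norm (D x) powr p + norm (D x) powr q) * ?g (u x) * \<phi> x) \<le> 0" by simp
    then show "0 \<le> (LBINT x. (pq_flux p q (D x) \<bullet> grad \<phi> x) * H n (u x))" using ri(2) by linarith
  qed
  have full: "integrable lborel (\<lambda>x. pq_flux p q (D x) \<bullet> grad \<phi> x)"
  proof -
    have b: "bounded_Borel (\<lambda>t. 0) 0" by (simp add: bounded_Borel_def)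
    show ?thesis
      using renorm_inequality(1)[OF b _ continuous_on_const _ _ \<phi>, of 0 1] by (simp add: prim_zero)
  qed
  have "(\<lambda>n. LBINT x. (pq_flux p q (D x) \<bullet> grad \<phi> x) * H n (u x))
      \<longlonglongrightarrow> (LBINT x. (indicator {x. u x \<le> k} x *\<^sub>R pq_flux p q (D x)) \<bullet> grad \<phi> x)"
  proof (rule integral_dominated_convergence)
    show "integrable lborel (\<lambda>x. norm (pq_flux p q (D x) \<bullet> grad \<phi> x))" by (rule integrable_norm[OF full])
    show "(\<lambda>x. (pq_flux p q (D x) \<bullet> grad \<phi> x) * H n (u x)) \<in> borel_measurable lborel" for n
      by (rule borel_measurable_integrable[OF key(1)])
    show "(\<lambda>x. (indicator {x. u x \<le> k} x *\<^sub>R pq_flux p q (D x)) \<bullet> grad \<phi> x) \<in> borel_measurable lborel"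
      by measurable
    show "AE x in lborel. norm ((pq_flux p q (D x) \<bullet> grad \<phi> x) * H n (u x)) \<le> norm (pq_flux p q (D x) \<bullet> grad \<phi> x)" (is "AE x in _. ?P x") for n
    proof (rule AE_I2)
      fix x
      show "?P x"
        using Hb[of n "u x"] by (simp add: abs_mult mult_left_le)
    qed
    show "AE x in lborel. (\<lambda>n. (pq_flux p q (D x) \<bullet> grad \<phi> x) * H n (u x))
        \<longlonglongrightarrow> (indicator {x. u x \<le> k} x *\<^sub>R pq_flux p q (D x)) \<bullet> grad \<phi> x" (is "AE x in _. ?P x")
    proof (rule AE_I2)
      fix x
      have "(\<lambda>n. H n (u x)) \<longlonglongrightarrow> indicator {x. u x \<le> k} x"
      proof (cases "u x \<le> k")
        case True
        have "H n (u x) = 1" for n using True \<delta>[of n] by (simp add: H_def clip_def)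
        then show ?thesis using True by simp
      next
        case False
        then obtain N :: nat where N: "1 / real (Suc N) < u x - k"
          using reals_Archimedean[of "u x - k"] by (auto simp: inverse_eq_divide)
        have "H n (u x) = 0" if "N \<le> n" for n
        proof -
          have "\<delta> n \<le> 1 / real (Suc N)" unfolding \<delta>_def using that by (intro divide_left_mono) auto
          then show ?thesis using N \<delta>[of n] by (simp add: H_def clip_def)
        qed
        then have "\<forall>\<^sub>F n in sequentially. H n (u x) = 0" by (rule eventually_sequentiallyI)
        then show ?thesis using False by (simp add: tendsto_eventually)
      qed
      from tendsto_mult[OF tendsto_const[of "pq_flux p q (D x) \<bullet> grad \<phi> x"] this]
      show "?P x"
        by (simp add: mult.commute)
    qed
  qed
  then show ?thesis by (intro LIMSEQ_le_const) (use key(2) in auto)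
qed

end

section \<open>The comparison principle\<close>

lemma prim_positive_part:
  assumes e: "0 < e"
  shows "prim (indicator {e<..}) t = max 0 (t - e)"
proof -
  have "prim (indicator {e<..}) t = max 0 (t - e) - max 0 (0 - e)"
  proof (rule prim_eqI[where S = "{e}" and C = 1])
    show "bounded_Borel (indicator {e<..}) 1" by (rule bounded_Borel_indicator) simp
    show "continuous_on UNIV (\<lambda>t. max 0 (t - e))" by (intro continuous_intros)
    fix t assume "t \<notin> {e}"
    then consider "t < e" | "e < t" by force
    then show "((\<lambda>t. max 0 (t - e)) has_real_derivative indicator {e<..} t) (at t)"
    proof cases
      case 1
      have "((\<lambda>_. 0) has_real_derivative 0) (at t)" by simp
      then have "((\<lambda>t. max 0 (t - e)) has_real_derivative 0) (at t)"
        by (rule has_field_derivative_transform_within_open[of _ _ _ "{..<e}"]) (use 1 in auto)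
      then show ?thesis using 1 by simp
    next
      case 2
      have "((\<lambda>t. t - e) has_real_derivative 1) (at t)" by (auto intro!: derivative_eq_intros)
      then have "((\<lambda>t. max 0 (t - e)) has_real_derivative 1) (at t)"
        by (rule has_field_derivative_transform_within_open[of _ _ _ "{e<..}"]) (use 2 in auto)
      then show ?thesis using 2 by simp
    qed
  qed simp
  then show ?thesis using e by simp
qed

text \<open>The field chosen by \<open>weak_grad\<close> inherits the integrability of the gradient in \<open>W1_loc\<close> because weak
  gradients are unique almost everywhere.\<close>

lemma q_harmonic_gradient:
  fixes U :: "'a::euclidean_space set"
  assumes U: "open U" and h: "q_harmonic_on p q U h"
  obtains w0 where "has_weak_gradient U h (weak_grad U h)" "w0 \<in> borel_measurable borel"
    "AE x in lborel. indicator U x *\<^sub>R weak_grad U h x = w0 x"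
    "\<And>K. compact K \<Longrightarrow> K \<subseteq> U \<Longrightarrow> integrable lborel (\<lambda>x. indicator K x * norm (w0 x) powr q)"
    "\<And>\<phi>. \<phi> \<in> test_functions U \<Longrightarrow> (LBINT x. pq_flux p q (w0 x) \<bullet> grad \<phi> x) = 0"
proof -
  let ?w = "weak_grad U h"
  obtain v where v: "v \<in> Lp_loc q U" "has_weak_gradient U h v"
    using h by (auto simp: q_harmonic_on_def W1_loc_def)
  have hw: "has_weak_gradient U h ?w" unfolding weak_grad_def by (rule someI[of _ v]) (rule v(2))
  have wL: "?w \<in> Lp_loc 1 U" using hw by (simp add: has_weak_gradient_def)
  obtain w0 where w0: "w0 \<in> borel_measurable borel" "AE x in lborel. indicator U x *\<^sub>R ?w x = w0 x"
    by (rule lebesgue_Borel_representative[OF Lp_loc_measurable[OF wL]])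
  note [measurable] = w0(1)
  have ae: "AE x in lebesgue. indicator U x *\<^sub>R ?w x = w0 x" using w0(2) by (simp add: AE_completion_iff)
  show ?thesis
  proof (rule that[OF hw w0])
    fix K :: "'a set" assume K: "compact K" "K \<subseteq> U"
    have [measurable]: "K \<in> sets borel" by (rule borel_compact[OF K(1)])
    have i: "integrable lebesgue (\<lambda>x. indicator K x *\<^sub>R norm (v x) powr q)"
      using v(1) K by (simp add: Lp_loc_def set_integrable_def)
    have m: "(\<lambda>x. indicator K x * norm (w0 x) powr q) \<in> borel_measurable borel" by measurable
    have "AE x in lebesgue. indicator K x *\<^sub>R norm (v x) powr q = indicator K x * norm (w0 x) powr q"
      using ae weak_gradient_unique[OF U hw v(2)]
    proof eventually_elim
      fix x assume x: "indicator U x *\<^sub>R ?w x = w0 x" "x \<in> U \<longrightarrow> ?w x = v x"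
      show "indicator K x *\<^sub>R norm (v x) powr q = indicator K x * norm (w0 x) powr q"
      proof (cases "x \<in> K")
        case True
        then have "x \<in> U" using K(2) by blast
        then show ?thesis using x by simp
      qed simp
    qed
    from integral_AE_Borel(2)[OF m this] i
    show "integrable lborel (\<lambda>x. indicator K x * norm (w0 x) powr q)" by (rule iffD1)
  next
    fix \<phi> :: "'a \<Rightarrow> real" assume t: "\<phi> \<in> test_functions U"
    note [measurable] = test_borel[OF t]
    have m: "(\<lambda>x. pq_flux p q (w0 x) \<bullet> grad \<phi> x) \<in> borel_measurable borel" by measurable
    have "AE x in lebesgue. indicator U x *\<^sub>R (pq_flux p q (?w x) \<bullet> grad \<phi> x) = pq_flux p q (w0 x) \<bullet> grad \<phi> x"
      using ae
    proof eventually_elim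
      fix x assume x: "indicator U x *\<^sub>R ?w x = w0 x"
      show "indicator U x *\<^sub>R (pq_flux p q (?w x) \<bullet> grad \<phi> x) = pq_flux p q (w0 x) \<bullet> grad \<phi> x"
        using x test_zero(2)[OF t, of x] by (cases "x \<in> U") auto
    qed
    from integral_AE_Borel(1)[OF m this] show "(LBINT x. pq_flux p q (w0 x) \<bullet> grad \<phi> x) = 0"
      using h t by (simp add: q_harmonic_on_def set_lebesgue_integral_def)
  qed
qed

context supersolution
begin

text \<open>The test function is \<open>(h - e - u)\<^sup>+\<close>.  It vanishes off \<open>E\<close>, and where it is positive \<open>u\<close> lies between
  \<open>- k\<close> and \<open>k\<close>, so that both the truncated inequality for \<open>u\<close> and the equation for \<open>h\<close> apply to it.  Strict
  monotonicity of the flux makes its gradient vanish.\<close>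

lemma comparison_AE:
  assumes U: "open U" "U \<subseteq> \<Omega>" and h: "q_harmonic_on p q U h" and E: "compact E" "E \<subseteq> U"
    and k: "0 < k" "\<And>x. x \<in> U \<Longrightarrow> h x \<le> k" "AE x in lborel. x \<in> U \<longrightarrow> - k < u x" and e: "0 < e"
    and off: "AE x in lborel. x \<in> U \<longrightarrow> x \<notin> E \<longrightarrow> h x - e \<le> u x"
  shows "AE x in lborel. x \<in> U \<longrightarrow> h x - e \<le> u x"
proof -
  obtain w0 where w: "has_weak_gradient U h (weak_grad U h)" and w0m [measurable]: "w0 \<in> borel_measurable borel"
    and w0: "AE x in lborel. indicator U x *\<^sub>R weak_grad U h x = w0 x"
      "\<And>K. compact K \<Longrightarrow> K \<subseteq> U \<Longrightarrow> integrable lborel (\<lambda>x. indicator K x * norm (w0 x) powr q)"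
      "\<And>\<phi>. \<phi> \<in> test_functions U \<Longrightarrow> (LBINT x. pq_flux p q (w0 x) \<bullet> grad \<phi> x) = 0"
    by (rule q_harmonic_gradient[OF U(1) h]) blast
  have hL: "h \<in> Lp_loc 1 U" using w by (simp add: has_weak_gradient_def)
  obtain h0 where h0m [measurable]: "h0 \<in> borel_measurable borel" and h0: "AE x in lborel. indicator U x *\<^sub>R h x = h0 x"
    by (rule lebesgue_Borel_representative[OF Lp_loc_measurable[OF hL]])
  have tm [measurable]: "trunc k \<in> borel_measurable borel" unfolding trunc_def[abs_def] by measurable
  have Em [measurable]: "E \<in> sets borel" by (rule borel_compact[OF E(1)])
  let ?g = "indicator {e<..} :: real \<Rightarrow> real"
  let ?D = "\<lambda>x. indicator {x. \<bar>u x\<bar> < k} x *\<^sub>R D x"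
  let ?f = "\<lambda>x. h x - (trunc k \<circ> u) x"
  have fw: "has_weak_gradient U ?f (\<lambda>x. weak_grad U h x - ?D x)"
    by (rule weak_gradient_diff[OF w weak_gradient_subset[OF trunc_gradient[OF k(1)] U]])
  have gb: "bounded_Borel ?g 1" by (rule bounded_Borel_indicator) simp
  note cw = chain_rule[OF U(1) fw gb]
  obtain \<eta> V where \<eta>: "\<eta> \<in> test_functions U" "\<And>x. 0 \<le> \<eta> x" "\<And>x. \<eta> x \<le> 1"
    "open V" "E \<subseteq> V" "V \<subseteq> U" "\<And>x. x \<in> V \<Longrightarrow> \<eta> x = 1" "\<And>x. x \<in> V \<Longrightarrow> grad \<eta> x = 0"
    by (rule cutoff_compact[OF E(1) U(1) E(2)]) blast
  obtain f' v' where f': "Wgrad f' v'" "AE x in lborel. f' x = indicator U x * (\<eta> x * prim ?g (?f x))"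
    "AE x in lborel. v' x = indicator U x *\<^sub>R (\<eta> x *\<^sub>R (?g (?f x) *\<^sub>R (weak_grad U h x - ?D x)) + prim ?g (?f x) *\<^sub>R grad \<eta> x)"
    by (rule local_to_global[OF cw \<eta>(1)])
  define P where "P = {x. e < h0 x - trunc k (u x)} \<inter> E"
  define F where "F x = indicator E x * max 0 (h0 x - trunc k (u x) - e)" for x
  define G where "G x = indicator P x *\<^sub>R (w0 x - ?D x)" for x
  have Pm [measurable]: "P \<in> sets borel" unfolding P_def by measurable
  have Fm: "F \<in> borel_measurable borel" unfolding F_def[abs_def] by measurable
  have Gm: "G \<in> borel_measurable borel" unfolding G_def[abs_def] by measurable
  have small: "?f x \<le> e" if "h x - e \<le> u x" "- k < u x" "x \<in> U" for x
    using that k(1) k(2)[OF that(3)] e by (auto simp: trunc_def max_def min_def)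
  have aeF: "AE x in lborel. f' x = F x" and aeG: "AE x in lborel. v' x = G x"
  proof -
    have "AE x in lborel. f' x = F x \<and> v' x = G x"
      using f'(2) f'(3) h0 w0(1) off k(3)
    proof eventually_elim
      case x: (elim x)
      consider "x \<notin> U" | "x \<in> U" "x \<notin> E" | "x \<in> U" "x \<in> E" by blast
      then show ?case
      proof cases
        case 1
        then have "x \<notin> E" using E(2) by blast
        then show ?thesis using x(1,2) 1 by (simp add: F_def G_def P_def)
      next
        case 2
        then have fe: "?f x \<le> e" using small x(5,6) by blast
        then have "prim ?g (?f x) = 0" "?g (?f x) = 0" unfolding prim_positive_part[OF e] by auto
        then show ?thesis using x(1,2) 2 by (simp add: F_def G_def P_def)
      next
        case 3
        then have "\<eta> x = 1" "grad \<eta> x = 0" using \<eta>(5,7,8) by blast+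
        moreover have "h0 x = h x" "w0 x = weak_grad U h x" using x(3,4) 3 by auto
        ultimately show ?thesis
          using x(1,2) 3 unfolding prim_positive_part[OF e] F_def G_def P_def
          by (auto simp: indicator_def)
      qed
    qed
    then show "AE x in lborel. f' x = F x" "AE x in lborel. v' x = G x"
      by (auto elim: eventually_mono)
  qed
  have W: "Wgrad F G" by (rule Wgrad_cong[OF f'(1) Fm aeF Gm aeG])
  have F0: "0 \<le> F x" "x \<notin> E \<Longrightarrow> F x = 0" for x by (auto simp: F_def)
  have G0: "x \<notin> E \<Longrightarrow> G x = 0" for x by (simp add: G_def P_def)
  have EO: "E \<subseteq> \<Omega>" using E(2) U(2) by blast
  have Gq: "integrable lborel (\<lambda>x. norm (G x) powr q)"
  proof (rule Bochner_Integration.integrable_bound)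
    show "integrable lborel (\<lambda>x. 2 powr q * (indicator E x * norm (w0 x) powr q
        + indicator E x * (indicator {x. \<bar>u x\<bar> < k} x * norm (D x) powr q)))"
      by (intro integrable_mult_right Bochner_Integration.integrable_add w0(2) E D_integrable k(1) EO)
    show "(\<lambda>x. norm (G x) powr q) \<in> borel_measurable lborel" using Gm by measurable
    show "AE x in lborel. norm (norm (G x) powr q) \<le> norm (2 powr q * (indicator E x * norm (w0 x) powr q
        + indicator E x * (indicator {x. \<bar>u x\<bar> < k} x * norm (D x) powr q)))" (is "AE x in _. ?P x")
    proof (rule AE_I2)
      fix x
      show "?P x"
      proof (cases "x \<in> E")
        case True
        have "norm (G x) \<le> norm (w0 x - ?D x)" by (simp add: G_def indicator_def)
        also have "\<dots> \<le> norm (w0 x) + norm (?D x)" by (rule norm_triangle_ineq4)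
        also have "\<dots> \<le> 2 * max (norm (w0 x)) (norm (?D x))" by simp
        finally have "norm (G x) powr q \<le> (2 * max (norm (w0 x)) (norm (?D x))) powr q"
          using q1 by (intro powr_mono2) auto
        also have "\<dots> = 2 powr q * (max (norm (w0 x)) (norm (?D x))) powr q" by (simp add: powr_mult)
        also have "(max (norm (w0 x)) (norm (?D x))) powr q \<le> norm (w0 x) powr q + norm (?D x) powr q"
          by (simp add: max_def)
        also have "norm (?D x) powr q = indicator {x. \<bar>u x\<bar> < k} x * norm (D x) powr q"
          using q1 by (simp add: indicator_def)
        finally have "norm (G x) powr q \<le> 2 powr q * (norm (w0 x) powr q + indicator {x. \<bar>u x\<bar> < k} x * norm (D x) powr q)"
          by simp
        then show ?thesis using True by (simp add: order_trans[OF _ abs_ge_self])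
      qed (simp add: G0)
    qed
  qed
  define V1 where "V1 x = indicator {x. u x \<le> k} x *\<^sub>R pq_flux p q (D x)" for x
  define V2 where "V2 x = pq_flux p q (w0 x)" for x
  have V1m: "V1 \<in> borel_measurable borel" unfolding V1_def[abs_def] by measurable
  have V2m: "V2 \<in> borel_measurable borel" unfolding V2_def[abs_def] by measurable
  let ?s = "q / (q - 1)"
  have bi: "integrable lborel (indicator K :: 'a \<Rightarrow> real)" if "compact K" for K
    using that by (intro integrable_indicator_bounded borel_compact compact_imp_bounded)
  have iV1: "integrable lborel (\<lambda>x. indicator K x * norm (V1 x) powr ?s)" if K: "compact K" "K \<subseteq> U" for K
  proof (rule Bochner_Integration.integrable_bound)
    have [measurable]: "K \<in> sets borel" by (rule borel_compact[OF K(1)])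
    have KO: "K \<subseteq> \<Omega>" using K(2) U(2) by blast
    show "integrable lborel (\<lambda>x. 3 powr ?s * (indicator K x + indicator K x * (indicator {x. \<bar>u x\<bar> < k + 1} x * norm (D x) powr q)))"
      using k(1) by (intro integrable_mult_right Bochner_Integration.integrable_add bi D_integrable K(1) KO) auto
    show "(\<lambda>x. indicator K x * norm (V1 x) powr ?s) \<in> borel_measurable lborel" using V1m by measurable
    from k(3) show "AE x in lborel. norm (indicator K x * norm (V1 x) powr ?s)
        \<le> norm (3 powr ?s * (indicator K x + indicator K x * (indicator {x. \<bar>u x\<bar> < k + 1} x * norm (D x) powr q)))" (is "AE x in _. ?P x")
    proof eventually_elim
      fix x assume x: "x \<in> U \<longrightarrow> - k < u x"
      show "?P x"
      proof (cases "x \<in> K \<and> u x \<le> k")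
        case True
        then have "\<bar>u x\<bar> < k + 1" using x K(2) by fastforce
        then show ?thesis using True flux_power_bound[OF p1 pq, of "D x"] by (simp add: V1_def)
      next
        case False
        then have z: "indicator K x * norm (V1 x) powr ?s = 0" by (auto simp: V1_def indicator_def)
        show ?thesis unfolding z by simp
      qed
    qed
  qed
  have iV2: "integrable lborel (\<lambda>x. indicator K x * norm (- V2 x) powr ?s)" if K: "compact K" "K \<subseteq> U" for K
  proof (rule Bochner_Integration.integrable_bound)
    have [measurable]: "K \<in> sets borel" by (rule borel_compact[OF K(1)])
    show "integrable lborel (\<lambda>x. 3 powr ?s * (indicator K x + indicator K x * norm (w0 x) powr q))"
      by (intro integrable_mult_right Bochner_Integration.integrable_add bi w0(2) K)
    show "(\<lambda>x. indicator K x * norm (- V2 x) powr ?s) \<in> borel_measurable lborel" using V2m by measurable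
    show "AE x in lborel. norm (indicator K x * norm (- V2 x) powr ?s)
        \<le> norm (3 powr ?s * (indicator K x + indicator K x * norm (w0 x) powr q))"
      using flux_power_bound[OF p1 pq] by (intro AE_I2) (auto simp: V2_def indicator_def)
  qed
  have weak1: "0 \<le> (LBINT x. V1 x \<bullet> grad \<phi> x)" if "\<phi> \<in> test_functions U" "\<forall>x. 0 \<le> \<phi> x" for \<phi>
    unfolding V1_def by (rule truncated_flux_nonneg[OF test_mono[OF that(1) U(2)] that(2)])
  have weak2: "0 \<le> (LBINT x. - V2 x \<bullet> grad \<phi> x)" if "\<phi> \<in> test_functions U" "\<forall>x. 0 \<le> \<phi> x" for \<phi>
    using w0(3)[OF that(1)] by (simp add: V2_def)
  have r1: "integrable lborel (\<lambda>x. V1 x \<bullet> G x)" "0 \<le> (LBINT x. V1 x \<bullet> G x)"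
    by (rule weak_inequality_extends[OF q1 V1m _ _ U(1) E W _ _ _ Gq];
        (erule (1) iV1 | erule (1) weak1 | rule F0(1) | erule F0(2) | erule G0))+
  have V2m': "(\<lambda>x. - V2 x) \<in> borel_measurable borel" using V2m by simp
  have r2: "integrable lborel (\<lambda>x. - V2 x \<bullet> G x)" "0 \<le> (LBINT x. - V2 x \<bullet> G x)"
    by (rule weak_inequality_extends[OF q1 V2m' _ _ U(1) E W _ _ _ Gq];
        (erule (1) iV2 | erule (1) weak2 | rule F0(1) | erule F0(2) | erule G0))+
  define Z where "Z x = - (V1 x \<bullet> G x) - (- V2 x \<bullet> G x)" for x
  have Zi: "integrable lborel Z"
    unfolding Z_def by (intro Bochner_Integration.integrable_diff integrable_minus r1(1) r2(1))
  have Zle: "(LBINT x. Z x) \<le> 0"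
  proof -
    have "(LBINT x. Z x) = - (LBINT x. V1 x \<bullet> G x) - (LBINT x. - V2 x \<bullet> G x)"
      unfolding Z_def using r1(1) r2(1)
      by (subst Bochner_Integration.integral_diff) (simp_all only: integrable_minus Bochner_Integration.integral_minus)
    then show ?thesis using r1(2) r2(2) by linarith
  qed
  have Zae: "AE x in lborel. 0 \<le> Z x \<and> (Z x = 0 \<longrightarrow> G x = 0)"
    using k(3) h0
  proof eventually_elim
    fix x assume x: "x \<in> U \<longrightarrow> - k < u x" "indicator U x *\<^sub>R h x = h0 x"
    show "0 \<le> Z x \<and> (Z x = 0 \<longrightarrow> G x = 0)"
    proof (cases "x \<in> P")
      case True
      then have xU: "x \<in> U" and pe: "e < h0 x - trunc k (u x)" using E(2) by (auto simp: P_def)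
      have "h0 x \<le> k" using x(2) xU k(2)[OF xU] by simp
      then have "trunc k (u x) < k" using pe e by linarith
      moreover have "- k < u x" using x(1) xU by blast
      ultimately have uk: "\<bar>u x\<bar> < k" by (auto simp: trunc_def max_def min_def split: if_splits)
      have Gx: "G x = w0 x - D x" using True uk by (simp add: G_def)
      have "Z x = (pq_flux p q (w0 x) - pq_flux p q (D x)) \<bullet> (w0 x - D x)"
        using uk by (simp add: Z_def V1_def V2_def Gx inner_diff_left)
      then show ?thesis using pq_flux_strict_mono[OF p1 q1, of "w0 x" "D x"] Gx
        by (cases "w0 x = D x") auto
    next
      case False
      then show ?thesis by (simp add: Z_def G_def)
    qed
  qed
  have Zn: "AE x in lborel. 0 \<le> Z x" using Zae by eventually_elim blast
  have "0 \<le> (LBINT x. Z x)" by (rule integral_nonneg_AE[OF Zn])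
  then have "(LBINT x. Z x) = 0" using Zle by simp
  then have "AE x in lborel. Z x = 0" using integral_nonneg_eq_0_iff_AE[OF Zi Zn] by simp
  then have "AE x in lborel. G x = 0" using Zae by eventually_elim blast
  then have "(LBINT x. norm (G x)) = 0" by (intro integral_eq_zero_AE) (auto elim: eventually_mono)
  moreover have "emeasure lborel E < \<infinity>" by (rule emeasure_bounded_finite[OF compact_imp_bounded[OF E(1)]])
  ultimately have "(LBINT x. \<bar>F x\<bar>) \<le> 0"
    using Faber_Krahn[OF W Em] F0(2) by simp
  moreover have "0 \<le> (LBINT x. \<bar>F x\<bar>)" by (rule Bochner_Integration.integral_nonneg) simp
  ultimately have "(LBINT x. \<bar>F x\<bar>) = 0" by simp
  then have "AE x in lborel. \<bar>F x\<bar> = 0"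
    using integral_nonneg_eq_0_iff_AE[OF integrable_abs[OF WgradD(1)[OF W]]] by simp
  then show ?thesis using off h0 k(3)
  proof (eventually_elim, intro impI)
    fix x assume x: "\<bar>F x\<bar> = 0" "x \<in> U \<longrightarrow> x \<notin> E \<longrightarrow> h x - e \<le> u x" "indicator U x *\<^sub>R h x = h0 x"
      "x \<in> U \<longrightarrow> - k < u x" and xU: "x \<in> U"
    show "h x - e \<le> u x"
    proof (cases "x \<in> E")
      case True
      have "h x - trunc k (u x) - e \<le> 0" using x(1,3) xU True by (auto simp: F_def max_def split: if_splits)
      moreover have "trunc k (u x) \<le> u x" using x(4) xU by (simp add: trunc_def)
      ultimately show ?thesis by linarith
    qed (use x(2) xU in blast)
  qed
qed

end

context integrable_supersolution
begin

text \<open>The boundary condition and lower semicontinuity make \<open>E\<close>, the set where \<open>ess_liminf u \<le> h - e\<close>, a compact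
  subset of \<open>U\<close>.  The level \<open>k\<close> comes from compactness of the closure of \<open>U\<close>, where \<open>ess_liminf u\<close> is never \<open>-\<infinity>\<close>.\<close>

lemma comparison:
  assumes U: "open U" "compact (closure U)" "closure U \<subseteq> \<Omega>"
    and h: "continuous_on (closure U) h" "q_harmonic_on p q U h"
    and boundary: "\<forall>x\<in>frontier U. ereal (h x) \<le> ess_liminf u x" and x: "x \<in> U"
  shows "ereal (h x) \<le> ess_liminf u x"
proof (rule ereal_le_epsilon2)
  fix e' :: real assume "0 < e'"
  define e where "e = e' / 2"
  have e: "0 < e" using \<open>0 < e'\<close> by (simp add: e_def)
  have UO: "U \<subseteq> \<Omega>" using U(3) closure_subset[of U] by blast
  (* with an extension of h to the whole space the exceptional set has an open complement *)
  obtain H where H: "continuous_on UNIV H" "\<And>y. y \<in> closure U \<Longrightarrow> H y = h y"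
    by (rule Tietze_unbounded[OF h(1), of UNIV]) auto
  define O1 where "O1 = (\<Union>c. {y. H y - e < c} \<inter> {y. ereal c < ess_liminf u y})"
  have "open O1" unfolding O1_def
    by (intro open_UN ballI open_Int open_less_ess_liminf open_Collect_less continuous_intros H(1))
  define E where "E = closure U - O1"
  have Ec: "compact E" unfolding E_def by (rule compact_diff[OF U(2) \<open>open O1\<close>])
  have EU: "E \<subseteq> U"
  proof
    fix y assume y: "y \<in> E"
    show "y \<in> U"
    proof (rule ccontr)
      assume "y \<notin> U"
      then have "y \<in> frontier U" using y U(1) by (simp add: E_def frontier_def interior_open)
      then have "ereal (h y) \<le> ess_liminf u y" using boundary by blast
      then have "ereal (h y - e / 2) < ess_liminf u y"
        by (rule less_le_trans[rotated]) (use e in simp)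
      moreover have "H y - e < h y - e / 2" using H(2) y e by (simp add: E_def)
      ultimately have "y \<in> O1" unfolding O1_def by blast
      then show False using y by (simp add: E_def)
    qed
  qed
  have off: "AE y in lborel. y \<in> U \<longrightarrow> y \<notin> E \<longrightarrow> h y - e \<le> u y"
    using ess_liminf_le_AE[of u]
  proof (eventually_elim, intro impI)
    fix y assume y: "ess_liminf u y \<le> ereal (u y)" "y \<in> U" "y \<notin> E"
    then have "y \<in> closure U" using closure_subset by blast
    then obtain c where "h y - e < c" "ereal c < ess_liminf u y" using y(3) H(2) by (auto simp: E_def O1_def)
    then show "h y - e \<le> u y" using y(1) by (metis ereal_less_eq(3) less_imp_le order_less_le_trans order_trans)
  qed
  obtain M where M: "\<And>y. y \<in> closure U \<Longrightarrow> \<bar>h y\<bar> \<le> M"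
    using compact_imp_bounded[OF compact_continuous_image[OF h(1) U(2)]] by (auto simp: bounded_iff)
  have "closure U \<subseteq> (\<Union>i. {y. ereal (- real i) < ess_liminf u y})"
  proof
    fix y assume "y \<in> closure U"
    then have "ess_liminf u y \<noteq> -\<infinity>" using U(3) by (intro ess_liminf_not_MInfty) blast
    then have "\<exists>b. ereal b < ess_liminf u y" by (cases "ess_liminf u y") (auto intro: lt_ex)
    then obtain b where b: "ereal b < ess_liminf u y" by blast
    obtain i :: nat where "- b < real i" using reals_Archimedean2 by blast
    then have "ereal (- real i) < ess_liminf u y" using b by (intro less_trans[OF _ b]) simp
    then show "y \<in> (\<Union>i. {y. ereal (- real i) < ess_liminf u y})" by blast
  qed
  then obtain I :: "nat set" where I: "finite I" "closure U \<subseteq> (\<Union>i\<in>I. {y. ereal (- real i) < ess_liminf u y})"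
    by (rule compactE_image[OF U(2) open_less_ess_liminf]) blast
  define k where "k = 1 + \<bar>M\<bar> + real (Max (insert 0 I))"
  have kM: "0 < k" "M \<le> k" by (auto simp: k_def)
  have low: "AE y in lborel. y \<in> U \<longrightarrow> - k < u y"
    using ess_liminf_le_AE[of u]
  proof (eventually_elim, intro impI)
    fix y assume y: "ess_liminf u y \<le> ereal (u y)" "y \<in> U"
    then have "y \<in> closure U" using closure_subset by blast
    then obtain i where i: "i \<in> I" "ereal (- real i) < ess_liminf u y" using I(2) by blast
    have "i \<le> Max (insert 0 I)" using i(1) I(1) by (intro Max_ge) auto
    then have "real i \<le> k" by (simp add: k_def)
    moreover have "ereal (- real i) < ereal (u y)" using i(2) y(1) by (rule less_le_trans)
    ultimately show "- k < u y" by simp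
  qed
  have hk: "h y \<le> k" if "y \<in> U" for y
    using M[of y] that closure_subset[of U] kM(2) by (fastforce simp: abs_le_iff)
  have ae: "AE y in lborel. y \<in> U \<longrightarrow> h y - e \<le> u y"
    by (rule comparison_AE[OF U(1) UO h(2) Ec EU kM(1) hk low e off])
  have "open (U \<inter> {y. h x - e < H y})"
    by (intro open_Int U(1) open_Collect_less continuous_intros H(1))
  moreover have "x \<in> U \<inter> {y. h x - e < H y}" using x H(2) closure_subset[of U] e by (auto simp: subset_iff)
  moreover have "AE y in lborel. y \<in> U \<inter> {y. h x - e < H y} \<longrightarrow> h x - e' \<le> u y"
    using ae
  proof (eventually_elim, intro impI)
    fix y assume y: "y \<in> U \<longrightarrow> h y - e \<le> u y" "y \<in> U \<inter> {y. h x - e < H y}"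
    then have "H y = h y" using H(2) closure_subset by blast
    then show "h x - e' \<le> u y" using y by (simp add: e_def)
  qed
  ultimately have "ereal (h x - e') \<le> ess_liminf u x" by (rule ess_liminf_ge_on_open)
  then show "ereal (h x) \<le> ess_liminf u x + ereal e'" by (cases "ess_liminf u x") auto
qed

lemma superharmonic_ess_liminf: "q_superharmonic_on p q \<Omega> (ess_liminf u)"
  unfolding q_superharmonic_on_def
proof (intro conjI)
  show "\<forall>x\<in>\<Omega>. ess_liminf u x \<noteq> -\<infinity>" using ess_liminf_not_MInfty by blast
  show "lower_semicontinuous_on \<Omega> (ess_liminf u)"
    unfolding lower_semicontinuous_on_def
  proof
    fix a
    have "{x \<in> \<Omega>. a < ess_liminf u x} = \<Omega> \<inter> {x. a < ess_liminf u x}" by blast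
    then show "openin (top_of_set \<Omega>) {x \<in> \<Omega>. a < ess_liminf u x}"
      using openin_open_Int[OF open_less_ess_liminf] by simp
  qed
  show "\<forall>C\<in>components \<Omega>. \<exists>x\<in>C. ess_liminf u x \<noteq> \<infinity>"
  proof (rule ballI, rule ccontr)
    fix C assume C: "C \<in> components \<Omega>" and "\<not> (\<exists>x\<in>C. ess_liminf u x \<noteq> \<infinity>)"
    then have inf: "ess_liminf u x = \<infinity>" if "x \<in> C" for x using that by blast
    have "open C" by (rule open_components[OF open_dom C])
    have "C \<subseteq> \<Omega>" by (rule in_components_subset[OF C])
    have "AE x in lborel. x \<notin> C"
      using ess_liminf_eq_AE by eventually_elim (use inf \<open>C \<subseteq> \<Omega>\<close> in force)
    then have "C \<in> null_sets lborel" using \<open>open C\<close> by (subst (asm) AE_iff_null_sets[symmetric]) auto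
    then have "negligible C" by (simp add: negligible_iff_null_sets null_sets_completionI)
    then show False using open_not_negligible[OF \<open>open C\<close> in_components_nonempty[OF C]] by blast
  qed
qed (use comparison in blast)

end

theorem renormalized_superharmonic:
  fixes \<Omega> :: "'a::euclidean_space set"
  assumes \<Omega>: "open \<Omega>" and p: "1 < p" "p \<le> q" "q \<le> real DIM('a)" and sol: "local_renormalized_solution p q \<Omega> \<mu> u"
  shows "\<exists>u'. q_superharmonic_on p q \<Omega> u' \<and> (AE x in lebesgue_on \<Omega>. u' x = ereal (u x))"
proof -
  obtain u0 D where super: "renorm_super p q \<Omega> u0 D" and ae: "AE x in lebesgue. x \<in> \<Omega> \<longrightarrow> u0 x = u x"
    and int: "\<And>m K. 1 \<le> m \<Longrightarrow> (q < real DIM('a) \<longrightarrow> m < real DIM('a) / (real DIM('a) - q)) \<Longrightarrow> compact K \<Longrightarrow> K \<subseteq> \<Omega> \<Longrightarrow>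
       integrable lborel (\<lambda>x. indicator K x * \<bar>u0 x\<bar> powr ((q - 1) * m))"
    by (rule renormalized_representative[OF \<Omega> sol]) blast
  have "\<exists>m. 1 < m \<and> m < 2 \<and> (q < real DIM('a) \<longrightarrow> m < real DIM('a) / (real DIM('a) - q))"
  proof (cases "q < real DIM('a)")
    case True
    then have "1 < min 2 (real DIM('a) / (real DIM('a) - q))" using p by (simp add: less_divide_eq)
    then obtain m where "1 < m" "m < min 2 (real DIM('a) / (real DIM('a) - q))" using dense by blast
    then show ?thesis by auto
  next
    case False
    then show ?thesis by (intro exI[of _ "3/2"]) auto
  qed
  then obtain m where m: "1 < m" "m < 2" "q < real DIM('a) \<longrightarrow> m < real DIM('a) / (real DIM('a) - q)" by blast
  interpret integrable_supersolution p q \<Omega> u0 D "(q - 1) * m"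
  proof
    have q: "0 < q - 1" using p by simp
    show "q - 1 < (q - 1) * m" using q m(1) by simp
    show "(q - 1) * m < 2 * (q - 1)" using mult_strict_left_mono[OF m(2) q] by (simp only: mult.commute)
    show "integrable lborel (\<lambda>x. indicator K x * \<bar>u0 x\<bar> powr ((q - 1) * m))" if "compact K" "K \<subseteq> \<Omega>" for K
      using m that by (intro int) auto
  qed (use \<Omega> p super in auto)
  have "AE x in lebesgue. x \<in> \<Omega> \<longrightarrow> ess_liminf u0 x = ereal (u0 x)"
    using ess_liminf_eq_AE by (simp add: AE_completion_iff)
  then have "AE x in lebesgue. x \<in> \<Omega> \<longrightarrow> ess_liminf u0 x = ereal (u x)" using ae by eventually_elim auto
  then have "AE x in lebesgue_on \<Omega>. ess_liminf u0 x = ereal (u x)"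
    using \<Omega> by (subst AE_restrict_space_iff) auto
  then show ?thesis using superharmonic_ess_liminf by blast
qed

theorem theorem1p1:
  fixes \<Omega> :: "(real ^ 'n) set"
    and p q :: real
    and \<mu> :: "(real ^ 'n) measure"
    and u :: "real ^ 'n \<Rightarrow> real"
  assumes "open \<Omega>" "connected \<Omega>" "\<Omega> \<noteq> {}" "bounded \<Omega>"
    and "1 < p" "p \<le> q" "q \<le> real CARD('n)"
    and "bounded_Radon_measure_on \<Omega> \<mu>"
    and "local_renormalized_solution p q \<Omega> \<mu> u"
  shows "\<exists>u'. q_superharmonic_on p q \<Omega> u' \<and>
    (AE x in lebesgue_on \<Omega>. u' x = ereal (u x))"
  by (rule renormalized_superharmonic) (use assms in auto)

end
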